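(* Let $A$ be the ring of integers of a finite extension of $\mathbb{F}_q(t)$, where $\mathbb{F}_q$ is a finite field with $q$ elements. Let $G \subseteq GL_2(A)$ be a finite group, acting linearly on the polynomial ring $R = A[X,Y]$ (fixing $A$). Then the ring of invariants $R^G$ is Cohen-Macaulay.
   Context: The ring of integers of a finite extension $K$ of $\mathbb{F}_q(t)$ is the integral closure of $\mathbb{F}_q[t]$ in $K$. A subgroup $G \subseteq GL_2(A)$ acts on $A[X,Y]$ by $A$-algebra automorphisms, via the linear action of matrices on the free $A$-module $AX \oplus AY$ with basis $X, Y$. $R^G$ denotes the subring of elements of $R$ fixed by every element of $G$. *)

theory Defs
  imports
    "HOL-Algebra.Algebraic_Closure_Type"
    "HOL-Analysis.Cartesian_Space"
    "HOL-Computational_Algebra.Fraction_Field"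
    "HOL-Computational_Algebra.Polynomial"
    "HOL-Library.Extended_Nat"
begin

section \<open>Cohen--Macaulay rings\<close>

subsection \<open>Localization\<close>

definition frac_rel :: "('a, 'm) ring_scheme \<Rightarrow> 'a set \<Rightarrow> (('a \<times> 'a) \<times> ('a \<times> 'a)) set"
  where "frac_rel R S =
    {((a, s), (b, t)). a \<in> carrier R \<and> b \<in> carrier R \<and> s \<in> S \<and> t \<in> S \<and>
       (\<exists>u\<in>S. u \<otimes>\<^bsub>R\<^esub> (t \<otimes>\<^bsub>R\<^esub> a \<ominus>\<^bsub>R\<^esub> s \<otimes>\<^bsub>R\<^esub> b) = \<zero>\<^bsub>R\<^esub>)}"

definition fraction :: "('a, 'm) ring_scheme \<Rightarrow> 'a set \<Rightarrow> 'a \<Rightarrow> 'a \<Rightarrow> ('a \<times> 'a) set"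
  where "fraction R S a s = frac_rel R S `` {(a, s)}"

text \<open>The ring of fractions of \<open>R\<close> by a multiplicative set \<open>S\<close>. As usual for quotients, the
  operations are unions over representatives; all members of such a union coincide.\<close>

definition ring_of_fracs :: "('a, 'm) ring_scheme \<Rightarrow> 'a set \<Rightarrow> ('a \<times> 'a) set ring"
  where "ring_of_fracs R S =
    \<lparr>carrier = (carrier R \<times> S) // frac_rel R S,
     monoid.mult = (\<lambda>x y. \<Union>(a, s)\<in>x. \<Union>(b, t)\<in>y. fraction R S (a \<otimes>\<^bsub>R\<^esub> b) (s \<otimes>\<^bsub>R\<^esub> t)),
     one = fraction R S \<one>\<^bsub>R\<^esub> \<one>\<^bsub>R\<^esub>,
     ring.zero = fraction R S \<zero>\<^bsub>R\<^esub> \<one>\<^bsub>R\<^esub>,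
     add = (\<lambda>x y. \<Union>(a, s)\<in>x. \<Union>(b, t)\<in>y.
              fraction R S (t \<otimes>\<^bsub>R\<^esub> a \<oplus>\<^bsub>R\<^esub> s \<otimes>\<^bsub>R\<^esub> b) (s \<otimes>\<^bsub>R\<^esub> t))\<rparr>"

definition localization :: "('a, 'm) ring_scheme \<Rightarrow> 'a set \<Rightarrow> ('a \<times> 'a) set ring"
  where "localization R P = ring_of_fracs R (carrier R - P)"

subsection \<open>Dimension and depth\<close>

definition krull_dim :: "('a, 'm) ring_scheme \<Rightarrow> enat"
  where "krull_dim R = Sup {enat n | n. \<exists>P :: nat \<Rightarrow> 'a set.
    (\<forall>i\<le>n. primeideal (P i) R) \<and> (\<forall>i<n. P i \<subset> P (Suc i))}"

text \<open>The second clause says that \<open>xs ! i\<close> is a nonzerodivisor on the quotient of \<open>R\<close> by the ideal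
  generated by its predecessors.\<close>

definition regular_seq :: "('a, 'm) ring_scheme \<Rightarrow> 'a list \<Rightarrow> bool"
  where "regular_seq R xs \<longleftrightarrow>
    set xs \<subseteq> carrier R \<and>
    (\<forall>i<length xs. \<forall>a\<in>carrier R.
       xs ! i \<otimes>\<^bsub>R\<^esub> a \<in> genideal R (set (take i xs)) \<longrightarrow> a \<in> genideal R (set (take i xs))) \<and>
    genideal R (set xs) \<noteq> carrier R"

definition depth :: "('a, 'm) ring_scheme \<Rightarrow> 'a set \<Rightarrow> enat"
  where "depth R I = Sup {enat (length xs) | xs. set xs \<subseteq> I \<and> regular_seq R xs}"

subsection \<open>The Cohen--Macaulay property\<close>

definition cohen_macaulay_local :: "('a, 'm) ring_scheme \<Rightarrow> bool"
  where "cohen_macaulay_local R \<longleftrightarrow>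
    cring R \<and> noetherian_ring R \<and>
    (\<exists>m. {I. maximalideal I R} = {m} \<and> depth R m = krull_dim R)"

definition cohen_macaulay :: "('a, 'm) ring_scheme \<Rightarrow> bool"
  where "cohen_macaulay R \<longleftrightarrow>
    cring R \<and> noetherian_ring R \<and>
    (\<forall>m. maximalideal m R \<longrightarrow> cohen_macaulay_local (localization R m))"

section \<open>Rings of integers of global function fields\<close>

definition integral_closure :: "'a::comm_ring_1 set \<Rightarrow> 'a set"
  where "integral_closure S =
    {x. \<exists>p. lead_coeff p = 1 \<and> (\<forall>i. Polynomial.coeff p i \<in> S) \<and> poly p x = 0}"

text \<open>\<open>\<phi>\<close> exhibits the field \<open>'k\<close> as a finite extension of the rational function field over \<open>'q\<close>.\<close>

definition finite_function_field_ext :: "('q::field poly fract \<Rightarrow> 'k::field) \<Rightarrow> bool"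
  where "finite_function_field_ext \<phi> \<longleftrightarrow>
    \<phi> \<in> ring_hom ring_of_type_algebra ring_of_type_algebra \<and>
    ring.finite_dimension (ring_of_type_algebra :: 'k ring) (range \<phi>) UNIV"

definition ring_of_integers :: "('q::field poly fract \<Rightarrow> 'k::field) \<Rightarrow> 'k set"
  where "ring_of_integers \<phi> = integral_closure (range (\<lambda>f. \<phi> (Fract f 1)))"

section \<open>The linear action on polynomials in two variables\<close>

definition GL2 :: "'k::comm_ring_1 set \<Rightarrow> ('k^2^2) monoid"
  where "GL2 A = units_of
    \<lparr>carrier = {M. \<forall>i j. M $ i $ j \<in> A}, monoid.mult = (\<lambda>M N. M ** N), one = mat 1\<rparr>"

text \<open>Polynomials in \<open>X, Y\<close> are polynomials in \<open>Y\<close> whose coefficients are polynomials in \<open>X\<close>.\<close>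

definition var_X :: "'k::comm_ring_1 poly poly" where "var_X = [:[:0, 1:]:]"

definition var_Y :: "'k::comm_ring_1 poly poly" where "var_Y = [:0, 1:]"

definition poly2_over :: "'k::comm_ring_1 set \<Rightarrow> 'k poly poly set"
  where "poly2_over A = {f. \<forall>i j. Polynomial.coeff (Polynomial.coeff f i) j \<in> A}"

definition subst2 :: "'k::comm_ring_1 poly poly \<Rightarrow> 'k poly poly \<Rightarrow> 'k poly poly \<Rightarrow> 'k poly poly"
  where "subst2 f u v = poly (map_poly (\<lambda>p. poly (map_poly (\<lambda>c. [:[:c:]:]) p) u) f) v"

definition linear_form :: "'k::comm_ring_1^2 \<Rightarrow> 'k poly poly"
  where "linear_form w = [:[:w $ 1:]:] * var_X + [:[:w $ 2:]:] * var_Y"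

text \<open>With respect to the basis \<open>X, Y\<close>, the images of \<open>X\<close> and \<open>Y\<close> under \<open>M\<close> are given by the
  columns of \<open>M\<close>.\<close>

definition lin_act :: "'k::comm_ring_1^2^2 \<Rightarrow> 'k poly poly \<Rightarrow> 'k poly poly"
  where "lin_act M f = subst2 f (linear_form (column 1 M)) (linear_form (column 2 M))"

definition invariant_ring :: "'k::comm_ring_1 set \<Rightarrow> ('k^2^2) set \<Rightarrow> 'k poly poly ring"
  where "invariant_ring A G =
    ring_of_type_algebra\<lparr>carrier := {f \<in> poly2_over A. \<forall>g\<in>G. lin_act g f = f}\<rparr>"

end

theory Submission
  imports Defs "HOL-Analysis.Determinants"
begin

text \<open>Write \<open>S\<close> for the ring of invariants and \<open>p\<close> for the characteristic. The localization of \<open>S\<close> at any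
  maximal ideal has a regular sequence of length three, while \<open>S\<close> has no chain of primes of length four.

  The bridge from \<open>R\<close> to \<open>S\<close> is purity: after localizing at a prime of \<open>A\<close>, so that the base is a valuation
  ring, an element of \<open>S\<close> that is an \<open>R\<close>-linear combination of invariants is an \<open>S\<close>-linear one. Let \<open>G\<close> act
  on pairs of a nonzero vector and a nonzero scalar, \<open>g\<close> multiplying the scalar by \<open>det g\<close>. Suitable finite
  spans over the prime field contain a number of such pairs prime to \<open>p\<close>, so some orbit has length prime to \<open>p\<close>.
  Its stabilizer is unipotent, hence \<open>R\<close> is free over the invariants of the stabilizer, with \<open>1\<close> in the basis;
  averaging over the orbit leads back to \<open>S\<close>. Consequently \<open>S\<close> is noetherian because \<open>R\<close> is, and invariants
  that form a regular sequence in \<open>R\<close> form one in \<open>S\<close>.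

  The residue fields of \<open>R\<close> are finite. Hence a maximal ideal contains some \<open>x1 = t ^ i - t ^ j\<close> and, for suitable
  powers \<open>s\<close> and \<open>Q\<close> of \<open>p\<close>, the elements \<open>U = X ^ (s * Q) - X ^ s\<close> and \<open>W = Y ^ (s * Q) - Y ^ s\<close>, on which \<open>G\<close>
  acts linearly modulo \<open>x1\<close>. Since \<open>E = W ^ Q - W * U ^ (Q - 1) + U ^ Q\<close> has no zero on a line rational over
  the field with \<open>Q\<close> elements, \<open>x1\<close>, the norm of \<open>U\<close> and the norm of \<open>E\<close> form a regular sequence.

  The bound on the dimension comes from counting: any four elements of \<open>R\<close> are algebraically dependent
  over the finite constant field, whereas a chain of primes of length four yields four independent ones.\<close>

text \<open>The obstacle is that \<open>p\<close> may divide the order of \<open>G\<close>: there is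
  then no averaging over \<open>G\<close>, and invariant rings of finite groups can fail to be
  Cohen-Macaulay. Rank two rescues the argument. Matrices of determinant 1 that fix a common vector
  are transvections along one line, and over the invariants of such a group the polynomial ring is
  free. Freeness needs the fixed vector to extend to a basis, hence a valuation ring as base; over
  \<open>A\<close> purity holds only up to a factor outside a chosen prime, which is why regularity
  is stated with a factor outside \<open>m\<close>. The extension of the rational function field may
  be inseparable, so the trace form does not show that \<open>A\<close> is a finite module;
  expansions at infinity do. The exponents in \<open>U\<close> and \<open>W\<close> are chosen so
  that \<open>G\<close> acts on them by matrices whose entries are fixed by the \<open>Q\<close>-th
  power modulo \<open>x1\<close>: the power \<open>s\<close> moves each entry into that set. If
  \<open>w ^ Q = w\<close>, then \<open>E\<close> takes the value \<open>w ^ Q - w + 1 = 1\<close>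
  at \<open>(U, W) = (1, w)\<close>, and it is 1 at \<open>(0, 1)\<close> too; this is how it avoids
  the rational lines.\<close>

no_notation fps_nth (infixl "$" 75)

subsection \<open>Noetherian modules and integral elements\<close>

text \<open>All modules below are rings viewed over another ring along a homomorphism
  \<open>h\<close>. Indexing span and submodule by \<open>h\<close> alone lets one theory serve
  ideals (the identity), coefficients of polynomials, field extensions and
  \<open>hD\<close>.\<close>

definition spn :: "('r::comm_ring_1 \<Rightarrow> 'u::comm_ring_1) \<Rightarrow> 'u set \<Rightarrow> 'u set"
  where "spn h = Modules.module.span (\<lambda>r x. h r * x)"

definition smod :: "('r::comm_ring_1 \<Rightarrow> 'u::comm_ring_1) \<Rightarrow> 'u set \<Rightarrow> bool"
  where "smod h = Modules.module.subspace (\<lambda>r x. h r * x)"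

locale rhom =
  fixes h :: "'r::comm_ring_1 \<Rightarrow> 'u::comm_ring_1"
  assumes hom_1: "h 1 = 1" and hom_add: "h (x + y) = h x + h y" and hom_mult: "h (x * y) = h x * h y"
begin

sublocale M: Modules.module "\<lambda>r x. h r * x"
  by standard (simp_all add: hom_1 hom_add hom_mult algebra_simps)

lemmas subspaceI = M.subspaceI[folded spn_def smod_def]
lemmas subspace_0 = M.subspace_0[folded spn_def smod_def]
lemmas subspace_add = M.subspace_add[folded spn_def smod_def]
lemmas subspace_scale = M.subspace_scale[folded spn_def smod_def]
lemmas subspace_diff = M.subspace_diff[folded spn_def smod_def]
lemmas subspace_sum = M.subspace_sum[folded spn_def smod_def]
lemmas subspace_inter = M.subspace_inter[folded spn_def smod_def]
lemmas subspace_span = M.subspace_span[folded spn_def smod_def]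
lemmas span_finite = M.span_finite[folded spn_def smod_def]
lemmas span_mono = M.span_mono[folded spn_def smod_def]
lemmas span_base = M.span_base[folded spn_def smod_def]
lemmas span_superset = M.span_superset[folded spn_def smod_def]
lemmas span_zero = M.span_zero[folded spn_def smod_def]
lemmas span_add = M.span_add[folded spn_def smod_def]
lemmas span_scale = M.span_scale[folded spn_def smod_def]
lemmas span_neg = M.span_neg[folded spn_def smod_def]
lemmas span_diff = M.span_diff[folded spn_def smod_def]
lemmas span_sum = M.span_sum[folded spn_def smod_def]
lemmas span_minimal = M.span_minimal[folded spn_def smod_def]
lemmas span_breakdown_eq = M.span_breakdown_eq[folded spn_def smod_def]
lemmas span_empty [simp] = M.span_empty[folded spn_def smod_def]
lemmas span_span = M.span_span[folded spn_def smod_def]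
lemmas span_induct_alt [consumes 1, case_names base step] = M.span_induct_alt[folded spn_def smod_def]

lemma hom_0: "h 0 = 0"
  using hom_add[of 0 0] by simp

lemma hom_minus: "h (- x) = - h x"
  using hom_add[of x "- x"] by (simp add: hom_0 eq_neg_iff_add_eq_0 add.commute)

lemma hom_diff: "h (x - y) = h x - h y"
  using hom_add[of x "- y"] by (simp add: hom_minus)

lemma hom_power: "h (x ^ n) = h x ^ n"
  by (induction n) (simp_all add: hom_1 hom_mult)

lemma hom_sum: "h (sum f S) = (\<Sum>x\<in>S. h (f x))"
  by (induction S rule: infinite_finite_induct) (simp_all add: hom_0 hom_add)

lemma hom_prod: "h (prod f S) = (\<Prod>x\<in>S. h (f x))"
  by (induction S rule: infinite_finite_induct) (simp_all add: hom_1 hom_mult)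

lemma hom_of_nat: "h (of_nat n) = of_nat n"
  by (induction n) (simp_all add: hom_0 hom_1 hom_add)

end

lemma rhom_id: "rhom (\<lambda>x. x)"
  by standard auto

definition noetherian_type :: "'r::comm_ring_1 itself \<Rightarrow> bool"
  where "noetherian_type _ \<longleftrightarrow>
    (\<forall>I::'r set. smod (\<lambda>x. x) I \<longrightarrow> (\<exists>T. finite T \<and> spn (\<lambda>x. x) T = I))"

lemma noetherian_type_field: "noetherian_type TYPE('a::field)"
  unfolding noetherian_type_def
proof (intro allI impI)
  interpret rhom "\<lambda>x::'a. x" by (rule rhom_id)
  fix I :: "'a set" assume I: "smod (\<lambda>x. x) I"
  show "\<exists>T. finite T \<and> spn (\<lambda>x. x) T = I"
  proof (cases "I \<subseteq> {0}")
    case True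
    then have "I = {0}" using subspace_0[OF I] by auto
    then show ?thesis by (intro exI[of _ "{}"]) auto
  next
    case False
    then obtain a where a: "a \<in> I" "a \<noteq> 0" by auto
    have "x \<in> I" for x
      using subspace_scale[OF I a(1), of "x / a"] a(2) by simp
    then have "I = UNIV" by auto
    moreover have "x \<in> spn (\<lambda>x. x) {1}" for x :: 'a
      using span_scale[OF span_base, of 1 "{1}" x] by simp
    ultimately show ?thesis by (intro exI[of _ "{1}"]) auto
  qed
qed

context rhom
begin

text \<open>Induction on the generators: the coefficients that elements of \<open>N\<close> can have
  at the new generator \<open>a\<close>, modulo the span of the others, form an ideal. Lifts of its
  generators together with generators of the part of \<open>N\<close> in the smaller span generate
  \<open>N\<close>.\<close>

lemma noetherian_submodule:
  assumes noeth: "noetherian_type TYPE('r)"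
  assumes "finite T" "smod h N" "N \<subseteq> spn h T"
  shows "\<exists>Y. finite Y \<and> Y \<subseteq> N \<and> spn h Y = N"
  using assms(2-)
proof (induction T arbitrary: N rule: finite_induct)
  case empty
  then have "N = {0}" using subspace_0[OF empty(1)] by auto
  then show ?case by (intro exI[of _ "{}"]) auto
next
  case (insert a T)
  interpret Id: rhom "\<lambda>x::'r. x" by (rule rhom_id)
  define I where "I = {r. \<exists>w\<in>spn h T. h r * a + w \<in> N}"
  have "smod (\<lambda>x. x) I"
  proof (rule Id.subspaceI)
    show "0 \<in> I" unfolding I_def using span_zero subspace_0[OF insert.prems(1)]
      by (auto simp: hom_0 intro!: bexI[of _ 0])
    fix x y assume "x \<in> I" "y \<in> I"
    then obtain w w' where "w \<in> spn h T" "h x * a + w \<in> N" "w' \<in> spn h T" "h y * a + w' \<in> N"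
      unfolding I_def by blast
    then show "x + y \<in> I" unfolding I_def
      using span_add[of w T w'] subspace_add[OF insert.prems(1), of "h x * a + w" "h y * a + w'"]
      by (auto simp: hom_add algebra_simps intro!: bexI[of _ "w + w'"])
  next
    fix c x assume "x \<in> I"
    then obtain w where "w \<in> spn h T" "h x * a + w \<in> N"
      unfolding I_def by blast
    then show "c * x \<in> I" unfolding I_def
      using span_scale[of w T c] subspace_scale[OF insert.prems(1), of "h x * a + w" c]
      by (auto simp: hom_mult algebra_simps intro!: bexI[of _ "h c * w"])
  qed
  then obtain R0 where R0: "finite R0" "spn (\<lambda>x. x) R0 = I"
    using noeth unfolding noetherian_type_def by blast
  have "R0 \<subseteq> I" using R0(2) Id.span_superset by blast
  then have "\<forall>r\<in>R0. \<exists>w\<in>spn h T. h r * a + w \<in> N" unfolding I_def by blast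
  then obtain w where w: "\<And>r. r \<in> R0 \<Longrightarrow> w r \<in> spn h T" "\<And>r. r \<in> R0 \<Longrightarrow> h r * a + w r \<in> N"
    by metis
  have "smod h (N \<inter> spn h T)"
    by (rule subspace_inter[OF insert.prems(1) subspace_span])
  then obtain Y where Y: "finite Y" "Y \<subseteq> N \<inter> spn h T" "spn h Y = N \<inter> spn h T"
    using insert.IH[of "N \<inter> spn h T"] by blast
  define Z where "Z = Y \<union> (\<lambda>r. h r * a + w r) ` R0"
  have ZN: "Z \<subseteq> N" using Y(2) w(2) by (auto simp: Z_def)
  have "N \<subseteq> spn h Z"
  proof
    fix x assume x: "x \<in> N"
    then obtain k where k: "x - h k * a \<in> spn h T"
      using insert.prems(2) span_breakdown_eq by blast
    have "k \<in> I" unfolding I_def using k x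
      by (auto intro!: bexI[of _ "x - h k * a"])
    then obtain c where c: "k = (\<Sum>r\<in>R0. c r * r)"
      using R0 Id.span_finite[OF R0(1)] by auto
    define y where "y = (\<Sum>r\<in>R0. h (c r) * (h r * a + w r))"
    have y: "y \<in> spn h Z" unfolding y_def
      by (intro span_sum span_scale span_base) (auto simp: Z_def)
    have yN: "y \<in> N" unfolding y_def
      by (intro subspace_sum[OF insert.prems(1)] subspace_scale[OF insert.prems(1)] w(2))
    have "x - y = (x - h k * a) - (\<Sum>r\<in>R0. h (c r) * w r)"
      unfolding y_def c by (simp add: hom_sum hom_mult sum_distrib_right sum_distrib_left sum.distrib algebra_simps)
    also have "\<dots> \<in> spn h T"
      by (intro span_diff k span_sum span_scale w(1))
    finally have "x - y \<in> spn h Y" using Y(3) subspace_diff[OF insert.prems(1) x yN] by blast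
    then have "x - y \<in> spn h Z" using span_mono[of Y Z] by (auto simp: Z_def)
    then show "x \<in> spn h Z" using span_add[OF _ y] by fastforce
  qed
  moreover have "spn h Z \<subseteq> N" using ZN insert.prems(1) by (rule span_minimal)
  ultimately show ?case using ZN Y(1) R0(1)
    by (intro exI[of _ Z]) (auto simp: Z_def)
qed

lemma span_finite_subset:
  assumes "x \<in> spn h T"
  shows "\<exists>Y. finite Y \<and> Y \<subseteq> T \<and> x \<in> spn h Y"
  using assms
proof (induction rule: span_induct_alt)
  case base
  then show ?case using span_zero by blast
next
  case (step c x y)
  then obtain Y where Y: "finite Y" "Y \<subseteq> T" "y \<in> spn h Y" by blast
  then have "h c * x + y \<in> spn h (insert x Y)"
    using span_add[OF span_scale[OF span_base]] span_mono[of Y "insert x Y"] by blast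
  then show ?case using Y step.hyps by (intro exI[of _ "insert x Y"]) auto
qed

lemma span_finite_subset':
  assumes "finite F" "F \<subseteq> spn h T"
  shows "\<exists>Y. finite Y \<and> Y \<subseteq> T \<and> F \<subseteq> spn h Y"
proof -
  obtain Y where Y: "\<And>x. x \<in> F \<Longrightarrow> finite (Y x) \<and> Y x \<subseteq> T \<and> x \<in> spn h (Y x)"
    using span_finite_subset[OF subsetD[OF assms(2)]] by metis
  have "F \<subseteq> spn h (\<Union>x\<in>F. Y x)"
    using Y span_mono[of "Y _" "\<Union>x\<in>F. Y x"] by blast
  then show ?thesis using Y assms(1) by (intro exI[of _ "\<Union>x\<in>F. Y x"]) auto
qed

text \<open>The span of all powers of \<open>z\<close> lies in a noetherian module, so finitely many
  powers generate it, and any \<open>n\<close> beyond their exponents works. This takes the role of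
  the determinant trick for integral elements.\<close>

lemma power_in_span_lower_powers:
  assumes noeth: "noetherian_type TYPE('r)" and "finite W" "\<And>i. z ^ i \<in> spn h W"
  shows "\<exists>n. z ^ n \<in> spn h ((\<lambda>i. z ^ i) ` {..<n})"
proof -
  let ?N = "spn h (range (\<lambda>i. z ^ i))"
  have sub: "range (\<lambda>i. z ^ i) \<subseteq> spn h W"
    by (rule image_subsetI) (rule assms(3))
  have "?N \<subseteq> spn h W" 
    by (rule span_minimal[OF sub subspace_span])
  from noetherian_submodule[OF noeth assms(2) subspace_span this]
  obtain Y where Y: "finite Y" "Y \<subseteq> ?N" "spn h Y = ?N" by (elim exE conjE)
  from span_finite_subset'[OF Y(1,2)]
  obtain P where P: "finite P" "P \<subseteq> range (\<lambda>i. z ^ i)" "Y \<subseteq> spn h P" by blast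
  then obtain E where E: "finite E" "P = (\<lambda>i. z ^ i) ` E"
    by (meson finite_subset_image)
  define n where "n = Suc (Max (insert 0 E))"
  have "P \<subseteq> (\<lambda>i. z ^ i) ` {..<n}"
    using E by (auto simp: n_def less_Suc_eq_le)
  then have "spn h P \<subseteq> spn h ((\<lambda>i. z ^ i) ` {..<n})" by (rule span_mono)
  moreover have "?N \<subseteq> spn h P"
    using P(3) Y(3) by (metis span_minimal subspace_span)
  moreover have "z ^ n \<in> ?N" by (intro span_base) auto
  ultimately show ?thesis by blast
qed

lemma span_powers_explicit:
  assumes "z ^ n \<in> spn h ((\<lambda>i. z ^ i) ` {..<n})"
  shows "\<exists>c. z ^ n = (\<Sum>i<n. h (c i) * z ^ i)"
proof -
  have "x \<in> spn h ((\<lambda>i. z ^ i) ` {..<n}) \<Longrightarrow> \<exists>c. x = (\<Sum>i<n. h (c i) * z ^ i)" for x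
  proof (induction rule: span_induct_alt)
    case base
    show ?case by (intro exI[of _ "\<lambda>_. 0"]) (simp add: hom_0)
  next
    case (step b x y)
    from step(2) obtain c where c: "y = (\<Sum>i<n. h (c i) * z ^ i)" by blast
    from step(1) obtain j where j: "j < n" "x = z ^ j" by blast
    have "(\<Sum>i<n. h (if i = j then b + c i else c i) * z ^ i)
        = (\<Sum>i<n. (if i = j then h b * z ^ j else 0) + h (c i) * z ^ i)"
      by (intro sum.cong) (auto simp: hom_add algebra_simps)
    also have "\<dots> = h b * x + y" using j(1) by (simp add: sum.distrib c j(2))
    finally show ?case by (intro exI[of _ "\<lambda>i. if i = j then b + c i else c i"]) simp
  qed
  then show ?thesis using assms by blast
qed

end

section \<open>Hilbert's basis theorem\<close>

lemma rhom_const: "rhom (\<lambda>c::'a::comm_ring_1. [:c:])"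
  by standard (auto simp: one_pCons)

theorem hilbert_basis:
  assumes noeth: "noetherian_type TYPE('a::comm_ring_1)"
  shows "noetherian_type TYPE('a poly)"
  unfolding noetherian_type_def
proof (intro allI impI)
  interpret Id: rhom "\<lambda>x::'a. x" by (rule rhom_id)
  interpret P: rhom "\<lambda>x::'a poly. x" by (rule rhom_id)
  interpret K: rhom "\<lambda>c::'a. [:c:]" by (rule rhom_const)
  fix I :: "'a poly set" assume I: "smod (\<lambda>x. x) I"
  \<comment> \<open>\<open>n\<close> may exceed the degree: so \<open>0\<close> belongs to
    \<open>L\<close>, and sums of shifted polynomials show closure under addition even when leading
    terms cancel.\<close>
  define L where "L = {a. \<exists>p\<in>I. \<exists>n. degree p \<le> n \<and> poly.coeff p n = a}"
  have Lmem: "poly.coeff p n \<in> L" if "p \<in> I" "degree p \<le> n" for p n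
    using that by (auto simp: L_def)
  have "smod (\<lambda>x. x) L"
  proof (rule Id.subspaceI)
    show "0 \<in> L" using Lmem[of 0 0] P.subspace_0[OF I] by simp
    fix x y assume "x \<in> L" "y \<in> L"
    then obtain p n q m where pq: "p \<in> I" "degree p \<le> n" "poly.coeff p n = x"
        "q \<in> I" "degree q \<le> m" "poly.coeff q m = y"
      unfolding L_def by blast
    have "monom 1 m * p + monom 1 n * q \<in> I"
      by (intro P.subspace_add[OF I] P.subspace_scale[OF I] pq)
    moreover have "degree (monom 1 m * p + monom 1 n * q) \<le> n + m"
      using pq(2,5) by (intro degree_le) (auto simp: coeff_monom_mult coeff_eq_0)
    moreover have "poly.coeff (monom 1 m * p + monom 1 n * q) (n + m) = x + y"
      using pq by (simp add: coeff_monom_mult)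
    ultimately show "x + y \<in> L" using Lmem by metis
  next
    fix c x assume "x \<in> L"
    then obtain p n where p: "p \<in> I" "degree p \<le> n" "poly.coeff p n = x"
      unfolding L_def by blast
    have "[:c:] * p \<in> I" by (intro P.subspace_scale[OF I] p)
    moreover have "degree ([:c:] * p) \<le> n" using p(2) by (auto intro: order.trans[OF degree_smult_le])
    ultimately show "c * x \<in> L" using Lmem p(3) by force
  qed
  then obtain T where T: "finite T" "spn (\<lambda>x. x) T = L"
    using noeth unfolding noetherian_type_def by blast
  have "T \<subseteq> L" using T(2) Id.span_superset by blast
  then have "\<forall>x\<in>T. \<exists>p n. p \<in> I \<and> degree p \<le> n \<and> poly.coeff p n = x"
    unfolding L_def by blast
  then obtain p n where pn: "\<And>x. x \<in> T \<Longrightarrow> p x \<in> I \<and> degree (p x) \<le> n x \<and> poly.coeff (p x) (n x) = x"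
    by metis
  define d where "d = Max (insert 0 (n ` T))"
  have nd: "n x \<le> d" if "x \<in> T" for x using that T(1) by (auto simp: d_def)
  \<comment> \<open>The part of \<open>I\<close> of degree below \<open>d\<close> is a module over
    the coefficients alone, inside the span of finitely many monomials, so the module lemma applies
    to it.\<close>
  define N where "N = {q\<in>I. \<forall>i\<ge>d. poly.coeff q i = 0}"
  have N: "smod (\<lambda>c. [:c:]) N"
    using P.subspace_0[OF I] P.subspace_add[OF I] P.subspace_scale[OF I, of _ "[:_:]"]
    by (intro K.subspaceI) (auto simp: N_def)
  define W where "W = (\<lambda>i. monom (1::'a) i) ` {..<d}"
  have "N \<subseteq> spn (\<lambda>c. [:c:]) W"
  proof
    fix q assume q: "q \<in> N"
    have "q = (\<Sum>i<d. [:poly.coeff q i:] * monom 1 i)"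
    proof (rule poly_eqI)
      fix k
      have "poly.coeff (\<Sum>i<d. [:poly.coeff q i:] * monom 1 i) k
          = (\<Sum>i<d. if i = k then poly.coeff q i else 0)"
        unfolding coeff_sum by (rule sum.cong) auto
      also have "\<dots> = poly.coeff q k" using q by (auto simp: N_def)
      finally show "poly.coeff q k = poly.coeff (\<Sum>i<d. [:poly.coeff q i:] * monom 1 i) k" by simp
    qed
    also have "\<dots> \<in> spn (\<lambda>c. [:c:]) W"
      by (intro K.span_sum K.span_scale K.span_base) (auto simp: W_def)
    finally show "q \<in> spn (\<lambda>c. [:c:]) W" .
  qed
  then obtain Y where Y: "finite Y" "Y \<subseteq> N" "spn (\<lambda>c. [:c:]) Y = N"
    using K.noetherian_submodule[OF noeth _ N, of W] by (auto simp: W_def)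
  define Z where "Z = p ` T \<union> Y"
  have NZ: "N \<subseteq> spn (\<lambda>x. x) Z"
  proof -
    have "spn (\<lambda>c. [:c:]) Y \<subseteq> spn (\<lambda>x. x) Z"
      using P.span_superset[of Z] P.span_zero[of Z] P.span_add[of _ Z] P.span_scale[of _ Z]
      by (intro K.span_minimal K.subspaceI) (auto simp: Z_def simp del: mult_pCons_left)
    then show ?thesis using Y(3) by simp
  qed
  \<comment> \<open>Induction on a degree bound: for \<open>k\<close> not below \<open>d\<close>,
    the chosen elements can be shifted up to degree \<open>k\<close>, and subtracting
    \<open>s\<close> removes the top coefficient.\<close>
  have "q \<in> I \<Longrightarrow> (\<forall>i\<ge>k. poly.coeff q i = 0) \<Longrightarrow> q \<in> spn (\<lambda>x. x) Z" for q k
  proof (induction k arbitrary: q)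
    case 0
    then have "q = 0" by (auto intro: poly_eqI)
    then show ?case using P.span_zero by simp
  next
    case (Suc k)
    show ?case
    proof (cases "k < d")
      case True
      then show ?thesis using Suc.prems NZ by (auto simp: N_def)
    next
      case False
      have "degree q \<le> k" using Suc.prems(2) by (intro degree_le) auto
      then have "poly.coeff q k \<in> spn (\<lambda>x. x) T" using T(2) Lmem[OF Suc.prems(1)] by simp
      then obtain c where c: "poly.coeff q k = (\<Sum>x\<in>T. c x * x)"
        using Id.span_finite[OF T(1)] by auto
      define s where "s = (\<Sum>x\<in>T. monom (c x) (k - n x) * p x)"
      have sI: "s \<in> I" unfolding s_def
        by (intro P.subspace_sum[OF I] P.subspace_scale[OF I]) (use pn in auto)
      have sZ: "s \<in> spn (\<lambda>x. x) Z" unfolding s_def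
        by (intro P.span_sum P.span_scale P.span_base) (auto simp: Z_def)
      have "poly.coeff s i = 0" if "i > k" for i
        unfolding s_def coeff_sum
      proof (intro sum.neutral ballI)
        fix x assume x: "x \<in> T"
        then have "degree (p x) < i - (k - n x)" using pn[OF x] nd[OF x] that False by linarith
        then show "poly.coeff (monom (c x) (k - n x) * p x) i = 0"
          by (auto simp: coeff_monom_mult coeff_eq_0)
      qed
      moreover have "poly.coeff s k = poly.coeff q k"
        unfolding s_def coeff_sum c
      proof (intro sum.cong refl)
        fix x assume x: "x \<in> T"
        then have "n x \<le> k" using nd[OF x] False by simp
        then show "poly.coeff (monom (c x) (k - n x) * p x) k = c x * x"
          using pn[OF x] by (simp add: coeff_monom_mult)
      qed
      ultimately have "\<forall>i\<ge>k. poly.coeff (q - s) i = 0"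
        using Suc.prems(2) by (metis (no_types) Suc_leI coeff_diff diff_self le_neq_implies_less)
      then have "q - s \<in> spn (\<lambda>x. x) Z"
        using Suc.IH P.subspace_diff[OF I Suc.prems(1) sI] by blast
      then show ?thesis using P.span_add[OF _ sZ] by fastforce
    qed
  qed
  then have "q \<in> spn (\<lambda>x. x) Z" if "q \<in> I" for q
    using that coeff_eq_0[of q] by (metis Suc_le_eq)
  moreover have "spn (\<lambda>x. x) Z \<subseteq> I"
    using pn Y(2) by (intro P.span_minimal I) (auto simp: Z_def N_def)
  moreover have "finite Z" using T(1) Y(1) by (simp add: Z_def)
  ultimately show "\<exists>T. finite T \<and> spn (\<lambda>x. x) T = I" by blast
qed

section \<open>Subrings and integral elements\<close>

definition is_subring :: "'u::comm_ring_1 set \<Rightarrow> bool"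
  where "is_subring B \<longleftrightarrow> 1 \<in> B \<and> (\<forall>x\<in>B. \<forall>y\<in>B. x - y \<in> B \<and> x * y \<in> B)"

lemma is_subringD:
  assumes "is_subring B"
  shows subring_0: "0 \<in> B" and subring_1: "1 \<in> B"
    and subring_diff: "x \<in> B \<Longrightarrow> y \<in> B \<Longrightarrow> x - y \<in> B"
    and subring_mult: "x \<in> B \<Longrightarrow> y \<in> B \<Longrightarrow> x * y \<in> B"
    and subring_uminus: "x \<in> B \<Longrightarrow> - x \<in> B"
    and subring_add: "x \<in> B \<Longrightarrow> y \<in> B \<Longrightarrow> x + y \<in> B"
proof -
  show 1: "1 \<in> B" and d: "x \<in> B \<Longrightarrow> y \<in> B \<Longrightarrow> x - y \<in> B" and "x \<in> B \<Longrightarrow> y \<in> B \<Longrightarrow> x * y \<in> B" for x y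
    using assms by (auto simp: is_subring_def)
  show 0: "0 \<in> B" using d[OF 1 1] by simp
  show u: "x \<in> B \<Longrightarrow> - x \<in> B" for x using d[OF 0] by fastforce
  show "x \<in> B \<Longrightarrow> y \<in> B \<Longrightarrow> x + y \<in> B" for x y using d[of x "- y"] u by simp
qed

lemma subring_power: "is_subring B \<Longrightarrow> x \<in> B \<Longrightarrow> x ^ n \<in> B"
  by (induction n) (auto simp: subring_1 subring_mult)

lemma subring_sum: "is_subring B \<Longrightarrow> (\<And>i. i \<in> I \<Longrightarrow> f i \<in> B) \<Longrightarrow> sum f I \<in> B"
  by (induction I rule: infinite_finite_induct) (auto simp: subring_0 subring_add)

lemma subring_prod: "is_subring B \<Longrightarrow> (\<And>i. i \<in> I \<Longrightarrow> f i \<in> B) \<Longrightarrow> prod f I \<in> B"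
  by (induction I rule: infinite_finite_induct) (auto simp: subring_1 subring_mult)

lemma subring_of_nat: "is_subring B \<Longrightarrow> of_nat n \<in> B"
  by (induction n) (auto simp: subring_0 subring_1 subring_add)

lemmas subring_closed = subring_0 subring_1 subring_diff subring_mult subring_uminus subring_add
  subring_power subring_sum subring_prod subring_of_nat

context rhom
begin

text \<open>A monic equation with its coefficients hidden in the span;
  \<open>span_powers_explicit\<close> recovers them.\<close>

definition integral :: "'u \<Rightarrow> bool"
  where "integral z \<longleftrightarrow> (\<exists>n. z ^ n \<in> spn h ((\<lambda>i. z ^ i) ` {..<n}))"

text \<open>The ring of multipliers of the module spanned by \<open>Y\<close>. Over a noetherian
  base the integral elements are the members of such rings for finite \<open>Y\<close> with
  \<open>1\<close> in the span, and this gives closure under the ring operations.\<close>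

definition stab :: "'u set \<Rightarrow> 'u set"
  where "stab Y = {z. \<forall>y\<in>Y. z * y \<in> spn h Y}"

lemma stab_span:
  assumes "z \<in> stab Y" "y \<in> spn h Y"
  shows "z * y \<in> spn h Y"
  using assms(2)
proof (induction rule: span_induct_alt)
  case base
  then show ?case by (simp add: span_zero)
next
  case (step c x y)
  then have "h c * (z * x) + z * y \<in> spn h Y"
    using assms(1) by (intro span_add span_scale) (auto simp: stab_def)
  then show ?case by (simp add: algebra_simps)
qed

lemma stab_hom: "h r \<in> stab Y"
  by (auto simp: stab_def intro: span_scale span_base)

lemma is_subring_stab: "is_subring (stab Y)"
proof -
  have "1 \<in> stab Y" using stab_hom[of 1] by (simp add: hom_1)
  moreover have "x - y \<in> stab Y" if "x \<in> stab Y" "y \<in> stab Y" for x y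
    using that by (auto simp: stab_def left_diff_distrib intro!: span_diff)
  moreover have "x * y \<in> stab Y" if "x \<in> stab Y" "y \<in> stab Y" for x y
  proof -
    have "x * (y * z) \<in> spn h Y" if "z \<in> Y" for z
      using \<open>y \<in> stab Y\<close> that by (subst stab_span[OF \<open>x \<in> stab Y\<close>]) (auto simp: stab_def)
    then show ?thesis by (simp add: stab_def mult.assoc)
  qed
  ultimately show ?thesis by (simp add: is_subring_def)
qed

lemma stab_integral:
  assumes "noetherian_type TYPE('r)" "finite Y" "1 \<in> spn h Y" "z \<in> stab Y"
  shows "integral z"
proof -
  have "z ^ i \<in> spn h Y" for i
    by (induction i) (auto simp: assms(3) intro: stab_span[OF assms(4)])
  from power_in_span_lower_powers[OF assms(1,2) this] show ?thesis
    unfolding integral_def by blast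
qed

text \<open>The products \<open>y * z ^ j\<close> span a module stable under \<open>z\<close>,
  because the equation rewrites \<open>z * z ^ n\<close> by powers up to \<open>n\<close>. The
  coefficients \<open>s i\<close> may be any multipliers of the module of \<open>Y\<close>, and from
  this comes transitivity of integrality.\<close>

lemma stab_adjoin:
  assumes Y: "finite Y" "1 \<in> spn h Y" and s: "\<And>i. i < n \<Longrightarrow> s i \<in> stab Y"
    and z: "z ^ n = (\<Sum>i<n. s i * z ^ i)"
  shows "\<exists>Z. finite Z \<and> 1 \<in> spn h Z \<and> z \<in> stab Z \<and> stab Y \<subseteq> stab Z"
proof -
  define Z where "Z = (\<lambda>(y, j). y * z ^ j) ` (Y \<times> {..n})"
  have mult: "w * z ^ j \<in> spn h Z" if "w \<in> spn h Y" "j \<le> n" for w j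
    using that
  proof (induction rule: span_induct_alt)
    case base
    show ?case by (simp add: span_zero)
  next
    case (step c x y)
    then have "x * z ^ j \<in> Z" by (auto simp: Z_def)
    with step have "h c * (x * z ^ j) + y * z ^ j \<in> spn h Z"
      by (intro span_add[OF span_scale[OF span_base]]) auto
    then show ?case by (simp add: algebra_simps)
  qed
  have "z \<in> stab Z"
    unfolding stab_def
  proof (intro CollectI ballI)
    fix w assume "w \<in> Z"
    then obtain y j where w: "y \<in> Y" "j \<le> n" "w = y * z ^ j" by (auto simp: Z_def)
    show "z * w \<in> spn h Z"
    proof (cases "j < n")
      case True
      then show ?thesis using mult[of y "Suc j"] w by (simp add: span_base algebra_simps)
    next
      case False
      then have "z * w = y * (z * z ^ n)" using w by simp
      also have "\<dots> = (\<Sum>i<n. (s i * y) * z ^ Suc i)"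
        unfolding z by (simp add: sum_distrib_left algebra_simps)
      also have "\<dots> \<in> spn h Z"
        using s w(1) by (intro span_sum mult) (auto simp: stab_def)
      finally show ?thesis .
    qed
  qed
  moreover have "stab Y \<subseteq> stab Z"
  proof
    fix x assume x: "x \<in> stab Y"
    then have "(x * y) * z ^ j \<in> spn h Z" if "y \<in> Y" "j \<le> n" for y j
      using that by (intro mult) (auto simp: stab_def)
    then show "x \<in> stab Z" by (auto simp: stab_def Z_def algebra_simps)
  qed
  moreover have "1 \<in> spn h Z" using mult[OF Y(2), of 0] by simp
  ultimately show ?thesis using Y(1) by (intro exI[of _ Z]) (auto simp: Z_def)
qed

lemma integral_adjoin:
  assumes "finite Y" "1 \<in> spn h Y" "integral z"
  shows "\<exists>Z. finite Z \<and> 1 \<in> spn h Z \<and> z \<in> stab Z \<and> stab Y \<subseteq> stab Z"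
proof -
  obtain n where "z ^ n \<in> spn h ((\<lambda>i. z ^ i) ` {..<n})"
    using assms(3) unfolding integral_def by blast
  from span_powers_explicit[OF this] obtain c where "z ^ n = (\<Sum>i<n. h (c i) * z ^ i)" by blast
  then show ?thesis by (intro stab_adjoin[OF assms(1,2)]) (auto intro: stab_hom)
qed

lemma common_stab:
  assumes "finite F" "\<And>z. z \<in> F \<Longrightarrow> integral z"
  shows "\<exists>Y. finite Y \<and> 1 \<in> spn h Y \<and> F \<subseteq> stab Y"
  using assms
proof (induction rule: finite_induct)
  case empty
  then show ?case by (intro exI[of _ "{1}"]) (auto intro: span_base)
next
  case (insert z F)
  then obtain Y where Y: "finite Y" "1 \<in> spn h Y" "F \<subseteq> stab Y" by auto
  from integral_adjoin[OF Y(1,2)] insert.prems obtain Z where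
    "finite Z" "1 \<in> spn h Z" "z \<in> stab Z" "stab Y \<subseteq> stab Z" by blast
  then show ?case using Y(3) by blast
qed

text \<open>A finite module stable under all the \<open>s i\<close> is enlarged to one that is
  stable under \<open>z\<close> as well.\<close>

lemma integral_trans:
  assumes noeth: "noetherian_type TYPE('r)"
    and s: "\<And>i. i < n \<Longrightarrow> integral (s i)" and z: "z ^ n = (\<Sum>i<n. s i * z ^ i)"
  shows "integral z"
proof -
  have "\<exists>Y. finite Y \<and> 1 \<in> spn h Y \<and> s ` {..<n} \<subseteq> stab Y"
    by (rule common_stab) (use s in auto)
  then obtain Y where Y: "finite Y" "1 \<in> spn h Y" "s ` {..<n} \<subseteq> stab Y" by blast
  have "s i \<in> stab Y" if "i < n" for i using Y(3) that by auto
  from stab_adjoin[OF Y(1,2) this z] obtain Z where "finite Z" "1 \<in> spn h Z" "z \<in> stab Z" by blast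
  then show ?thesis by (rule stab_integral[OF noeth])
qed

lemma is_subring_integral:
  assumes noeth: "noetherian_type TYPE('r)"
  shows "is_subring (Collect integral)"
proof -
  have "x - y \<in> Collect integral \<and> x * y \<in> Collect integral" if "integral x" "integral y" for x y
  proof -
    have "\<exists>Y. finite Y \<and> 1 \<in> spn h Y \<and> {x, y} \<subseteq> stab Y"
      by (rule common_stab) (use that in auto)
    then obtain Y where Y: "finite Y" "1 \<in> spn h Y" "{x, y} \<subseteq> stab Y" by blast
    then have "x - y \<in> stab Y" "x * y \<in> stab Y"
      using subring_diff[OF is_subring_stab, of x Y y] subring_mult[OF is_subring_stab, of x Y y] by auto
    then show ?thesis by (simp add: stab_integral[OF noeth Y(1,2)])
  qed
  moreover have "integral 1" unfolding integral_def
    by (intro exI[of _ 1]) (auto intro: span_base)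
  ultimately show ?thesis by (auto simp: is_subring_def)
qed

lemma integral_hom: "integral (h r)"
  unfolding integral_def using span_scale[OF span_base, of 1 "{1}" r]
  by (intro exI[of _ 1]) (auto simp: lessThan_Suc)

lemma integral_closure_range: "integral_closure (range h) = Collect integral"
proof (intro equalityI subsetI)
  fix x assume "x \<in> integral_closure (range h)"
  then obtain p where p: "lead_coeff p = 1" "\<And>i. poly.coeff p i \<in> range h" "poly p x = 0"
    unfolding integral_closure_def by blast
  let ?n = "degree p"
  have "(\<Sum>i<?n. poly.coeff p i * x ^ i) + x ^ ?n = 0"
    using p(1,3) by (simp add: poly_altdef lessThan_Suc_atMost[symmetric])
  then have "x ^ ?n = - (\<Sum>i<?n. poly.coeff p i * x ^ i)"
    by (simp add: eq_neg_iff_add_eq_0 add.commute)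
  also have "\<dots> \<in> spn h ((\<lambda>i. x ^ i) ` {..<?n})"
  proof (intro span_neg span_sum)
    fix i assume "i \<in> {..<?n}"
    moreover obtain c where "poly.coeff p i = h c" using p(2)[of i] by auto
    ultimately show "poly.coeff p i * x ^ i \<in> spn h ((\<lambda>i. x ^ i) ` {..<?n})"
      by (auto intro: span_scale span_base)
  qed
  finally show "x \<in> Collect integral" by (auto simp: integral_def)
next
  fix x assume "x \<in> Collect integral"
  then obtain n where "x ^ n \<in> spn h ((\<lambda>i. x ^ i) ` {..<n})" by (auto simp: integral_def)
  from span_powers_explicit[OF this] obtain c where c: "x ^ n = (\<Sum>i<n. h (c i) * x ^ i)" by blast
  define p where "p = monom 1 n - (\<Sum>i<n. monom (h (c i)) i)"
  have co: "poly.coeff p i = (if i = n then 1 else if i < n then h (- c i) else 0)" for i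
  proof -
    have "(\<Sum>j<n. if j = i then h (c j) else 0) = (if i < n then h (c i) else 0)" by simp
    then show ?thesis by (auto simp: p_def coeff_sum hom_minus)
  qed
  have deg: "degree p = n"
    by (rule antisym[OF degree_le le_degree]) (auto simp: co)
  have "poly p x = 0" by (simp add: p_def poly_sum poly_monom c)
  moreover have "poly.coeff p i \<in> range h" for i
    using hom_0[symmetric] hom_1[symmetric] by (auto simp: co)
  ultimately show "x \<in> integral_closure (range h)"
    unfolding integral_closure_def by (auto simp: deg co intro!: exI[of _ p])
qed

end

subsection \<open>Finiteness of the ring of integers\<close>

lemma polys_degree_le: "{p::'q::zero poly. degree p \<le> N} \<subseteq> Poly ` {xs. set xs \<subseteq> UNIV \<and> length xs = Suc N}"
proof
  fix p :: "'q poly" assume p: "p \<in> {p. degree p \<le> N}"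
  have "p = Poly (map (poly.coeff p) [0..<Suc N])"
  proof (rule poly_eqI)
    fix n show "poly.coeff p n = poly.coeff (Poly (map (poly.coeff p) [0..<Suc N])) n"
      using p by (cases "n < Suc N")
        (auto simp: coeff_Poly_eq nth_default_def coeff_eq_0 simp del: upt_Suc)
  qed
  then show "p \<in> Poly ` {xs. set xs \<subseteq> UNIV \<and> length xs = Suc N}"
    by (intro image_eqI[of _ _ "map (poly.coeff p) [0..<Suc N]"]) auto
qed

lemma finite_polys_degree_le: "finite {p::'q::{zero,finite} poly. degree p \<le> N}"
  by (rule finite_subset[OF polys_degree_le]) (intro finite_imageI finite_lists_length_eq finite)

text \<open>The degree of \<open>r\<close> is below \<open>- N\<close>, or \<open>r\<close> is zero:
  a bound at the place at infinity. The strict inequality makes \<open>small 0\<close> mean a proper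
  fraction.\<close>

definition small :: "nat \<Rightarrow> 'q::field poly fract \<Rightarrow> bool"
  where "small N r \<longleftrightarrow> (\<exists>a b. b \<noteq> 0 \<and> r = Fract a b \<and> (a = 0 \<or> degree a + N < degree b))"

lemma smallI: "b \<noteq> 0 \<Longrightarrow> a = 0 \<or> degree a + N < degree b \<Longrightarrow> small N (Fract a b)"
  unfolding small_def by blast

lemma small_0: "small N 0"
  unfolding small_def by (intro exI[of _ 0] exI[of _ 1]) (simp add: fract_collapse)

lemma small_mono: "small M r \<Longrightarrow> N \<le> M \<Longrightarrow> small N r"
  unfolding small_def by fastforce

lemma small_add:
  assumes "small N r" "small N s"
  shows "small N (r + s)"
proof -
  obtain a b where r: "b \<noteq> 0" "r = Fract a b" "a = 0 \<or> degree a + N < degree b"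
    using assms(1) unfolding small_def by blast
  obtain c d where s: "d \<noteq> 0" "s = Fract c d" "c = 0 \<or> degree c + N < degree d"
    using assms(2) unfolding small_def by blast
  show ?thesis
  proof (cases "a * d + c * b = 0")
    case True
    then have "r + s = 0" using r(1,2) s(1,2) by (simp add: fract_collapse)
    then show ?thesis by (simp add: small_0)
  next
    case False
    have "a * d = 0 \<or> degree (a * d) + N < degree (b * d)"
      using r s degree_mult_le[of a d] by (auto simp: degree_mult_eq)
    moreover have "c * b = 0 \<or> degree (c * b) + N < degree (b * d)"
      using r s degree_mult_le[of c b] by (auto simp: degree_mult_eq)
    moreover have "degree (a * d + c * b) \<le> max (degree (a * d)) (degree (c * b))"
      by (rule degree_add_le_max)
    ultimately have "degree (a * d + c * b) + N < degree (b * d)" using False by force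
    then show ?thesis using r(1,2) s(1,2) unfolding small_def
      by (intro exI[of _ "a * d + c * b"] exI[of _ "b * d"]) simp
  qed
qed

lemma small_uminus: "small N r \<Longrightarrow> small N (- r)"
  unfolding small_def by (metis degree_minus minus_fract neg_equal_0_iff_equal)

lemma small_diff: "small N r \<Longrightarrow> small N s \<Longrightarrow> small N (r - s)"
  using small_add[of N r "- s"] small_uminus[of N s] by simp

lemma small_sum: "(\<And>i. i \<in> I \<Longrightarrow> small N (f i)) \<Longrightarrow> small N (sum f I)"
  by (induction I rule: infinite_finite_induct) (auto simp: small_0 small_add)

lemma small_mult:
  assumes "small N r" "small M s"
  shows "small (N + M) (r * s)"
proof -
  obtain a b where r: "b \<noteq> 0" "r = Fract a b" "a = 0 \<or> degree a + N < degree b"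
    using assms(1) unfolding small_def by blast
  obtain c d where s: "d \<noteq> 0" "s = Fract c d" "c = 0 \<or> degree c + M < degree d"
    using assms(2) unfolding small_def by blast
  have "a * c = 0 \<or> degree (a * c) + (N + M) < degree (b * d)"
    using r s degree_mult_le[of a c] by (auto simp: degree_mult_eq)
  then show ?thesis using r(1,2) s(1,2) unfolding small_def
    by (intro exI[of _ "a * c"] exI[of _ "b * d"]) simp
qed

lemma small_poly_mult:
  assumes "small (N + degree d) r"
  shows "small N (Fract d 1 * r)"
proof -
  obtain a b where r: "b \<noteq> 0" "r = Fract a b" "a = 0 \<or> degree a + (N + degree d) < degree b"
    using assms unfolding small_def by blast
  have "d * a = 0 \<or> degree (d * a) + N < degree b"
    using r degree_mult_le[of d a] by (auto simp: degree_mult_eq)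
  then show ?thesis using r(1,2) unfolding small_def
    by (intro exI[of _ "d * a"] exI[of _ b]) simp
qed

lemma small_bounded_mult: "\<exists>D. \<forall>N r. small (N + D) r \<longrightarrow> small N (s * r)"
proof -
  obtain c d where s: "s = Fract c d" "d \<noteq> 0" by (cases s)
  have "small N (s * r)" if small: "small (N + degree c) r" for N r
  proof -
    obtain a b where r: "b \<noteq> 0" "r = Fract a b" "a = 0 \<or> degree a + (N + degree c) < degree b"
      using small unfolding small_def by blast
    have "c * a = 0 \<or> degree (c * a) + N < degree (d * b)"
      using r s degree_mult_le[of c a] by (auto simp: degree_mult_eq)
    then show ?thesis using r(1,2) s unfolding small_def
      by (intro exI[of _ "c * a"] exI[of _ "d * b"]) simp
  qed
  then show ?thesis by blast
qed

lemma small_poly_eq_0: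
  assumes "small N (Fract e 1)"
  shows "e = 0"
proof (rule ccontr)
  assume e: "e \<noteq> 0"
  obtain a b where r: "b \<noteq> 0" "Fract e 1 = Fract a b" "a = 0 \<or> degree a + N < degree b"
    using assms unfolding small_def by blast
  then have "e * b = a" by (simp add: eq_fract)
  then have "a \<noteq> 0" "degree a = degree e + degree b" using e r(1) by (auto simp: degree_mult_eq)
  then show False using r(3) by simp
qed

lemma small_fractional_part: "\<exists>q. small 0 (r - Fract q 1)"
proof -
  obtain a b where r: "r = Fract a b" "b \<noteq> 0" by (cases r)
  have "r - Fract (a div b) 1 = Fract (a mod b) b"
    using r by (simp add: minus_mult_div_eq_mod[symmetric] algebra_simps)
  moreover have "small 0 (Fract (a mod b) b)"
    using degree_mod_less[OF r(2)] by (intro smallI r(2)) simp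
  ultimately show ?thesis by (intro exI[of _ "a div b"]) simp
qed

text \<open>\<open>q\<close> holds the leading digits, down to the one at \<open>- N\<close>, of the
  expansion of \<open>r\<close> at infinity. Its degree being bounded, only finitely many
  \<open>q\<close> occur over a finite field.\<close>

lemma small_approximation:
  assumes "small 0 r"
  shows "\<exists>q. degree q \<le> N \<and> small 0 (Fract (monom 1 N) 1 * r - Fract q 1)"
proof -
  obtain a b where r: "b \<noteq> 0" "r = Fract a b" "a = 0 \<or> degree a < degree b"
    using assms unfolding small_def by auto
  define q where "q = (monom 1 N * a) div b"
  have "degree q \<le> N"
  proof (cases "q = 0")
    case False
    have qb: "q * b = monom 1 N * a - (monom 1 N * a) mod b"
      by (simp add: q_def minus_mod_eq_div_mult)
    then have a: "a \<noteq> 0" using False r(1) by auto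
    have "degree q + degree b = degree (q * b)" using False r(1) by (simp add: degree_mult_eq)
    also have "\<dots> \<le> max (degree (monom 1 N * a)) (degree ((monom 1 N * a) mod b))"
      unfolding qb by (rule degree_diff_le_max)
    also have "\<dots> \<le> N + degree b"
      using r(3) a degree_mod_less[OF r(1), of "monom 1 N * a"]
      by (auto simp: degree_mult_eq degree_monom_eq)
    finally show ?thesis by simp
  qed simp
  moreover have "small 0 (Fract (monom 1 N) 1 * r - Fract q 1)"
  proof -
    have "Fract (monom 1 N) 1 * r - Fract q 1 = Fract ((monom 1 N * a) mod b) b"
      using r(1,2) by (simp add: q_def minus_mult_div_eq_mod[symmetric] algebra_simps)
    moreover have "small 0 (Fract ((monom 1 N * a) mod b) b)"
      using degree_mod_less[OF r(1)] by (intro smallI r(1)) simp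
    ultimately show ?thesis by simp
  qed
  ultimately show ?thesis by blast
qed

lemma small_cancel_monom:
  assumes "small 0 (Fract (monom 1 N) 1 * r)"
  shows "small N r"
proof -
  obtain a b where r: "b \<noteq> 0" "Fract (monom 1 N) 1 * r = Fract a b" "a = 0 \<or> degree a < degree b"
    using assms unfolding small_def by auto
  obtain c d where s: "r = Fract c d" "d \<noteq> 0" by (cases r)
  have nz: "monom (1::'a) N \<noteq> 0" by simp
  have "r = Fract a (b * monom 1 N)"
    using r(1,2) s nz by (simp add: eq_fract algebra_simps)
  moreover have "a = 0 \<or> degree a + N < degree (b * monom 1 N)"
    using r(1,3) by (simp add: degree_mult_eq degree_monom_eq)
  moreover have "b * monom 1 N \<noteq> 0" using r(1) nz by simp
  ultimately show ?thesis unfolding small_def by blast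
qed

lemma common_denominator:
  assumes "finite R"
  shows "\<exists>d::'q::idom. d \<noteq> 0 \<and> (\<forall>r\<in>R. \<exists>f. Fract d 1 * r = Fract f 1)"
  using assms
proof (induction rule: finite_induct)
  case empty
  then show ?case by (intro exI[of _ 1]) auto
next
  case (insert r R)
  then obtain d where d: "d \<noteq> 0" "\<forall>r\<in>R. \<exists>f. Fract d 1 * r = Fract f 1" by blast
  obtain a b where r: "r = Fract a b" "b \<noteq> 0" by (cases r)
  have "Fract (d * b) 1 * r = Fract (d * a) 1" using r by (simp add: eq_fract)
  moreover have "\<exists>f. Fract (d * b) 1 * s = Fract f 1" if "s \<in> R" for s
  proof -
    obtain f where f: "Fract d 1 * s = Fract f 1" using d(2) \<open>s \<in> R\<close> by blast
    have "Fract (d * b) 1 = Fract b 1 * Fract d 1" by (simp add: mult.commute)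
    then have "Fract (d * b) 1 * s = Fract b 1 * (Fract d 1 * s)" by (simp only: mult.assoc)
    then show ?thesis unfolding f by auto
  qed
  ultimately show ?case using d(1) r(2) by (intro exI[of _ "d * b"]) auto
qed

section \<open>The integral elements form a finite module\<close>

locale function_field = rhom \<phi> for \<phi> :: "'q::{field, finite} poly fract \<Rightarrow> 'k::field" +
  assumes finite_ext: "\<exists>T. finite T \<and> spn \<phi> T = UNIV"
begin

definition \<psi> :: "'q poly \<Rightarrow> 'k" where "\<psi> f = \<phi> (Fract f 1)"

sublocale C: rhom \<psi>
proof
  have "Fract (x + y) 1 = Fract x 1 + Fract y 1" "Fract (x * y) 1 = Fract x 1 * Fract y 1"
    for x y :: "'q poly" by simp_all
  then show "\<psi> (x + y) = \<psi> x + \<psi> y" "\<psi> (x * y) = \<psi> x * \<psi> y" for x y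
    unfolding \<psi>_def by (simp_all only: hom_add hom_mult)
  show "\<psi> 1 = 1" unfolding \<psi>_def One_fract_def[symmetric] by (rule hom_1)
qed

lemma inj_\<phi>: "\<phi> r = 0 \<longleftrightarrow> r = 0"
proof
  show "r = 0" if "\<phi> r = 0"
  proof (rule ccontr)
    assume "r \<noteq> 0"
    then have "\<phi> (r * inverse r) = 1" using hom_1 by simp
    then show False using that by (simp add: hom_mult)
  qed
qed (simp add: hom_0)

lemma inj_\<psi>: "\<psi> f = 0 \<longleftrightarrow> f = 0"
  unfolding \<psi>_def inj_\<phi> by (simp add: Zero_fract_def eq_fract)

abbreviation A :: "'k set" where "A \<equiv> Collect C.integral"

lemma noetherian_C: "noetherian_type TYPE('q poly)"
  by (intro hilbert_basis noetherian_type_field)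

lemma is_subring_A: "is_subring A"
  by (rule C.is_subring_integral[OF noetherian_C])

lemma algebraic_over_C:
  "\<exists>n d f. d \<noteq> 0 \<and> \<psi> d * x ^ n = (\<Sum>i<n. \<psi> (f i) * x ^ i)"
proof -
  obtain T where T: "finite T" "spn \<phi> T = UNIV" using finite_ext by blast
  have "\<exists>n. x ^ n \<in> spn \<phi> ((\<lambda>i. x ^ i) ` {..<n})"
    by (rule power_in_span_lower_powers[OF noetherian_type_field T(1)]) (simp add: T(2))
  then obtain n where n: "x ^ n \<in> spn \<phi> ((\<lambda>i. x ^ i) ` {..<n})" by blast
  from span_powers_explicit[OF this] obtain r where r: "x ^ n = (\<Sum>i<n. \<phi> (r i) * x ^ i)" by blast
  obtain d where d: "d \<noteq> 0" "\<forall>s\<in>r ` {..<n}. \<exists>f. Fract d 1 * s = Fract f 1"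
    using common_denominator[of "r ` {..<n}"] by auto
  then have "\<forall>i\<in>{..<n}. \<exists>f. Fract d 1 * r i = Fract f 1" by blast
  then obtain f where f: "\<And>i. i < n \<Longrightarrow> Fract d 1 * r i = Fract (f i) 1"
    by (metis lessThan_iff)
  have "\<psi> d * x ^ n = (\<Sum>i<n. \<phi> (Fract d 1 * r i) * x ^ i)"
    unfolding r \<psi>_def sum_distrib_left by (simp only: hom_mult mult.assoc)
  also have "\<dots> = (\<Sum>i<n. \<psi> (f i) * x ^ i)"
    by (intro sum.cong refl) (simp add: f \<psi>_def)
  finally show ?thesis using d(1) by blast
qed

text \<open>Multiplying a relation for \<open>x\<close> with leading coefficient \<open>d\<close> by
  \<open>d ^ (n - 1)\<close> makes it monic in \<open>d * x\<close>.\<close>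

lemma scale_into_A: "\<exists>c. c \<noteq> 0 \<and> \<psi> c * x \<in> A"
proof -
  obtain n d f where d: "d \<noteq> 0" "\<psi> d * x ^ n = (\<Sum>i<n. \<psi> (f i) * x ^ i)"
    using algebraic_over_C[of x] by blast
  \<comment> \<open>For \<open>n = 0\<close> the relation would read
    \<open>\<psi> d = 0\<close>.\<close>
  have "n \<noteq> 0" using d by (intro notI) (simp add: inj_\<psi>)
  then obtain m where m: "n = Suc m" by (cases n) auto
  have "(\<psi> d * x) ^ n = \<psi> d ^ (n - 1) * (\<psi> d * x ^ n)"
    unfolding m by (simp add: power_mult_distrib mult_ac)
  also have "\<dots> = (\<Sum>i<n. \<psi> (d ^ (n - 1 - i) * f i) * (\<psi> d * x) ^ i)"
    unfolding d(2) sum_distrib_left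
  proof (intro sum.cong refl)
    fix i assume "i \<in> {..<n}"
    then have "\<psi> d ^ (n - 1) = \<psi> d ^ (n - 1 - i) * \<psi> d ^ i" by (simp add: power_add[symmetric])
    then show "\<psi> d ^ (n - 1) * (\<psi> (f i) * x ^ i)
        = \<psi> (d ^ (n - 1 - i) * f i) * (\<psi> d * x) ^ i"
      by (simp add: C.hom_mult C.hom_power power_mult_distrib mult_ac)
  qed
  finally have "C.integral (\<psi> d * x)"
    by (intro C.integral_trans[OF noetherian_C C.integral_hom])
  then show ?thesis using d(1) by blast
qed

text \<open>An arbitrary basis \<open>B\<close> is scaled into \<open>A\<close>. The unscaled basis
  serves as index set, \<open>e b\<close> is the scaled member, and \<open>co\<close> divides the
  old coordinate by the scaling factor.\<close>

lemma integral_coordinates: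
  "\<exists>(B::'k set) e co. finite B \<and> (\<forall>b\<in>B. e b \<in> A) \<and> (\<forall>x. x = (\<Sum>b\<in>B. \<phi> (co b x) * e b)) \<and>
    (\<forall>b\<in>B. \<forall>x y. co b (x + y) = co b x + co b y) \<and> (\<forall>b\<in>B. \<forall>r x. co b (\<phi> r * x) = r * co b x) \<and>
    (\<forall>b\<in>B. \<forall>b'\<in>B. co b (e b') = (if b = b' then 1 else 0))"
proof -
  interpret V: Vector_Spaces.vector_space "\<lambda>r x. \<phi> r * x"
    by standard (simp_all add: hom_1 hom_add hom_mult algebra_simps)
  obtain T where T: "finite T" "spn \<phi> T = UNIV" using finite_ext by blast
  obtain B where B: "B \<subseteq> T" "\<not> M.dependent B" "T \<subseteq> M.span B"
    using V.maximal_independent_subset by blast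
  have fB: "finite B" using B(1) T(1) finite_subset by blast
  have sB: "M.span B = UNIV"
    using T(2) B(3) M.span_mono[OF B(3)] M.span_span[of B] unfolding spn_def by auto
  obtain c where c: "\<And>b. c b \<noteq> 0 \<and> \<psi> (c b) * b \<in> A" using scale_into_A by metis
  define e where "e b = \<psi> (c b) * b" for b
  define co where "co b x = M.representation B x b / Fract (c b) 1" for b x
  have expand: "x = (\<Sum>b\<in>B. \<phi> (co b x) * e b)" for x
  proof -
    have "x = (\<Sum>b\<in>B. \<phi> (M.representation B x b) * b)"
      using M.sum_representation_eq[OF B(2) _ fB order.refl, of x] sB by simp
    also have "\<dots> = (\<Sum>b\<in>B. \<phi> (co b x) * e b)"
    proof (intro sum.cong refl)
      fix b
      have "Fract (c b) 1 \<noteq> 0" using c by (simp add: Zero_fract_def eq_fract)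
      then show "\<phi> (M.representation B x b) * b = \<phi> (co b x) * e b"
        by (simp add: co_def e_def \<psi>_def mult.assoc[symmetric] hom_mult[symmetric])
    qed
    finally show ?thesis .
  qed
  have add: "co b (x + y) = co b x + co b y" for b x y
    using sB by (simp add: co_def M.representation_add[OF B(2)] add_divide_distrib)
  have scale: "co b (\<phi> r * x) = r * co b x" for b r x
    using sB by (simp add: co_def M.representation_scale[OF B(2)])
  have basis: "co b (e b') = (if b = b' then 1 else 0)" if "b \<in> B" "b' \<in> B" for b b'
  proof -
    have "Fract (c b) 1 \<noteq> 0" using c by (simp add: Zero_fract_def eq_fract)
    then show ?thesis using sB that
      by (auto simp: co_def e_def \<psi>_def M.representation_scale[OF B(2)] M.representation_basis[OF B(2)])
  qed
  have "e b \<in> A" for b using c by (simp add: e_def)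
  with expand add scale basis fB show ?thesis
    by (intro exI[of _ B] exI[of _ e] exI[of _ co] conjI ballI allI)
qed

text \<open>A lattice argument: subtracting a polynomial combination of the integral basis makes all
  coordinates of an integral element proper fractions. Only finitely many integral elements have
  such coordinates, and they generate \<open>A\<close> together with the basis.\<close>

theorem A_finitely_generated: "\<exists>Y. finite Y \<and> Y \<subseteq> A \<and> A = spn \<psi> Y"
proof -
  from integral_coordinates obtain B :: "'k set" and e co where fB: "finite B"
    and *: "\<forall>b\<in>B. e b \<in> A" "\<forall>x. x = (\<Sum>b\<in>B. \<phi> (co b x) * e b)"
      "\<forall>b\<in>B. \<forall>x y. co b (x + y) = co b x + co b y"
      "\<forall>b\<in>B. \<forall>r x. co b (\<phi> r * x) = r * co b x"
      "\<forall>b\<in>B. \<forall>b'\<in>B. co b (e b') = (if b = b' then 1 else 0)"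
    by (elim exE conjE)
  have e: "e b \<in> A" if "b \<in> B" for b using *(1) that by (rule bspec)
  have expand: "x = (\<Sum>b\<in>B. \<phi> (co b x) * e b)" for x using *(2) by (rule spec)
  have co_add: "co b (x + y) = co b x + co b y" if "b \<in> B" for b x y
    using bspec[OF *(3) that] by simp
  have co_scale: "co b (\<phi> r * x) = r * co b x" if "b \<in> B" for b r x
    using bspec[OF *(4) that] by simp
  have co_basis: "co b (e b') = (if b = b' then 1 else 0)" if "b \<in> B" "b' \<in> B" for b b'
    using bspec[OF bspec[OF *(5) that(1)] that(2)] .
  have co_0: "co b 0 = 0" if "b \<in> B" for b using co_scale[OF that, of 0 0] by simp
  have co_diff: "co b (x - y) = co b x - co b y" if "b \<in> B" for b x y
    using co_add[OF that, of "x - y" y] by simp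
  have co_sum: "co b (sum f I) = (\<Sum>i\<in>I. co b (f i))" if "b \<in> B" for b I and f :: "'i \<Rightarrow> 'k"
    by (induction I rule: infinite_finite_induct) (auto simp: co_0[OF that] co_add[OF that])
  have co_mult: "co c (x * y) = (\<Sum>b\<in>B. \<Sum>b'\<in>B. co b x * co b' y * co c (e b * e b'))"
    if "c \<in> B" for c x y
  proof -
    have "x * y = (\<Sum>b\<in>B. \<phi> (co b x) * e b) * (\<Sum>b\<in>B. \<phi> (co b y) * e b)"
      using expand by metis
    also have "\<dots> = (\<Sum>b\<in>B. \<Sum>b'\<in>B. \<phi> (co b x * co b' y) * (e b * e b'))"
      by (simp add: sum_product hom_mult mult_ac)
    finally show ?thesis by (simp add: co_sum[OF that] co_scale[OF that])
  qed
  obtain D0 :: "'q poly fract \<Rightarrow> nat" where D0: "\<And>s N r. small (N + D0 s) r \<Longrightarrow> small N (s * r)"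
    using small_bounded_mult by metis
  \<comment> \<open>A sum over all structure constants of the multiplication, so that one number
    bounds the loss of smallness for each of them.\<close>
  define D where "D = (\<Sum>c\<in>B. \<Sum>b\<in>B. \<Sum>b'\<in>B. D0 (co c (e b * e b')))"
  have D: "small N (co c (e b * e b') * r)" if "small (N + D) r" "b \<in> B" "b' \<in> B" "c \<in> B" for N r b b' c
  proof -
    have "D0 (co c (e b * e b')) \<le> (\<Sum>b'\<in>B. D0 (co c (e b * e b')))"
      by (rule member_le_sum) (use that fB in auto)
    also have "\<dots> \<le> (\<Sum>b\<in>B. \<Sum>b'\<in>B. D0 (co c (e b * e b')))"
      by (rule member_le_sum) (use that fB in auto)
    also have "\<dots> \<le> D" unfolding D_def
      by (rule member_le_sum) (use that fB in auto)
    finally show ?thesis using D0 small_mono[OF that(1)] by simp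
  qed
  \<comment> \<open>Each multiplication by \<open>z\<close> gains \<open>Suc D\<close> and loses
    \<open>D\<close>, so the coordinates of \<open>z ^ Suc k\<close> are small to order
    \<open>k\<close>. All powers of \<open>z\<close> lie in one finite module, hence have a common
    denominator \<open>d\<close>; at \<open>k = degree d\<close> the cleared coordinates are
    polynomials of negative degree, that is zero.\<close>
  have small_zero: "z = 0" if z: "z \<in> A" "\<And>b. b \<in> B \<Longrightarrow> small (Suc D) (co b z)" for z
  proof -
    have pow: "\<forall>c\<in>B. small k (co c (z ^ Suc k))" for k
    proof (induction k)
      case 0
      then show ?case using z(2) small_mono by fastforce
    next
      case (Suc k)
      show ?case
      proof
        fix c assume c: "c \<in> B"
        have "small (Suc k) (\<Sum>b\<in>B. \<Sum>b'\<in>B. co b (z ^ Suc k) * co b' z * co c (e b * e b'))"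
          unfolding mult.commute[of _ "co c _"]
        proof (intro small_sum D c)
          fix b b' assume b: "b \<in> B" "b' \<in> B"
          have "small (k + Suc D) (co b (z ^ Suc k) * co b' z)"
            using Suc b z(2) by (intro small_mult) auto
          then show "small (Suc k + D) (co b (z ^ Suc k) * co b' z)" by simp
        qed
        moreover have "co c (z ^ Suc (Suc k)) = co c (z ^ Suc k * z)" by (simp add: mult_ac)
        ultimately show "small (Suc k) (co c (z ^ Suc (Suc k)))"
          by (simp only: co_mult[OF c, of "z ^ Suc k" z])
      qed
    qed
    obtain Y where Y: "finite Y" "1 \<in> spn \<psi> Y" "{z} \<subseteq> C.stab Y"
      using C.common_stab[of "{z}"] z(1) by auto
    have zi: "z ^ i \<in> spn \<psi> Y" for i
      by (induction i) (use Y C.stab_span in auto)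
    obtain d where d: "d \<noteq> 0" "\<forall>r\<in>(\<lambda>(b, y). co b y) ` (B \<times> Y). \<exists>f. Fract d 1 * r = Fract f 1"
      using common_denominator[of "(\<lambda>(b, y). co b y) ` (B \<times> Y)"] fB Y(1) by blast
    have den: "\<exists>f. Fract d 1 * co b w = Fract f 1" if w: "w \<in> spn \<psi> Y" and b: "b \<in> B" for w b
      using w
    proof (induction rule: C.span_induct_alt)
      case base
      show ?case using co_0[OF b] by (intro exI[of _ 0]) (simp add: fract_collapse)
    next
      case (step c x y)
      then obtain f g where fg: "Fract d 1 * co b y = Fract f 1" "Fract d 1 * co b x = Fract g 1"
        using d(2) b step.hyps by force
      have "co b (\<psi> c * x + y) = Fract c 1 * co b x + co b y"
        by (simp add: co_add[OF b] co_scale[OF b] \<psi>_def)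
      then have "Fract d 1 * co b (\<psi> c * x + y) = Fract c 1 * (Fract d 1 * co b x) + Fract d 1 * co b y"
        by (simp only: algebra_simps)
      also have "\<dots> = Fract (c * g + f) 1" unfolding fg by simp
      finally show ?case by blast
    qed
    have "co b (z ^ Suc (degree d)) = 0" if b: "b \<in> B" for b
    proof -
      obtain f where f: "Fract d 1 * co b (z ^ Suc (degree d)) = Fract f 1"
        using den[OF zi b] by blast
      have "small 0 (Fract f 1)" unfolding f[symmetric]
        using pow b by (intro small_poly_mult) auto
      then have "f = 0" by (rule small_poly_eq_0)
      moreover have "Fract d 1 \<noteq> 0" using d(1) by (simp add: Zero_fract_def eq_fract)
      ultimately show ?thesis using f by (simp add: fract_collapse)
    qed
    then have "z ^ Suc (degree d) = 0" by (subst expand) (simp add: hom_0)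
    then show "z = 0" by auto
  qed
  define T where "T = {x \<in> A. \<forall>b\<in>B. small 0 (co b x)}"
  have fT: "finite T"
  proof -
    \<comment> \<open>If all coordinates of two elements of \<open>T\<close> share their digits to
      this depth, \<open>small_zero\<close> applies to the difference.\<close>
    define N where "N = Suc D"
    obtain f :: "'q poly fract \<Rightarrow> 'q poly" where f: "\<And>r. small 0 r \<Longrightarrow> degree (f r) \<le> N \<and> small 0 (Fract (monom 1 N) 1 * r - Fract (f r) 1)"
      using small_approximation by metis
    let ?F = "\<lambda>x. restrict (\<lambda>b. f (co b x)) B"
    have "inj_on ?F T"
    proof (rule inj_onI)
      fix x y assume xy: "x \<in> T" "y \<in> T" "?F x = ?F y"
      have "x - y \<in> A" using xy(1,2) subring_diff[OF is_subring_A] by (auto simp: T_def)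
      moreover have "small (Suc D) (co b (x - y))" if b: "b \<in> B" for b
      proof -
        have eq: "f (co b x) = f (co b y)" using fun_cong[OF xy(3), of b] b by simp
        have "small 0 ((Fract (monom 1 N) 1 * co b x - Fract (f (co b x)) 1)
            - (Fract (monom 1 N) 1 * co b y - Fract (f (co b y)) 1))"
          using xy(1,2) b f by - (rule small_diff, auto simp: T_def)
        then have "small 0 (Fract (monom 1 N) 1 * co b (x - y))"
          unfolding eq by (simp add: co_diff[OF b] right_diff_distrib)
        then show ?thesis unfolding N_def by (rule small_cancel_monom)
      qed
      ultimately have "x - y = 0" by (rule small_zero)
      then show "x = y" by simp
    qed
    moreover have "?F ` T \<subseteq> (\<Pi>\<^sub>E b\<in>B. {p. degree p \<le> N})"
      using f by (auto simp: T_def)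
    moreover have "finite (\<Pi>\<^sub>E b\<in>B. {p::'q poly. degree p \<le> N})"
      by (intro finite_PiE fB finite_polys_degree_le)
    ultimately show ?thesis by (meson finite_imageD finite_subset)
  qed
  have eqA: "A = spn \<psi> (e ` B \<union> T)"
  proof
    have "smod \<psi> A"
      using subring_closed[OF is_subring_A] C.integral_hom by (intro C.subspaceI) auto
    then show "spn \<psi> (e ` B \<union> T) \<subseteq> A" using e
      by (intro C.span_minimal) (auto simp: T_def)
    show "A \<subseteq> spn \<psi> (e ` B \<union> T)"
    proof
      fix x assume x: "x \<in> A"
      obtain q :: "'q poly fract \<Rightarrow> 'q poly" where q: "\<And>r. small 0 (r - Fract (q r) 1)" using small_fractional_part by metis
      define w where "w = (\<Sum>b\<in>B. \<psi> (q (co b x)) * e b)"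
      have w: "w \<in> spn \<psi> (e ` B \<union> T)" unfolding w_def
        by (intro C.span_sum C.span_scale C.span_base) auto
      have "w \<in> A" using \<open>spn \<psi> (e ` B \<union> T) \<subseteq> A\<close> w by blast
      have "co b (x - w) = co b x - Fract (q (co b x)) 1" if b: "b \<in> B" for b
        using fB b by (simp add: w_def \<psi>_def co_diff[OF b] co_sum[OF b] co_scale[OF b] co_basis if_distrib
            cong: if_cong)
      then have "x - w \<in> T" using x \<open>w \<in> A\<close> q subring_diff[OF is_subring_A] by (auto simp: T_def)
      then have "x - w \<in> spn \<psi> (e ` B \<union> T)" by (intro C.span_base) auto
      then show "x \<in> spn \<psi> (e ` B \<union> T)" using C.span_add[OF _ w] by fastforce
    qed
  qed
  have sub: "e ` B \<union> T \<subseteq> A" using e by (auto simp: T_def)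
  show ?thesis
    by (intro exI[of _ "e ` B \<union> T"] conjI finite_UnI finite_imageI fB fT sub eqA)
qed

end

section \<open>Ideals, primes and local rings inside a larger ring\<close>

definition is_ideal :: "'u::comm_ring_1 set \<Rightarrow> 'u set \<Rightarrow> bool"
  where "is_ideal B I \<longleftrightarrow> I \<subseteq> B \<and> 0 \<in> I \<and> (\<forall>x\<in>I. \<forall>y\<in>I. x + y \<in> I) \<and> (\<forall>b\<in>B. \<forall>x\<in>I. b * x \<in> I)"

definition is_prime :: "'u::comm_ring_1 set \<Rightarrow> 'u set \<Rightarrow> bool"
  where "is_prime B P \<longleftrightarrow> is_ideal B P \<and> 1 \<notin> P \<and> (\<forall>x\<in>B. \<forall>y\<in>B. x * y \<in> P \<longrightarrow> x \<in> P \<or> y \<in> P)"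

lemma is_idealD:
  assumes "is_ideal B I"
  shows ideal_subset: "I \<subseteq> B" and ideal_0: "0 \<in> I"
    and ideal_add: "x \<in> I \<Longrightarrow> y \<in> I \<Longrightarrow> x + y \<in> I"
    and ideal_mult: "b \<in> B \<Longrightarrow> x \<in> I \<Longrightarrow> b * x \<in> I"
    and ideal_mult': "b \<in> B \<Longrightarrow> x \<in> I \<Longrightarrow> x * b \<in> I"
  using assms by (auto simp: is_ideal_def mult.commute[of _ b])

lemma ideal_uminus:
  assumes "is_subring B" "is_ideal B I" "x \<in> I"
  shows "- x \<in> I"
  using ideal_mult[OF assms(2), of "- 1" x] assms subring_uminus[OF assms(1) subring_1[OF assms(1)]] by simp

lemma ideal_diff:
  assumes "is_subring B" "is_ideal B I" "x \<in> I" "y \<in> I"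
  shows "x - y \<in> I"
  using ideal_add[OF assms(2,3) ideal_uminus[OF assms(1,2,4)]] by simp

lemma ideal_sum: "is_ideal B I \<Longrightarrow> (\<And>i. i \<in> J \<Longrightarrow> f i \<in> I) \<Longrightarrow> sum f J \<in> I"
  by (induction J rule: infinite_finite_induct) (auto simp: ideal_0 ideal_add)

lemma prime_ideal: "is_prime B P \<Longrightarrow> is_ideal B P"
  by (simp add: is_prime_def)

lemma primeD: "is_prime B P \<Longrightarrow> x \<in> B \<Longrightarrow> y \<in> B \<Longrightarrow> x * y \<in> P \<Longrightarrow> x \<in> P \<or> y \<in> P"
  by (simp add: is_prime_def)

lemma prime_power_mem: "is_subring B \<Longrightarrow> is_prime B P \<Longrightarrow> x \<in> B \<Longrightarrow> x ^ n \<in> P \<Longrightarrow> x \<in> P"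
proof (induction n)
  case 0
  then show ?case by (simp add: is_prime_def)
next
  case (Suc n)
  then show ?case using primeD[of B P x "x ^ n"] subring_power[of B x n] by auto
qed

definition local_ring_at :: "'k::field set \<Rightarrow> 'k set \<Rightarrow> 'k set"
  where "local_ring_at B P = {a / s | a s. a \<in> B \<and> s \<in> B \<and> s \<notin> P}"

lemma local_ring_atI: "a \<in> B \<Longrightarrow> s \<in> B \<Longrightarrow> s \<notin> P \<Longrightarrow> a / s \<in> local_ring_at B P"
  unfolding local_ring_at_def by blast

lemma prime_1: "is_prime B P \<Longrightarrow> 1 \<notin> P"
  by (simp add: is_prime_def)

lemma is_subring_local_ring_at:
  assumes B: "is_subring B" and P: "is_prime B P"
  shows "is_subring (local_ring_at B P)"
proof -
  have P0: "0 \<in> P" by (rule ideal_0[OF prime_ideal[OF P]])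
  have "1 \<in> local_ring_at B P"
    using local_ring_atI[OF subring_1[OF B] subring_1[OF B] prime_1[OF P]] by simp
  moreover have "x - y \<in> local_ring_at B P \<and> x * y \<in> local_ring_at B P"
    if x: "x \<in> local_ring_at B P" and y: "y \<in> local_ring_at B P" for x y
  proof -
    obtain a s where x: "x = a / s" "a \<in> B" "s \<in> B" "s \<notin> P"
      using x unfolding local_ring_at_def by blast
    obtain b t where y: "y = b / t" "b \<in> B" "t \<in> B" "t \<notin> P"
      using y unfolding local_ring_at_def by blast
    have st: "s * t \<in> B" "s * t \<notin> P" using x y primeD[OF P] subring_mult[OF B] by auto
    have "s \<noteq> 0" "t \<noteq> 0" using x y P0 by auto
    then have "x - y = (a * t - b * s) / (s * t)" "x * y = (a * b) / (s * t)"
      using x y by (auto simp: field_simps)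
    moreover have "a * t - b * s \<in> B" "a * b \<in> B" using x y subring_closed[OF B] by auto
    ultimately show ?thesis using st unfolding local_ring_at_def by blast
  qed
  ultimately show ?thesis by (simp add: is_subring_def)
qed

lemma local_ring_at_subset: "is_subring B \<Longrightarrow> is_prime B P \<Longrightarrow> B \<subseteq> local_ring_at B P"
  using local_ring_atI[of _ B 1 P] subring_1[of B] prime_1[of B P] by fastforce

lemma local_ring_at_common_denominator:
  assumes B: "is_subring B" and P: "is_prime B P" and "finite F" "F \<subseteq> local_ring_at B P"
  shows "\<exists>s\<in>B. s \<notin> P \<and> (\<forall>x\<in>F. s * x \<in> B)"
  using assms(3,4)
proof (induction rule: finite_induct)
  case empty
  then show ?case using P subring_1[OF B] by (auto simp: is_prime_def)
next
  case (insert x F)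
  then obtain s where s: "s \<in> B" "s \<notin> P" "\<forall>x\<in>F. s * x \<in> B" by auto
  obtain a t where x: "x = a / t" "a \<in> B" "t \<in> B" "t \<notin> P"
    using insert.prems unfolding local_ring_at_def by blast
  have "0 \<in> P" by (rule ideal_0[OF prime_ideal[OF P]])
  then have "t \<noteq> 0" using x by auto
  then have "(s * t) * x = s * a" using x by simp
  then have "(s * t) * x \<in> B" using s x subring_closed[OF B] by auto
  moreover have "(s * t) * y \<in> B" if "y \<in> F" for y
    using subring_mult[OF B, of t "s * y"] s(3) that x(3) by (auto simp: mult_ac)
  moreover have "s * t \<in> B" "s * t \<notin> P" using s x subring_mult[OF B, of s t] primeD[OF P, of s t] by auto
  ultimately show ?case by blast
qed

section \<open>Localizations of the ring of integers are valuation rings\<close>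

context function_field
begin

text \<open>The descent rests on \<open>A\<close> being integrally closed: for the leading
  coefficient \<open>l\<close>, the element \<open>y = l * x\<close> lies in \<open>A\<close>. If
  \<open>l\<close> is outside \<open>P\<close>, then \<open>x = y / l\<close>; otherwise the top
  term, read as \<open>y * x ^ n\<close>, is absorbed into the next coefficient and the relation
  gets shorter.\<close>

lemma u_or_inverse:
  assumes P: "is_prime A P"
  shows "(\<And>i. i \<le> n \<Longrightarrow> c i \<in> A) \<Longrightarrow> (\<Sum>i\<le>n. c i * x ^ i) = 0 \<Longrightarrow> \<exists>i\<le>n. c i \<notin> P \<Longrightarrow>
    x \<in> local_ring_at A P \<or> inverse x \<in> local_ring_at A P"
proof (induction n arbitrary: c)
  case 0
  then show ?case using ideal_0[OF prime_ideal[OF P]] by auto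
next
  case (Suc n)
  have P0: "0 \<in> P" by (rule ideal_0[OF prime_ideal[OF P]])
  let ?l = "c (Suc n)"
  define y where "y = ?l * x"
  have rel: "?l * x ^ Suc n = - (\<Sum>i\<le>n. c i * x ^ i)"
    using Suc.prems(2) by (simp add: eq_neg_iff_add_eq_0 add.commute)
  have "y ^ Suc n = ?l ^ n * (?l * x ^ Suc n)" by (simp add: y_def power_mult_distrib mult_ac)
  also have "\<dots> = (\<Sum>i\<le>n. ?l ^ n * (- (c i * x ^ i)))"
    unfolding rel by (simp add: sum_distrib_left sum_negf)
  also have "\<dots> = (\<Sum>i\<le>n. (- (c i * ?l ^ (n - i))) * y ^ i)"
  proof (intro sum.cong refl)
    fix i assume "i \<in> {..n}"
    then have "?l ^ n = ?l ^ (n - i) * ?l ^ i" by (simp add: power_add[symmetric])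
    then show "?l ^ n * (- (c i * x ^ i)) = (- (c i * ?l ^ (n - i))) * y ^ i"
      by (simp add: y_def power_mult_distrib mult_ac)
  qed
  finally have *: "y ^ Suc n = (\<Sum>i<Suc n. (- (c i * ?l ^ (n - i))) * y ^ i)"
    by (simp only: lessThan_Suc_atMost)
  have "- (c i * ?l ^ (n - i)) \<in> A" if "i < Suc n" for i
    using Suc.prems(1) that
    by (intro subring_uminus[OF is_subring_A] subring_mult[OF is_subring_A] subring_power[OF is_subring_A]) auto
  then have yA: "y \<in> A" using C.integral_trans[OF noetherian_C _ *] by auto
  have lA: "?l \<in> A" using Suc.prems(1) by blast
  show ?case
  proof (cases "?l \<in> P")
    case False
    then have "x = y / ?l" using P0 by (auto simp: y_def)
    then show ?thesis using yA False lA unfolding local_ring_at_def by blast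
  next
    case True
    define d where "d i = (if i = n then y + c n else c i)" for i
    have dA: "d i \<in> A" if "i \<le> n" for i
      using that Suc.prems(1) yA subring_add[OF is_subring_A, of y "c n"] by (auto simp: d_def simp del: mem_Collect_eq)
    have "(\<Sum>i\<le>n. d i * x ^ i) = (\<Sum>i\<le>n. c i * x ^ i + (if i = n then y * x ^ n else 0))"
      by (intro sum.cong refl) (auto simp: d_def algebra_simps)
    also have "\<dots> = 0" using Suc.prems(2) by (simp add: sum.distrib y_def mult_ac)
    finally have d0: "(\<Sum>i\<le>n. d i * x ^ i) = 0" .
    show ?thesis
    proof (cases "\<exists>i\<le>n. d i \<notin> P")
      case ex: True
      show ?thesis by (rule Suc.IH[OF dA d0 ex])
    next
      case False
      \<comment> \<open>The only old coefficient outside \<open>P\<close> is then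
        \<open>c n\<close>, while \<open>y + c n\<close> lies in \<open>P\<close>. So
        \<open>y\<close> is outside \<open>P\<close> and can be the denominator of
        \<open>inverse x\<close>.\<close>
      then have "c i \<in> P" if "i < n" for i using that by (auto simp: d_def split: if_splits dest: spec[of _ i])
      with Suc.prems(3) True have "c n \<notin> P" by (metis le_Suc_eq le_neq_implies_less)
      moreover have "y + c n \<in> P" using False by (auto simp: d_def)
      ultimately have "y \<notin> P"
        using ideal_diff[OF is_subring_A prime_ideal[OF P], of "y + c n" y] by auto
      then have "y \<noteq> 0" using P0 by auto
      then have "inverse x = ?l / y" by (simp add: y_def field_simps)
      then show ?thesis using yA lA \<open>y \<notin> P\<close> unfolding local_ring_at_def by blast
    qed
  qed
qed

text \<open>For use with the contraction of a prime of \<open>A\<close>; the alternative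
  \<open>d = 0\<close> covers the zero ideal.\<close>

lemma proper_ideal_of_C_principal:
  fixes I :: "'q poly set"
  assumes I: "is_ideal UNIV I" and "1 \<notin> I"
  shows "\<exists>d. (d = 0 \<or> degree d > 0) \<and> (\<forall>f\<in>I. d dvd f)"
proof (cases "I \<subseteq> {0}")
  case True
  then show ?thesis by (intro exI[of _ 0]) auto
next
  case False
  then obtain g where "g \<in> I" "g \<noteq> 0" by auto
  then obtain d where d: "d \<in> I" "d \<noteq> 0" and min: "\<And>f. f \<in> I \<Longrightarrow> f \<noteq> 0 \<Longrightarrow> degree d \<le> degree f"
    using ex_has_least_nat[of "\<lambda>f. f \<in> I \<and> f \<noteq> 0" g degree] by blast
  have "degree d > 0"
  proof (rule ccontr)
    assume "\<not> degree d > 0"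
    then obtain c where c: "d = [:c:]" using degree_eq_zeroE by blast
    then have "[:inverse c:] * d = 1" using d(2) by (simp add: one_pCons)
    then show False using ideal_mult[OF I, of "[:inverse c:]" d] d(1) assms(2) by auto
  qed
  moreover have "d dvd f" if "f \<in> I" for f
  proof -
    have "f mod d = f + (- (f div d)) * d" by (simp add: minus_div_mult_eq_mod[symmetric])
    also have "\<dots> \<in> I" by (intro ideal_add[OF I] ideal_mult[OF I] that d) auto
    finally have "f mod d = 0" using min degree_mod_less[OF d(2), of f] by force
    then show ?thesis by (simp add: dvd_eq_mod_eq_0)
  qed
  ultimately show ?thesis by blast
qed

text \<open>Take a relation for \<open>x\<close> over the polynomial ring whose coefficients have
  least total degree. If all of them were in \<open>P\<close>, the nonunit \<open>g\<close> would
  divide them all, and the quotients would form a relation of smaller degree. So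
  \<open>u_or_inverse\<close> applies.\<close>

theorem valuation_ring:
  assumes P: "is_prime A P"
  shows "x \<in> local_ring_at A P \<or> inverse x \<in> local_ring_at A P"
proof -
  define R where "R n c \<longleftrightarrow> (\<exists>i\<le>n. c i \<noteq> 0) \<and> (\<Sum>i\<le>n. \<psi> (c i) * x ^ i) = 0" for n and c :: "nat \<Rightarrow> 'q poly"
  obtain n d f where d: "d \<noteq> 0" "\<psi> d * x ^ n = (\<Sum>i<n. \<psi> (f i) * x ^ i)"
    using algebraic_over_C[of x] by blast
  have "R n (\<lambda>i. if i = n then d else - f i)"
  proof -
    have "(\<Sum>i\<le>n. \<psi> (if i = n then d else - f i) * x ^ i) = (\<Sum>i<n. \<psi> (- f i) * x ^ i) + \<psi> d * x ^ n"
      by (simp add: lessThan_Suc_atMost[symmetric])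
    also have "\<dots> = 0" by (simp add: d(2) C.hom_minus sum_negf)
    finally show ?thesis using d(1) by (auto simp: R_def)
  qed
  then obtain c where c: "R n c" and min: "\<And>c'. R n c' \<Longrightarrow> (\<Sum>i\<le>n. degree (c i)) \<le> (\<Sum>i\<le>n. degree (c' i))"
    using ex_has_least_nat[of "R n" _ "\<lambda>c. \<Sum>i\<le>n. degree (c i)"] by blast
  define I where "I = {f. \<psi> f \<in> P}"
  have I: "is_ideal UNIV I"
    using ideal_0[OF prime_ideal[OF P]] ideal_add[OF prime_ideal[OF P]] ideal_mult[OF prime_ideal[OF P]] C.integral_hom
    by (auto simp: is_ideal_def I_def C.hom_0 C.hom_add C.hom_mult)
  have "1 \<notin> I" using P by (auto simp: I_def C.hom_1 is_prime_def)
  then obtain g where g: "g = 0 \<or> degree g > 0" "\<And>f. f \<in> I \<Longrightarrow> g dvd f"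
    using proper_ideal_of_C_principal[OF I] by blast
  have "\<exists>i\<le>n. \<psi> (c i) \<notin> P"
  proof (rule ccontr)
    assume "\<not> ?thesis"
    then have "g dvd c i" if "i \<le> n" for i using g(2) that by (auto simp: I_def)
    then have "\<forall>i. \<exists>k. i \<le> n \<longrightarrow> c i = g * k" by (auto simp: dvd_def)
    then obtain k where k: "\<And>i. i \<le> n \<Longrightarrow> c i = g * k i" by metis
    obtain j where j: "j \<le> n" "c j \<noteq> 0" using c by (auto simp: R_def)
    then have g0: "g \<noteq> 0" "k j \<noteq> 0" using k by auto
    have "\<psi> g * (\<Sum>i\<le>n. \<psi> (k i) * x ^ i) = (\<Sum>i\<le>n. \<psi> (c i) * x ^ i)"
      unfolding sum_distrib_left
    proof (intro sum.cong refl)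
      fix i assume "i \<in> {..n}"
      then have "c i = g * k i" using k by simp
      then show "\<psi> g * (\<psi> (k i) * x ^ i) = \<psi> (c i) * x ^ i" by (simp only: C.hom_mult mult.assoc)
    qed
    then have "R n k" using c g0 j(1) by (auto simp: R_def inj_\<psi>)
    then have "(\<Sum>i\<le>n. degree (c i)) \<le> (\<Sum>i\<le>n. degree (k i))" by (rule min)
    moreover have "(\<Sum>i\<le>n. degree (k i)) < (\<Sum>i\<le>n. degree (c i))"
    proof (rule sum_strict_mono_ex1)
      show "\<forall>i\<in>{..n}. degree (k i) \<le> degree (c i)"
      proof
        fix i assume "i \<in> {..n}"
        then show "degree (k i) \<le> degree (c i)"
          using k[of i] g0(1) by (cases "k i = 0") (auto simp: degree_mult_eq)
      qed
      show "\<exists>i\<in>{..n}. degree (k i) < degree (c i)"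
        using j k[OF j(1)] g0 g(1) by (intro bexI[of _ j]) (auto simp: degree_mult_eq)
    qed auto
    ultimately show False by simp
  qed
  then show ?thesis using c u_or_inverse[OF P, of n "\<lambda>i. \<psi> (c i)" x] C.integral_hom by (auto simp: R_def)
qed

end

subsection \<open>The linear action\<close>

abbreviation const2 :: "'k::comm_ring_1 \<Rightarrow> 'k poly poly" where "const2 c \<equiv> [:[:c:]:]"

lemma rhom_const2: "rhom (const2 :: 'k::comm_ring_1 \<Rightarrow> _)"
  by standard (auto simp: one_pCons)

lemma rhom_poly_map_poly:
  assumes "rhom h"
  shows "rhom (\<lambda>f. poly (map_poly h f) v)"
proof -
  interpret rhom h by (rule assms)
  have pC: "map_poly h (pCons a p) = pCons (h a) (map_poly h p)" for a p
    by (rule poly_eqI) (simp add: coeff_map_poly hom_0 coeff_pCons split: nat.splits)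
  have ad: "map_poly h (f + g) = map_poly h f + map_poly h g" for f g
    by (rule poly_eqI) (simp add: coeff_map_poly hom_0 hom_add)
  have sm: "map_poly h (smult a g) = smult (h a) (map_poly h g)" for a g
    by (rule poly_eqI) (simp add: coeff_map_poly hom_0 hom_mult)
  have mu: "map_poly h (f * g) = map_poly h f * map_poly h g" for f g
    by (induction f) (simp_all add: ad sm pC hom_0)
  show ?thesis by standard (simp_all add: ad mu hom_1)
qed

lemma rhom_subst2: "rhom (\<lambda>f. subst2 f u v)"
  unfolding subst2_def by (intro rhom_poly_map_poly rhom_const2)

lemma subst2_const2 [simp]: "subst2 (const2 c) u v = const2 c"
  by (simp add: subst2_def map_poly_pCons)

lemma subst2_var_X [simp]: "subst2 var_X u v = u"
  by (simp add: subst2_def var_X_def map_poly_pCons flip: one_pCons)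

lemma subst2_var_Y [simp]: "subst2 var_Y u v = v"
  by (simp add: subst2_def var_Y_def map_poly_pCons flip: one_pCons)

lemma pCons_var_Y: "pCons a p = [:a:] + var_Y * p"
  by (simp add: var_Y_def)

lemma pCons_var_X: "[:pCons c q:] = const2 c + var_X * [:q:]"
  by (simp add: var_X_def)

lemma poly2_rhom_eqI:
  assumes f: "rhom f" and g: "rhom g"
    and "\<And>c. f (const2 c) = g (const2 c)" "f var_X = g var_X" "f var_Y = g var_Y"
  shows "f p = g p"
proof -
  interpret F: rhom f by (rule f)
  interpret G: rhom g by (rule g)
  have 0: "f 0 = g 0" by (simp add: F.hom_0 G.hom_0)
  have 1: "f [:q:] = g [:q:]" for q
  proof (induction q)
    case (pCons c q)
    then show ?case unfolding pCons_var_X[of c q] by (simp only: F.hom_add F.hom_mult G.hom_add G.hom_mult assms)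
  qed (simp add: 0)
  show ?thesis
  proof (induction p)
    case (pCons a p)
    then show ?case unfolding pCons_var_Y[of a p] by (simp only: F.hom_add F.hom_mult G.hom_add G.hom_mult assms 1)
  qed (simp add: 0)
qed

lemma rhom_lin_act: "rhom (lin_act M)"
  unfolding lin_act_def by (rule rhom_subst2)

interpretation LA: rhom "lin_act M" for M :: "'k::comm_ring_1^2^2"
  by (rule rhom_lin_act)

lemma lin_act_const2 [simp]: "lin_act M (const2 c) = const2 c"
  by (simp add: lin_act_def)

lemma linear_form_axis: "linear_form (axis 1 1) = var_X" "linear_form (axis 2 1) = var_Y"
  by (simp_all add: linear_form_def axis_def one_pCons[symmetric])

lemma linear_form_add: "linear_form (v + w) = linear_form v + linear_form w"
  by (simp add: linear_form_def algebra_simps var_X_def var_Y_def)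

lemma linear_form_scale: "linear_form (c *s v) = const2 c * linear_form v"
  by (simp add: linear_form_def algebra_simps)

lemma linear_form_eq_iff: "linear_form v = linear_form w \<longleftrightarrow> v = w"
proof
  assume "linear_form v = linear_form w"
  then have "poly.coeff (poly.coeff (linear_form v) 0) 1 = poly.coeff (poly.coeff (linear_form w) 0) 1"
    "poly.coeff (poly.coeff (linear_form v) 1) 0 = poly.coeff (poly.coeff (linear_form w) 1) 0" by simp_all
  then show "v = w" by (simp add: linear_form_def var_X_def var_Y_def vec_eq_iff forall_2)
qed simp

lemma lin_act_linear_form: "lin_act M (linear_form w) = linear_form (M *v w)"
proof -
  have "lin_act M (linear_form w) = const2 (w $ 1) * linear_form (column 1 M) + const2 (w $ 2) * linear_form (column 2 M)"
    unfolding linear_form_def[of w] by (simp only: LA.hom_add LA.hom_mult lin_act_const2)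
      (simp add: lin_act_def)
  also have "\<dots> = linear_form (w $ 1 *s column 1 M + w $ 2 *s column 2 M)"
    by (simp only: linear_form_add linear_form_scale)
  also have "w $ 1 *s column 1 M + w $ 2 *s column 2 M = M *v w"
    by (simp add: vec_eq_iff matrix_vector_mult_def column_def sum_2 mult.commute)
  finally show ?thesis .
qed

lemma lin_act_var:
  "lin_act M var_X = linear_form (column 1 M)" "lin_act M var_Y = linear_form (column 2 M)"
  by (simp_all add: lin_act_def)

text \<open>Both sides are ring homomorphisms fixing the constants, so comparing them on linear
  forms suffices, and there the action is the product of matrix and vector.\<close>

lemma lin_act_mult: "lin_act (M ** N) f = lin_act M (lin_act N f)"
proof (rule poly2_rhom_eqI[OF rhom_lin_act])
  show "rhom (\<lambda>f. lin_act M (lin_act N f))"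
    by standard (simp_all add: LA.hom_1 LA.hom_add LA.hom_mult)
  have "lin_act (M ** N) (linear_form w) = lin_act M (lin_act N (linear_form w))" for w
    by (simp add: lin_act_linear_form matrix_vector_mul_assoc)
  from this[of "axis 1 1"] this[of "axis 2 1"]
  show "lin_act (M ** N) var_X = lin_act M (lin_act N var_X)" "lin_act (M ** N) var_Y = lin_act M (lin_act N var_Y)"
    by (simp_all add: linear_form_axis)
qed simp

lemma lin_act_mat_1: "lin_act (mat 1) f = f"
proof (rule poly2_rhom_eqI[OF rhom_lin_act rhom_id])
  have "lin_act (mat 1) (linear_form w) = linear_form w" for w :: "'a^2"
    by (simp add: lin_act_linear_form)
  from this[of "axis 1 1"] this[of "axis 2 1"]
  show "lin_act (mat 1) var_X = (var_X :: 'a poly poly)" "lin_act (mat 1) var_Y = (var_Y :: 'a poly poly)"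
    by (simp_all add: linear_form_axis)
qed simp

subsection \<open>Polynomials over a subring\<close>

definition polys_over :: "'b::comm_ring_1 set \<Rightarrow> 'b poly set"
  where "polys_over B = {f. \<forall>i. poly.coeff f i \<in> B}"

lemma polys_over_coeff: "f \<in> polys_over B \<Longrightarrow> poly.coeff f i \<in> B"
  by (simp add: polys_over_def)

lemma is_subring_polys_over:
  assumes B: "is_subring B"
  shows "is_subring (polys_over B)"
  using subring_closed[OF B] unfolding is_subring_def polys_over_def
  by (auto simp: coeff_mult intro!: subring_sum[OF B])

lemma poly2_over_eq: "poly2_over B = polys_over (polys_over B)"
  by (auto simp: poly2_over_def polys_over_def)

lemma is_subring_poly2_over: "is_subring B \<Longrightarrow> is_subring (poly2_over B)"
  unfolding poly2_over_eq by (intro is_subring_polys_over)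

lemma polys_over_pConsD: "pCons a p \<in> polys_over B \<Longrightarrow> a \<in> B \<and> p \<in> polys_over B"
  unfolding polys_over_def by (auto dest: spec[of _ 0] spec[of _ "Suc _"])

lemma polys_over_mono: "B \<subseteq> C \<Longrightarrow> polys_over B \<subseteq> polys_over C"
  by (auto simp: polys_over_def)

lemma poly2_over_mono: "B \<subseteq> C \<Longrightarrow> poly2_over B \<subseteq> poly2_over C"
  unfolding poly2_over_eq by (intro polys_over_mono)

lemma polys_over_const: "is_subring B \<Longrightarrow> a \<in> B \<Longrightarrow> [:a:] \<in> polys_over B"
  by (auto simp: polys_over_def coeff_pCons subring_0 split: nat.splits)

lemma poly2_over_const2: "is_subring B \<Longrightarrow> c \<in> B \<Longrightarrow> const2 c \<in> poly2_over B"
  unfolding poly2_over_eq by (intro polys_over_const is_subring_polys_over)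

lemma poly2_over_var:
  assumes "is_subring B"
  shows "var_X \<in> poly2_over B" "var_Y \<in> poly2_over B"
  using subring_closed[OF assms]
  by (auto simp: poly2_over_def var_X_def var_Y_def coeff_pCons split: nat.splits)

lemma poly2_over_linear_form:
  fixes w :: "'k::comm_ring_1^2"
  assumes "is_subring B" "\<And>i. w $ i \<in> B"
  shows "linear_form w \<in> poly2_over B"
  unfolding linear_form_def
  by (intro subring_add subring_mult is_subring_poly2_over poly2_over_const2 poly2_over_var assms)

text \<open>An induction principle: \<open>N\<close> is to be stable under addition, constants and
  the two variables, not under products, so it can be a module over a smaller ring.\<close>

lemma poly2_over_subset:
  assumes add: "\<And>x y. x \<in> N \<Longrightarrow> y \<in> N \<Longrightarrow> x + y \<in> N" and one: "1 \<in> N" and zero: "0 \<in> N"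
    and const: "\<And>c x. c \<in> B \<Longrightarrow> x \<in> N \<Longrightarrow> const2 c * x \<in> N"
    and var: "\<And>x. x \<in> N \<Longrightarrow> var_X * x \<in> N" "\<And>x. x \<in> N \<Longrightarrow> var_Y * x \<in> N"
  shows "poly2_over B \<subseteq> N"
proof
  fix f assume f: "f \<in> poly2_over B"
  have 1: "[:q:] \<in> N" if "q \<in> polys_over B" for q
    using that
  proof (induction q)
    case (pCons c q)
    then have "const2 c * 1 + var_X * [:q:] \<in> N"
      using polys_over_pConsD[OF pCons.prems] by (intro add const one var) auto
    then show ?case unfolding pCons_var_X[of c q] by simp
  qed (simp add: zero)
  show "f \<in> N" using f unfolding poly2_over_eq
  proof (induction f)
    case (pCons a p)
    then have "[:a:] + var_Y * p \<in> N"
      using polys_over_pConsD[OF pCons.prems] by (intro add 1 var) auto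
    then show ?case unfolding pCons_var_Y[of a p] .
  qed (simp add: zero)
qed

lemma rhom_poly2_over_closed:
  assumes h: "rhom h" and S: "is_subring S"
    and "\<And>c. c \<in> B \<Longrightarrow> h (const2 c) \<in> S" "h var_X \<in> S" "h var_Y \<in> S" "f \<in> poly2_over B"
  shows "h f \<in> S"
proof -
  interpret rhom h by (rule h)
  have "poly2_over B \<subseteq> {f. h f \<in> S}"
    by (rule poly2_over_subset)
      (use assms subring_closed[OF S] in \<open>auto simp: hom_0 hom_1 hom_add hom_mult simp del: mult_pCons_left\<close>)
  then show ?thesis using assms by blast
qed

lemma lin_act_poly2_over:
  fixes M :: "'k::comm_ring_1^2^2"
  assumes B: "is_subring B" and M: "\<And>i j. M $ i $ j \<in> B" and "f \<in> poly2_over B"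
  shows "lin_act M f \<in> poly2_over B"
proof (rule rhom_poly2_over_closed[OF rhom_lin_act is_subring_poly2_over[OF B] _ _ _ assms(3)])
  show "lin_act M var_X \<in> poly2_over B" "lin_act M var_Y \<in> poly2_over B"
    unfolding lin_act_var by (intro poly2_over_linear_form B; simp add: column_def M)+
qed (simp add: poly2_over_const2[OF B])

subsection \<open>Orbits of length prime to the characteristic\<close>

lemma of_nat_mult_inverse_mod:
  fixes p :: nat
  assumes "prime p" "\<not> p dvd n" "of_nat p = (0::'v::comm_ring_1)"
  shows "\<exists>m. of_nat m * of_nat n = (1::'v)"
proof -
  have "coprime n p" using assms(1,2) by (metis prime_imp_coprime coprime_commute)
  then obtain x y where xy: "n * x = p * y + 1"
    using bezout_nat[of n p] assms(1,2) by (metis coprime_iff_gcd_eq_1 dvd_0_right)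
  have "of_nat x * of_nat n = (of_nat (n * x) :: 'v)" by (simp add: mult.commute)
  also have "\<dots> = 1" unfolding xy by (simp add: assms(3))
  finally show ?thesis by blast
qed

text \<open>Repeated translation by \<open>w0\<close> splits \<open>W\<close> into classes of
  exactly \<open>p\<close> elements each.\<close>

lemma prime_dvd_card_translation:
  fixes W :: "'v::comm_ring_1 set" and p :: nat
  assumes p: "prime p" "of_nat p = (0::'v)" and W: "finite W" "w0 \<noteq> 0" "\<And>x. x \<in> W \<Longrightarrow> x + w0 \<in> W"
  shows "p dvd card W"
proof -
  define cl where "cl x = range (\<lambda>i. x + of_nat i * w0)" for x
  have clW: "cl x \<subseteq> W" if x: "x \<in> W" for x
  proof -
    have "x + of_nat i * w0 \<in> W" for i
    proof (induction i)
      case (Suc i)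
      then have "x + of_nat i * w0 + w0 \<in> W" by (rule W(3))
      then show ?case by (simp add: algebra_simps)
    qed (simp add: x)
    then show ?thesis by (auto simp: cl_def)
  qed
  have self: "x \<in> cl x" for x unfolding cl_def by (rule range_eqI[of _ _ 0]) simp
  have card: "card (cl x) = p" for x
  proof -
    have "of_nat (i mod p) = (of_nat i :: 'v)" for i
    proof -
      have "of_nat i = (of_nat (p * (i div p) + i mod p) :: 'v)" by simp
      then show ?thesis by (simp only: of_nat_add of_nat_mult p(2)) simp
    qed
    then have "cl x = (\<lambda>i. x + of_nat i * w0) ` {..<p}"
      unfolding cl_def using prime_gt_0_nat[OF p(1)]
      by (auto simp: image_iff) (metis lessThan_iff mod_less_divisor)
    moreover have "inj_on (\<lambda>i. x + of_nat i * w0) {..<p}"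
    proof (rule linorder_inj_onI)
      fix i j assume ij: "i < j" "i \<in> {..<p}" "j \<in> {..<p}"
      then have "\<not> p dvd j - i" by (auto dest: dvd_imp_le)
      then obtain m where m: "of_nat m * of_nat (j - i) = (1::'v)"
        using of_nat_mult_inverse_mod[OF p(1) _ p(2)] by blast
      show "x + of_nat i * w0 \<noteq> x + of_nat j * w0"
      proof
        assume "x + of_nat i * w0 = x + of_nat j * w0"
        then have "of_nat (j - i) * w0 = 0" using ij(1) by (simp add: of_nat_diff algebra_simps)
        then have "of_nat m * of_nat (j - i) * w0 = 0" by (simp add: mult.assoc)
        then show False using m W(2) by simp
      qed
    qed auto
    ultimately show ?thesis by (simp add: card_image)
  qed
  have meet: "cl x \<subseteq> cl y" if zx: "z \<in> cl x" and zy: "z \<in> cl y" for x y z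
  proof
    fix u assume "u \<in> cl x"
    then obtain i where i1: "u = x + of_nat i * w0" unfolding cl_def by blast
    obtain j where i2: "z = x + of_nat j * w0" using zx unfolding cl_def by blast
    obtain k where i3: "z = y + of_nat k * w0" using zy unfolding cl_def by blast
    have i: "u = y + of_nat k * w0 - of_nat j * w0 + of_nat i * w0" using i1 i2 i3 by (simp add: algebra_simps)
    have p0: "of_nat (p * n) = (0::'v)" for n using p(2) by simp
    \<comment> \<open>Classes consist of natural multiples, so subtracting \<open>j\<close> copies
      of \<open>w0\<close> is rewritten as adding \<open>p * j - j\<close> copies.\<close>
    have "j \<le> p * j" using prime_gt_0_nat[OF p(1)] by simp
    have "u = y + (of_nat k + of_nat i + (of_nat (p * j) - of_nat j)) * w0"
      using i p0[of j] by (simp add: algebra_simps)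
    also have "\<dots> = y + of_nat (k + i + (p * j - j)) * w0"
      by (simp only: of_nat_add of_nat_diff[OF \<open>j \<le> p * j\<close>])
    finally show "u \<in> cl y" unfolding cl_def by (rule range_eqI)
  qed
  have "\<Union>(cl ` W) = W" using clW self by blast
  moreover have "p dvd card (\<Union>(cl ` W))"
  proof (rule dvd_partition)
    show "finite (\<Union>(cl ` W))" using \<open>\<Union>(cl ` W) = W\<close> W(1) by simp
    show "\<forall>c\<in>cl ` W. p dvd card c" using card by simp
    show "\<forall>c1\<in>cl ` W. \<forall>c2\<in>cl ` W. c1 \<noteq> c2 \<longrightarrow> c1 \<inter> c2 = {}"
    proof (intro ballI impI)
      fix c1 c2 assume c: "c1 \<in> cl ` W" "c2 \<in> cl ` W" "c1 \<noteq> c2"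
      then obtain x y where "c1 = cl x" "c2 = cl y" by blast
      then show "c1 \<inter> c2 = {}" using c(3) meet[of _ x y] meet[of _ y x] by blast
    qed
  qed
  ultimately show ?thesis by simp
qed

text \<open>In characteristic \<open>p\<close> this is the span of a finite set over the prime
  field, with natural numbers as coefficients.\<close>

definition nat_span :: "'v::comm_ring_1 set \<Rightarrow> 'v set"
  where "nat_span E = range (\<lambda>c. \<Sum>e\<in>E. of_nat (c e) * e)"

lemma finite_nat_span:
  assumes "finite (E::'v::comm_ring_1 set)" "of_nat p = (0::'v)" "p > 0"
  shows "finite (nat_span E)"
proof -
  have m: "of_nat (i mod p) = (of_nat i :: 'v)" for i
  proof -
    have "of_nat i = (of_nat (p * (i div p) + i mod p) :: 'v)" by simp
    then show ?thesis by (simp only: of_nat_add of_nat_mult assms(2)) simp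
  qed
  have "nat_span E \<subseteq> (\<lambda>c. \<Sum>e\<in>E. of_nat (c e) * e) ` (\<Pi>\<^sub>E e\<in>E. {..<p})"
  proof
    fix x assume "x \<in> nat_span E"
    then obtain c where "x = (\<Sum>e\<in>E. of_nat (c e) * e)" by (auto simp: nat_span_def)
    then have "x = (\<Sum>e\<in>E. of_nat (restrict (\<lambda>e. c e mod p) E e) * e)" by (simp add: m)
    then show "x \<in> (\<lambda>c. \<Sum>e\<in>E. of_nat (c e) * e) ` (\<Pi>\<^sub>E e\<in>E. {..<p})"
      using assms(3) by (intro image_eqI[of _ _ "restrict (\<lambda>e. c e mod p) E"]) auto
  qed
  then show ?thesis using assms(1) by (meson finite_PiE finite_imageI finite_lessThan finite_subset)
qed

lemma nat_span_add: "x \<in> nat_span E \<Longrightarrow> y \<in> nat_span E \<Longrightarrow> x + y \<in> nat_span E"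
proof -
  assume "x \<in> nat_span E" "y \<in> nat_span E"
  then obtain c d where "x = (\<Sum>e\<in>E. of_nat (c e) * e)" "y = (\<Sum>e\<in>E. of_nat (d e) * e)"
    by (auto simp: nat_span_def)
  then have "x + y = (\<Sum>e\<in>E. of_nat (c e + d e) * e)" by (simp add: sum.distrib algebra_simps)
  then show ?thesis unfolding nat_span_def by (rule range_eqI[where x = "\<lambda>e. c e + d e"])
qed

lemma nat_span_0: "0 \<in> nat_span E"
  unfolding nat_span_def by (rule range_eqI[of _ _ "\<lambda>_. 0"]) simp

lemma nat_span_sum: "(\<And>i. i \<in> I \<Longrightarrow> f i \<in> nat_span E) \<Longrightarrow> sum f I \<in> nat_span E"
  by (induction I rule: infinite_finite_induct) (auto simp: nat_span_0 nat_span_add)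

lemma nat_span_of_nat: "x \<in> nat_span E \<Longrightarrow> of_nat n * x \<in> nat_span E"
  by (induction n) (auto simp: nat_span_0 nat_span_add algebra_simps)

lemma nat_span_base:
  assumes "finite E" "e \<in> E"
  shows "e \<in> nat_span E"
proof -
  have "(\<Sum>x\<in>E. of_nat (if x = e then 1 else 0) * x) = (\<Sum>x\<in>E. if x = e then x else 0)"
    by (intro sum.cong) auto
  also have "\<dots> = e" using assms by simp
  finally show ?thesis unfolding nat_span_def by (intro range_eqI[of _ _ "\<lambda>x. if x = e then 1 else 0"]) (rule sym)
qed

lemma nat_span_closed:
  assumes f: "\<And>x y. f (x + y) = f x + f y" and E: "finite E" "\<And>e. e \<in> E \<Longrightarrow> f e \<in> E"
    and x: "x \<in> nat_span E"
  shows "f x \<in> nat_span E"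
proof -
  have f0: "f 0 = 0" using f[of 0 0] by simp
  have fs: "f (sum g I) = (\<Sum>i\<in>I. f (g i))" for g and I :: "'a set"
    by (induction I rule: infinite_finite_induct) (auto simp: f0 f)
  have fn: "f (of_nat n * y) = of_nat n * f y" for n y
    by (induction n) (auto simp: f0 f algebra_simps)
  obtain c where "x = (\<Sum>e\<in>E. of_nat (c e) * e)" using x by (auto simp: nat_span_def)
  then have "f x = (\<Sum>e\<in>E. of_nat (c e) * f e)" by (simp add: fs fn)
  also have "\<dots> \<in> nat_span E" by (intro nat_span_sum nat_span_of_nat nat_span_base E)
  finally show ?thesis .
qed

locale matrix_group =
  fixes G :: "('k::field^2^2) set" and p :: nat
  assumes fin: "finite G" and one: "mat 1 \<in> G" and mult: "g \<in> G \<Longrightarrow> h \<in> G \<Longrightarrow> g ** h \<in> G"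
    and inv: "g \<in> G \<Longrightarrow> \<exists>h\<in>G. g ** h = mat 1 \<and> h ** g = mat 1"
    and p: "prime p" "of_nat p = (0::'k)"
begin

text \<open>\<open>W\<close> is invariant under translation by \<open>w0\<close>, so
  \<open>p\<close> divides its cardinality; without \<open>0\<close> the count is \<open>- 1\<close>
  modulo \<open>p\<close>.\<close>

lemma not_p_dvd_card_minus_0:
  fixes W :: "'v::comm_ring_1 set"
  assumes "finite W" "0 \<in> W" "w0 \<in> W" "w0 \<noteq> 0" "\<And>x y. x \<in> W \<Longrightarrow> y \<in> W \<Longrightarrow> x + y \<in> W" "of_nat p = (0::'v)"
  shows "\<not> p dvd card (W - {0})"
proof
  assume dvd: "p dvd card (W - {0})"
  have "p dvd card W" using assms by (intro prime_dvd_card_translation[OF p(1) assms(6,1,4)]) auto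
  moreover have "card W = Suc (card (W - {0}))" by (rule card.remove[OF assms(1,2)])
  ultimately have "p dvd card (W - {0}) + 1" by simp
  then have "p dvd 1" using dvd by (simp only: dvd_add_right_iff)
  then show False using p(1) by simp
qed

text \<open>Orbits partition \<open>W\<close>; if \<open>p\<close> divided all their lengths, it
  would divide the cardinality.\<close>

lemma orbit_prime_to_p:
  fixes act :: "'k^2^2 \<Rightarrow> 'x \<Rightarrow> 'x"
  assumes "finite W" "\<not> p dvd card W" "\<And>g x. g \<in> G \<Longrightarrow> x \<in> W \<Longrightarrow> act g x \<in> W"
    and a1: "\<And>x. act (mat 1) x = x" and am: "\<And>g h x. act (g ** h) x = act g (act h x)"
  shows "\<exists>x\<in>W. \<not> p dvd card ((\<lambda>g. act g x) ` G)"
proof (rule ccontr)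
  assume neg: "\<not> ?thesis"
  define cl where "cl x = (\<lambda>g. act g x) ` G" for x
  have self: "x \<in> cl x" for x unfolding cl_def using one a1[of x] by (metis image_eqI)
  have meet: "cl x \<subseteq> cl y" if zx: "z \<in> cl x" and zy: "z \<in> cl y" for x y z
  proof -
    obtain g where "g \<in> G" "z = act g x" using zx unfolding cl_def by blast
    moreover obtain h where "h \<in> G" "z = act h y" using zy unfolding cl_def by blast
    ultimately have g: "g \<in> G" "z = act g x" "h \<in> G" "z = act h y" by simp_all
    obtain g' where g': "g' \<in> G" "g' ** g = mat 1" using inv[OF g(1)] by blast
    have "x = act (g' ** g) x" using g' a1 by simp
    also have "\<dots> = act (g' ** h) y" using g by (simp add: am)
    finally have x: "x = act (g' ** h) y" .
    show ?thesis
    proof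
      fix u assume "u \<in> cl x"
      then obtain k where k: "k \<in> G" "u = act k x" by (auto simp: cl_def)
      then have "u = act (k ** (g' ** h)) y" using x am by metis
      moreover have "k ** (g' ** h) \<in> G" using k g g' by (intro mult)
      ultimately show "u \<in> cl y" by (auto simp: cl_def)
    qed
  qed
  have U: "\<Union>(cl ` W) = W" using assms(3) self by (fastforce simp: cl_def)
  have "p dvd card (\<Union>(cl ` W))"
  proof (rule dvd_partition)
    show "finite (\<Union>(cl ` W))" using U assms(1) by simp
    show "\<forall>c\<in>cl ` W. p dvd card c" using neg by (auto simp: cl_def)
    show "\<forall>c1\<in>cl ` W. \<forall>c2\<in>cl ` W. c1 \<noteq> c2 \<longrightarrow> c1 \<inter> c2 = {}"
    proof (intro ballI impI)
      fix c1 c2 assume c: "c1 \<in> cl ` W" "c2 \<in> cl ` W" "c1 \<noteq> c2"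
      then obtain x y where "c1 = cl x" "c2 = cl y" by blast
      then show "c1 \<inter> c2 = {}" using c(3) meet[of _ x y] meet[of _ y x] by blast
    qed
  qed
  then show False using U assms(2) by simp
qed

lemma of_nat_p_vec: "of_nat p = (0 :: 'k^2)"
  by (simp add: vec_eq_iff of_nat_index p(2))

text \<open>The stabilizer of the pair \<open>(v, d)\<close> consists of the \<open>g\<close> that fix \<open>v\<close> and have determinant \<open>1\<close>,
  so it is unipotent.\<close>

lemma unipotent_stabilizer:
  "\<exists>v d. v \<noteq> 0 \<and> d \<noteq> 0 \<and> \<not> p dvd card ((\<lambda>g. (g *v v, det g * d)) ` G)"
proof -
  \<comment> \<open>An orbit of vectors and the set of determinants span finite
    \<open>G\<close>-stable spaces over the prime field. Both contain a nonzero element, and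
    invertible matrices keep nonzero elements nonzero, so \<open>G\<close> acts on the product of
    the nonzero parts.\<close>
  define E1 where "E1 = (\<lambda>g. g *v axis 1 1 :: 'k^2) ` G"
  define E2 where "E2 = det ` G"
  have fE: "finite E1" "finite E2" using fin by (auto simp: E1_def E2_def)
  have closed1: "h *v e \<in> E1" if "h \<in> G" "e \<in> E1" for h e
    using that mult[of h] by (auto simp: E1_def matrix_vector_mul_assoc intro: image_eqI)
  have closed2: "det h * e \<in> E2" if "h \<in> G" "e \<in> E2" for h e
    using that mult[of h] by (auto simp: E2_def det_mul[symmetric])
  have p0: "p > 0" using p(1) prime_gt_0_nat by blast
  have fW: "finite (nat_span E1)" "finite (nat_span E2)"
    using finite_nat_span[OF fE(1) of_nat_p_vec p0] finite_nat_span[OF fE(2) p(2) p0] .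
  have e1: "axis 1 1 \<in> E1" unfolding E1_def using one by (metis image_eqI matrix_vector_mul_lid)
  have e2: "1 \<in> E2" unfolding E2_def using one by (metis det_I image_eqI)
  have n1: "\<not> p dvd card (nat_span E1 - {0})"
    by (rule not_p_dvd_card_minus_0[OF fW(1) nat_span_0 nat_span_base[OF fE(1) e1] _ nat_span_add of_nat_p_vec])
      (auto simp: axis_eq_0_iff)
  have n2: "\<not> p dvd card (nat_span E2 - {0})"
    by (rule not_p_dvd_card_minus_0[OF fW(2) nat_span_0 nat_span_base[OF fE(2) e2] _ nat_span_add p(2)]) auto
  let ?W = "(nat_span E1 - {0}) \<times> (nat_span E2 - {0})"
  let ?act = "\<lambda>g (v, d). (g *v v, det g * d)"
  have "\<exists>x\<in>?W. \<not> p dvd card ((\<lambda>g. ?act g x) ` G)"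
  proof (rule orbit_prime_to_p)
    show "finite ?W" using fW by simp
    show "\<not> p dvd card ?W" using n1 n2 p(1) by (simp add: card_cartesian_product prime_dvd_mult_iff)
    show "?act (mat 1) x = x" for x by (cases x) simp
    show "?act (g ** h) x = ?act g (?act h x)" for g h x
      by (cases x) (simp add: matrix_vector_mul_assoc det_mul mult.assoc)
    fix g x assume g: "g \<in> G" and x: "x \<in> ?W"
    obtain h where h: "h ** g = mat 1" using inv[OF g] by blast
    have "det h * det g = 1" using h det_mul[of h g] by simp
    then have "det g \<noteq> 0" by auto
    have nz: "g *v v \<noteq> 0" if "v \<noteq> 0" for v :: "'k^2"
    proof
      assume "g *v v = 0"
      then have "h *v (g *v v) = 0" by simp
      then show False using that h by (simp add: matrix_vector_mul_assoc)
    qed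
    have "g *v v \<in> nat_span E1" if "v \<in> nat_span E1" for v
      by (rule nat_span_closed[OF _ fE(1) _ that]) (auto simp: matrix_vector_right_distrib closed1[OF g])
    moreover have "det g * d \<in> nat_span E2" if "d \<in> nat_span E2" for d
      by (rule nat_span_closed[OF _ fE(2) _ that]) (simp_all add: distrib_left closed2[OF g])
    ultimately show "?act g x \<in> ?W" using x nz \<open>det g \<noteq> 0\<close> by auto
  qed
  then show ?thesis by auto
qed

end

subsection \<open>Purity of the invariants\<close>

definition invariants :: "'k::comm_ring_1 set \<Rightarrow> ('k^2^2) set \<Rightarrow> 'k poly poly set"
  where "invariants B G = {f \<in> poly2_over B. \<forall>g\<in>G. lin_act g f = f}"

lemma is_subring_invariants: "is_subring B \<Longrightarrow> is_subring (invariants B G)"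
  using is_subring_poly2_over[of B]
  by (auto simp: is_subring_def invariants_def LA.hom_1 LA.hom_diff LA.hom_mult)

lemma invariants_const2: "is_subring B \<Longrightarrow> c \<in> B \<Longrightarrow> const2 c \<in> invariants B G"
  by (simp add: invariants_def poly2_over_const2)

lemma polys_over_prod:
  "is_subring B \<Longrightarrow> (\<And>i. i \<in> I \<Longrightarrow> f i \<in> polys_over B) \<Longrightarrow> prod f I \<in> polys_over B"
  by (intro subring_prod is_subring_polys_over)

locale valued_matrix_group = matrix_group G p
  for G :: "('k::field^2^2) set" and p :: nat +
  fixes V :: "'k set"
  assumes V: "is_subring V" and entries: "g \<in> G \<Longrightarrow> g $ i $ j \<in> V"
    and valuation: "x \<in> V \<or> inverse x \<in> V"
begin

abbreviation R :: "'k poly poly set" where "R \<equiv> poly2_over V"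

lemma is_subring_R: "is_subring R"
  by (rule is_subring_poly2_over[OF V])

lemma lin_act_R: "g \<in> G \<Longrightarrow> f \<in> R \<Longrightarrow> lin_act g f \<in> R"
  by (rule lin_act_poly2_over[OF V entries])

text \<open>The ratio of the coordinates or its inverse lies in \<open>V\<close>; dividing by the
  right coordinate gives a vector that extends to a basis.\<close>

lemma normalize_vector:
  fixes v :: "'k^2"
  assumes "v \<noteq> 0"
  shows "\<exists>c. c \<noteq> 0 \<and> (\<forall>i. (c *s v) $ i \<in> V) \<and> ((c *s v) $ 1 = 1 \<or> (c *s v) $ 2 = 1)"
proof -
  have 1: "1 \<in> V" and 0: "0 \<in> V" using subring_closed[OF V] by auto
  show ?thesis
  proof (cases "v $ 1 = 0")
    case True
    then have "v $ 2 \<noteq> 0" using assms by (auto simp: vec_eq_iff forall_2)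
    then show ?thesis using True 0 1 by (intro exI[of _ "inverse (v $ 2)"]) (auto simp: forall_2)
  next
    case False
    show ?thesis
    proof (cases "v $ 2 / v $ 1 \<in> V")
      case True
      then show ?thesis using False 1
        by (intro exI[of _ "inverse (v $ 1)"]) (auto simp: forall_2 divide_inverse mult.commute)
    next
      case nV: False
      then have "v $ 2 \<noteq> 0" using 0 by auto
      moreover have "v $ 1 / v $ 2 \<in> V" using valuation[of "v $ 2 / v $ 1"] nV by simp
      ultimately show ?thesis using 1
        by (intro exI[of _ "inverse (v $ 2)"]) (auto simp: forall_2 divide_inverse mult.commute)
    qed
  qed
qed

text \<open>\<open>v\<close> and \<open>e\<close> form a basis of the free module of rank two over the valuation ring.\<close>

lemma unipotent_basis:
  fixes v :: "'k^2"
  assumes "v \<noteq> 0" and H: "H = {g \<in> G. g *v v = v \<and> det g = 1}"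
  shows "\<exists>(u::'k^2) e a. u \<noteq> 0 \<and> (\<forall>i. u $ i \<in> V) \<and> (\<forall>i. e $ i \<in> V) \<and>
    (\<forall>h\<in>H. h *v u = u \<and> h *v e = e + a h *s u \<and> a h \<in> V) \<and>
    (\<forall>i. \<exists>c\<in>V. \<exists>d\<in>V. axis i 1 = c *s u + d *s e)"
proof -
  have 1: "1 \<in> V" and 0: "0 \<in> V" using subring_closed[OF V] by auto
  obtain c where c: "c \<noteq> 0" "\<And>i. (c *s v) $ i \<in> V" "(c *s v) $ 1 = 1 \<or> (c *s v) $ 2 = 1"
    using normalize_vector[OF assms(1)] by blast
  define u where "u = c *s v"
  have hu: "h *v u = u" if "h \<in> H" for h
    using that by (simp add: H u_def matrix_vector_mult_scaleR vector_scalar_commute)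
  have u0: "u \<noteq> 0" using c(1) assms(1) by (simp add: u_def)
  have uV: "u $ i \<in> V" for i using c(2) by (simp add: u_def)
  have coord: "h $ 1 $ 1 * u $ 1 + h $ 1 $ 2 * u $ 2 = u $ 1" "h $ 2 $ 1 * u $ 1 + h $ 2 $ 2 * u $ 2 = u $ 2"
    "h $ 1 $ 1 * h $ 2 $ 2 - h $ 1 $ 2 * h $ 2 $ 1 = 1" if "h \<in> H" for h :: "'k^2^2"
  proof -
    have "(h *v u) $ 1 = u $ 1" "(h *v u) $ 2 = u $ 2" using hu[OF that] by simp_all
    then show "h $ 1 $ 1 * u $ 1 + h $ 1 $ 2 * u $ 2 = u $ 1" "h $ 2 $ 1 * u $ 1 + h $ 2 $ 2 * u $ 2 = u $ 2"
      by (simp_all add: matrix_vector_mult_def sum_2)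
    have "det h = 1" using that by (simp add: H)
    then show "h $ 1 $ 1 * h $ 2 $ 2 - h $ 1 $ 2 * h $ 2 $ 1 = 1" by (simp add: det_2)
  qed
  have hV: "h $ i $ j \<in> V" if "h \<in> H" for h :: "'k^2^2" and i j using that entries by (auto simp: H)
  from c(3) show ?thesis
  proof
    assume "(c *s v) $ 1 = 1"
    then have u1: "u $ 1 = 1" by (simp add: u_def)
    have "h *v axis 2 1 = axis 2 1 + (h $ 1 $ 2) *s u" if h: "h \<in> H" for h :: "'k^2^2"
    proof -
      \<comment> \<open>Fixing \<open>u = (1, y)\<close> expresses the first column of
        \<open>h\<close> by the second, and determinant one then forces
        \<open>\<delta> = 1 + \<beta> * y\<close>. So the second column, the image of
        \<open>axis 2 1\<close>, differs from it by \<open>\<beta>\<close> times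
        \<open>u\<close>.\<close>
      define \<alpha> \<beta> \<gamma> \<delta> y where d: "\<alpha> = h $ 1 $ 1" "\<beta> = h $ 1 $ 2" "\<gamma> = h $ 2 $ 1" "\<delta> = h $ 2 $ 2" "y = u $ 2"
      have c: "\<alpha> = 1 - \<beta> * y" "\<gamma> = y - \<delta> * y" "\<alpha> * \<delta> - \<beta> * \<gamma> = 1"
        using coord[OF h] u1 by (simp_all add: d eq_diff_eq)
      have "\<delta> - \<beta> * y = (1 - \<beta> * y) * \<delta> - \<beta> * (y - \<delta> * y)" by (simp add: algebra_simps)
      also have "\<dots> = 1" using c(3) unfolding c(1,2) .
      finally have "\<delta> = 1 + \<beta> * y" by (simp add: algebra_simps)
      then have "h $ 2 $ 2 = 1 + h $ 1 $ 2 * u $ 2" by (simp add: d)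
      then show ?thesis
        by (simp add: vec_eq_iff forall_2 matrix_vector_mult_def sum_2 axis_def u1)
    qed
    moreover have "\<exists>c\<in>V. \<exists>d\<in>V. axis i 1 = c *s u + d *s axis 2 1" for i :: 2
    proof (cases "i = 1")
      case True
      then show ?thesis using 1 uV[of 2] subring_uminus[OF V] u1
        by (intro bexI[of _ 1] bexI[of _ "- u $ 2"]) (auto simp: vec_eq_iff forall_2 axis_def)
    next
      case False
      then have "i = 2" using exhaust_2 by blast
      then show ?thesis using 0 1 by (intro bexI[of _ 0] bexI[of _ 1]) auto
    qed
    moreover have "(axis 2 1 :: 'k^2) $ i \<in> V" for i using 0 1 by (simp add: axis_def)
    ultimately show ?thesis using u0 uV hu hV
      by (intro exI[of _ u] exI[of _ "axis 2 1"] exI[of _ "\<lambda>h::'k^2^2. h $ 1 $ 2"]) auto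
  next
    assume "(c *s v) $ 2 = 1"
    then have u1: "u $ 2 = 1" by (simp add: u_def)
    have "h *v axis 1 1 = axis 1 1 + (h $ 2 $ 1) *s u" if h: "h \<in> H" for h :: "'k^2^2"
    proof -
      define \<alpha> \<beta> \<gamma> \<delta> y where d: "\<alpha> = h $ 1 $ 1" "\<beta> = h $ 1 $ 2" "\<gamma> = h $ 2 $ 1" "\<delta> = h $ 2 $ 2" "y = u $ 1"
      have c: "\<beta> = y - \<alpha> * y" "\<delta> = 1 - \<gamma> * y" "\<alpha> * \<delta> - \<beta> * \<gamma> = 1"
        using coord[OF h] u1 by (simp_all add: d eq_diff_eq add.commute)
      have "\<alpha> - \<gamma> * y = \<alpha> * (1 - \<gamma> * y) - (y - \<alpha> * y) * \<gamma>" by (simp add: algebra_simps)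
      also have "\<dots> = 1" using c(3) unfolding c(1,2) .
      finally have "\<alpha> = 1 + \<gamma> * y" by (simp add: algebra_simps)
      then have "h $ 1 $ 1 = 1 + h $ 2 $ 1 * u $ 1" by (simp add: d)
      then show ?thesis
        by (simp add: vec_eq_iff forall_2 matrix_vector_mult_def sum_2 axis_def u1)
    qed
    moreover have "\<exists>c\<in>V. \<exists>d\<in>V. axis i 1 = c *s u + d *s axis 1 1" for i :: 2
    proof (cases "i = 2")
      case True
      then show ?thesis using 1 uV[of 1] subring_uminus[OF V] u1
        by (intro bexI[of _ 1] bexI[of _ "- u $ 1"]) (auto simp: vec_eq_iff forall_2 axis_def)
    next
      case False
      then have "i = 1" using exhaust_2 by blast
      then show ?thesis using 0 1 by (intro bexI[of _ 0] bexI[of _ 1]) auto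
    qed
    moreover have "(axis 1 1 :: 'k^2) $ i \<in> V" for i using 0 1 by (simp add: axis_def)
    ultimately show ?thesis using u0 uV hu hV
      by (intro exI[of _ u] exI[of _ "axis 1 1"] exI[of _ "\<lambda>h::'k^2^2. h $ 2 $ 1"]) auto
  qed
qed

text \<open>The polynomial ring is free over the invariants of the unipotent group \<open>H\<close>, with basis
  the powers \<open>w ^ i\<close>, \<open>i < card H\<close>: the norm of \<open>w\<close> gives an equation for \<open>w\<close>, and a shorter relation
  would have all the conjugates of \<open>w\<close> as roots.\<close>

lemma unipotent_free_basis:
  fixes v :: "'k^2"
  assumes v: "v \<noteq> 0" and H: "H = {g \<in> G. g *v v = v \<and> det g = 1}"
  shows "\<exists>w d. d > 0 \<and> (\<forall>f\<in>R. \<exists>s. (\<forall>i. s i \<in> invariants V H) \<and> f = (\<Sum>i<d. s i * w ^ i)) \<and>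
    (\<forall>s. (\<forall>i. s i \<in> invariants V H) \<longrightarrow> (\<Sum>i<d. s i * w ^ i) = 0 \<longrightarrow> (\<forall>i<d. s i = 0))"
proof -
  obtain u e :: "'k^2" and a where u0: "u \<noteq> 0" and uV: "\<And>i. u $ i \<in> V" and eV: "\<And>i. e $ i \<in> V"
    and ha: "\<And>h. h \<in> H \<Longrightarrow> h *v u = u \<and> h *v e = e + a h *s u \<and> a h \<in> V"
    and ax: "\<And>i. \<exists>c\<in>V. \<exists>d\<in>V. axis i 1 = c *s u + d *s e"
    using unipotent_basis[OF assms] by metis
  define S where "S = invariants V H"
  have S: "is_subring S" unfolding S_def by (rule is_subring_invariants[OF V])
  have HG: "H \<subseteq> G" by (auto simp: H)
  have fH: "finite H" using fin HG finite_subset by blast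
  have H1: "mat 1 \<in> H" using one by (simp add: H)
  have Hm: "g ** h \<in> H" if "g \<in> H" "h \<in> H" for g h
    using that mult by (simp add: H det_mul) (metis matrix_vector_mul_assoc)
  define l where "l = linear_form u"
  define w where "w = linear_form e"
  have lS: "l \<in> S" using ha uV by (simp add: S_def l_def invariants_def poly2_over_linear_form[OF V] lin_act_linear_form)
  have wR: "w \<in> R" unfolding w_def by (rule poly2_over_linear_form[OF V eV])
  have hw: "lin_act h w = w + const2 (a h) * l" if "h \<in> H" for h
    using ha[OF that] unfolding w_def l_def lin_act_linear_form linear_form_scale[symmetric] linear_form_add[symmetric] by simp
  \<comment> \<open>The conjugates of \<open>w\<close> are distinct: every \<open>h\<close> fixes
    \<open>u\<close>, and \<open>u\<close> and \<open>e\<close> generate the module, so the image of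
    \<open>e\<close> determines \<open>h\<close>.\<close>
  have inj: "inj_on (\<lambda>h. lin_act h w) H"
  proof (rule inj_onI)
    fix g h assume gh: "g \<in> H" "h \<in> H" "lin_act g w = lin_act h w"
    then have e: "g *v e = h *v e" unfolding w_def lin_act_linear_form linear_form_eq_iff by simp
    have "g *v axis i 1 = h *v axis i 1" for i
    proof -
      obtain c d where "axis i 1 = c *s u + d *s e" using ax by blast
      then show ?thesis using e ha[OF gh(1)] ha[OF gh(2)]
        by (simp add: matrix_vector_right_distrib vector_scalar_commute)
    qed
    then have "(g *v axis i 1) $ k = (h *v axis i 1) $ k" for k i by simp
    then have "g $ k $ i = h $ k $ i" for k i
      by (simp add: matrix_vector_mult_def axis_def if_distrib cong: if_cong)
    then show "g = h" by (simp add: vec_eq_iff)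
  qed
  \<comment> \<open>As a polynomial in a new variable \<open>N\<close> is monic of degree
    \<open>d\<close> with invariant coefficients, and its value at \<open>w\<close> is the norm of
    \<open>w\<close>. Subtracting that invariant value from \<open>N\<close> yields a monic equation
    for \<open>w\<close> over \<open>S\<close>.\<close>
  define N where "N = (\<Prod>h\<in>H. [:const2 (a h) * l, 1:])"
  define d where "d = card H"
  have d0: "d > 0" unfolding d_def using fH H1 card_gt_0_iff by blast
  have degN: "degree N = d" unfolding N_def d_def by (subst degree_prod_sum_eq) auto
  have lcN: "poly.coeff N d = 1" unfolding degN[symmetric] N_def by (subst lead_coeff_prod) simp
  have NS: "poly.coeff N i \<in> S" for i
  proof -
    have "const2 (a h) * l \<in> S" if "h \<in> H" for h
      using ha[OF that] lS invariants_const2[OF V, of "a h" H]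
      by (intro subring_mult[OF S]) (auto simp: S_def)
    then have "N \<in> polys_over S" unfolding N_def using subring_0[OF S] subring_1[OF S]
      by (intro polys_over_prod[OF S]) (auto simp: polys_over_def coeff_pCons split: nat.splits)
    then show ?thesis by (simp add: polys_over_def)
  qed
  have Nw: "poly N w \<in> S"
  proof -
    have Nw: "poly N w = (\<Prod>h\<in>H. lin_act h w)"
      unfolding N_def poly_prod by (intro prod.cong refl) (simp add: hw add.commute)
    have "lin_act g (\<Prod>h\<in>H. lin_act h w) = (\<Prod>h\<in>H. lin_act h w)" if g: "g \<in> H" for g
    proof -
      have inj_g: "inj_on (\<lambda>h. g ** h) H"
      proof (rule inj_onI)
        fix h k assume "g ** h = g ** k"
        moreover obtain g' where "g' ** g = mat 1" using inv g HG by blast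
        ultimately show "h = k" by (metis matrix_mul_assoc matrix_mul_lid)
      qed
      have im: "(\<lambda>h. g ** h) ` H = H"
        by (rule endo_inj_surj[OF fH _ inj_g]) (use Hm g in auto)
      have "lin_act g (\<Prod>h\<in>H. lin_act h w) = (\<Prod>h\<in>H. lin_act (g ** h) w)"
        by (simp add: LA.hom_prod lin_act_mult)
      also have "\<dots> = (\<Prod>h\<in>(\<lambda>h. g ** h) ` H. lin_act h w)"
        by (subst prod.reindex[OF inj_g]) simp
      finally show ?thesis by (simp only: im)
    qed
    moreover have "(\<Prod>h\<in>H. lin_act h w) \<in> R"
      using HG by (intro subring_prod[OF is_subring_R] lin_act_R wR) auto
    ultimately show ?thesis by (simp add: Nw S_def invariants_def)
  qed
  define M where "M = {f. \<exists>s. (\<forall>i. s i \<in> S) \<and> f = (\<Sum>i<d. s i * w ^ i)}"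
  have M_add: "f + g \<in> M" if f: "f \<in> M" and g: "g \<in> M" for f g
  proof -
    obtain s where "\<forall>i. s i \<in> S" "f = (\<Sum>i<d. s i * w ^ i)"
      using f unfolding M_def by blast
    moreover obtain t where "\<forall>i. t i \<in> S" "g = (\<Sum>i<d. t i * w ^ i)"
      using g unfolding M_def by blast
    ultimately show ?thesis unfolding M_def
      by (intro CollectI exI[of _ "\<lambda>i. s i + t i"]) (auto simp: subring_add[OF S] sum.distrib algebra_simps)
  qed
  have M_scale: "c * f \<in> M" if c: "c \<in> S" and f: "f \<in> M" for c f
  proof -
    obtain s where "\<forall>i. s i \<in> S" "f = (\<Sum>i<d. s i * w ^ i)"
      using f unfolding M_def by blast
    then show ?thesis unfolding M_def using c
      by (intro CollectI exI[of _ "\<lambda>i. c * s i"]) (auto simp: subring_mult[OF S] sum_distrib_left algebra_simps)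
  qed
  have M_const: "c \<in> M" if "c \<in> S" for c
  proof -
    have "(\<Sum>i<d. (if i = 0 then c else 0) * w ^ i) = (\<Sum>i<d. if i = 0 then c else 0)"
      by (intro sum.cong) auto
    then have "c = (\<Sum>i<d. (if i = 0 then c else 0) * w ^ i)" using d0 by simp
    then show ?thesis unfolding M_def using that subring_0[OF S]
      by (intro CollectI exI[of _ "\<lambda>i. if i = 0 then c else 0"]) auto
  qed
  have wd: "w ^ d \<in> M"
  proof -
    have "poly N w = (\<Sum>i<d. poly.coeff N i * w ^ i) + w ^ d"
      by (simp add: poly_altdef degN lessThan_Suc_atMost[symmetric] lcN)
    then have "w ^ d = poly N w + (\<Sum>i<d. - poly.coeff N i * w ^ i)"
      by (simp add: sum_negf algebra_simps)
    moreover have "(\<Sum>i<d. - poly.coeff N i * w ^ i) \<in> M" unfolding M_def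
      using NS subring_uminus[OF S] by (intro CollectI exI[of _ "\<lambda>i. - poly.coeff N i"]) auto
    ultimately show ?thesis using M_add[OF M_const[OF Nw]] by metis
  qed
  have M_w: "w * f \<in> M" if f: "f \<in> M" for f
  proof -
    obtain s where s: "\<forall>i. s i \<in> S" "f = (\<Sum>i<d. s i * w ^ i)"
      using f unfolding M_def by blast
    obtain m where m: "d = Suc m" using d0 by (cases d) auto
    define t where "t i = (if i = 0 then 0 else s (i - 1))" for i
    have "w * f = (\<Sum>i<m. s i * w ^ Suc i) + s m * w ^ d"
      by (simp add: s(2) m sum_distrib_left algebra_simps)
    also have "(\<Sum>i<m. s i * w ^ Suc i) = (\<Sum>i<d. t i * w ^ i)"
      unfolding m sum.lessThan_Suc_shift by (simp add: t_def)
    also have "(\<Sum>i<d. t i * w ^ i) + s m * w ^ d \<in> M"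
    proof (intro M_add M_scale wd)
      show "s m \<in> S" using s by blast
      show "(\<Sum>i<d. t i * w ^ i) \<in> M" unfolding M_def
        using s subring_0[OF S] by (intro CollectI exI[of _ t]) (auto simp: t_def)
    qed
    finally show ?thesis .
  qed
  have M_axis: "linear_form (axis i 1) * f \<in> M" if "f \<in> M" for i f
  proof -
    obtain c b where cb: "c \<in> V" "b \<in> V" "axis i 1 = c *s u + b *s e" using ax by blast
    have "linear_form (axis i 1) * f = (const2 c * l) * f + const2 b * (w * f)"
      unfolding cb(3) linear_form_add linear_form_scale l_def w_def by (simp only: distrib_right mult.assoc)
    also have "\<dots> \<in> M"
      using invariants_const2[OF V, of _ H] cb(1,2) lS
      by (intro M_add M_scale M_w that subring_mult[OF S]) (auto simp: S_def)
    finally show ?thesis .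
  qed
  have RM: "R \<subseteq> M"
  proof (rule poly2_over_subset)
    show "const2 c * x \<in> M" if "c \<in> V" "x \<in> M" for c x
      using that invariants_const2[OF V, of c H] by (intro M_scale) (auto simp: S_def)
  qed (use M_add M_const[OF subring_1[OF S]] M_const[OF subring_0[OF S]] M_axis[of _ 1] M_axis[of _ 2] in
      \<open>auto simp: linear_form_axis\<close>)
  have indep: "s i = 0" if s: "\<forall>i. s i \<in> S" and sum0: "(\<Sum>i<d. s i * w ^ i) = 0" and "i < d" for s i
  proof -
    define Q where "Q = (\<Sum>i<d. monom (s i) i)"
    have co: "poly.coeff Q j = (if j < d then s j else 0)" for j
      by (simp add: Q_def coeff_sum)
    have "poly Q (lin_act h w) = 0" if h: "h \<in> H" for h
    proof -
      have inv_s: "lin_act h (s i) = s i" for i using s h by (auto simp: S_def invariants_def)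
      have "poly Q (lin_act h w) = lin_act h (\<Sum>i<d. s i * w ^ i)"
        by (simp add: Q_def poly_sum poly_monom LA.hom_sum LA.hom_mult LA.hom_power inv_s)
      then show ?thesis by (simp add: sum0 LA.hom_0)
    qed
    then have sub: "(\<lambda>h. lin_act h w) ` H \<subseteq> {x. poly Q x = 0}" by auto
    have "Q = 0"
    proof (rule ccontr)
      assume Q0: "Q \<noteq> 0"
      have "d = card ((\<lambda>h. lin_act h w) ` H)" by (simp add: d_def card_image[OF inj])
      also have "\<dots> \<le> card {x. poly Q x = 0}" by (rule card_mono[OF poly_roots_finite[OF Q0] sub])
      also have "\<dots> \<le> degree Q" by (rule card_poly_roots_bound[OF Q0])
      finally have "d \<le> degree Q" .
      then have "poly.coeff Q (degree Q) = 0" by (simp add: co)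
      then show False using Q0 by simp
    qed
    then show "s i = 0" using co[of i] that(3) by simp
  qed
  show ?thesis
    using d0 RM indep unfolding M_def S_def
    by (intro exI[of _ w] exI[of _ d] conjI ballI allI impI) blast+
qed

text \<open>Two maps that are linear over the invariants of \<open>G\<close> and fix them are
  applied to the relation in turn: the coefficient of \<open>w ^ 0\<close> over the invariants of
  the stabilizer, and the average over the orbit.\<close>

theorem purity:
  assumes J: "finite J" and x: "\<And>j. j \<in> J \<Longrightarrow> x j \<in> invariants V G" and r: "\<And>j. j \<in> J \<Longrightarrow> r j \<in> R"
    and f: "(\<Sum>j\<in>J. x j * r j) \<in> invariants V G"
  shows "\<exists>s. (\<forall>j\<in>J. s j \<in> invariants V G) \<and> (\<Sum>j\<in>J. x j * r j) = (\<Sum>j\<in>J. x j * s j)"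
proof -
  define F where "F = (\<Sum>j\<in>J. x j * r j)"
  have FG: "F \<in> invariants V G" using f by (simp add: F_def)
  obtain v :: "'k^2" and \<delta> where v: "v \<noteq> 0" "\<delta> \<noteq> 0" and np: "\<not> p dvd card ((\<lambda>g. (g *v v, det g * \<delta>)) ` G)"
    using unipotent_stabilizer by blast
  define H where "H = {g \<in> G. g *v v = v \<and> det g = 1}"
  have GH: "f \<in> invariants V H" if "f \<in> invariants V G" for f
    using that by (auto simp: invariants_def H_def)
  from unipotent_free_basis[OF v(1) H_def] obtain w d where d0: "d > (0::nat)"
    and span: "\<forall>f\<in>R. \<exists>s. (\<forall>i. s i \<in> invariants V H) \<and> f = (\<Sum>i<d. s i * w ^ i)"
    and indep: "\<forall>s. (\<forall>i. s i \<in> invariants V H) \<longrightarrow> (\<Sum>i<d. s i * w ^ i) = 0 \<longrightarrow> (\<forall>i<d. s i = 0)"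
    by (elim exE conjE)
  have SH: "is_subring (invariants V H)" by (rule is_subring_invariants[OF V])
  have "\<forall>j\<in>J. \<exists>s. (\<forall>i. s i \<in> invariants V H) \<and> r j = (\<Sum>i<d. s i * w ^ i)" using r span by blast
  then obtain s where s: "\<And>j i. j \<in> J \<Longrightarrow> s j i \<in> invariants V H" "\<And>j. j \<in> J \<Longrightarrow> r j = (\<Sum>i<d. s j i * w ^ i)"
    by metis
  have FH: "F = (\<Sum>j\<in>J. x j * s j 0)"
  proof -
    \<comment> \<open>\<open>F\<close> is itself invariant under \<open>H\<close>, so it equals its
      own coefficient at exponent \<open>0\<close>. Subtracting it there turns the two expansions of
      \<open>F\<close> into one relation among basis elements.\<close>
    define t where "t i = (\<Sum>j\<in>J. x j * s j i) - (if i = 0 then F else 0)" for i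
    have "\<forall>i. t i \<in> invariants V H"
      using subring_0[OF SH] x s(1) GH FG unfolding t_def
      by (intro allI subring_diff[OF SH] subring_sum[OF SH] subring_mult[OF SH]) auto
    moreover have "(\<Sum>i<d. t i * w ^ i) = 0"
    proof -
      have "(\<Sum>i<d. (if i = 0 then F else 0) * w ^ i) = (\<Sum>i<d. if i = 0 then F else 0)"
        by (intro sum.cong) auto
      also have "\<dots> = F" using d0 by simp
      finally have 1: "(\<Sum>i<d. (if i = 0 then F else 0) * w ^ i) = F" .
      have "(\<Sum>i<d. (\<Sum>j\<in>J. x j * s j i) * w ^ i) = (\<Sum>j\<in>J. \<Sum>i<d. x j * s j i * w ^ i)"
        by (subst sum.swap) (simp add: sum_distrib_right)
      also have "\<dots> = F" unfolding F_def
        by (intro sum.cong refl) (simp add: s(2) sum_distrib_left mult.assoc)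
      finally show ?thesis using 1 by (simp add: t_def left_diff_distrib sum_subtractf)
    qed
    ultimately have "t 0 = 0" using indep d0 by blast
    then show ?thesis by (simp add: t_def)
  qed
  define W where "W = (\<lambda>g. (g *v v, det g * \<delta>)) ` G"
  have fW: "finite W" using fin by (simp add: W_def)
  have "\<forall>o'\<in>W. \<exists>g\<in>G. o' = (g *v v, det g * \<delta>)" by (auto simp: W_def)
  then obtain rep where rep: "\<And>o'. o' \<in> W \<Longrightarrow> rep o' \<in> G \<and> o' = (rep o' *v v, det (rep o') * \<delta>)" by metis
  \<comment> \<open>The relative trace from \<open>H\<close> to \<open>G\<close>: the points of the
    orbit stand for the cosets of \<open>H\<close>, and \<open>rep\<close> picks arbitrary
    representatives.\<close>
  define tr where "tr f = (\<Sum>o'\<in>W. lin_act (rep o') f)" for f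
  have tr_inv: "tr f \<in> invariants V G" if f: "f \<in> invariants V H" for f
  proof -
    have "tr f \<in> R" unfolding tr_def
      using f rep by (intro subring_sum[OF is_subring_R] lin_act_R) (auto simp: invariants_def)
    moreover have "lin_act g (tr f) = tr f" if g: "g \<in> G" for g
    proof -
      let ?act = "\<lambda>(a, b). (g *v a, det g * b)"
      obtain g' where g': "g' \<in> G" "g' ** g = mat 1" using inv[OF g] by blast
      have dg: "det g' * det g = 1" using g'(2) det_mul[of g' g] by simp
      have closed: "?act o' \<in> W" if "o' \<in> W" for o'
        using that mult[OF g] by (auto simp: W_def matrix_vector_mul_assoc det_mul mult.assoc intro!: image_eqI)
      have inj: "inj_on ?act W"
      proof (rule inj_onI)
        fix a b assume "?act a = ?act b"
        then have "g' *v (g *v fst a) = g' *v (g *v fst b)" "det g' * (det g * snd a) = det g' * (det g * snd b)"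
          by (auto simp: case_prod_beta)
        then show "a = b" using g'(2) dg by (simp add: matrix_vector_mul_assoc mult.assoc[symmetric] prod_eq_iff)
      qed
      have im: "?act ` W = W" by (rule endo_inj_surj[OF fW _ inj]) (use closed in blast)
      \<comment> \<open>\<open>g ** rep o'\<close> and the representative of the moved point differ
        on the right by an element of \<open>H\<close>, which fixes \<open>f\<close>.\<close>
      have step: "lin_act g (lin_act (rep o') f) = lin_act (rep (?act o')) f" if o: "o' \<in> W" for o'
      proof -
        let ?k = "rep (?act o')"
        have k: "?k \<in> G" "?act o' = (?k *v v, det ?k * \<delta>)" using rep[OF closed[OF o]] by auto
        have ro: "rep o' \<in> G" "o' = (rep o' *v v, det (rep o') * \<delta>)" using rep[OF o] by auto
        have eq: "(g *v (rep o' *v v), det g * (det (rep o') * \<delta>)) = (?k *v v, det ?k * \<delta>)"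
          using k(2) arg_cong[OF ro(2), of ?act] by simp
        obtain k' where k': "k' \<in> G" "?k ** k' = mat 1" "k' ** ?k = mat 1" using inv[OF k(1)] by blast
        define h where "h = k' ** (g ** rep o')"
        have "h \<in> G" unfolding h_def by (intro mult g k' ro)
        moreover have "h *v v = v"
        proof -
          have "h *v v = k' *v (g *v (rep o' *v v))" by (simp add: h_def matrix_vector_mul_assoc)
          also have "\<dots> = k' *v (?k *v v)" using eq by simp
          finally show ?thesis using k' by (simp add: matrix_vector_mul_assoc)
        qed
        moreover have "det h = 1"
        proof -
          have "det g * det (rep o') = det ?k" using eq v(2) by simp
          then have "det h = det k' * det ?k" by (simp add: h_def det_mul)
          also have "\<dots> = 1" using k'(3) det_mul[of k' ?k] by simp
          finally show ?thesis .
        qed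
        ultimately have "h \<in> H" by (simp add: H_def)
        then have "lin_act h f = f" using f by (simp add: invariants_def)
        then have "lin_act ?k (lin_act h f) = lin_act ?k f" by simp
        moreover have "?k ** h = g ** rep o'" using k' by (simp add: h_def matrix_mul_assoc)
        ultimately show ?thesis by (simp add: lin_act_mult[symmetric])
      qed
      have "lin_act g (tr f) = (\<Sum>o'\<in>W. lin_act (rep (?act o')) f)"
        by (simp add: tr_def LA.hom_sum step)
      also have "\<dots> = (\<Sum>o'\<in>?act ` W. lin_act (rep o') f)"
        by (subst sum.reindex[OF inj]) simp
      finally show ?thesis by (simp only: im tr_def)
    qed
    ultimately show ?thesis by (simp add: invariants_def)
  qed
  obtain m where m: "of_nat m * of_nat (card W) = (1::'k)"
    using of_nat_mult_inverse_mod[OF p(1) _ p(2)] np unfolding W_def by blast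
  have "of_nat (card W) * F = tr F"
  proof -
    have "lin_act (rep o') F = F" if "o' \<in> W" for o' using rep[OF that] FG by (auto simp: invariants_def)
    then show ?thesis by (simp add: tr_def)
  qed
  also have "tr F = (\<Sum>j\<in>J. x j * tr (s j 0))"
  proof -
    have "lin_act (rep o') F = (\<Sum>j\<in>J. x j * lin_act (rep o') (s j 0))" if "o' \<in> W" for o'
      unfolding FH LA.hom_sum LA.hom_mult using rep[OF that] x
      by (intro sum.cong refl) (auto simp: invariants_def)
    then have "tr F = (\<Sum>o'\<in>W. \<Sum>j\<in>J. x j * lin_act (rep o') (s j 0))" by (simp add: tr_def)
    also have "\<dots> = (\<Sum>j\<in>J. x j * tr (s j 0))"
      by (subst sum.swap) (simp add: tr_def sum_distrib_left)
    finally show ?thesis .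
  qed
  finally have eq: "of_nat (card W) * F = (\<Sum>j\<in>J. x j * tr (s j 0))" .
  have "const2 (of_nat m * of_nat (card W)) = of_nat m * (of_nat (card W) :: 'k poly poly)"
    by (simp add: of_nat_poly)
  then have "F = of_nat m * (of_nat (card W) * F)" using m by (simp add: mult.assoc[symmetric] one_pCons)
  also have "\<dots> = (\<Sum>j\<in>J. x j * (of_nat m * tr (s j 0)))"
    unfolding eq by (simp add: sum_distrib_left mult_ac)
  finally have "F = (\<Sum>j\<in>J. x j * (of_nat m * tr (s j 0)))" .
  moreover have "of_nat m * tr (s j 0) \<in> invariants V G" if "j \<in> J" for j
    using s(1)[OF that] is_subring_invariants[OF V, of G]
    by (intro subring_mult subring_of_nat tr_inv)
  ultimately show ?thesis unfolding F_def by (intro exI[of _ "\<lambda>j. of_nat m * tr (s j 0)"]) auto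
qed

end

subsection \<open>Ideals\<close>

definition lincomb :: "'u::comm_ring_1 set \<Rightarrow> 'u set \<Rightarrow> 'u set"
  where "lincomb B F = {\<Sum>x\<in>F. c x * x | c. \<forall>x\<in>F. c x \<in> B}"

lemma lincombI: "(\<And>x. x \<in> F \<Longrightarrow> c x \<in> B) \<Longrightarrow> (\<Sum>x\<in>F. c x * x) \<in> lincomb B F"
  by (auto simp: lincomb_def)

lemma lincombD: "y \<in> lincomb B F \<Longrightarrow> \<exists>c. (\<forall>x\<in>F. c x \<in> B) \<and> y = (\<Sum>x\<in>F. c x * x)"
  unfolding lincomb_def by blast

lemma is_ideal_lincomb:
  assumes B: "is_subring B" and F: "F \<subseteq> B"
  shows "is_ideal B (lincomb B F)"
  unfolding is_ideal_def
proof (intro conjI ballI)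
  show "lincomb B F \<subseteq> B"
    using F by (auto simp: lincomb_def intro!: subring_sum[OF B] subring_mult[OF B])
  show "0 \<in> lincomb B F"
    using lincombI[of F "\<lambda>_. 0" B] subring_0[OF B] by simp
next
  fix x y assume x: "x \<in> lincomb B F" and y: "y \<in> lincomb B F"
  obtain c where c: "\<forall>x\<in>F. c x \<in> B" "x = (\<Sum>x\<in>F. c x * x)" using lincombD[OF x] by blast
  obtain d where d: "\<forall>x\<in>F. d x \<in> B" "y = (\<Sum>x\<in>F. d x * x)" using lincombD[OF y] by blast
  have "x + y = (\<Sum>x\<in>F. (c x + d x) * x)" by (simp add: c(2) d(2) sum.distrib distrib_right)
  then show "x + y \<in> lincomb B F" using c(1) d(1) subring_add[OF B] by (auto intro: lincombI)
next
  fix b y assume b: "b \<in> B" and y: "y \<in> lincomb B F"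
  obtain d where d: "\<forall>x\<in>F. d x \<in> B" "y = (\<Sum>x\<in>F. d x * x)" using lincombD[OF y] by blast
  have "b * y = (\<Sum>x\<in>F. (b * d x) * x)" by (simp add: d(2) sum_distrib_left mult.assoc)
  then show "b * y \<in> lincomb B F" using b d(1) subring_mult[OF B] by (auto intro: lincombI)
qed

lemma lincomb_base:
  assumes B: "is_subring B" and F: "finite F" "x \<in> F"
  shows "x \<in> lincomb B F"
proof -
  have "(\<Sum>y\<in>F. (if y = x then 1 else 0) * y) = (\<Sum>y\<in>F. if y = x then y else 0)"
    by (intro sum.cong) auto
  also have "\<dots> = x" using F by simp
  finally show ?thesis
    using lincombI[of F "\<lambda>y. if y = x then 1 else 0" B] subring_0[OF B] subring_1[OF B] by simp
qed

lemma lincomb_subset_ideal: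
  assumes "is_ideal B I" "F \<subseteq> I"
  shows "lincomb B F \<subseteq> I"
  using assms by (auto simp: lincomb_def intro!: ideal_sum[OF assms(1)] ideal_mult[OF assms(1)])

definition is_maximal :: "'u::comm_ring_1 set \<Rightarrow> 'u set \<Rightarrow> bool"
  where "is_maximal B P \<longleftrightarrow> is_ideal B P \<and> 1 \<notin> P \<and> (\<forall>J. is_ideal B J \<longrightarrow> P \<subseteq> J \<longrightarrow> 1 \<notin> J \<longrightarrow> J = P)"

lemma exists_maximal_avoiding:
  assumes I: "is_ideal B I" "I \<inter> W = {}"
  shows "\<exists>P. is_ideal B P \<and> I \<subseteq> P \<and> P \<inter> W = {} \<and>
    (\<forall>J. is_ideal B J \<longrightarrow> P \<subseteq> J \<longrightarrow> J \<inter> W = {} \<longrightarrow> J = P)"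
proof -
  let ?A = "{J. is_ideal B J \<and> I \<subseteq> J \<and> J \<inter> W = {}}"
  have "\<exists>M\<in>?A. \<forall>X'\<in>?A. M \<subseteq> X' \<longrightarrow> X' = M"
  proof (rule subset_Zorn_nonempty)
    show "?A \<noteq> {}" using I by auto
    fix C assume C: "C \<noteq> {}" "subset.chain ?A C"
    have mem: "J \<in> ?A" if "J \<in> C" for J using C(2) that by (auto simp: subset.chain_def)
    have "x + y \<in> \<Union>C" if "x \<in> \<Union>C" "y \<in> \<Union>C" for x y
    proof -
      obtain J K where JK: "J \<in> C" "x \<in> J" "K \<in> C" "y \<in> K" using \<open>x \<in> \<Union>C\<close> \<open>y \<in> \<Union>C\<close> by blast
      have "J \<subseteq> K \<or> K \<subseteq> J" using subset.chain_total[OF C(2) JK(1,3)] by auto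
      then show ?thesis using JK mem[OF JK(1)] mem[OF JK(3)] by (auto dest: ideal_add intro: UnionI)
    qed
    moreover have "\<Union>C \<subseteq> B" by (rule Union_least) (use mem ideal_subset in blast)
    moreover obtain J0 where J0: "J0 \<in> C" using C(1) by blast
    then have "0 \<in> \<Union>C" using mem[OF J0] ideal_0 by blast
    moreover have "b * x \<in> \<Union>C" if bB: "b \<in> B" and xC: "x \<in> \<Union>C" for b x
    proof -
      obtain J where J: "J \<in> C" "x \<in> J" using xC by blast
      then show ?thesis using mem[OF J(1)] ideal_mult[of B J b x] bB by blast
    qed
    ultimately have "is_ideal B (\<Union>C)" unfolding is_ideal_def by blast
    moreover have "I \<subseteq> \<Union>C" using C(1) mem by auto
    moreover have "\<Union>C \<inter> W = {}" using mem by auto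
    ultimately show "\<Union>C \<in> ?A" by blast
  qed
  then obtain M where "M \<in> ?A" "\<forall>X'\<in>?A. M \<subseteq> X' \<longrightarrow> X' = M" by blast
  then show ?thesis by (intro exI[of _ M]) auto
qed

lemma is_ideal_plus_principal:
  assumes B: "is_subring B" and P: "is_ideal B P" and x: "x \<in> B"
  shows "is_ideal B {u + b * x | u b. u \<in> P \<and> b \<in> B}"
    and "P \<subseteq> {u + b * x | u b. u \<in> P \<and> b \<in> B}" and "x \<in> {u + b * x | u b. u \<in> P \<and> b \<in> B}"
proof -
  let ?J = "{u + b * x | u b. u \<in> P \<and> b \<in> B}"
  show "P \<subseteq> ?J" using subring_0[OF B] by force
  show "x \<in> ?J" using subring_1[OF B] ideal_0[OF P] by force
  have "?J \<subseteq> B" using ideal_subset[OF P] x by (auto intro!: subring_add[OF B] subring_mult[OF B])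
  moreover have "v + w \<in> ?J" if v: "v \<in> ?J" and w: "w \<in> ?J" for v w
  proof -
    obtain u b where 1: "v = u + b * x" "u \<in> P" "b \<in> B" using v by blast
    obtain u' b' where 2: "w = u' + b' * x" "u' \<in> P" "b' \<in> B" using w by blast
    have "v + w = (u + u') + (b + b') * x" by (simp add: 1 2 algebra_simps)
    then show ?thesis using 1 2 ideal_add[OF P] subring_add[OF B] by blast
  qed
  moreover have "c * v \<in> ?J" if c: "c \<in> B" and v: "v \<in> ?J" for c v
  proof -
    obtain u b where 1: "v = u + b * x" "u \<in> P" "b \<in> B" using v by blast
    have "c * v = c * u + (c * b) * x" by (simp add: 1 algebra_simps)
    then show ?thesis using 1 c ideal_mult[OF P] subring_mult[OF B] by blast
  qed
  moreover have "0 \<in> ?J" using \<open>P \<subseteq> ?J\<close> ideal_0[OF P] by (rule subsetD)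
  ultimately show "is_ideal B ?J"
    unfolding is_ideal_def by (intro conjI ballI)
qed

text \<open>Two elements outside an ideal maximal among those missing \<open>W\<close> generate with
  it elements of \<open>W\<close>, whose product would lie in the ideal if theirs did. Maximality
  stays in the conclusion so that \<open>W = {1}\<close> yields maximal ideals.\<close>

lemma prime_avoiding:
  assumes B: "is_subring B" and I: "is_ideal B I" "I \<inter> W = {}"
    and W: "1 \<in> W" "\<And>x y. x \<in> W \<Longrightarrow> y \<in> W \<Longrightarrow> x * y \<in> W"
  shows "\<exists>P. is_prime B P \<and> I \<subseteq> P \<and> P \<inter> W = {} \<and> (\<forall>J. is_ideal B J \<longrightarrow> P \<subseteq> J \<longrightarrow> J \<inter> W = {} \<longrightarrow> J = P)"
proof -
  obtain P where P: "is_ideal B P" "I \<subseteq> P" "P \<inter> W = {}"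
    and max: "\<And>J. is_ideal B J \<Longrightarrow> P \<subseteq> J \<Longrightarrow> J \<inter> W = {} \<Longrightarrow> J = P"
    using exists_maximal_avoiding[OF I] by blast
  have ex: "\<exists>u b. u \<in> P \<and> b \<in> B \<and> u + b * x \<in> W" if x: "x \<in> B" "x \<notin> P" for x
  proof (rule ccontr)
    assume "\<not> ?thesis"
    then have "{u + b * x | u b. u \<in> P \<and> b \<in> B} \<inter> W = {}" by blast
    then have "{u + b * x | u b. u \<in> P \<and> b \<in> B} = P"
      using is_ideal_plus_principal[OF B P(1) x(1)] max by blast
    then show False using is_ideal_plus_principal(3)[OF B P(1) x(1)] x(2) by blast
  qed
  have "x \<in> P \<or> y \<in> P" if xy: "x \<in> B" "y \<in> B" "x * y \<in> P" for x y
  proof (rule ccontr)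
    assume n: "\<not> ?thesis"
    obtain u b where 1: "u \<in> P" "b \<in> B" "u + b * x \<in> W" using ex[of x] xy n by blast
    obtain v c where 2: "v \<in> P" "c \<in> B" "v + c * y \<in> W" using ex[of y] xy n by blast
    have uv: "u \<in> B" "v \<in> B" using 1(1) 2(1) ideal_subset[OF P(1)] by auto
    have "(u + b * x) * (v + c * y) = (v + c * y) * u + (b * x) * v + (b * c) * (x * y)"
      by (simp add: algebra_simps)
    also have "\<dots> \<in> P"
      by (intro ideal_add[OF P(1)] ideal_mult[OF P(1)] subring_add[OF B] subring_mult[OF B] uv 1(1,2) 2(1,2) xy)
    finally show False using W(2)[OF 1(3) 2(3)] P(3) by blast
  qed
  moreover have "1 \<notin> P" using W(1) P(3) by blast
  ultimately have "is_prime B P" using P(1) by (simp add: is_prime_def)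
  then show ?thesis using P max by blast
qed

lemma exists_maximal:
  assumes B: "is_subring B" and I: "is_ideal B I" "1 \<notin> I"
  shows "\<exists>P. is_maximal B P \<and> is_prime B P \<and> I \<subseteq> P"
proof -
  have "\<exists>P. is_prime B P \<and> I \<subseteq> P \<and> P \<inter> {1} = {} \<and>
    (\<forall>J. is_ideal B J \<longrightarrow> P \<subseteq> J \<longrightarrow> J \<inter> {1} = {} \<longrightarrow> J = P)"
    by (rule prime_avoiding[OF B I(1)]) (use I(2) in auto)
  then show ?thesis unfolding is_maximal_def by (auto intro: prime_ideal)
qed

lemma maximal_inverse:
  assumes B: "is_subring B" and M: "is_maximal B M" and x: "x \<in> B" "x \<notin> M"
  shows "\<exists>z\<in>B. x * z - 1 \<in> M"
proof -
  have I: "is_ideal B M" using M by (simp add: is_maximal_def)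
  let ?J = "{u + b * x | u b. u \<in> M \<and> b \<in> B}"
  have "1 \<in> ?J"
    using is_ideal_plus_principal[OF B I x(1)] M x(2) unfolding is_maximal_def by blast
  then obtain u b where "1 = u + b * x" "u \<in> M" "b \<in> B" by blast
  have "x * b - 1 = - u" using \<open>1 = u + b * x\<close> by (simp add: algebra_simps)
  then show ?thesis using ideal_uminus[OF B I \<open>u \<in> M\<close>] \<open>b \<in> B\<close> by (intro bexI[of _ b]) simp_all
qed

lemma maximal_prime: 
  assumes B: "is_subring B" and M: "is_maximal B M"
  shows "is_prime B M"
proof -
  have "is_ideal B M" "1 \<notin> M" using M by (auto simp: is_maximal_def)
  from exists_maximal[OF B this] obtain P where "is_prime B P" "M \<subseteq> P" by blast
  then have "P = M" using M unfolding is_maximal_def by (auto simp: is_prime_def)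
  then show ?thesis using \<open>is_prime B P\<close> by simp
qed

lemma eval_closed:
  assumes "rhom h" "\<And>c. h c \<in> S" "v \<in> S" "is_subring S"
  shows "poly (map_poly h f) v \<in> S"
proof -
  interpret rhom h by (rule assms(1))
  show ?thesis unfolding poly_altdef
    using assms by (intro subring_sum subring_mult subring_power) (auto simp: coeff_map_poly hom_0)
qed

section \<open>Invariants over the ring of integers\<close>

locale invariant_theory = function_field \<phi> for \<phi> :: "'q::{field, finite} poly fract \<Rightarrow> 'k::field" +
  fixes G :: "('k^2^2) set"
  assumes finG: "finite G" and oneG: "mat 1 \<in> G" and multG: "g \<in> G \<Longrightarrow> h \<in> G \<Longrightarrow> g ** h \<in> G"
    and invG: "g \<in> G \<Longrightarrow> \<exists>h\<in>G. g ** h = mat 1 \<and> h ** g = mat 1"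
    and entriesG: "g \<in> G \<Longrightarrow> g $ i $ j \<in> A"
begin

lemma prime_char_p: "prime CHAR('q)"
  by (intro prime_CHAR_semidom finite_imp_CHAR_pos) simp

lemma of_nat_char_p: "of_nat CHAR('q) = (0::'k)"
proof -
  have "of_nat CHAR('q) = \<psi> (of_nat CHAR('q))" by (simp add: C.hom_of_nat)
  also have "of_nat CHAR('q) = (0 :: 'q poly)" by (simp add: of_nat_poly)
  finally show ?thesis by (simp add: C.hom_0)
qed

abbreviation RA :: "'k poly poly set" where "RA \<equiv> poly2_over A"
abbreviation SA :: "'k poly poly set" where "SA \<equiv> invariants A G"

lemma is_subring_RA: "is_subring RA" by (rule is_subring_poly2_over[OF is_subring_A])
lemma is_subring_SA: "is_subring SA" by (rule is_subring_invariants[OF is_subring_A])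
lemma SA_RA: "SA \<subseteq> RA" by (auto simp: invariants_def)

lemma valued_group:
  assumes P: "is_prime A P"
  shows "valued_matrix_group G CHAR('q) (local_ring_at A P)"
proof
  show "g $ i $ j \<in> local_ring_at A P" if "g \<in> G" for g :: "'k^2^2" and i j
    using local_ring_at_subset[OF is_subring_A P] entriesG[OF that] by (rule subsetD)
qed (fact finG oneG multG invG prime_char_p of_nat_char_p is_subring_local_ring_at[OF is_subring_A P]
    valuation_ring[OF P])+

lemma finite_range_coeff: "finite (range (poly.coeff (f :: 'b::zero poly)))"
proof -
  have "range (poly.coeff f) \<subseteq> insert 0 (poly.coeff f ` {..degree f})"
    using coeff_eq_0 by (auto simp: not_le[symmetric])
  then show ?thesis by (meson finite.insertI finite_atMost finite_imageI finite_subset)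
qed

lemma invariants_clear_denominators:
  assumes P: "is_prime A P" and J: "finite J" and s: "\<And>j. j \<in> J \<Longrightarrow> s j \<in> invariants (local_ring_at A P) G"
  shows "\<exists>a\<in>A. a \<notin> P \<and> (\<forall>j\<in>J. const2 a * s j \<in> SA)"
proof -
  define F where "F = (\<Union>j\<in>J. \<Union>q\<in>range (poly.coeff (s j)). range (poly.coeff q))"
  have "finite F" unfolding F_def by (intro finite_UN_I J finite_range_coeff)
  moreover have "F \<subseteq> local_ring_at A P"
    using s by (auto simp: F_def invariants_def poly2_over_def)
  ultimately obtain a where a: "a \<in> A" "a \<notin> P" "\<forall>x\<in>F. a * x \<in> A"
    using local_ring_at_common_denominator[OF is_subring_A P] by blast
  have "const2 a * s j \<in> SA" if j: "j \<in> J" for j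
  proof -
    have "poly.coeff (poly.coeff (const2 a * s j) i) k = a * poly.coeff (poly.coeff (s j) i) k" for i k by simp
    moreover have "poly.coeff (poly.coeff (s j) i) k \<in> F" for i k using j by (auto simp: F_def)
    ultimately have "const2 a * s j \<in> RA" using a(3) unfolding poly2_over_def by (auto simp del: mem_Collect_eq)
    then show ?thesis using s[OF j] by (simp add: invariants_def LA.hom_mult del: mult_pCons_left)
  qed
  then show ?thesis using a by blast
qed

text \<open>Purity is applied over the valuation ring at \<open>P\<close>; the factor
  \<open>a\<close> clears the denominators of the coefficients that it produces.\<close>

lemma purity_local:
  assumes P: "is_prime A P" and J: "finite J" and x: "\<And>j. j \<in> J \<Longrightarrow> x j \<in> SA"
    and r: "\<And>j. j \<in> J \<Longrightarrow> r j \<in> poly2_over (local_ring_at A P)"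
    and f: "(\<Sum>j\<in>J. x j * r j) \<in> SA"
  shows "\<exists>a\<in>A. a \<notin> P \<and> (\<exists>s. (\<forall>j\<in>J. s j \<in> SA) \<and> const2 a * (\<Sum>j\<in>J. x j * r j) = (\<Sum>j\<in>J. x j * s j))"
proof -
  interpret valued_matrix_group G "CHAR('q)" "local_ring_at A P" by (rule valued_group[OF P])
  have sub: "SA \<subseteq> invariants (local_ring_at A P) G"
    using poly2_over_mono[OF local_ring_at_subset[OF is_subring_A P]] by (auto simp: invariants_def)
  have "\<exists>s. (\<forall>j\<in>J. s j \<in> invariants (local_ring_at A P) G) \<and> (\<Sum>j\<in>J. x j * r j) = (\<Sum>j\<in>J. x j * s j)"
    by (rule purity[OF J _ r]) (use x f sub in auto)
  then obtain s where s: "\<And>j. j \<in> J \<Longrightarrow> s j \<in> invariants (local_ring_at A P) G"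
    "(\<Sum>j\<in>J. x j * r j) = (\<Sum>j\<in>J. x j * s j)" by blast
  obtain a where a: "a \<in> A" "a \<notin> P" "\<forall>j\<in>J. const2 a * s j \<in> SA"
    using invariants_clear_denominators[OF P J, of s] s(1) by blast
  have "const2 a * (\<Sum>j\<in>J. x j * r j) = (\<Sum>j\<in>J. x j * (const2 a * s j))"
    unfolding s(2) sum_distrib_left by (intro sum.cong refl) (simp only: mult.left_commute)
  then show ?thesis using a by (intro bexI[of _ a] conjI exI[of _ "\<lambda>j. const2 a * s j"]) auto
qed

lemma lincomb_purity_local:
  assumes P: "is_prime A P" and F: "finite F" "F \<subseteq> SA"
    and f: "f \<in> lincomb (poly2_over (local_ring_at A P)) F" "f \<in> SA"
  shows "\<exists>a\<in>A. a \<notin> P \<and> const2 a * f \<in> lincomb SA F"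
proof -
  obtain r where r: "\<forall>x\<in>F. r x \<in> poly2_over (local_ring_at A P)" "f = (\<Sum>x\<in>F. r x * x)"
    using lincombD[OF f(1)] by blast
  have eq: "f = (\<Sum>x\<in>F. x * r x)" by (simp add: r(2) mult.commute)
  have "\<exists>a\<in>A. a \<notin> P \<and> (\<exists>s. (\<forall>x\<in>F. s x \<in> SA) \<and> const2 a * (\<Sum>x\<in>F. x * r x) = (\<Sum>x\<in>F. x * s x))"
    by (rule purity_local[OF P F(1)]) (use F f(2) eq r(1) in auto)
  then obtain a s where a: "a \<in> A" "a \<notin> P" "\<And>x. x \<in> F \<Longrightarrow> s x \<in> SA"
    "const2 a * f = (\<Sum>x\<in>F. x * s x)" unfolding eq[symmetric] by blast
  have "(\<Sum>x\<in>F. x * s x) = (\<Sum>x\<in>F. s x * x)" by (simp add: mult.commute)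
  then show ?thesis using a(1,2) lincombI[of F s SA] a(3,4) by metis
qed

text \<open>The structure map from the polynomial ring over the finite field in \<open>t\<close>,
  \<open>X\<close>, \<open>Y\<close>. It turns \<open>RA\<close> into a finite module over a
  noetherian ring whose elements can be counted by degree.\<close>

definition hD :: "'q poly poly poly \<Rightarrow> 'k poly poly"
  where "hD d = poly (map_poly (\<lambda>q. poly (map_poly (\<lambda>c. const2 (\<psi> c)) q) var_X) d) var_Y"

lemma rhom_const2_\<psi>: "rhom (\<lambda>c. const2 (\<psi> c))"
  by standard (simp_all add: C.hom_1 C.hom_add C.hom_mult flip: one_pCons)

sublocale D: rhom hD
  unfolding hD_def by (intro rhom_poly_map_poly rhom_const2_\<psi>)

lemma noetherian_D: "noetherian_type TYPE('q poly poly poly)"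
  by (intro hilbert_basis noetherian_type_field)

lemma hD_RA: "hD d \<in> RA"
  unfolding hD_def
  by (intro eval_closed rhom_poly_map_poly rhom_const2_\<psi> poly2_over_var[OF is_subring_A] is_subring_RA
      poly2_over_const2[OF is_subring_A]) (simp add: C.integral_hom)

lemma hD_const: "hD [:[:c:]:] = const2 (\<psi> c)"
  by (simp add: hD_def map_poly_pCons C.hom_0)

lemma hD_X: "hD [:[:0, 1:]:] = var_X"
  by (simp add: hD_def map_poly_pCons C.hom_0 C.hom_1 flip: one_pCons)

lemma hD_Y: "hD [:0, 1:] = var_Y"
  by (simp add: hD_def map_poly_pCons C.hom_0 C.hom_1 flip: one_pCons)

text \<open>Module generators of \<open>A\<close> remain generators when the two variables are
  adjoined to both rings.\<close>

lemma RA_finitely_generated: "\<exists>Z. finite Z \<and> RA = spn hD Z"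
proof -
  from A_finitely_generated obtain Y where Y: "finite Y" "Y \<subseteq> A" "A = spn \<psi> Y" by (elim exE conjE)
  let ?Z = "const2 ` Y"
  have const: "const2 a \<in> spn hD ?Z" if "a \<in> A" for a
  proof -
    from that have "a \<in> spn \<psi> Y" using Y(3) by simp
    then show ?thesis
    proof (induction rule: C.span_induct_alt)
      case base
      show ?case using D.span_zero by simp
    next
      case (step c x y)
      have "hD [:[:c:]:] * const2 x + const2 y \<in> spn hD ?Z"
        using step by (intro D.span_add[OF D.span_scale[OF D.span_base]]) auto
      then show ?case by (simp add: hD_const)
    qed
  qed
  have scale: "const2 c * x \<in> spn hD ?Z" if c: "c \<in> A" and x: "x \<in> spn hD ?Z" for c x
    using x
  proof (induction rule: D.span_induct_alt)
    case base
    show ?case using D.span_zero by simp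
  next
    case (step d x y)
    then obtain b where b: "b \<in> Y" "x = const2 b" by blast
    have "c * b \<in> A" using subring_mult[OF is_subring_A c] b(1) Y(2) by blast
    then have "hD d * const2 (c * b) + const2 c * y \<in> spn hD ?Z"
      using step by (intro D.span_add[OF D.span_scale[OF const]])
    moreover have "const2 c * (hD d * x + y) = hD d * const2 (c * b) + const2 c * y"
      by (simp add: b(2) smult_add_right mult.commute)
    ultimately show ?case by simp
  qed
  have "RA \<subseteq> spn hD ?Z"
  proof (rule poly2_over_subset)
    have "const2 1 \<in> spn hD ?Z" by (intro const subring_1[OF is_subring_A])
    then show "1 \<in> spn hD ?Z" by (simp add: one_pCons)
    show "var_X * x \<in> spn hD ?Z" if "x \<in> spn hD ?Z" for x
      using D.span_scale[OF that, of "[:[:0, 1:]:]"] by (simp only: hD_X)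
    show "var_Y * x \<in> spn hD ?Z" if "x \<in> spn hD ?Z" for x
      using D.span_scale[OF that, of "[:0, 1:]"] by (simp only: hD_Y)
  qed (rule D.span_add D.span_zero scale; assumption)+
  moreover have "smod hD RA"
    using subring_closed[OF is_subring_RA] hD_RA by (intro D.subspaceI) auto
  then have "spn hD ?Z \<subseteq> RA"
    using poly2_over_const2[OF is_subring_A] Y(2) by (intro D.span_minimal) blast+
  ultimately show ?thesis using Y(1) by (intro exI[of _ ?Z]) auto
qed

text \<open>The ideal that \<open>I\<close> generates in the noetherian ring \<open>RA\<close> is
  generated by finitely many members of \<open>I\<close>. Purity, applied at each prime of
  \<open>A\<close>, turns their combinations that lie in \<open>I\<close> into combinations with
  invariant coefficients.\<close>

theorem SA_noetherian:
  assumes I: "is_ideal SA I"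
  shows "\<exists>F. finite F \<and> F \<subseteq> I \<and> I = lincomb SA F"
proof -
  from RA_finitely_generated obtain Z where Z: "finite Z" "RA = spn hD Z" by (elim exE conjE)
  \<comment> \<open>Spans are taken over the polynomial ring, so the products with elements of
    \<open>RA\<close> are put in by hand to obtain an ideal of \<open>RA\<close>.\<close>
  let ?P = "{r * x | r x. r \<in> RA \<and> x \<in> I}"
  have IR: "I \<subseteq> RA" using ideal_subset[OF I] SA_RA by blast
  have smodRA: "smod hD RA"
    using subring_closed[OF is_subring_RA] hD_RA by (intro D.subspaceI) auto
  have "spn hD ?P \<subseteq> spn hD Z"
    unfolding Z(2)[symmetric] by (rule D.span_minimal[OF _ smodRA]) (use IR subring_mult[OF is_subring_RA] in blast)
  from D.noetherian_submodule[OF noetherian_D Z(1) D.subspace_span this]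
  obtain Y where Y: "finite Y" "Y \<subseteq> spn hD ?P" "spn hD Y = spn hD ?P" by (elim exE conjE)
  from D.span_finite_subset'[OF Y(1,2)] obtain Q where Q: "finite Q" "Q \<subseteq> ?P" "Y \<subseteq> spn hD Q"
    by (elim exE conjE)
  have "\<forall>q\<in>Q. \<exists>x. x \<in> I \<and> (\<exists>r\<in>RA. q = r * x)" using Q(2) by blast
  then obtain xx where xx: "\<And>q. q \<in> Q \<Longrightarrow> xx q \<in> I" "\<And>q. q \<in> Q \<Longrightarrow> \<exists>r\<in>RA. q = r * xx q" by metis
  define F where "F = xx ` Q"
  have F: "finite F" "F \<subseteq> I" using Q(1) xx(1) by (auto simp: F_def)
  have FS: "F \<subseteq> SA" using F(2) ideal_subset[OF I] by blast
  have FR: "F \<subseteq> RA" using FS SA_RA by blast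
  have idl: "is_ideal RA (lincomb RA F)" by (rule is_ideal_lincomb[OF is_subring_RA FR])
  have sm: "smod hD (lincomb RA F)"
    using ideal_0[OF idl] ideal_add[OF idl] ideal_mult[OF idl hD_RA] by (intro D.subspaceI)
  have "Q \<subseteq> lincomb RA F"
  proof
    fix q assume q: "q \<in> Q"
    then obtain r where "r \<in> RA" "q = r * xx q" using xx(2) by blast
    moreover have "xx q \<in> lincomb RA F"
      using q F(1) by (intro lincomb_base[OF is_subring_RA]) (auto simp: F_def)
    ultimately show "q \<in> lincomb RA F" using ideal_mult[OF idl] by metis
  qed
  then have "spn hD Q \<subseteq> lincomb RA F" using sm by (rule D.span_minimal)
  then have "Y \<subseteq> lincomb RA F" using Q(3) by blast
  then have "spn hD Y \<subseteq> lincomb RA F" using sm by (rule D.span_minimal)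
  moreover have "I \<subseteq> spn hD ?P"
  proof
    fix x assume "x \<in> I"
    then have "1 * x \<in> ?P" using subring_1[OF is_subring_RA] by blast
    then show "x \<in> spn hD ?P" using D.span_base[of "1 * x" ?P] by simp
  qed
  ultimately have IL: "I \<subseteq> lincomb RA F" using Y(3) by simp
  have idS: "is_ideal SA (lincomb SA F)" by (rule is_ideal_lincomb[OF is_subring_SA FS])
  have "I \<subseteq> lincomb SA F"
  proof
    fix f assume f: "f \<in> I"
    \<comment> \<open>The denominators that suffice for \<open>f\<close>. Purity puts into
      \<open>K\<close> an element outside any given prime of \<open>A\<close>, so \<open>K\<close>
      is the unit ideal.\<close>
    define K where "K = {a \<in> A. const2 a * f \<in> lincomb SA F}"
    have K: "is_ideal A K"
    proof -
      have "0 \<in> K" using subring_0[OF is_subring_A] ideal_0[OF idS] by (auto simp: K_def simp del: mem_Collect_eq) 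
      moreover have "a + b \<in> K" if "a \<in> K" "b \<in> K" for a b
      proof -
        have "const2 (a + b) * f = const2 a * f + const2 b * f"
          unfolding distrib_right[symmetric] by simp
        then show ?thesis using that subring_add[OF is_subring_A, of a b] ideal_add[OF idS] by (simp add: K_def)
      qed
      moreover have "b * a \<in> K" if b: "b \<in> A" and a: "a \<in> K" for a b
      proof -
        have "const2 a * f \<in> lincomb SA F" using a unfolding K_def by blast
        then have "const2 b * (const2 a * f) \<in> lincomb SA F"
          by (rule ideal_mult[OF idS invariants_const2[OF is_subring_A b]])
        moreover have "const2 (b * a) * f = const2 b * (const2 a * f)" by simp
        ultimately show ?thesis using a b subring_mult[OF is_subring_A, of b a] by (simp add: K_def)
      qed
      ultimately show ?thesis unfolding is_ideal_def K_def by blast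
    qed
    have "1 \<in> K"
    proof (rule ccontr)
      assume "1 \<notin> K"
      then obtain P where P: "is_prime A P" "K \<subseteq> P" using exists_maximal[OF is_subring_A K] by blast
      have "RA \<subseteq> poly2_over (local_ring_at A P)"
        by (intro poly2_over_mono local_ring_at_subset[OF is_subring_A P(1)])
      then have "f \<in> lincomb (poly2_over (local_ring_at A P)) F"
        using IL f unfolding lincomb_def by blast
      moreover have "f \<in> SA" using f ideal_subset[OF I] by blast
      ultimately obtain a where "a \<in> A" "a \<notin> P" "const2 a * f \<in> lincomb SA F"
        using lincomb_purity_local[OF P(1) F(1) FS] by blast
      then show False using P(2) by (auto simp: K_def)
    qed
    then show "f \<in> lincomb SA F" by (simp add: K_def flip: one_pCons)
  qed
  moreover have "lincomb SA F \<subseteq> I" by (rule lincomb_subset_ideal[OF I F(2)])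
  ultimately show ?thesis using F by blast
qed

definition base_prime :: "'k poly poly set \<Rightarrow> 'k set"
  where "base_prime m = {a \<in> A. const2 a \<in> m}"

lemma is_prime_base_prime:
  assumes m: "is_prime SA m"
  shows "is_prime A (base_prime m)"
proof -
  have I: "is_ideal SA m" by (rule prime_ideal[OF m])
  have c: "const2 (a * b) = const2 a * const2 b" "const2 (a + b) = const2 a + const2 b" for a b :: 'k
    by simp_all
  have S: "const2 a \<in> SA" if "a \<in> A" for a using that by (rule invariants_const2[OF is_subring_A])
  have "is_ideal A (base_prime m)"
    unfolding is_ideal_def
  proof (intro conjI ballI)
    show "b * x \<in> base_prime m" if "b \<in> A" "x \<in> base_prime m" for b x
      using that subring_mult[OF is_subring_A, of b x] ideal_mult[OF I S, of b "const2 x"]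
      unfolding base_prime_def by (simp only: mem_Collect_eq c; blast?)
    show "x + y \<in> base_prime m" if "x \<in> base_prime m" "y \<in> base_prime m" for x y
      using that subring_add[OF is_subring_A, of x y] ideal_add[OF I, of "const2 x" "const2 y"]
      unfolding base_prime_def by (simp only: mem_Collect_eq c; blast?)
    show "0 \<in> base_prime m"
      using subring_0[OF is_subring_A] ideal_0[OF I] by (simp add: base_prime_def)
  qed (auto simp: base_prime_def)
  moreover have "1 \<notin> base_prime m" using m by (simp add: base_prime_def is_prime_def one_pCons)
  moreover have "a \<in> base_prime m \<or> b \<in> base_prime m" if "a \<in> A" "b \<in> A" "a * b \<in> base_prime m" for a b
    using primeD[OF m S[OF that(1)] S[OF that(2)]] that by (simp only: base_prime_def mem_Collect_eq c) blast
  ultimately show ?thesis by (simp add: is_prime_def)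
qed

text \<open>By purity \<open>m\<close> generates a proper ideal of \<open>RA\<close>: a combination
  equal to \<open>1\<close> would put a constant outside \<open>base_prime m\<close> into
  \<open>m\<close>. A maximal ideal above it meets \<open>SA\<close> in a proper ideal containing
  \<open>m\<close>, hence in \<open>m\<close>.\<close>

theorem maximal_ideal_above:
  assumes m: "is_maximal SA m"
  shows "\<exists>M. is_maximal RA M \<and> M \<inter> SA = m"
proof -
  have I: "is_ideal SA m" and "1 \<notin> m" using m by (auto simp: is_maximal_def)
  have pm: "is_prime SA m" by (rule maximal_prime[OF is_subring_SA m])
  obtain F where F: "finite F" "F \<subseteq> m" "m = lincomb SA F" using SA_noetherian[OF I] by blast
  have FS: "F \<subseteq> SA" using F(2) ideal_subset[OF I] by blast
  have idl: "is_ideal RA (lincomb RA F)" using FS SA_RA by (intro is_ideal_lincomb[OF is_subring_RA]) blast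
  have "1 \<notin> lincomb RA F"
  proof
    assume 1: "1 \<in> lincomb RA F"
    let ?P = "base_prime m"
    have P: "is_prime A ?P" by (rule is_prime_base_prime[OF pm])
    have "RA \<subseteq> poly2_over (local_ring_at A ?P)"
      by (intro poly2_over_mono local_ring_at_subset[OF is_subring_A P])
    then have "1 \<in> lincomb (poly2_over (local_ring_at A ?P)) F"
      using 1 unfolding lincomb_def by blast
    then obtain a where "a \<in> A" "a \<notin> ?P" "const2 a * 1 \<in> lincomb SA F"
      using lincomb_purity_local[OF P F(1) FS _ subring_1[OF is_subring_SA]] by blast
    then show False using F(3) by (simp add: base_prime_def)
  qed
  then obtain M where M: "is_maximal RA M" "lincomb RA F \<subseteq> M"
    using exists_maximal[OF is_subring_RA idl] by blast
  have MI: "is_ideal RA M" "1 \<notin> M" using M(1) by (auto simp: is_maximal_def)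
  have "is_ideal SA (M \<inter> SA)"
    unfolding is_ideal_def
  proof (intro conjI ballI)
    show "b * x \<in> M \<inter> SA" if "b \<in> SA" "x \<in> M \<inter> SA" for b x
      using that ideal_mult[OF MI(1), of b x] subring_mult[OF is_subring_SA, of b x] SA_RA by auto
  qed (use subring_0[OF is_subring_SA] subring_add[OF is_subring_SA] ideal_0[OF MI(1)] ideal_add[OF MI(1)] in auto)
  moreover have "m \<subseteq> M \<inter> SA"
    using M(2) F(3) SA_RA ideal_subset[OF I] unfolding lincomb_def by blast
  moreover have "1 \<notin> M \<inter> SA" using MI(2) by blast
  ultimately have "M \<inter> SA = m" using m by (auto simp: is_maximal_def)
  then show ?thesis using M(1) by blast
qed

end

subsection \<open>Finiteness of residue fields\<close>

text \<open>The quotient by \<open>P\<close> is a Goldman domain: inverting the class of one element \<open>b\<close> makes it a field.\<close>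

definition goldman :: "'b::comm_ring_1 set \<Rightarrow> bool"
  where "goldman P \<longleftrightarrow> is_prime UNIV P \<and>
    (\<exists>b. b \<notin> P \<and> (\<forall>c. c \<notin> P \<longrightarrow> (\<exists>N w. c * w - b ^ N \<in> P)))"

definition finite_quotient :: "'b::comm_ring_1 set \<Rightarrow> 'b set \<Rightarrow> bool"
  where "finite_quotient B P \<longleftrightarrow> (\<exists>F. finite F \<and> F \<subseteq> B \<and> (\<forall>x\<in>B. \<exists>y\<in>F. x - y \<in> P))"

lemma power_Suc_minus_1: "a ^ Suc n - 1 = a * (a ^ n - 1) + (a - 1 :: 'a::comm_ring_1)"
  by (simp add: algebra_simps)

lemma is_subring_UNIV: "is_subring UNIV"
  by (simp add: is_subring_def)

section \<open>Goldman ideals of polynomial rings\<close>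

definition contract_const :: "'b::comm_ring_1 poly set \<Rightarrow> 'b set"
  where "contract_const P = {c. [:c:] \<in> P}"

lemma is_prime_contract_const:
  assumes P: "is_prime UNIV P"
  shows "is_prime UNIV (contract_const P)"
proof -
  have I: "is_ideal UNIV P" by (rule prime_ideal[OF P])
  have c: "[:a * b:] = [:a:] * [:b:]" "[:a + b:] = [:a:] + [:b:]" for a b :: 'a by simp_all
  have "is_ideal UNIV (contract_const P)"
    unfolding is_ideal_def
  proof (intro conjI ballI)
    show "x + y \<in> contract_const P" if "x \<in> contract_const P" "y \<in> contract_const P" for x y
      using ideal_add[OF I, of "[:x:]" "[:y:]"] that unfolding contract_const_def mem_Collect_eq c by blast
    show "b * x \<in> contract_const P" if "x \<in> contract_const P" for b x
      using ideal_mult[OF I, of "[:b:]" "[:x:]"] that unfolding contract_const_def mem_Collect_eq c by blast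
  qed (use ideal_0[OF I] in \<open>auto simp: contract_const_def\<close>)
  moreover have "1 \<notin> contract_const P" using P by (simp add: contract_const_def is_prime_def flip: one_pCons)
  moreover have "a \<in> contract_const P \<or> b \<in> contract_const P" if "a * b \<in> contract_const P" for a b
    using that primeD[OF P, of "[:a:]" "[:b:]"] unfolding contract_const_def mem_Collect_eq c by blast
  ultimately show ?thesis by (simp add: is_prime_def)
qed

lemma polys_over_contract_const:
  assumes P: "is_ideal UNIV P" and f: "f \<in> polys_over (contract_const P)"
  shows "f \<in> P"
  using f
proof (induction f)
  case 0
  show ?case by (rule ideal_0[OF P])
next
  case (pCons a f)
  have "[:a:] \<in> P" "f \<in> P"
    using polys_over_pConsD[OF pCons.prems] pCons.IH by (auto simp: contract_const_def)
  then have "[:a:] + [:0, 1:] * f \<in> P" by (intro ideal_add[OF P] ideal_mult[OF P]) auto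
  then show ?case by simp
qed

lemma max_coeff_notin:
  fixes f :: "'b::comm_ring_1 poly"
  assumes Q: "0 \<in> Q" and f: "f \<notin> polys_over Q"
  shows "\<exists>i. poly.coeff f i \<notin> Q \<and> (\<forall>j>i. poly.coeff f j \<in> Q)"
proof -
  let ?I = "{i. poly.coeff f i \<notin> Q}"
  have "?I \<subseteq> {..degree f}" using coeff_eq_0[of f] Q by (force simp: not_le[symmetric])
  then have fin: "finite ?I" by (rule finite_subset) simp
  have ne: "?I \<noteq> {}" using f by (auto simp: polys_over_def)
  have "Max ?I \<in> ?I" by (rule Max_in[OF fin ne])
  moreover have "poly.coeff f j \<in> Q" if "j > Max ?I" for j
    using Max_ge[OF fin, of j] that by auto
  ultimately show ?thesis by blast
qed

text \<open>All other terms of the convolution have a factor in \<open>Q\<close>, so modulo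
  \<open>Q\<close> the leading coefficients multiply as over a domain.\<close>

lemma coeff_mult_notin:
  assumes Q: "is_prime UNIV Q"
    and i: "poly.coeff f i \<notin> Q" "\<And>j. j > i \<Longrightarrow> poly.coeff f j \<in> Q"
    and k: "poly.coeff g k \<notin> Q" "\<And>j. j > k \<Longrightarrow> poly.coeff g j \<in> Q"
  shows "poly.coeff (f * g) (i + k) \<notin> Q"
proof
  assume fg: "poly.coeff (f * g) (i + k) \<in> Q"
  have QI: "is_ideal UNIV Q" by (rule prime_ideal[OF Q])
  have "poly.coeff (f * g) (i + k) = poly.coeff f i * poly.coeff g k
      + (\<Sum>j\<in>{..i + k} - {i}. poly.coeff f j * poly.coeff g (i + k - j))"
    unfolding coeff_mult by (subst sum.remove[of _ i]) auto
  then have e: "poly.coeff f i * poly.coeff g k = poly.coeff (f * g) (i + k)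
      - (\<Sum>j\<in>{..i + k} - {i}. poly.coeff f j * poly.coeff g (i + k - j))" by simp
  have "poly.coeff f j * poly.coeff g (i + k - j) \<in> Q" if "j \<in> {..i + k} - {i}" for j
  proof (cases "j < i")
    case True
    then show ?thesis by (intro ideal_mult[OF QI] k(2)) auto
  next
    case False
    then show ?thesis using that by (intro ideal_mult'[OF QI] i(2)) auto
  qed
  then have "poly.coeff f i * poly.coeff g k \<in> Q"
    unfolding e by (intro ideal_diff[OF is_subring_UNIV QI] ideal_sum[OF QI] fg)
  then show False using primeD[OF Q] i(1) k(1) by auto
qed

text \<open>Powers of the leading coefficient replace its inverse. The degree bound on
  \<open>q\<close> serves later to make a quotient smaller than an element of minimal
  degree.\<close>

lemma pseudo_division:
  fixes f r :: "'b::comm_ring_1 poly"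
  shows "\<exists>N q s. [:lead_coeff r:] ^ N * f = q * r + s \<and> (s = 0 \<or> degree s < degree r) \<and>
    (q = 0 \<or> degree q + degree r \<le> degree f)"
proof (induction "degree f" arbitrary: f rule: less_induct)
  case less
  let ?l = "lead_coeff r"
  show ?case
  proof (cases "f = 0 \<or> degree f < degree r")
    case True
    then show ?thesis by (intro exI[of _ 0] exI[of _ f]) auto
  next
    case False
    let ?k = "degree f - degree r"
    define m where "m = monom (lead_coeff f) ?k"
    have dm: "degree m \<le> ?k" unfolding m_def by (rule degree_monom_le)
    define f' where "f' = [:?l:] * f - m * r"
    have df: "degree f' \<le> degree f"
    proof -
      have "degree ([:?l:] * f) \<le> degree f" by (simp add: degree_smult_le)
      moreover have "degree (m * r) \<le> degree f"
        using False degree_mult_le[of m r] dm by linarith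
      ultimately show ?thesis unfolding f'_def by (intro degree_diff_le)
    qed
    have cf: "poly.coeff f' (degree f) = 0"
      using False by (simp add: f'_def m_def coeff_monom_mult mult.commute[of "lead_coeff f"])
    have "\<exists>N q s. [:?l:] ^ N * f' = q * r + s \<and> (s = 0 \<or> degree s < degree r) \<and>
      (q = 0 \<or> degree q + degree r \<le> degree f)"
    proof (cases "f' = 0")
      case True
      then show ?thesis by (intro exI[of _ 0]) auto
    next
      case nz: False
      have "degree f' \<noteq> degree f" using cf nz leading_coeff_0_iff[of f'] by metis
      then have "degree f' < degree f" using df by simp
      from less[OF this] obtain N q s where "[:?l:] ^ N * f' = q * r + s" "s = 0 \<or> degree s < degree r"
        "q = 0 \<or> degree q + degree r \<le> degree f'" by blast
      moreover from this(3) df have "q = 0 \<or> degree q + degree r \<le> degree f" by linarith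
      ultimately show ?thesis by blast
    qed
    then obtain N q s where N: "[:?l:] ^ N * f' = q * r + s" "s = 0 \<or> degree s < degree r"
      "q = 0 \<or> degree q + degree r \<le> degree f" by blast
    have "[:?l:] ^ Suc N * f = [:?l:] ^ N * f' + [:?l:] ^ N * m * r"
      by (simp only: f'_def power_Suc algebra_simps)
    also have "\<dots> = (q + [:?l:] ^ N * m) * r + s" unfolding N(1) by (simp only: algebra_simps)
    finally have eq: "[:?l:] ^ Suc N * f = (q + [:?l:] ^ N * m) * r + s" .
    have "degree ([:?l:] ^ N * m) \<le> ?k"
      using degree_mult_le[of "[:?l:] ^ N" m] degree_power_le[of "[:?l:]" N] dm by simp
    moreover have "degree q \<le> ?k" using N(3) by auto
    ultimately have "degree (q + [:?l:] ^ N * m) \<le> ?k" by (intro degree_add_le)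
    then have "degree (q + [:?l:] ^ N * m) + degree r \<le> degree f" using False by linarith
    then show ?thesis using eq N(2) by blast
  qed
qed

text \<open>Choose \<open>r\<close> of least degree outside \<open>polys_over Q\<close>. If its
  leading coefficient were in \<open>Q\<close>, removing the leading term would give a smaller such
  element.\<close>

lemma minimal_degree_element:
  assumes Q: "is_ideal UNIV Q" and J: "is_ideal UNIV J" "polys_over Q \<subseteq> J"
    and f0: "f0 \<in> J" "f0 \<notin> polys_over Q"
  shows "\<exists>r\<in>J. lead_coeff r \<notin> Q \<and> (\<forall>f\<in>J. f = 0 \<or> degree f < degree r \<longrightarrow> f \<in> polys_over Q)"
proof -
  define bad where "bad f \<longleftrightarrow> f \<in> J \<and> f \<notin> polys_over Q" for f
  have "bad f0" using f0 by (simp add: bad_def)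
  then obtain r where r: "bad r" and min: "\<And>f. bad f \<Longrightarrow> degree r \<le> degree f"
    using ex_has_least_nat[of bad f0 degree] by blast
  have P0: "0 \<in> polys_over Q" using ideal_0[OF Q] by (simp add: polys_over_def)
  have lr: "lead_coeff r \<notin> Q"
  proof
    assume l: "lead_coeff r \<in> Q"
    let ?m = "monom (lead_coeff r) (degree r)"
    have m: "?m \<in> polys_over Q" using l ideal_0[OF Q] by (auto simp: polys_over_def)
    have ns: "r - ?m \<notin> polys_over Q"
    proof
      assume d: "r - ?m \<in> polys_over Q"
      have "poly.coeff r i \<in> Q" for i
      proof -
        have "poly.coeff (r - ?m) i + poly.coeff ?m i \<in> Q"
          by (intro ideal_add[OF Q] polys_over_coeff d m)
        then show ?thesis by simp
      qed
      then show False using r by (simp add: bad_def polys_over_def)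
    qed
    have rJ: "r \<in> J" using r by (simp add: bad_def)
    have "r - ?m \<in> J" using m J(2) rJ by (intro ideal_diff[OF is_subring_UNIV J(1)]) auto
    then have b: "bad (r - ?m)" using ns by (simp add: bad_def)
    have nz: "r - ?m \<noteq> 0" using ns P0 by metis
    have "degree (r - ?m) \<le> degree r" by (rule degree_diff_le) (auto simp: degree_monom_le)
    moreover have "poly.coeff (r - ?m) (degree r) = 0" by simp
    ultimately have "degree (r - ?m) < degree r" using nz by (metis le_neq_implies_less leading_coeff_0_iff)
    then show False using min[OF b] by simp
  qed
  have "f \<in> polys_over Q" if "f \<in> J" "f = 0 \<or> degree f < degree r" for f
    using that min[of f] P0 by (fastforce simp: bad_def)
  then show ?thesis using r lr by (intro bexI[of _ r]) (auto simp: bad_def)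
qed

text \<open>If \<open>P\<close> were just \<open>polys_over Q\<close>, the variable would be free
  over the quotient, and \<open>1 + X * b\<close> would have to be a unit modulo \<open>P\<close>,
  which its degree forbids. So some \<open>r\<close> is an algebraic equation for the variable. A
  Goldman witness for the contraction is the leading coefficient of \<open>r\<close> times a
  constant \<open>d\<close> that is a multiple of \<open>b\<close> modulo \<open>P\<close>.\<close>

lemma goldman_polynomial_ring:
  assumes g: "goldman P"
  shows "goldman (contract_const P)" and "\<exists>r\<in>P. lead_coeff r \<notin> contract_const P"
proof -
  have P: "is_prime UNIV P" using g by (simp add: goldman_def)
  have I: "is_ideal UNIV P" by (rule prime_ideal[OF P])
  let ?Q = "contract_const P"
  have Q: "is_prime UNIV ?Q" by (rule is_prime_contract_const[OF P])
  have QI: "is_ideal UNIV ?Q" by (rule prime_ideal[OF Q])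
  obtain b where b: "b \<notin> P" "\<And>c. c \<notin> P \<Longrightarrow> \<exists>N w. c * w - b ^ N \<in> P"
    using g unfolding goldman_def by blast
  have QP: "polys_over ?Q \<subseteq> P" using polys_over_contract_const[OF I] by blast
  have Q0: "0 \<in> ?Q" by (rule ideal_0[OF QI])
  have "\<exists>f\<in>P. f \<notin> polys_over ?Q"
  proof (rule ccontr)
    assume "\<not> ?thesis"
    then have PQ: "f \<in> P \<longleftrightarrow> f \<in> polys_over ?Q" for f
      using QP by blast
    define c where "c = 1 + [:0, 1:] * b"
    have "b \<notin> polys_over ?Q" using b(1) PQ by blast
    then obtain i where i: "poly.coeff b i \<notin> ?Q" "\<And>j. j > i \<Longrightarrow> poly.coeff b j \<in> ?Q"
      using max_coeff_notin[OF Q0] by blast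
    have ci: "poly.coeff c (Suc i) = poly.coeff b i" by (simp add: c_def)
    have cj: "poly.coeff c j \<in> ?Q" if "j > Suc i" for j
      using that i(2)[of "j - 1"] by (cases j) (auto simp: c_def)
    have "c \<notin> P" using i(1) ci PQ polys_over_coeff[of c ?Q "Suc i"] by auto
    then obtain N w where w: "c * w - b ^ N \<in> P" using b(2) by blast
    have bc: "[:0, 1:] * b - (- 1) = c" by (simp add: c_def)
    \<comment> \<open>modulo \<open>P\<close>, the element \<open>c\<close> divides a power of \<open>b\<close> and is coprime to \<open>b\<close>\<close>
    have "\<exists>v. c * v - 1 \<in> P"
    proof -
      have pw: "\<exists>v. (([:0, 1:] * b) ^ n) - (- 1) ^ n = c * v" for n
      proof (induction n)
        case 0
        show ?case by (intro exI[of _ 0]) simp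
      next
        case (Suc n)
        then obtain v where v: "([:0, 1:] * b) ^ n - (- 1) ^ n = c * v" by blast
        have "([:0, 1:] * b) ^ Suc n - (- 1) ^ Suc n
          = ([:0, 1:] * b) * (([:0, 1:] * b) ^ n - (- 1) ^ n) + (- 1) ^ n * ([:0, 1:] * b - (- 1))"
          by (simp only: power_Suc algebra_simps)
        also have "\<dots> = c * (([:0, 1:] * b) * v + (- 1) ^ n)"
          unfolding v bc by (simp only: algebra_simps)
        finally show ?case by blast
      qed
      obtain v where v: "([:0, 1:] * b) ^ N - (- 1) ^ N = c * v" using pw by blast
      have "c * ((- 1) ^ N * ([:0, 1:] ^ N * w - v)) - 1
        = (- 1) ^ N * [:0, 1:] ^ N * (c * w - b ^ N) + (- 1) ^ N * (([:0, 1:] * b) ^ N - c * v) - 1"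
        by (simp only: power_mult_distrib algebra_simps)
      also have "([:0, 1:] * b) ^ N - c * v = (- 1) ^ N" using v by (simp only: algebra_simps)
      also have "(- 1) ^ N * (- 1) ^ N = (1 :: 'a poly)" by (simp flip: power_mult_distrib)
      finally have eq: "c * ((- 1) ^ N * ([:0, 1:] ^ N * w - v)) - 1
        = (- 1) ^ N * [:0, 1:] ^ N * (c * w - b ^ N)" by simp
      show ?thesis
        by (rule exI[of _ "(- 1) ^ N * ([:0, 1:] ^ N * w - v)"]) (simp only: eq ideal_mult[OF I] UNIV_I w)
    qed
    then obtain v where v: "c * v - 1 \<in> polys_over ?Q" using PQ by blast
    have "v \<notin> polys_over ?Q"
    proof
      assume "v \<in> polys_over ?Q"
      then have "v \<in> P" "c * v - 1 \<in> P" using v PQ by blast+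
      then have "c * v - (c * v - 1) \<in> P"
        by (rule ideal_diff[OF is_subring_UNIV I ideal_mult[OF I UNIV_I]])
      then show False using P by (simp add: is_prime_def)
    qed
    then obtain k where k: "poly.coeff v k \<notin> ?Q" "\<And>j. j > k \<Longrightarrow> poly.coeff v j \<in> ?Q"
      using max_coeff_notin[OF Q0] by blast
    have "poly.coeff (c * v) (Suc i + k) \<notin> ?Q"
      by (rule coeff_mult_notin[OF Q _ cj k]) (use i(1) ci in simp_all)
    \<comment> \<open>The index is positive, so subtracting the constant \<open>1\<close> does not
      change this coefficient.\<close>
    moreover have "poly.coeff (c * v - 1) (Suc i + k) \<in> ?Q" by (rule polys_over_coeff[OF v])
    ultimately show False by simp
  qed
  then obtain r where rP: "r \<in> P" and lr: "lead_coeff r \<notin> ?Q"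
    and small: "\<And>f. f \<in> P \<Longrightarrow> f = 0 \<or> degree f < degree r \<Longrightarrow> f \<in> polys_over ?Q"
    using minimal_degree_element[OF QI I QP] by blast
  show "\<exists>r\<in>P. lead_coeff r \<notin> contract_const P" using rP lr by blast
  let ?l = "lead_coeff r"
  have reduce: "\<exists>N s. [:?l:] ^ N * f - s \<in> P \<and> (s = 0 \<or> degree s < degree r)" for f
  proof -
    obtain N q s where N: "[:?l:] ^ N * f = q * r + s" "s = 0 \<or> degree s < degree r"
      using pseudo_division[of r f] by blast
    have "[:?l:] ^ N * f - s = q * r" by (simp add: N(1))
    then have "[:?l:] ^ N * f - s \<in> P" using ideal_mult[OF I UNIV_I rP] by simp
    then show ?thesis using N(2) by blast
  qed
  have hom: "[:x * y:] = [:x:] * [:y:]" "[:x ^ n:] = [:x:] ^ n" "[:x - y:] = [:x:] - [:y:]" for x y :: 'a and n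
    by (simp_all add: rhom.hom_power[OF rhom_const])
  \<comment> \<open>The ideal generated by \<open>P\<close> and \<open>b\<close> contains a constant
    outside \<open>Q\<close>. A minimal element \<open>s\<close> of positive degree would divide
    \<open>r\<close>, up to constants and \<open>polys_over Q\<close>, with a quotient that lies in
    \<open>P\<close> and has smaller degree than \<open>r\<close>; this would force the leading
    coefficient of \<open>r\<close> into \<open>Q\<close>.\<close>
  obtain d u where d: "d \<notin> ?Q" "[:d:] - b * u \<in> P"
  proof -
    define J where "J = {v + w * b | v w. v \<in> P \<and> w \<in> UNIV}"
    have J: "is_ideal UNIV J" and PJ: "P \<subseteq> J" and bJ: "b \<in> J"
      unfolding J_def by (rule is_ideal_plus_principal[OF is_subring_UNIV I UNIV_I])+
    have "b \<notin> polys_over ?Q" using b(1) QP by blast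
    then obtain s where sJ: "s \<in> J" and ls: "lead_coeff s \<notin> ?Q"
      and smallJ: "\<And>f. f \<in> J \<Longrightarrow> f = 0 \<or> degree f < degree s \<Longrightarrow> f \<in> polys_over ?Q"
      using minimal_degree_element[OF QI J _ bJ] QP PJ by blast
    have lsP: "[:lead_coeff s:] \<notin> P" using ls by (simp add: contract_const_def)
    have lsN: "[:lead_coeff s:] ^ N \<notin> P" for N using prime_power_mem[OF is_subring_UNIV P] lsP by blast
    have rem: "t \<in> polys_over ?Q" if "f \<in> J" "[:lead_coeff s:] ^ N * f = q * s + t" "t = 0 \<or> degree t < degree s" for f N q t
    proof -
      have "t = [:lead_coeff s:] ^ N * f - q * s" using that(2) by simp
      also have "\<dots> \<in> J" by (intro ideal_diff[OF is_subring_UNIV J] ideal_mult[OF J] UNIV_I that(1) sJ)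
      finally show ?thesis using smallJ that(3) by blast
    qed
    have sP: "s \<notin> P"
    proof
      assume "s \<in> P"
      obtain N q t where N: "[:lead_coeff s:] ^ N * b = q * s + t" "t = 0 \<or> degree t < degree s"
        using pseudo_division[of s b] by blast
      have "t \<in> P" using rem[OF bJ N] QP by blast
      then have "[:lead_coeff s:] ^ N * b \<in> P"
        unfolding N(1) by (intro ideal_add[OF I] ideal_mult[OF I] UNIV_I \<open>s \<in> P\<close>)
      then show False using primeD[OF P UNIV_I UNIV_I] lsN b(1) by blast
    qed
    have "degree s = 0"
    proof (rule ccontr)
      assume ds: "degree s \<noteq> 0"
      obtain N q t where N: "[:lead_coeff s:] ^ N * r = q * s + t" "t = 0 \<or> degree t < degree s"
        "q = 0 \<or> degree q + degree s \<le> degree r"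
        using pseudo_division[of s r] by blast
      have tQ: "t \<in> polys_over ?Q" using rem[OF _ N(1,2)] rP PJ by blast
      have "q * s = [:lead_coeff s:] ^ N * r - t" using N(1) by simp
      also have "\<dots> \<in> P" using tQ QP rP by (intro ideal_diff[OF is_subring_UNIV I] ideal_mult[OF I] UNIV_I) auto
      finally have "q \<in> P" using primeD[OF P UNIV_I UNIV_I] sP by blast
      moreover have "q = 0 \<or> degree q < degree r" using N(3) ds by auto
      ultimately have qQ: "q \<in> polys_over ?Q" by (rule small)
      have "q * s + t \<in> polys_over ?Q" unfolding polys_over_def
        using qQ tQ by (auto simp: coeff_mult intro!: ideal_add[OF QI] ideal_sum[OF QI] ideal_mult'[OF QI] dest: polys_over_coeff)
      then have "poly.coeff ([:lead_coeff s:] ^ N * r) (degree r) \<in> ?Q" unfolding N(1) by (rule polys_over_coeff)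
      moreover have "[:lead_coeff s:] ^ N = [:lead_coeff s ^ N:]" by (induction N) (simp_all add: one_pCons)
      ultimately have "lead_coeff s ^ N * ?l \<in> ?Q" by simp
      then have "lead_coeff s ^ N \<in> ?Q" using primeD[OF Q UNIV_I UNIV_I] lr by blast
      then show False using prime_power_mem[OF is_subring_UNIV Q UNIV_I] ls by blast
    qed
    then obtain d where d: "s = [:d:]" by (metis degree_eq_zeroE)
    obtain v w where "s = v + w * b" "v \<in> P" using sJ unfolding J_def by blast
    then have "[:d:] - b * w \<in> P" using d by (simp add: algebra_simps)
    then show ?thesis using that[of d w] ls d by simp
  qed
  have "\<exists>N w. c * w - (?l * d) ^ N \<in> ?Q" if c: "c \<notin> ?Q" for c
  proof -
    have "[:c:] \<notin> P" using c by (simp add: contract_const_def)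
    then obtain N w where w: "[:c:] * w - b ^ N \<in> P" using b(2) by blast
    have dN: "[:d:] ^ N - b ^ N * u ^ N \<in> P"
    proof (induction N)
      case 0
      then show ?case using ideal_0[OF I] by simp
    next
      case (Suc n)
      have "[:d:] ^ Suc n - b ^ Suc n * u ^ Suc n
        = [:d:] * ([:d:] ^ n - b ^ n * u ^ n) + (b ^ n * u ^ n) * ([:d:] - b * u)"
        by (simp only: power_Suc algebra_simps)
      also have "\<dots> \<in> P" by (intro ideal_add[OF I] ideal_mult[OF I] Suc d) auto
      finally show ?case .
    qed
    \<comment> \<open>The cofactor is reduced below the degree of \<open>r\<close>. The resulting
      element of \<open>P\<close> is then too small not to lie in \<open>polys_over Q\<close>, and
      its constant term is the congruence wanted modulo \<open>Q\<close>.\<close>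
    obtain K s where K: "[:?l:] ^ K * (w * u ^ N) - s \<in> P" "s = 0 \<or> degree s < degree r"
      using reduce by blast
    have "[:c:] * s - [:?l:] ^ K * [:d:] ^ N
      = [:?l:] ^ K * u ^ N * ([:c:] * w - b ^ N) - [:?l:] ^ K * ([:d:] ^ N - b ^ N * u ^ N)
        - [:c:] * ([:?l:] ^ K * (w * u ^ N) - s)"
      by (simp only: algebra_simps)
    also have "\<dots> \<in> P"
      by (intro ideal_diff[OF is_subring_UNIV I] ideal_mult[OF I] K w dN) auto
    finally have e: "[:c:] * s - [:?l ^ K * d ^ N:] \<in> P" by (simp only: hom)
    have "[:c:] * s - [:?l ^ K * d ^ N:] \<in> polys_over ?Q"
    proof (cases "degree r = 0")
      case True
      then obtain c where "r = [:c:]" by (metis degree_eq_zeroE)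
      then show ?thesis using rP lr by (simp add: contract_const_def)
    next
      case False
      have "degree ([:c:] * s - [:?l ^ K * d ^ N:]) < degree r"
        using K(2) False degree_smult_le[of c s] by (intro degree_diff_less) auto
      then show ?thesis using e by (intro small) auto
    qed
    then have "poly.coeff ([:c:] * s - [:?l ^ K * d ^ N:]) 0 \<in> ?Q" by (rule polys_over_coeff)
    then have "c * poly.coeff s 0 - ?l ^ K * d ^ N \<in> ?Q" by simp
    \<comment> \<open>The factor evens out the exponents of the leading coefficient and of
      \<open>d\<close> to \<open>N + K\<close>.\<close>
    then have "?l ^ N * d ^ K * (c * poly.coeff s 0 - ?l ^ K * d ^ N) \<in> ?Q" by (rule ideal_mult[OF QI UNIV_I])
    moreover have "?l ^ N * d ^ K * (c * poly.coeff s 0 - ?l ^ K * d ^ N)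
      = c * (?l ^ N * d ^ K * poly.coeff s 0) - (?l * d) ^ (N + K)"
      by (simp add: algebra_simps power_add power_mult_distrib)
    ultimately show ?thesis by metis
  qed
  moreover have "?l * d \<notin> ?Q" using lr d(1) primeD[OF Q] by blast
  ultimately show "goldman ?Q" using Q unfolding goldman_def by blast
qed

lemma finite_quotient_pigeonhole:
  assumes B: "is_subring B" and P: "is_ideal B P" and fin: "finite_quotient B P" and x: "\<And>n::nat. x n \<in> B"
  shows "\<exists>i j. i < j \<and> x j - x i \<in> P"
proof -
  obtain F where F: "finite F" "\<forall>x\<in>B. \<exists>y\<in>F. x - y \<in> P" using fin unfolding finite_quotient_def by blast
  then have "\<forall>n. \<exists>y\<in>F. x n - y \<in> P" using x by blast
  then obtain y where y: "\<And>n. y n \<in> F" "\<And>n. x n - y n \<in> P" by metis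
  have "finite (range y)" using y(1) F(1) by (meson finite_subset image_subsetI)
  then have "\<not> inj y" using finite_imageD infinite_UNIV_nat by blast
  then obtain i j where "i < j" "y i = y j" unfolding inj_def by (metis linorder_neqE_nat)
  then show ?thesis using ideal_diff[OF B P y(2)[of j] y(2)[of i]] by auto
qed

text \<open>A finite domain is a field: two powers of \<open>l\<close> agree modulo
  \<open>P\<close>, and the smaller one cancels.\<close>

lemma finite_quotient_inverse:
  assumes P: "is_prime UNIV P" and fin: "finite_quotient UNIV P" and l: "l \<notin> P"
  shows "\<exists>k. k * l - 1 \<in> P"
proof -
  obtain i j where ij: "i < j" "l ^ j - l ^ i \<in> P"
    using finite_quotient_pigeonhole[OF is_subring_UNIV prime_ideal[OF P] fin, of "\<lambda>n. l ^ n"] by auto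
  obtain d where d: "j = Suc (i + d)" using ij(1) less_imp_Suc_add by blast
  have "l ^ i * (l ^ d * l - 1) \<in> P" using ij(2) by (simp add: d power_add algebra_simps)
  then show ?thesis using primeD[OF P UNIV_I UNIV_I] prime_power_mem[OF is_subring_UNIV P UNIV_I] l by blast
qed

text \<open>The leading coefficient of \<open>r\<close> is invertible modulo \<open>P\<close>, so
  every class has a representative of degree below that of \<open>r\<close> with coefficients from a
  finite set.\<close>

lemma finite_quotient_polynomial_ring:
  assumes P: "is_prime UNIV P" and fin: "finite_quotient UNIV (contract_const P)"
    and r: "r \<in> P" "lead_coeff r \<notin> contract_const P"
  shows "finite_quotient UNIV P"
proof -
  have I: "is_ideal UNIV P" by (rule prime_ideal[OF P])
  let ?Q = "contract_const P" and ?l = "[:lead_coeff r:]"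
  obtain k where "k * lead_coeff r - 1 \<in> ?Q"
    using finite_quotient_inverse[OF is_prime_contract_const[OF P] fin r(2)] by blast
  then have k: "[:k:] * ?l - 1 \<in> P" by (simp add: contract_const_def one_pCons mult.commute)
  obtain F where F: "finite F" "\<And>x. \<exists>y\<in>F. x - y \<in> ?Q" using fin unfolding finite_quotient_def by auto
  then obtain y where y: "\<And>x. y x \<in> F" "\<And>x. x - y x \<in> ?Q" by metis
  let ?n = "degree r"
  let ?F = "(\<lambda>c. \<Sum>i<?n. monom (c i) i) ` (\<Pi>\<^sub>E i\<in>{..<?n}. F)"
  have "\<exists>y\<in>?F. f - y \<in> P" for f
  proof -
    obtain N q s where N: "?l ^ N * f = q * r + s" "s = 0 \<or> degree s < degree r"
      using pseudo_division[of r f] by blast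
    have kN: "([:k:] * ?l) ^ N - 1 \<in> P"
    proof (induction N)
      case 0
      then show ?case using ideal_0[OF I] by simp
    next
      case (Suc N)
      show ?case unfolding power_Suc_minus_1 by (intro ideal_add[OF I] ideal_mult[OF I UNIV_I] Suc k)
    qed
    define s' where "s' = [:k:] ^ N * s"
    have ks: "[:k:] ^ N * s = smult (k ^ N) s"
      by (induction N) (simp_all add: smult_smult)
    have "f - s' = ([:k:] ^ N * q) * r - f * (([:k:] * ?l) ^ N - 1)"
    proof -
      have "f * ([:k:] * ?l) ^ N = [:k:] ^ N * (?l ^ N * f)" by (simp only: power_mult_distrib mult_ac)
      then have "f * ([:k:] * ?l) ^ N = [:k:] ^ N * q * r + s'" unfolding N(1) s'_def by (simp only: algebra_simps)
      then show ?thesis by (simp only: right_diff_distrib) simp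
    qed
    also have "\<dots> \<in> P" by (intro ideal_diff[OF is_subring_UNIV I] ideal_mult[OF I UNIV_I] r(1) kN)
    finally have fs: "f - s' \<in> P" .
    have cs: "poly.coeff s' i = 0" if "i \<ge> ?n" for i
      using N(2) that by (auto simp: s'_def ks coeff_eq_0)
    have e: "(\<Sum>i<?n. monom (poly.coeff s' i) i) = s'"
      by (rule poly_eqI) (use cs in \<open>auto simp: coeff_sum\<close>)
    have "(\<Sum>i<?n. monom (poly.coeff s' i) i) - (\<Sum>i<?n. monom (y (poly.coeff s' i)) i)
      = (\<Sum>i<?n. monom 1 i * [:poly.coeff s' i - y (poly.coeff s' i):])"
      by (simp add: sum_subtractf[symmetric] diff_monom smult_monom)
    also have "\<dots> \<in> P"
      using y(2) by (intro ideal_sum[OF I] ideal_mult[OF I UNIV_I]) (simp add: contract_const_def)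
    finally have "s' - (\<Sum>i<?n. monom (y (poly.coeff s' i)) i) \<in> P" unfolding e .
    then have "(f - s') + (s' - (\<Sum>i<?n. monom (y (poly.coeff s' i)) i)) \<in> P"
      by (intro ideal_add[OF I fs])
    moreover have "(\<Sum>i<?n. monom (y (poly.coeff s' i)) i) \<in> ?F"
      using y(1) by (intro image_eqI[of _ _ "restrict (\<lambda>i. y (poly.coeff s' i)) {..<?n}"]) auto
    ultimately show ?thesis by (intro bexI) auto
  qed
  moreover have "finite ?F" using F(1) by (intro finite_imageI finite_PiE) auto
  ultimately show ?thesis unfolding finite_quotient_def by (intro exI[of _ ?F]) auto
qed

lemma (in rhom) finite_quotient_module:
  assumes fin: "finite_quotient UNIV Q" and Z: "finite Z" and M: "0 \<in> M" "\<And>x y. x \<in> M \<Longrightarrow> y \<in> M \<Longrightarrow> x + y \<in> M"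
    and QZ: "\<And>c z. c \<in> Q \<Longrightarrow> z \<in> Z \<Longrightarrow> h c * z \<in> M"
  shows "finite_quotient (spn h Z) M"
proof -
  obtain F where F: "finite F" "\<And>x. \<exists>y\<in>F. x - y \<in> Q" using fin unfolding finite_quotient_def by auto
  then obtain y where y: "\<And>x. y x \<in> F" "\<And>x. x - y x \<in> Q" by metis
  let ?F = "(\<lambda>c. \<Sum>z\<in>Z. h (c z) * z) ` (\<Pi>\<^sub>E z\<in>Z. F)"
  have sumM: "sum f I \<in> M" if "\<And>i. i \<in> I \<Longrightarrow> f i \<in> M" for f and I :: "'u set"
    using that by (induction I rule: infinite_finite_induct) (auto simp: M)
  have "\<exists>y\<in>?F. x - y \<in> M" if x: "x \<in> spn h Z" for x
  proof -
    obtain c where c: "x = (\<Sum>z\<in>Z. h (c z) * z)" using x span_finite[OF Z] by auto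
    have "x - (\<Sum>z\<in>Z. h (y (c z)) * z) = (\<Sum>z\<in>Z. h (c z - y (c z)) * z)"
      by (simp add: c sum_subtractf hom_diff left_diff_distrib)
    also have "\<dots> \<in> M" by (intro sumM QZ y)
    finally show ?thesis using y(1)
      by (intro bexI[of _ "\<Sum>z\<in>Z. h (y (c z)) * z"] image_eqI[of _ _ "restrict (\<lambda>z. y (c z)) Z"]) auto
  qed
  moreover have "finite ?F" using F(1) Z by (intro finite_imageI finite_PiE)
  moreover have "?F \<subseteq> spn h Z"
    by (rule image_subsetI, intro span_sum span_scale, rule span_base)
  ultimately show ?thesis unfolding finite_quotient_def by blast
qed

section \<open>Finite quotients of the polynomial ring and of the ring of integers\<close>

context invariant_theory
begin

text \<open>The contraction \<open>Q\<close> of \<open>M\<close> has a field as quotient, so it is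
  Goldman with \<open>b = 1\<close>. Removing the three variables one at a time leads down to the
  finite constant field, and finiteness climbs back up the same way.\<close>

theorem finite_residue_ring:
  assumes M: "is_maximal RA M"
  shows "finite_quotient RA M"
proof -
  from RA_finitely_generated obtain Z where Z: "finite Z" "RA = spn hD Z" by (elim exE conjE)
  have P: "is_prime RA M" by (rule maximal_prime[OF is_subring_RA M])
  have I: "is_ideal RA M" by (rule prime_ideal[OF P])
  define Q where "Q = {d. hD d \<in> M}"
  have QI: "is_ideal UNIV Q"
    using ideal_0[OF I] ideal_add[OF I] ideal_mult[OF I hD_RA]
    by (auto simp: is_ideal_def Q_def D.hom_0 D.hom_add D.hom_mult)
  have Q: "is_prime UNIV Q"
    using QI primeD[OF P hD_RA hD_RA] P by (auto simp: is_prime_def Q_def D.hom_1 D.hom_mult)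
  \<comment> \<open>Modulo \<open>M\<close> the image of \<open>c\<close> has an inverse
    \<open>z\<close>, which satisfies a monic equation over the polynomial ring. Multiplied by the
    \<open>n\<close>-th power of that image, the equation writes \<open>1\<close> as a multiple of
    \<open>c\<close>.\<close>
  have inv: "\<exists>w. c * w - 1 \<in> Q" if c: "c \<notin> Q" for c
  proof -
    define k where "k = hD c"
    have kR: "k \<in> RA" by (simp add: k_def hD_RA)
    obtain z where z: "z \<in> RA" "k * z - 1 \<in> M"
      using maximal_inverse[OF is_subring_RA M kR] c by (auto simp: Q_def k_def)
    have "z ^ i \<in> spn hD Z" for i
      using subring_power[OF is_subring_RA z(1)] Z(2) by blast
    from D.power_in_span_lower_powers[OF noetherian_D Z(1) this]
    obtain n where "z ^ n \<in> spn hD ((\<lambda>i. z ^ i) ` {..<n})" by blast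
    from D.span_powers_explicit[OF this] obtain e where e: "z ^ n = (\<Sum>i<n. hD (e i) * z ^ i)" by blast
    have pw: "(k * z) ^ i - 1 \<in> M" for i
    proof (induction i)
      case 0
      then show ?case using ideal_0[OF I] by simp
    next
      case (Suc i)
      show ?case unfolding power_Suc_minus_1
        by (intro ideal_add[OF I] ideal_mult[OF I] subring_mult[OF is_subring_RA] Suc z kR)
    qed
    define w where "w = (\<Sum>i<n. e i * c ^ (n - 1 - i))"
    have "(k * z) ^ n = (\<Sum>i<n. (hD (e i) * k ^ (n - i)) * (k * z) ^ i)"
      unfolding power_mult_distrib e sum_distrib_left
    proof (intro sum.cong refl)
      fix i assume "i \<in> {..<n}"
      then have "k ^ n = k ^ (n - i) * k ^ i" by (simp add: power_add[symmetric])
      then show "k ^ n * (hD (e i) * z ^ i) = hD (e i) * k ^ (n - i) * (k ^ i * z ^ i)"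
        by (simp only: mult_ac)
    qed
    moreover have "hD (c * w) = (\<Sum>i<n. hD (e i) * k ^ (n - i))"
      unfolding w_def D.hom_mult D.hom_sum D.hom_power k_def[symmetric] sum_distrib_left
    proof (intro sum.cong refl)
      fix i assume "i \<in> {..<n}"
      then have "k ^ (n - i) = k * k ^ (n - 1 - i)" by (simp add: power_Suc[symmetric] Suc_diff_Suc del: power_Suc)
      then show "k * (hD (e i) * k ^ (n - 1 - i)) = hD (e i) * k ^ (n - i)" by (simp only: mult_ac)
    qed
    ultimately have "hD (c * w) - 1 = ((k * z) ^ n - 1) - (\<Sum>i<n. (hD (e i) * k ^ (n - i)) * ((k * z) ^ i - 1))"
      by (simp add: right_diff_distrib sum_subtractf)
    also have "\<dots> \<in> M"
      by (intro ideal_diff[OF is_subring_RA I] ideal_sum[OF I] ideal_mult[OF I] pw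
          subring_mult[OF is_subring_RA] subring_power[OF is_subring_RA] hD_RA kR)
    finally have "c * w - 1 \<in> Q" by (simp add: Q_def D.hom_diff D.hom_1)
    then show ?thesis by blast
  qed
  have "1 \<notin> Q" using Q by (simp add: is_prime_def)
  moreover have "\<exists>N w. c * w - 1 ^ N \<in> Q" if "c \<notin> Q" for c
  proof -
    obtain w where "c * w - 1 \<in> Q" using inv[OF \<open>c \<notin> Q\<close>] by blast
    then show ?thesis by (intro exI[of _ 0] exI[of _ w]) simp
  qed
  ultimately have g3: "goldman Q" using Q unfolding goldman_def by blast
  note g2 = goldman_polynomial_ring[OF g3]
  note g1 = goldman_polynomial_ring[OF g2(1)]
  note g0 = goldman_polynomial_ring[OF g1(1)]
  define Q0 where "Q0 = contract_const (contract_const (contract_const Q))"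
  have "0 \<in> Q0" using g0(1) unfolding goldman_def Q0_def by (blast intro: ideal_0 prime_ideal)
  then have "x - x \<in> Q0" for x by simp
  then have "finite_quotient UNIV Q0"
    unfolding finite_quotient_def by (intro exI[of _ UNIV] conjI ballI bexI finite subset_UNIV UNIV_I)
  then have "finite_quotient UNIV (contract_const (contract_const (contract_const Q)))" by (simp only: Q0_def)
  then have "finite_quotient UNIV (contract_const (contract_const Q))"
    using finite_quotient_polynomial_ring g0(2) g1(1) by (auto simp: goldman_def)
  then have "finite_quotient UNIV (contract_const Q)"
    using finite_quotient_polynomial_ring g1(2) g2(1) by (auto simp: goldman_def)
  then have fin: "finite_quotient UNIV Q"
    using finite_quotient_polynomial_ring g2(2) g3 by (auto simp: goldman_def)
  have ZR: "Z \<subseteq> RA" unfolding Z(2) by (rule D.span_superset)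
  show ?thesis unfolding Z(2)
    by (rule D.finite_quotient_module[OF fin Z(1) ideal_0[OF I] ideal_add[OF I]])
      (use ZR ideal_mult'[OF I] in \<open>auto simp: Q_def\<close>)
qed

theorem finite_quotient_A:
  assumes g: "g \<noteq> 0"
  shows "finite_quotient A {\<psi> g * a | a. a \<in> A}"
proof -
  from A_finitely_generated obtain Y where Y: "finite Y" "Y \<subseteq> A" "A = spn \<psi> Y" by (elim exE conjE)
  have "finite_quotient UNIV {f. g dvd f}" unfolding finite_quotient_def
  proof (intro exI[of _ "{f. degree f \<le> degree g}"] conjI ballI)
    show "finite {f::'q poly. degree f \<le> degree g}" by (rule finite_polys_degree_le)
    fix f
    have "degree (f mod g) \<le> degree g" using degree_mod_less[OF g, of f] by auto
    then show "\<exists>y\<in>{f. degree f \<le> degree g}. f - y \<in> {f. g dvd f}"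
      by (intro bexI[of _ "f mod g"]) (auto simp: minus_mod_eq_mult_div)
  qed auto
  then have "finite_quotient (spn \<psi> Y) {\<psi> g * a | a. a \<in> A}"
  proof (rule C.finite_quotient_module[OF _ Y(1)])
    show "0 \<in> {\<psi> g * a | a. a \<in> A}" using subring_0[OF is_subring_A] by force
    show "x + y \<in> {\<psi> g * a | a. a \<in> A}" if x: "x \<in> {\<psi> g * a | a. a \<in> A}" and y: "y \<in> {\<psi> g * a | a. a \<in> A}" for x y
    proof -
      obtain a b where "x = \<psi> g * a" "a \<in> A" "y = \<psi> g * b" "b \<in> A" using x y by blast
      then have "x + y = \<psi> g * (a + b)" "a + b \<in> A" using subring_add[OF is_subring_A] by (auto simp: distrib_left)
      then show ?thesis by blast
    qed
    fix c z assume cz: "c \<in> {f. g dvd f}" "z \<in> Y"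
    then obtain k where "c = g * k" by (auto simp: dvd_def)
    then have "\<psi> c * z = \<psi> g * (\<psi> k * z)" by (simp add: C.hom_mult)
    moreover have "\<psi> k * z \<in> A"
      using cz(2) Y(2) C.integral_hom by (intro subring_mult[OF is_subring_A]) auto
    ultimately show "\<psi> c * z \<in> {\<psi> g * a | a. a \<in> A}" by blast
  qed
  then show ?thesis by (simp only: Y(3)[symmetric])
qed

end

subsection \<open>A regular sequence\<close>

text \<open>Take the highest coefficient of \<open>f\<close> outside \<open>I\<close>: times the
  leading coefficient of \<open>p\<close> it is, up to elements of \<open>I\<close>, a coefficient
  of \<open>p * f\<close>.\<close>

lemma polys_over_unit_lead_cancel:
  assumes B: "is_subring B" and I: "is_ideal B I" and p: "p \<in> polys_over B" and f: "f \<in> polys_over B"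
    and u: "u \<in> B" "u * lead_coeff p = 1" and pf: "p * f \<in> polys_over I"
  shows "f \<in> polys_over I"
proof (rule ccontr)
  assume "f \<notin> polys_over I"
  then obtain i where i: "poly.coeff f i \<notin> I" "\<And>j. j > i \<Longrightarrow> poly.coeff f j \<in> I"
    using max_coeff_notin[OF ideal_0[OF I]] by blast
  let ?d = "degree p"
  have "poly.coeff (p * f) (?d + i) = lead_coeff p * poly.coeff f i
      + (\<Sum>j\<in>{..?d + i} - {?d}. poly.coeff p j * poly.coeff f (?d + i - j))"
    unfolding coeff_mult by (subst sum.remove[of _ ?d]) auto
  then have e: "lead_coeff p * poly.coeff f i = poly.coeff (p * f) (?d + i)
      - (\<Sum>j\<in>{..?d + i} - {?d}. poly.coeff p j * poly.coeff f (?d + i - j))" by simp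
  have "poly.coeff p j * poly.coeff f (?d + i - j) \<in> I" if "j \<in> {..?d + i} - {?d}" for j
  proof (cases "j < ?d")
    case True
    then show ?thesis by (intro ideal_mult[OF I] polys_over_coeff[OF p] i(2)) auto
  next
    case False
    then have "poly.coeff p j = 0" using that by (intro coeff_eq_0) auto
    then show ?thesis using ideal_0[OF I] by simp
  qed
  then have "lead_coeff p * poly.coeff f i \<in> I"
    unfolding e by (intro ideal_diff[OF B I] ideal_sum[OF I] polys_over_coeff[OF pf])
  then have "u * (lead_coeff p * poly.coeff f i) \<in> I" by (rule ideal_mult[OF I u(1)])
  then show False using i(1) u(2) by (simp add: mult.assoc[symmetric])
qed

lemma division_unit_lead:
  fixes l :: "'b::comm_ring_1 poly"
  assumes B: "is_subring B" and l: "l \<in> polys_over B" and u: "u \<in> B" "u * lead_coeff l = 1"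
    and f: "f \<in> polys_over B"
  shows "\<exists>q\<in>polys_over B. \<exists>r\<in>polys_over B. f = q * l + r \<and> (\<forall>i\<ge>degree l. poly.coeff r i = 0)"
proof -
  have PB: "is_subring (polys_over B)" by (rule is_subring_polys_over[OF B])
  have "f \<in> polys_over B \<Longrightarrow> (\<forall>i\<ge>n. poly.coeff f i = 0) \<Longrightarrow>
    \<exists>q\<in>polys_over B. \<exists>r\<in>polys_over B. f = q * l + r \<and> (\<forall>i\<ge>degree l. poly.coeff r i = 0)" for n f
  proof (induction n arbitrary: f)
    case 0
    then have "f = 0" by (auto intro: poly_eqI)
    then show ?case using subring_0[OF PB] by (intro bexI[of _ 0]) auto
  next
    case (Suc n)
    show ?case
    proof (cases "n < degree l")
      case True
      then show ?thesis using Suc.prems subring_0[OF PB] by (intro bexI[of _ 0] bexI[of _ f]) auto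
    next
      case False
      define m where "m = monom (u * poly.coeff f n) (n - degree l)"
      have m: "m \<in> polys_over B"
        using subring_mult[OF B u(1) polys_over_coeff[OF Suc.prems(1)]] subring_0[OF B]
        by (auto simp: m_def polys_over_def)
      have "f - m * l \<in> polys_over B"
        by (intro subring_diff[OF PB] subring_mult[OF PB] m l Suc.prems(1))
      moreover have "\<forall>i\<ge>n. poly.coeff (f - m * l) i = 0"
      proof (intro allI impI)
        fix i assume "i \<ge> n"
        show "poly.coeff (f - m * l) i = 0"
        proof (cases "i = n")
          case True
          have "u * poly.coeff f n * lead_coeff l = (u * lead_coeff l) * poly.coeff f n" by (simp only: mult_ac)
          then show ?thesis using True False u(2) by (simp add: m_def coeff_monom_mult)
        next
          case ne: False
          then show ?thesis using \<open>i \<ge> n\<close> Suc.prems(2) False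
            by (auto simp: m_def coeff_monom_mult coeff_eq_0)
        qed
      qed
      ultimately obtain q r where q: "q \<in> polys_over B" "r \<in> polys_over B" "f - m * l = q * l + r"
        "\<forall>i\<ge>degree l. poly.coeff r i = 0" using Suc.IH by blast
      have "f = (q + m) * l + r" using q(3) by (simp add: algebra_simps)
      then show ?thesis using q subring_add[OF PB q(1) m] by blast
    qed
  qed
  moreover have "\<forall>i\<ge>Suc (degree f). poly.coeff f i = 0" by (simp add: coeff_eq_0)
  ultimately show ?thesis using f by blast
qed

section \<open>Nonzerodivisors over a valuation ring\<close>

context valued_matrix_group
begin

lemma CHAR_k: "CHAR('k) = p"
proof -
  have "CHAR('k) dvd p" using p(2) by (simp add: of_nat_eq_0_iff_char_dvd)
  then show ?thesis using p(1) CHAR_not_1[where 'a = 'k] by (metis prime_nat_iff One_nat_def)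
qed

lemma frobenius: "(a + b :: 'k poly poly) ^ (p ^ n) = a ^ (p ^ n) + b ^ (p ^ n)"
  using freshmans_dream'[of "p ^ n" n a b] p(1) by (simp add: CHAR_k)

text \<open>With \<open>l = 0\<close> this is the principal ideal of \<open>x\<close>, so one notion
  covers both steps of the sequence.\<close>

definition gen2 :: "'k \<Rightarrow> 'k poly poly \<Rightarrow> 'k poly poly set"
  where "gen2 x l = {const2 x * g + l * g' | g g'. g \<in> R \<and> g' \<in> R}"

definition nonzerodivisor_mod :: "'k poly poly \<Rightarrow> 'k poly poly set \<Rightarrow> bool"
  where "nonzerodivisor_mod e J \<longleftrightarrow> (\<forall>f\<in>R. e * f \<in> J \<longrightarrow> f \<in> J)"

lemma gen2I: "g \<in> R \<Longrightarrow> g' \<in> R \<Longrightarrow> const2 x * g + l * g' \<in> gen2 x l"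
  by (auto simp: gen2_def)

lemma gen2_left: "g \<in> R \<Longrightarrow> const2 x * g \<in> gen2 x l"
  using gen2I[of g 0 x l] subring_0[OF is_subring_R] by simp

lemma gen2_right: "g \<in> R \<Longrightarrow> l * g \<in> gen2 x l"
  using gen2I[of 0 g x l] subring_0[OF is_subring_R] by simp

lemma is_ideal_gen2:
  assumes "x \<in> V" "l \<in> R"
  shows "is_ideal R (gen2 x l)"
  unfolding is_ideal_def
proof (intro conjI ballI)
  show "gen2 x l \<subseteq> R" unfolding gen2_def
    using assms poly2_over_const2[OF V assms(1)]
    by (auto intro!: subring_add[OF is_subring_R] subring_mult[OF is_subring_R] simp del: mult_pCons_left)
  show "0 \<in> gen2 x l" using gen2_left[of 0 x l] subring_0[OF is_subring_R] by simp
next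
  fix a b assume a: "a \<in> gen2 x l" and b: "b \<in> gen2 x l"
  obtain g g' where 1: "a = const2 x * g + l * g'" "g \<in> R" "g' \<in> R" using a unfolding gen2_def by blast
  obtain k k' where 2: "b = const2 x * k + l * k'" "k \<in> R" "k' \<in> R" using b unfolding gen2_def by blast
  have "a + b = const2 x * (g + k) + l * (g' + k')" by (simp only: 1 2 algebra_simps)
  then show "a + b \<in> gen2 x l" using gen2I[of "g + k" "g' + k'" x l] 1 2 subring_add[OF is_subring_R] by metis
next
  fix c a assume c: "c \<in> R" and a: "a \<in> gen2 x l"
  obtain g g' where 1: "a = const2 x * g + l * g'" "g \<in> R" "g' \<in> R" using a unfolding gen2_def by blast
  have "c * a = const2 x * (c * g) + l * (c * g')" by (simp only: 1 algebra_simps)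
  then show "c * a \<in> gen2 x l" using gen2I[of "c * g" "c * g'" x l] c 1 subring_mult[OF is_subring_R] by metis
qed

lemma gen2_mono: "gen2 x 0 \<subseteq> gen2 x l"
  unfolding gen2_def using gen2_left by (auto simp: gen2_def simp del: mult_pCons_left)

lemma gen2_0: "f \<in> gen2 x 0 \<longleftrightarrow> (\<exists>g\<in>R. f = const2 x * g)"
  unfolding gen2_def using subring_0[OF is_subring_R] by (auto simp del: mult_pCons_left)

text \<open>Divisibility by \<open>x\<close> is tested on coefficients, which makes the cancellation
  lemma for \<open>polys_over\<close> applicable.\<close>

lemma gen2_0_iff:
  assumes "x \<noteq> 0"
  shows "f \<in> gen2 x 0 \<longleftrightarrow> f \<in> polys_over (polys_over {x * v | v. v \<in> V})"
proof
  assume "f \<in> gen2 x 0"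
  then obtain g where "g \<in> R" "f = const2 x * g" unfolding gen2_0 by blast
  then show "f \<in> polys_over (polys_over {x * v | v. v \<in> V})"
    by (auto simp: polys_over_def poly2_over_def)
next
  assume f: "f \<in> polys_over (polys_over {x * v | v. v \<in> V})"
  have "const2 (inverse x) * f \<in> R"
    unfolding poly2_over_def
  proof (intro CollectI allI)
    fix i j
    have "poly.coeff (poly.coeff f i) j \<in> {x * v | v. v \<in> V}" using f by (simp add: polys_over_def)
    then show "poly.coeff (poly.coeff (const2 (inverse x) * f) i) j \<in> V" using assms by (auto simp: mult.assoc[symmetric])
  qed
  moreover have "f = const2 x * (const2 (inverse x) * f)" using assms by (simp flip: one_pCons)
  ultimately show "f \<in> gen2 x 0" unfolding gen2_0 by blast
qed

lemma is_ideal_multiples: "x \<in> V \<Longrightarrow> is_ideal V {x * v | v. v \<in> V}"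
  unfolding is_ideal_def
proof (intro conjI ballI)
  assume x: "x \<in> V"
  show "{x * v | v. v \<in> V} \<subseteq> V" using x subring_mult[OF V] by auto
  show "0 \<in> {x * v | v. v \<in> V}" using subring_0[OF V] by force
  fix a assume "a \<in> {x * v | v. v \<in> V}"
  then obtain v where v: "a = x * v" "v \<in> V" by blast
  show "a + b \<in> {x * v | v. v \<in> V}" if b: "b \<in> {x * v | v. v \<in> V}" for b
  proof -
    obtain w where "b = x * w" "w \<in> V" using b by blast
    then have "a + b = x * (v + w)" "v + w \<in> V" using v subring_add[OF V] by (auto simp: algebra_simps)
    then show ?thesis by blast
  qed
  show "b * a \<in> {x * v | v. v \<in> V}" if b: "b \<in> V" for b
  proof -
    have "b * a = x * (b * v)" "b * v \<in> V" using v b subring_mult[OF V] by (auto simp: algebra_simps)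
    then show ?thesis by blast
  qed
qed

lemma is_ideal_polys_over:
  assumes B: "is_subring B" and I: "is_ideal B I"
  shows "is_ideal (polys_over B) (polys_over I)"
  unfolding is_ideal_def
proof (intro conjI ballI)
  show "polys_over I \<subseteq> polys_over B" by (rule polys_over_mono[OF ideal_subset[OF I]])
  show "0 \<in> polys_over I" using ideal_0[OF I] by (simp add: polys_over_def)
  show "f + g \<in> polys_over I" if "f \<in> polys_over I" "g \<in> polys_over I" for f g
    using that ideal_add[OF I] by (auto simp: polys_over_def)
  show "f * g \<in> polys_over I" if "f \<in> polys_over B" "g \<in> polys_over I" for f g
    using that by (auto simp: polys_over_def coeff_mult intro!: ideal_sum[OF I] ideal_mult[OF I])
qed

lemma unit_lead_nonzerodivisor:
  assumes x: "x \<in> V" "x \<noteq> 0" and l: "l \<in> R" "lead_coeff l = [:\<beta>:]" "\<beta> \<noteq> 0" "inverse \<beta> \<in> V"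
  shows "nonzerodivisor_mod l (gen2 x 0)"
  unfolding nonzerodivisor_mod_def gen2_0_iff[OF x(2)]
proof (intro ballI impI)
  fix f assume f: "f \<in> R" "l * f \<in> polys_over (polys_over {x * v | v. v \<in> V})"
  show "f \<in> polys_over (polys_over {x * v | v. v \<in> V})"
    by (rule polys_over_unit_lead_cancel[OF is_subring_polys_over[OF V]
        is_ideal_polys_over[OF V is_ideal_multiples[OF x(1)]] _ _ polys_over_const[OF V l(4)] _ f(2)])
      (use l f(1) in \<open>auto simp: poly2_over_eq one_pCons\<close>)
qed

text \<open>Division by \<open>l\<close> leaves remainders of bounded degree in \<open>Y\<close>,
  with coefficients that are polynomials in \<open>X\<close>. On these \<open>e\<close> acts modulo
  \<open>x\<close> and \<open>l\<close> as the unit \<open>\<epsilon>\<close> times the monic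
  \<open>h\<close>, and \<open>h\<close> cancels coefficient by coefficient.\<close>

lemma nonzerodivisor_mod_unit_lead:
  assumes x: "x \<in> V" "x \<noteq> 0" and l: "l \<in> R" "lead_coeff l = [:\<beta>:]" "\<beta> \<noteq> 0" "inverse \<beta> \<in> V"
    and h: "h \<in> polys_over V" "lead_coeff h = 1" and \<epsilon>: "\<epsilon> \<noteq> 0" "inverse \<epsilon> \<in> V"
    and e: "e - const2 \<epsilon> * [:h:] \<in> gen2 x l"
  shows "nonzerodivisor_mod e (gen2 x l)"
  unfolding nonzerodivisor_mod_def
proof (intro ballI impI)
  fix f assume f: "f \<in> R" "e * f \<in> gen2 x l"
  have J: "is_ideal R (gen2 x l)" by (rule is_ideal_gen2[OF x(1) l(1)])
  have u: "[:inverse \<beta>:] \<in> polys_over V" "[:inverse \<beta>:] * lead_coeff l = 1"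
    using l by (auto intro: polys_over_const[OF V] simp: one_pCons)
  have lp: "l \<in> polys_over (polys_over V)" using l(1) by (simp add: poly2_over_eq)
  have \<epsilon>R: "const2 (inverse \<epsilon>) \<in> R" by (rule poly2_over_const2[OF V \<epsilon>(2)])
  have "e * f - (e - const2 \<epsilon> * [:h:]) * f \<in> gen2 x l"
    by (rule ideal_diff[OF is_subring_R J f(2) ideal_mult'[OF J f(1) e]])
  then have "const2 (inverse \<epsilon>) * (e * f - (e - const2 \<epsilon> * [:h:]) * f) \<in> gen2 x l"
    by (rule ideal_mult[OF J \<epsilon>R])
  moreover have "const2 (inverse \<epsilon>) * (e * f - (e - const2 \<epsilon> * [:h:]) * f) = [:h:] * f"
  proof -
    have "const2 (inverse \<epsilon>) * const2 \<epsilon> = 1" using \<epsilon>(1) by (simp add: one_pCons)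
    moreover have "e * f - (e - const2 \<epsilon> * [:h:]) * f = const2 \<epsilon> * [:h:] * f" by (simp only: algebra_simps)
    ultimately show ?thesis by (simp only: mult.assoc[symmetric] mult_1_left)
  qed
  ultimately obtain a b where ab: "[:h:] * f = const2 x * a + l * b" "a \<in> R" "b \<in> R"
    unfolding gen2_def by auto
  obtain q r where q: "q \<in> R" "r \<in> R" "f = q * l + r" "\<forall>i\<ge>degree l. poly.coeff r i = 0"
    using division_unit_lead[OF is_subring_polys_over[OF V] lp u, of f] f(1) by (auto simp: poly2_over_eq)
  obtain q' a' where a': "q' \<in> R" "a' \<in> R" "a = q' * l + a'" "\<forall>i\<ge>degree l. poly.coeff a' i = 0"
    using division_unit_lead[OF is_subring_polys_over[OF V] lp u, of a] ab(2) by (auto simp: poly2_over_eq)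
  define t where "t = b + const2 x * q' - [:h:] * q"
  have "[:h:] * (q * l + r) = const2 x * (q' * l + a') + l * b" using ab(1) unfolding q(3) a'(3) .
  then have eq: "[:h:] * r - const2 x * a' = l * t" unfolding t_def by (simp only: algebra_simps)
  \<comment> \<open>Both remainders have smaller degree in \<open>Y\<close> than \<open>l\<close>,
    so a nonzero \<open>t\<close> would give the right side a coefficient that the left side
    lacks.\<close>
  have "t = 0"
  proof (rule ccontr)
    assume "t \<noteq> 0"
    moreover have "l \<noteq> 0" using l(2,3) by auto
    ultimately have "poly.coeff (l * t) (degree l + degree t) \<noteq> 0"
      by (simp add: coeff_mult_degree_sum)
    then have "poly.coeff ([:h:] * r - const2 x * a') (degree l + degree t) \<noteq> 0" unfolding eq .
    moreover have "poly.coeff r (degree l + degree t) = 0" "poly.coeff a' (degree l + degree t) = 0"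
      using q(4) a'(4) by auto
    ultimately show False by simp
  qed
  then have hr: "[:h:] * r = const2 x * a'" using eq by simp
  have "poly.coeff r i \<in> polys_over {x * v | v. v \<in> V}" for i
  proof (rule polys_over_unit_lead_cancel[OF V is_ideal_multiples[OF x(1)] h(1) _ subring_1[OF V]])
    show "poly.coeff r i \<in> polys_over V" using q(2) by (simp add: poly2_over_eq polys_over_def)
    show "1 * lead_coeff h = 1" using h(2) by simp
    have "h * poly.coeff r i = [:x:] * poly.coeff a' i"
      using arg_cong[OF hr, of "\<lambda>f. poly.coeff f i"] by simp
    then show "h * poly.coeff r i \<in> polys_over {x * v | v. v \<in> V}"
      using a'(2) by (auto simp: poly2_over_def polys_over_def)
  qed
  then have "r \<in> gen2 x 0" unfolding gen2_0_iff[OF x(2)] by (simp add: polys_over_def)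
  then have "r \<in> gen2 x l" using gen2_mono by blast
  moreover have "l * q \<in> gen2 x l" by (rule gen2_right[OF q(1)])
  ultimately have "l * q + r \<in> gen2 x l" by (intro ideal_add[OF J])
  then show "f \<in> gen2 x l" unfolding q(3) by (simp only: mult.commute)
qed

text \<open>Regularity passes along an automorphism; this serves for the elements of
  \<open>G\<close> and for the exchange of the variables.\<close>

lemma nonzerodivisor_mod_transport:
  fixes M M' :: "'k^2^2"
  assumes M: "M ** M' = mat 1" "M' ** M = mat 1" "\<And>i j. M $ i $ j \<in> V" "\<And>i j. M' $ i $ j \<in> V"
    and nz: "nonzerodivisor_mod (lin_act M e) (gen2 x (lin_act M l))"
  shows "nonzerodivisor_mod e (gen2 x l)"
  unfolding nonzerodivisor_mod_def
proof (intro ballI impI)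
  fix f assume f: "f \<in> R" "e * f \<in> gen2 x l"
  have MR: "lin_act M g \<in> R" "lin_act M' g \<in> R" if "g \<in> R" for g
    using lin_act_poly2_over[OF V _ that] M(3,4) by auto
  have inv: "lin_act M' (lin_act M g) = g" for g
    by (simp add: lin_act_mult[symmetric] M(2) lin_act_mat_1)
  obtain g g' where g: "e * f = const2 x * g + l * g'" "g \<in> R" "g' \<in> R" using f(2) unfolding gen2_def by blast
  have "lin_act M e * lin_act M f = const2 x * lin_act M g + lin_act M l * lin_act M g'"
    using arg_cong[OF g(1), of "lin_act M"] by (simp only: LA.hom_mult LA.hom_add lin_act_const2)
  then have "lin_act M e * lin_act M f \<in> gen2 x (lin_act M l)" using MR g gen2I by metis
  then have "lin_act M f \<in> gen2 x (lin_act M l)" using nz MR(1)[OF f(1)] unfolding nonzerodivisor_mod_def by blast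
  then obtain k k' where k: "lin_act M f = const2 x * k + lin_act M l * k'" "k \<in> R" "k' \<in> R"
    unfolding gen2_def by blast
  have "f = const2 x * lin_act M' k + l * lin_act M' k'"
    using arg_cong[OF k(1), of "lin_act M'"] by (simp only: LA.hom_mult LA.hom_add lin_act_const2 inv)
  then show "f \<in> gen2 x l" using MR(2) k gen2I by metis
qed

lemma nonzerodivisor_mod_prod:
  assumes "finite I" "\<And>i. i \<in> I \<Longrightarrow> e i \<in> R" "\<And>i. i \<in> I \<Longrightarrow> nonzerodivisor_mod (e i) J"
  shows "nonzerodivisor_mod (prod e I) J"
  using assms
proof (induction I rule: finite_induct)
  case empty
  then show ?case by (simp add: nonzerodivisor_mod_def)
next
  case (insert i I)
  have "f \<in> J" if f: "f \<in> R" "prod e (insert i I) * f \<in> J" for f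
  proof -
    have "prod e I * f \<in> R"
      using insert.prems(1) f(1) by (intro subring_mult[OF is_subring_R] subring_prod[OF is_subring_R]) auto
    moreover have "e i * (prod e I * f) \<in> J" using f(2) insert.hyps by (simp add: mult.assoc)
    ultimately have "prod e I * f \<in> J" using insert.prems(2) unfolding nonzerodivisor_mod_def by blast
    then show ?thesis using insert f(1) unfolding nonzerodivisor_mod_def by blast
  qed
  then show ?case by (simp only: nonzerodivisor_mod_def) blast
qed

text \<open>Cancelling \<open>e\<close> modulo the first factor gives
  \<open>s = x * u + F i * t\<close> up to notation. Regularity of \<open>F i\<close> modulo
  \<open>x\<close> then turns the relation into one for \<open>t\<close> and the remaining
  product.\<close>

lemma nonzerodivisor_mod_gen2_prod:
  assumes x: "x \<in> V" and e: "e \<in> R"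
    and I: "finite I" "\<And>i. i \<in> I \<Longrightarrow> F i \<in> R" "\<And>i. i \<in> I \<Longrightarrow> nonzerodivisor_mod (F i) (gen2 x 0)"
      "\<And>i. i \<in> I \<Longrightarrow> nonzerodivisor_mod e (gen2 x (F i))"
  shows "nonzerodivisor_mod e (gen2 x (prod F I))"
  using I
proof (induction I rule: finite_induct)
  case empty
  have "f \<in> gen2 x 1" if "f \<in> R" for f using gen2_right[OF that, of 1 x] by simp
  then show ?case by (simp add: nonzerodivisor_mod_def)
next
  case (insert i I)
  let ?P = "prod F I"
  have PR: "?P \<in> R" using insert.prems(1) by (intro subring_prod[OF is_subring_R]) auto
  have FR: "F i \<in> R" using insert.prems(1) by auto
  have J: "is_ideal R (gen2 x ?P)" by (rule is_ideal_gen2[OF x PR])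
  have IH: "nonzerodivisor_mod e (gen2 x ?P)" using insert by auto
  have "s \<in> gen2 x (F i * ?P)" if s: "s \<in> R" "e * s \<in> gen2 x (F i * ?P)" for s
  proof -
    obtain a b where ab: "e * s = const2 x * a + (F i * ?P) * b" "a \<in> R" "b \<in> R"
      using s(2) unfolding gen2_def by blast
    have "e * s = const2 x * a + F i * (?P * b)" by (simp only: ab(1) mult.assoc)
    then have "e * s \<in> gen2 x (F i)" using gen2I[OF ab(2) subring_mult[OF is_subring_R PR ab(3)]] by metis
    then have "s \<in> gen2 x (F i)" using insert.prems(3) s(1) unfolding nonzerodivisor_mod_def by blast
    then obtain u t where ut: "s = const2 x * u + F i * t" "u \<in> R" "t \<in> R" unfolding gen2_def by blast
    have "e * (const2 x * u + F i * t) = const2 x * a + (F i * ?P) * b" using ab(1) unfolding ut(1) .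
    then have "F i * (e * t - ?P * b) = const2 x * (a - e * u)" by (simp only: algebra_simps)
    moreover have "a - e * u \<in> R" by (intro subring_diff[OF is_subring_R] subring_mult[OF is_subring_R] ab ut e)
    ultimately have "F i * (e * t - ?P * b) \<in> gen2 x 0" unfolding gen2_0 by blast
    moreover have "e * t - ?P * b \<in> R"
      by (intro subring_diff[OF is_subring_R] subring_mult[OF is_subring_R] ab ut e PR)
    ultimately have "e * t - ?P * b \<in> gen2 x 0" using insert.prems(2) unfolding nonzerodivisor_mod_def by blast
    then have "e * t - ?P * b \<in> gen2 x ?P" using gen2_mono by blast
    then have "(e * t - ?P * b) + ?P * b \<in> gen2 x ?P" by (rule ideal_add[OF J _ gen2_right[OF ab(3)]])
    then have "e * t \<in> gen2 x ?P" by simp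
    then have "t \<in> gen2 x ?P" using IH ut(3) unfolding nonzerodivisor_mod_def by blast
    then obtain k k' where k: "t = const2 x * k + ?P * k'" "k \<in> R" "k' \<in> R" unfolding gen2_def by blast
    have "s = const2 x * (u + F i * k) + (F i * ?P) * k'" unfolding ut(1) k(1) by (simp only: algebra_simps)
    moreover have "u + F i * k \<in> R" by (intro subring_add[OF is_subring_R] subring_mult[OF is_subring_R] ut FR k)
    ultimately show ?thesis using gen2I k(3) by metis
  qed
  then show ?case using insert.hyps by (simp add: nonzerodivisor_mod_def)
qed

end

lemma ideal_power_diff:
  assumes B: "is_subring B" and J: "is_ideal B J" and ab: "a \<in> B" "b \<in> B" "a - b \<in> J"
  shows "a ^ n - b ^ n \<in> J"
proof (induction n)
  case 0
  then show ?case using ideal_0[OF J] by simp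
next
  case (Suc n)
  have "a ^ Suc n - b ^ Suc n = a * (a ^ n - b ^ n) + b ^ n * (a - b)" by (simp add: algebra_simps)
  also have "\<dots> \<in> J" by (intro ideal_add[OF J] ideal_mult[OF J] subring_power[OF B] Suc ab)
  finally show ?case .
qed

text \<open>For powers \<open>n\<close> and \<open>m\<close> of the characteristic this is additive
  in \<open>z\<close>. With \<open>z\<close> equal to \<open>X\<close> or \<open>Y\<close> it gives
  the elements called \<open>U\<close> and \<open>W\<close> in the overview.\<close>

definition var_pair :: "nat \<Rightarrow> nat \<Rightarrow> 'k::comm_ring_1 poly poly \<Rightarrow> 'k poly poly"
  where "var_pair n m z = z ^ n - z ^ m"

context valued_matrix_group
begin

text \<open>A valuation ring is local, and the second assumption says that \<open>\<gamma>\<close>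
  is a nonunit.\<close>

lemma valuation_local:
  assumes \<gamma>: "\<gamma> \<in> V" "\<gamma> = 0 \<or> inverse \<gamma> \<notin> V" and y: "y \<in> V"
  shows "1 - \<gamma> * y \<noteq> 0 \<and> inverse (1 - \<gamma> * y) \<in> V"
proof (cases "\<gamma> = 0")
  case True
  then show ?thesis using subring_1[OF V] by simp
next
  case nz: False
  define w where "w = 1 - \<gamma> * y"
  have i: "inverse \<gamma> = inverse \<gamma> * w + y" using nz by (simp add: w_def algebra_simps)
  have nV: "inverse \<gamma> * w \<notin> V"
  proof
    assume "inverse \<gamma> * w \<in> V"
    then have "inverse \<gamma> * w + y \<in> V" using y by (rule subring_add[OF V])
    then show False using \<gamma>(2) nz i by simp
  qed
  then have w0: "w \<noteq> 0" using subring_0[OF V] by auto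
  have "\<gamma> * inverse w \<in> V" using valuation[of "inverse \<gamma> * w"] nV by (simp add: mult.commute)
  then have "1 + y * (\<gamma> * inverse w) \<in> V" 
    by (intro subring_add[OF V subring_1[OF V]] subring_mult[OF V y])
  moreover have "1 + y * (\<gamma> * inverse w) = inverse w" using w0 by (simp add: w_def field_simps)
  ultimately show ?thesis using w0 by (simp add: w_def)
qed

text \<open>The first column of \<open>g\<close> gives the image of \<open>X\<close>. An inverse
  with entries in \<open>V\<close> combines its two entries to \<open>1\<close>, so they cannot both
  be nonunits.\<close>

lemma column_unit:
  assumes g: "g \<in> G"
  shows "(g $ 1 $ 1 \<noteq> 0 \<and> inverse (g $ 1 $ 1) \<in> V) \<or> (g $ 2 $ 1 \<noteq> 0 \<and> inverse (g $ 2 $ 1) \<in> V)"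
proof -
  obtain h where h: "h \<in> G" "h ** g = mat 1" using inv[OF g] by blast
  define a b c d where "a = g $ 1 $ 1" "b = g $ 2 $ 1" "c = h $ 1 $ 1" "d = h $ 1 $ 2"
  note defs = this
  have "(h ** g) $ 1 $ 1 = 1" using h by (simp add: mat_def)
  then have e: "c * a + d * b = 1" by (simp add: matrix_matrix_mult_def sum_2 defs)
  have cd: "c \<in> V" "d \<in> V" using entries[OF h(1)] by (simp_all add: defs)
  have "(a \<noteq> 0 \<and> inverse a \<in> V) \<or> (b \<noteq> 0 \<and> inverse b \<in> V)"
  proof (cases "a = 0")
    case True
    then have "b * d = 1" using e by (simp add: mult.commute)
    then have "b \<noteq> 0" "inverse b = d" using inverse_unique[of b d] by auto
    then show ?thesis using cd by simp
  next
    case a: False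
    show ?thesis
    proof (cases "b / a \<in> V")
      case True
      have ia: "inverse a = c + d * (b / a)" using e a by (simp add: field_simps)
      have "inverse a \<in> V" unfolding ia by (intro subring_add[OF V] subring_mult[OF V] True cd)
      then show ?thesis using a by blast
    next
      case False
      then have b: "b \<noteq> 0" using subring_0[OF V] by auto
      have "a / b \<in> V" using valuation[of "b / a"] False by simp
      then have "c * (a / b) + d \<in> V" by (intro subring_add[OF V] subring_mult[OF V] cd)
      moreover have "inverse b = c * (a / b) + d" using e b by (simp add: field_simps)
      ultimately show ?thesis using b by simp
    qed
  qed
  then show ?thesis by (simp add: defs)
qed

lemma gen2_cong:
  assumes x: "x \<in> V" and l: "l \<in> R" "l' \<in> R" "l - l' \<in> gen2 x 0"
  shows "gen2 x l = gen2 x l'"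
proof -
  have *: "gen2 x l \<subseteq> gen2 x l'" if l: "l \<in> R" "l' \<in> R" "l - l' \<in> gen2 x 0" for l l'
  proof
    fix f assume "f \<in> gen2 x l"
    then obtain g g' where g: "f = const2 x * g + l * g'" "g \<in> R" "g' \<in> R" unfolding gen2_def by blast
    obtain k where k: "l - l' = const2 x * k" "k \<in> R" using l(3) unfolding gen2_0 by blast
    have "f = const2 x * g + (l - l') * g' + l' * g'" unfolding g(1) by (simp only: algebra_simps)
    also have "\<dots> = const2 x * (g + k * g') + l' * g'" unfolding k(1) by (simp only: algebra_simps)
    finally show "f \<in> gen2 x l'"
      using gen2I[OF subring_add[OF is_subring_R g(2) subring_mult[OF is_subring_R k(2) g(3)]] g(3)] by metis
  qed
  have J0: "is_ideal R (gen2 x 0)" by (rule is_ideal_gen2[OF x subring_0[OF is_subring_R]])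
  have "l' - l \<in> gen2 x 0" using ideal_uminus[OF is_subring_R J0 l(3)] by simp
  then show ?thesis using *[OF l] *[OF l(2,1)] by blast
qed

lemma nonzerodivisor_mod_cong:
  assumes x: "x \<in> V" and l: "l - l' \<in> gen2 x 0" and nz: "nonzerodivisor_mod l' (gen2 x 0)"
  shows "nonzerodivisor_mod l (gen2 x 0)"
  unfolding nonzerodivisor_mod_def
proof (intro ballI impI)
  have J0: "is_ideal R (gen2 x 0)" by (rule is_ideal_gen2[OF x subring_0[OF is_subring_R]])
  fix f assume f: "f \<in> R" "l * f \<in> gen2 x 0"
  have "l * f - (l - l') * f \<in> gen2 x 0" by (rule ideal_diff[OF is_subring_R J0 f(2) ideal_mult'[OF J0 f(1) l]])
  then have "l' * f \<in> gen2 x 0" by (simp add: algebra_simps)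
  then show "f \<in> gen2 x 0" using nz f(1) unfolding nonzerodivisor_mod_def by blast
qed

text \<open>Raised to the power \<open>\<sigma>\<close>, the matrix entries are fixed modulo
  \<open>x\<close> by the power \<open>p ^ c\<close>: this is \<open>frob\<close>, because
  \<open>p ^ (b + c) = \<sigma> * p ^ c\<close>.\<close>

context
  fixes x :: 'k and \<sigma> b c :: nat
  assumes x: "x \<in> V" "x \<noteq> 0" and b: "\<sigma> = p ^ b" and c: "c > 0"
    and frob: "\<And>g i j. g \<in> G \<Longrightarrow> \<exists>v\<in>V. (g $ i $ j) ^ (p ^ (b + c)) - (g $ i $ j) ^ (p ^ b) = x * v"
begin

abbreviation (input) "Q \<equiv> p ^ c"
abbreviation (input) "n \<equiv> p ^ (b + c)"
abbreviation "Xt \<equiv> var_pair n \<sigma> var_X :: 'k poly poly"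
abbreviation "Yt \<equiv> var_pair n \<sigma> var_Y :: 'k poly poly"

definition Et :: "'k poly poly" where "Et = Yt ^ Q - Yt * Xt ^ (Q - 1) + Xt ^ Q"

lemma Q_ge_2: "Q \<ge> 2"
  using prime_ge_2_nat[OF p(1)] c self_le_power[of p c] by linarith

lemma \<sigma>_less_n: "\<sigma> < n"
  unfolding b using prime_gt_1_nat[OF p(1)] c by (intro power_strict_increasing) auto

lemma Xt_R: "Xt \<in> R" and Yt_R: "Yt \<in> R"
  unfolding var_pair_def
  by (intro subring_diff[OF is_subring_R] subring_power[OF is_subring_R] poly2_over_var[OF V])+

lemma Et_R: "Et \<in> R"
  unfolding Et_def
  by (intro subring_diff[OF is_subring_R] subring_add[OF is_subring_R] subring_mult[OF is_subring_R]
      subring_power[OF is_subring_R] Xt_R Yt_R)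

lemma ideal0: "is_ideal R (gen2 x 0)"
  by (rule is_ideal_gen2[OF x(1) subring_0[OF is_subring_R]])

text \<open>The second line collects the errors; for matrix entries as coefficients,
  \<open>frob\<close> makes them multiples of \<open>x\<close>.\<close>

lemma frobenius_form:
  fixes \<alpha> \<beta> :: 'k and z z' :: "'k poly poly"
  shows "var_pair n \<sigma> (const2 \<alpha> * z + const2 \<beta> * z') =
    (const2 (\<alpha> ^ \<sigma>) * var_pair n \<sigma> z + const2 (\<beta> ^ \<sigma>) * var_pair n \<sigma> z')
    + (const2 (\<alpha> ^ n - \<alpha> ^ \<sigma>) * z ^ n + const2 (\<beta> ^ n - \<beta> ^ \<sigma>) * z' ^ n)"
proof -
  have cp: "const2 u ^ k = const2 (u ^ k)" "const2 (u - v) = const2 u - const2 v" for u v :: 'k and k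
    using rhom.hom_power[OF rhom_const2, of u k] by simp_all
  show ?thesis unfolding var_pair_def b frobenius power_mult_distrib cp by (simp only: algebra_simps)
qed

lemma lin_act_Xt:
  assumes g: "g \<in> G"
  defines "\<alpha> \<equiv> (g $ 1 $ 1) ^ \<sigma>" and "\<beta> \<equiv> (g $ 2 $ 1) ^ \<sigma>"
  shows "lin_act g Xt - (const2 \<alpha> * Xt + const2 \<beta> * Yt) \<in> gen2 x 0"
proof -
  have col: "lin_act g var_X = const2 (g $ 1 $ 1) * var_X + const2 (g $ 2 $ 1) * var_Y"
    by (simp add: lin_act_var linear_form_def column_def)
  have "lin_act g Xt = var_pair n \<sigma> (lin_act g var_X)"
    by (simp only: var_pair_def LA.hom_diff LA.hom_power)
  then have eq: "lin_act g Xt - (const2 \<alpha> * Xt + const2 \<beta> * Yt)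
    = const2 ((g $ 1 $ 1) ^ n - \<alpha>) * var_X ^ n + const2 ((g $ 2 $ 1) ^ n - \<beta>) * var_Y ^ n"
    unfolding col frobenius_form \<alpha>_def \<beta>_def by (simp only: add_diff_cancel_left')
  have vr: "const2 ((g $ i $ 1) ^ n - (g $ i $ 1) ^ \<sigma>) * z ^ n \<in> gen2 x 0" if "z \<in> R" for i and z
  proof -
    obtain v where v: "v \<in> V" "(g $ i $ 1) ^ n - (g $ i $ 1) ^ \<sigma> = x * v" using frob[OF g, of i 1] unfolding b by blast
    have "const2 (x * v) * z ^ n = const2 x * (const2 v * z ^ n)" by simp
    then show ?thesis unfolding v(2) using gen2_left subring_mult[OF is_subring_R poly2_over_const2[OF V v(1)] subring_power[OF is_subring_R that]] by metis
  qed
  show ?thesis unfolding eq unfolding \<alpha>_def \<beta>_def by (intro ideal_add[OF ideal0] vr poly2_over_var[OF V])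
qed

text \<open>\<open>Xt\<close> is constant in \<open>Y\<close>, and the top power of \<open>Y\<close>
  in \<open>Yt\<close> is \<open>Y ^ n\<close>, so the leading coefficient comes from
  \<open>\<beta>\<close> alone.\<close>

lemma form_unit_lead:
  assumes "\<alpha> \<in> V" "\<beta> \<in> V" "\<beta> \<noteq> 0"
  shows "const2 \<alpha> * Xt + const2 \<beta> * Yt \<in> R" "lead_coeff (const2 \<alpha> * Xt + const2 \<beta> * Yt) = [:\<beta>:]"
proof -
  let ?l = "const2 \<alpha> * Xt + const2 \<beta> * Yt"
  show "?l \<in> R"
    by (intro subring_add[OF is_subring_R] subring_mult[OF is_subring_R] poly2_over_const2[OF V] assms Xt_R Yt_R)
  have n0: "n > 0" "p > 0" using prime_gt_0_nat[OF p(1)] by simp_all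
  have X: "var_X ^ k = [:[:0, 1:] ^ k:]" for k unfolding var_X_def
    by (induction k) (simp_all add: one_pCons)
  have Y: "var_Y ^ k = monom 1 k" for k :: nat by (simp add: var_Y_def monom_altdef)
  have cl: "poly.coeff ?l n = [:\<beta>:]"
    using n0 \<sigma>_less_n by (simp add: var_pair_def X Y one_pCons[symmetric] coeff_pCons split: nat.splits) 
  have hi: "poly.coeff ?l i = 0" if "i > n" for i
    using that n0 \<sigma>_less_n by (simp add: var_pair_def X Y coeff_pCons split: nat.splits)
  have "degree ?l = n"
    using cl hi assms(3) by (intro antisym degree_le le_degree) auto
  then show "lead_coeff ?l = [:\<beta>:]" using cl by simp
qed

lemma Xt_power: "Xt ^ k = [:([:0, 1:] ^ n - [:0, 1:] ^ \<sigma>) ^ k:]"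
proof -
  have X: "var_X ^ k = [:[:0, 1:] ^ k:]" for k unfolding var_X_def
    by (induction k) (simp_all add: one_pCons)
  have "Xt = [:[:0, 1:] ^ n - [:0, 1:] ^ \<sigma>:]" by (simp add: var_pair_def X)
  then show ?thesis by (simp add: rhom.hom_power[OF rhom_const])
qed

lemma monic_power: 
  "([:0, 1:] ^ n - [:0, 1:] ^ \<sigma> :: 'k poly) ^ k \<in> polys_over V" 
  "lead_coeff (([:0, 1:] ^ n - [:0, 1:] ^ \<sigma> :: 'k poly) ^ k) = 1"
proof -
  have X: "[:0, 1:] ^ k = monom (1::'k) k" for k by (simp add: monom_altdef)
  have "[:0, 1:] ^ n - [:0, 1:] ^ \<sigma> \<in> polys_over V"
    unfolding X using subring_closed[OF V] by (auto simp: polys_over_def)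
  then show "([:0, 1:] ^ n - [:0, 1:] ^ \<sigma>) ^ k \<in> polys_over V"
    by (rule subring_power[OF is_subring_polys_over[OF V]])
  have "degree (monom 1 n - monom (1::'k) \<sigma>) = n"
    using \<sigma>_less_n by (intro antisym degree_le le_degree) auto
  then have "lead_coeff (monom 1 n - monom (1::'k) \<sigma>) = 1" using \<sigma>_less_n by simp
  then show "lead_coeff (([:0, 1:] ^ n - [:0, 1:] ^ \<sigma> :: 'k poly) ^ k) = 1"
    unfolding X by (simp add: lead_coeff_power)
qed

text \<open>Modulo the form, \<open>Yt\<close> is \<open>- \<gamma> * Xt\<close>, and
  \<open>\<gamma>\<close> is fixed by the \<open>Q\<close>-th power modulo \<open>x\<close>. After
  this substitution the first two terms of \<open>Et\<close> cancel, leaving \<open>Xt ^ Q\<close>,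
  which is monic in \<open>X\<close>.\<close>

lemma nonzerodivisor_form_Y:
  assumes ab: "\<alpha> \<in> V" "\<beta> \<in> V" "\<beta> \<noteq> 0" "inverse \<beta> \<in> V"
    and fr: "\<exists>v\<in>V. \<alpha> ^ Q - \<alpha> = x * v" "\<exists>v\<in>V. \<beta> ^ Q - \<beta> = x * v"
  shows "nonzerodivisor_mod Et (gen2 x (const2 \<alpha> * Xt + const2 \<beta> * Yt))"
proof -
  let ?l = "const2 \<alpha> * Xt + const2 \<beta> * Yt"
  define \<gamma> where "\<gamma> = \<alpha> * inverse \<beta>"
  have \<gamma>V: "\<gamma> \<in> V" unfolding \<gamma>_def by (intro subring_mult[OF V] ab)
  note l = form_unit_lead[OF ab(1-3)]
  have J: "is_ideal R (gen2 x ?l)" by (rule is_ideal_gen2[OF x(1) l(1)])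
  obtain v w where vw: "v \<in> V" "w \<in> V" "\<alpha> ^ Q - \<alpha> = x * v" "\<beta> ^ Q - \<beta> = x * w" using fr by blast
  have \<gamma>Q: "\<gamma> ^ Q - \<gamma> = x * (inverse \<beta> * (v - w * \<gamma> ^ Q))"
  proof -
    have 1: "\<gamma> * \<beta> = \<alpha>" using ab(3) by (simp add: \<gamma>_def)
    then have "\<gamma> ^ Q * \<beta> ^ Q = \<alpha> ^ Q" by (simp flip: power_mult_distrib)
    then have "\<gamma> ^ Q * (\<beta> + x * w) = \<alpha> + x * v" using vw(3,4) by (metis add_diff_cancel_left' diff_add_cancel add.commute)
    then have "\<beta> * (\<gamma> ^ Q - \<gamma>) = x * (v - w * \<gamma> ^ Q)" using 1 by (simp add: algebra_simps)
    then have "inverse \<beta> * (\<beta> * (\<gamma> ^ Q - \<gamma>)) = inverse \<beta> * (x * (v - w * \<gamma> ^ Q))" by simp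
    then show ?thesis using ab(3) by (simp add: mult.assoc[symmetric] mult.commute)
  qed
  define s where "s = Yt + const2 \<gamma> * Xt"
  have "?l * const2 (inverse \<beta>) \<in> gen2 x ?l" by (intro gen2_right poly2_over_const2[OF V ab(4)])
  moreover have "?l * const2 (inverse \<beta>) = s"
  proof -
    have "const2 \<beta> * const2 (inverse \<beta>) = (1 :: 'k poly poly)" using ab(3) by (simp add: one_pCons)
    moreover have "?l * const2 (inverse \<beta>) = (const2 \<alpha> * const2 (inverse \<beta>)) * Xt + (const2 \<beta> * const2 (inverse \<beta>)) * Yt"
      by (simp only: algebra_simps)
    moreover have "const2 \<alpha> * const2 (inverse \<beta>) = const2 \<gamma>" by (simp add: \<gamma>_def)
    ultimately show ?thesis by (simp only: s_def mult_1_left add.commute)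
  qed
  ultimately have sJ: "s \<in> gen2 x ?l" by simp
  have sR: "s \<in> R" by (rule subsetD[OF ideal_subset[OF J] sJ])
  have Q1: "Q = Suc (Q - 1)" using Q_ge_2 by simp
  have sQ: "s ^ Q = Yt ^ Q + const2 (\<gamma> ^ Q) * Xt ^ Q"
    unfolding s_def frobenius power_mult_distrib using rhom.hom_power[OF rhom_const2, of \<gamma> Q] by simp
  have "Et - const2 1 * Xt ^ Q = s ^ Q - s * Xt ^ (Q - 1) - const2 (\<gamma> ^ Q - \<gamma>) * Xt ^ Q"
  proof -
    have XQ: "Xt * Xt ^ (Q - 1) = Xt ^ Q" by (subst (2) Q1) simp
    have "s * Xt ^ (Q - 1) = Yt * Xt ^ (Q - 1) + const2 \<gamma> * (Xt * Xt ^ (Q - 1))"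
      unfolding s_def by (simp only: algebra_simps)
    then have s1: "s * Xt ^ (Q - 1) = Yt * Xt ^ (Q - 1) + const2 \<gamma> * Xt ^ Q" by (simp only: XQ)
    have c1: "const2 (\<gamma> ^ Q - \<gamma>) = const2 (\<gamma> ^ Q) - const2 \<gamma>" by simp
    have c2: "const2 1 = (1 :: 'k poly poly)" by (simp add: one_pCons)
    show ?thesis unfolding sQ s1 c1 c2 Et_def by (simp only: algebra_simps mult_1_left mult_1_right)
  qed
  also have "\<dots> \<in> gen2 x ?l"
  proof (intro ideal_diff[OF is_subring_R J])
    have "s * s ^ (Q - 1) \<in> gen2 x ?l" by (intro ideal_mult'[OF J] subring_power[OF is_subring_R] sR sJ)
    then show "s ^ Q \<in> gen2 x ?l" by (subst Q1) simp
    show "s * Xt ^ (Q - 1) \<in> gen2 x ?l" by (intro ideal_mult'[OF J] subring_power[OF is_subring_R] Xt_R sJ)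
    let ?u = "inverse \<beta> * (v - w * \<gamma> ^ Q)"
    have "?u \<in> V" by (intro subring_mult[OF V] subring_diff[OF V] subring_power[OF V] vw ab \<gamma>V)
    then have "const2 x * (const2 ?u * Xt ^ Q) \<in> gen2 x ?l"
      by (intro gen2_left subring_mult[OF is_subring_R] subring_power[OF is_subring_R] Xt_R poly2_over_const2[OF V])
    moreover have "const2 (\<gamma> ^ Q - \<gamma>) * Xt ^ Q = const2 x * (const2 ?u * Xt ^ Q)"
      unfolding \<gamma>Q by simp
    ultimately show "const2 (\<gamma> ^ Q - \<gamma>) * Xt ^ Q \<in> gen2 x ?l" by simp
  qed
  finally have e: "Et - const2 1 * [:([:0, 1:] ^ n - [:0, 1:] ^ \<sigma>) ^ Q:] \<in> gen2 x ?l" unfolding Xt_power .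
  show ?thesis
    by (rule nonzerodivisor_mod_unit_lead[OF x l ab(3,4) monic_power _ _ e]) (use subring_1[OF V] in auto)
qed

text \<open>Leading coefficients are taken in \<open>Y\<close>, so a unit coefficient at
  \<open>Xt\<close> is dealt with after exchanging the variables.\<close>

definition sw :: "'k^2^2" where "sw = (\<chi> i j. if i = j then 0 else 1)"

lemma sw: "sw ** sw = mat 1" "sw $ i $ j \<in> V" "lin_act sw Xt = Yt" "lin_act sw Yt = Xt"
proof -
  show "sw ** sw = mat 1" by (simp add: sw_def matrix_matrix_mult_def mat_def vec_eq_iff sum_2 forall_2)
  show "sw $ i $ j \<in> V" using subring_0[OF V] subring_1[OF V] by (simp add: sw_def)
  have "lin_act sw var_X = var_Y" "lin_act sw var_Y = (var_X :: 'k poly poly)"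
    by (simp_all add: lin_act_var linear_form_def column_def sw_def one_pCons[symmetric])
  then show "lin_act sw Xt = Yt" "lin_act sw Yt = Xt"
    by (simp_all only: var_pair_def LA.hom_diff LA.hom_power)
qed

text \<open>Modulo the form, \<open>Xt\<close> is \<open>\<delta> * Yt\<close> with a nonunit
  \<open>\<delta>\<close>. So \<open>Et\<close> becomes
  \<open>1 - \<delta> ^ (Q - 1) + \<delta> ^ Q\<close> times \<open>Yt ^ Q\<close>, and the factor
  is a unit.\<close>

lemma nonzerodivisor_form_X:
  assumes ab: "\<alpha> \<in> V" "\<beta> \<in> V" "\<alpha> \<noteq> 0" "inverse \<alpha> \<in> V" and nu: "\<beta> = 0 \<or> inverse \<beta> \<notin> V"
  shows "nonzerodivisor_mod Et (gen2 x (const2 \<alpha> * Xt + const2 \<beta> * Yt))"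
proof (rule nonzerodivisor_mod_transport[OF sw(1,1,2,2)])
  define l where "l = const2 \<beta> * Xt + const2 \<alpha> * Yt"
  have l1: "lin_act sw (const2 \<alpha> * Xt + const2 \<beta> * Yt) = l"
    by (simp only: LA.hom_add LA.hom_mult lin_act_const2 sw l_def add.commute)
  have l: "l \<in> R" "lead_coeff l = [:\<alpha>:]" unfolding l_def by (intro form_unit_lead ab)+
  have E: "lin_act sw Et = Xt ^ Q - Xt * Yt ^ (Q - 1) + Yt ^ Q"
    by (simp only: Et_def LA.hom_add LA.hom_diff LA.hom_mult LA.hom_power sw)
  define \<delta> where "\<delta> = - (\<beta> * inverse \<alpha>)"
  have \<delta>V: "\<delta> \<in> V" unfolding \<delta>_def by (intro subring_uminus[OF V] subring_mult[OF V] ab)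
  have \<delta>nu: "\<delta> = 0 \<or> inverse \<delta> \<notin> V"
  proof (cases "\<beta> = 0")
    case False
    have "inverse \<beta> = - (inverse \<delta> * inverse \<alpha>)" using ab(3) False by (simp add: \<delta>_def field_simps)
    then show ?thesis using nu False subring_uminus[OF V] subring_mult[OF V _ ab(4)] by metis
  qed (simp add: \<delta>_def)
  have J: "is_ideal R (gen2 x l)" by (rule is_ideal_gen2[OF x(1) l(1)])
  have s: "Yt - const2 \<delta> * Xt \<in> gen2 x l"
  proof -
    have "const2 \<alpha> * const2 (inverse \<alpha>) = (1 :: 'k poly poly)" using ab(3) by (simp add: one_pCons)
    moreover have "l * const2 (inverse \<alpha>) = (const2 \<beta> * const2 (inverse \<alpha>)) * Xt + (const2 \<alpha> * const2 (inverse \<alpha>)) * Yt"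
      unfolding l_def by (simp only: algebra_simps)
    moreover have "const2 \<beta> * const2 (inverse \<alpha>) = - const2 \<delta>" by (simp add: \<delta>_def)
    ultimately have "l * const2 (inverse \<alpha>) = Yt - const2 \<delta> * Xt"
      by (simp only: mult_1_left mult_minus_left add.commute diff_conv_add_uminus)
    then show ?thesis using gen2_right[OF poly2_over_const2[OF V ab(4)], of l x] by simp
  qed
  have \<delta>X: "const2 \<delta> * Xt \<in> R" by (intro subring_mult[OF is_subring_R] poly2_over_const2[OF V \<delta>V] Xt_R)
  have pw: "Yt ^ k - (const2 \<delta> * Xt) ^ k \<in> gen2 x l" for k
    by (rule ideal_power_diff[OF is_subring_R J Yt_R \<delta>X s])
  define \<epsilon> where "\<epsilon> = 1 - \<delta> ^ (Q - 1) + \<delta> ^ Q"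
  have \<epsilon>: "\<epsilon> \<noteq> 0" "inverse \<epsilon> \<in> V"
  proof -
    \<comment> \<open>Since \<open>Q\<close> is at least \<open>2\<close>, both powers of
      \<open>\<delta>\<close> contain a factor \<open>\<delta>\<close>.\<close>
    define y where "y = \<delta> ^ (Q - 2) - \<delta> ^ (Q - 1)"
    have y: "y \<in> V" unfolding y_def by (intro subring_diff[OF V] subring_power[OF V] \<delta>V)
    have "Q - 1 = Suc (Q - 2)" "Q = Suc (Q - 1)" using Q_ge_2 by simp_all
    then have "\<delta> ^ (Q - 1) = \<delta> * \<delta> ^ (Q - 2)" "\<delta> ^ Q = \<delta> * \<delta> ^ (Q - 1)" by (metis power_Suc)+
    then have "\<epsilon> = 1 - \<delta> * y" by (simp add: \<epsilon>_def y_def algebra_simps)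
    then show "\<epsilon> \<noteq> 0" "inverse \<epsilon> \<in> V" using valuation_local[OF \<delta>V \<delta>nu y] by auto
  qed
  have cp: "const2 \<delta> ^ k = const2 (\<delta> ^ k)" for k using rhom.hom_power[OF rhom_const2, of \<delta> k] by simp
  have "lin_act sw Et - const2 \<epsilon> * Xt ^ Q
    = (Yt ^ Q - (const2 \<delta> * Xt) ^ Q) - Xt * (Yt ^ (Q - 1) - (const2 \<delta> * Xt) ^ (Q - 1))"
  proof -
    have "Q = Suc (Q - 1)" using Q_ge_2 by simp
    then have XQ: "Xt * Xt ^ (Q - 1) = Xt ^ Q" by (metis power_Suc)
    have c: "const2 \<epsilon> = 1 - const2 (\<delta> ^ (Q - 1)) + const2 (\<delta> ^ Q)" by (simp add: \<epsilon>_def one_pCons)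
    have "Xt * (const2 (\<delta> ^ (Q - 1)) * Xt ^ (Q - 1)) = const2 (\<delta> ^ (Q - 1)) * Xt ^ Q"
      by (subst XQ[symmetric]) (simp only: mult_ac)
    then show ?thesis unfolding E c power_mult_distrib cp right_diff_distrib
      by (simp only: algebra_simps mult_1_left mult_1_right)
  qed
  also have "\<dots> \<in> gen2 x l" by (intro ideal_diff[OF is_subring_R J] ideal_mult[OF J Xt_R] pw)
  finally have e: "lin_act sw Et - const2 \<epsilon> * [:([:0, 1:] ^ n - [:0, 1:] ^ \<sigma>) ^ Q:] \<in> gen2 x l" unfolding Xt_power .
  show "nonzerodivisor_mod (lin_act sw Et) (gen2 x (lin_act sw (const2 \<alpha> * Xt + const2 \<beta> * Yt)))"
    unfolding l1 by (rule nonzerodivisor_mod_unit_lead[OF x l ab(3,4) monic_power \<epsilon> e])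
qed

lemma nonzerodivisor_form:
  assumes ab: "\<alpha> \<in> V" "\<beta> \<in> V" "(\<alpha> \<noteq> 0 \<and> inverse \<alpha> \<in> V) \<or> (\<beta> \<noteq> 0 \<and> inverse \<beta> \<in> V)"
    and fr: "\<exists>v\<in>V. \<alpha> ^ Q - \<alpha> = x * v" "\<exists>v\<in>V. \<beta> ^ Q - \<beta> = x * v"
  shows "nonzerodivisor_mod (const2 \<alpha> * Xt + const2 \<beta> * Yt) (gen2 x 0)"
    "nonzerodivisor_mod Et (gen2 x (const2 \<alpha> * Xt + const2 \<beta> * Yt))"
proof -
  show "nonzerodivisor_mod Et (gen2 x (const2 \<alpha> * Xt + const2 \<beta> * Yt))"
    using nonzerodivisor_form_X[of \<alpha> \<beta>] nonzerodivisor_form_Y[of \<alpha> \<beta>] ab fr by blast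
  show "nonzerodivisor_mod (const2 \<alpha> * Xt + const2 \<beta> * Yt) (gen2 x 0)"
  proof (cases "\<beta> \<noteq> 0 \<and> inverse \<beta> \<in> V")
    case True
    then show ?thesis using form_unit_lead[OF ab(1,2)] by (intro unit_lead_nonzerodivisor[OF x]) auto
  next
    case False
    then have a: "\<alpha> \<noteq> 0" "inverse \<alpha> \<in> V" using ab(3) by auto
    have "lin_act sw (const2 \<alpha> * Xt + const2 \<beta> * Yt) = const2 \<beta> * Xt + const2 \<alpha> * Yt"
      by (simp only: LA.hom_add LA.hom_mult lin_act_const2 sw add.commute)
    moreover have "nonzerodivisor_mod (const2 \<beta> * Xt + const2 \<alpha> * Yt) (gen2 x 0)"
      using form_unit_lead[OF ab(2,1) a(1)] a by (intro unit_lead_nonzerodivisor[OF x]) auto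
    ultimately show ?thesis
      by - (rule nonzerodivisor_mod_transport[OF sw(1,1,2,2)], simp add: LA.hom_0)
  qed
qed

text \<open>The inverse of \<open>g\<close> moves a pair of conjugates of \<open>Et\<close> and
  \<open>Xt\<close> to \<open>Et\<close> itself and another conjugate of \<open>Xt\<close>, which
  modulo \<open>x\<close> is a form with a unit coefficient. The products follow factor by
  factor.\<close>

lemma regular_sequence:
  "nonzerodivisor_mod (\<Prod>g\<in>G. lin_act g Xt) (gen2 x 0)"
  "nonzerodivisor_mod (\<Prod>g\<in>G. lin_act g Et) (gen2 x (\<Prod>g\<in>G. lin_act g Xt))"
proof -
  have F: "nonzerodivisor_mod (lin_act g Xt) (gen2 x 0)" "nonzerodivisor_mod Et (gen2 x (lin_act g Xt))"
    if g: "g \<in> G" for g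
  proof -
    define \<alpha> \<beta> where ab: "\<alpha> = (g $ 1 $ 1) ^ \<sigma>" "\<beta> = (g $ 2 $ 1) ^ \<sigma>"
    have abV: "\<alpha> \<in> V" "\<beta> \<in> V" unfolding ab by (intro subring_power[OF V] entries[OF g])+
    have un: "(\<alpha> \<noteq> 0 \<and> inverse \<alpha> \<in> V) \<or> (\<beta> \<noteq> 0 \<and> inverse \<beta> \<in> V)"
      using column_unit[OF g] unfolding ab power_inverse[symmetric] by (auto intro: subring_power[OF V])
    have fr: "\<exists>v\<in>V. \<alpha> ^ Q - \<alpha> = x * v" "\<exists>v\<in>V. \<beta> ^ Q - \<beta> = x * v"
      using frob[OF g] unfolding ab b by (simp_all add: power_mult[symmetric] power_add)
    note nz = nonzerodivisor_form[OF abV un fr]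
    have cg: "lin_act g Xt - (const2 \<alpha> * Xt + const2 \<beta> * Yt) \<in> gen2 x 0"
      unfolding ab by (rule lin_act_Xt[OF g])
    show "nonzerodivisor_mod (lin_act g Xt) (gen2 x 0)" by (rule nonzerodivisor_mod_cong[OF x(1) cg nz(1)])
    have "gen2 x (lin_act g Xt) = gen2 x (const2 \<alpha> * Xt + const2 \<beta> * Yt)"
      by (rule gen2_cong[OF x(1) lin_act_R[OF g Xt_R] _ cg])
        (intro subring_add[OF is_subring_R] subring_mult[OF is_subring_R] poly2_over_const2[OF V] abV Xt_R Yt_R)
    then show "nonzerodivisor_mod Et (gen2 x (lin_act g Xt))" using nz(2) by simp
  qed
  show "nonzerodivisor_mod (\<Prod>g\<in>G. lin_act g Xt) (gen2 x 0)"
    by (intro nonzerodivisor_mod_prod fin lin_act_R Xt_R F)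
  have "nonzerodivisor_mod (lin_act g Et) (gen2 x (lin_act g' Xt))" if g: "g \<in> G" "g' \<in> G" for g g'
  proof -
    obtain h where h: "h \<in> G" "g ** h = mat 1" "h ** g = mat 1" using inv[OF g(1)] by blast
    have "lin_act h (lin_act g Et) = Et" by (simp add: lin_act_mult[symmetric] h lin_act_mat_1)
    moreover have "lin_act h (lin_act g' Xt) = lin_act (h ** g') Xt" by (simp add: lin_act_mult)
    ultimately show ?thesis
      using F(2)[OF mult[OF h(1) g(2)]]
      by - (rule nonzerodivisor_mod_transport[OF h(3,2) entries[OF h(1)] entries[OF g(1)]], simp)
  qed
  then show "nonzerodivisor_mod (\<Prod>g\<in>G. lin_act g Et) (gen2 x (\<Prod>g\<in>G. lin_act g Xt))"
    by (intro nonzerodivisor_mod_prod[OF fin lin_act_R[OF _ Et_R]]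
        nonzerodivisor_mod_gen2_prod[OF x(1) lin_act_R[OF _ Et_R] fin lin_act_R[OF _ Xt_R] F(1)])
qed

end

end

section \<open>Periods of the Frobenius powers in finite quotients\<close>

text \<open>Asking for all starting points from \<open>b\<close> on and all multiples of
  \<open>c\<close> makes the notion stable under enlarging \<open>b\<close> and under multiples of
  \<open>c\<close>, so finitely many elements get a common period.\<close>

definition frobenius_period :: "nat \<Rightarrow> 'u::comm_ring_1 set \<Rightarrow> 'u \<Rightarrow> nat \<Rightarrow> nat \<Rightarrow> bool"
  where "frobenius_period p I z b c \<longleftrightarrow> (\<forall>b'\<ge>b. \<forall>l. z ^ (p ^ (b' + l * c)) - z ^ (p ^ b') \<in> I)"

lemma frobenius_period_mono: "frobenius_period p I z b c \<Longrightarrow> b \<le> b' \<Longrightarrow> c dvd c' \<Longrightarrow> frobenius_period p I z b' c'"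
  unfolding frobenius_period_def by (auto simp: dvd_def) (metis mult.assoc mult.commute order.trans)

lemma exists_frobenius_period:
  assumes B: "is_subring B" and I: "is_ideal B I" and fin: "finite_quotient B I" and z: "z \<in> B"
  shows "\<exists>b c. c > 0 \<and> frobenius_period p I z b c"
proof -
  obtain i j where ij: "i < j" "z ^ (p ^ j) - z ^ (p ^ i) \<in> I"
    using finite_quotient_pigeonhole[OF B I fin, of "\<lambda>n. z ^ (p ^ n)"] subring_power[OF B z] by blast
  define c where "c = j - i"
  have j: "j = i + c" using ij(1) by (simp add: c_def)
  have step: "z ^ (p ^ (b + c)) - z ^ (p ^ b) \<in> I" if "b \<ge> i" for b
  proof -
    have "(z ^ (p ^ j)) ^ (p ^ (b - i)) - (z ^ (p ^ i)) ^ (p ^ (b - i)) \<in> I"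
      by (intro ideal_power_diff[OF B I] subring_power[OF B z] ij)
    moreover have "p ^ j * p ^ (b - i) = p ^ (b + c)" "p ^ i * p ^ (b - i) = p ^ b"
      using that by (simp_all add: j power_add[symmetric] add.commute)
    ultimately show ?thesis by (simp add: power_mult[symmetric])
  qed
  have "z ^ (p ^ (b + l * c)) - z ^ (p ^ b) \<in> I" if b: "b \<ge> i" for b l
  proof (induction l)
    case 0
    then show ?case using ideal_0[OF I] by simp
  next
    case (Suc l)
    have "(z ^ (p ^ (b + l * c + c)) - z ^ (p ^ (b + l * c))) + (z ^ (p ^ (b + l * c)) - z ^ (p ^ b)) \<in> I"
      by (rule ideal_add[OF I step Suc]) (use b in simp)
    then show ?case by (simp add: algebra_simps)
  qed
  then show ?thesis using ij(1) unfolding frobenius_period_def c_def by (intro exI[of _ i] exI[of _ "j - i"]) auto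
qed

lemma common_frobenius_period:
  assumes "finite Z" "\<And>z. z \<in> Z \<Longrightarrow> \<exists>b c. c > 0 \<and> frobenius_period p I z b c"
  shows "\<exists>b c. c > 0 \<and> (\<forall>z\<in>Z. frobenius_period p I z b c)"
  using assms
proof (induction rule: finite_induct)
  case empty
  then show ?case by (intro exI[of _ 0] exI[of _ 1]) auto
next
  case (insert z Z)
  then obtain b c where bc: "c > 0" "\<forall>z\<in>Z. frobenius_period p I z b c" by auto
  obtain b' c' where bc': "c' > 0" "frobenius_period p I z b' c'" using insert.prems[of z] by blast
  have "\<forall>y\<in>insert z Z. frobenius_period p I y (b + b') (c * c')"
    using bc bc' by (auto intro: frobenius_period_mono)
  then show ?case using bc(1) bc'(1) by (intro exI[of _ "b + b'"] exI[of _ "c * c'"]) auto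
qed

section \<open>Three elements of a maximal ideal of the invariants\<close>

context invariant_theory
begin

lemma norm_invariant:
  assumes f: "f \<in> RA"
  shows "(\<Prod>g\<in>G. lin_act g f) \<in> SA"
proof -
  have "lin_act g (\<Prod>h\<in>G. lin_act h f) = (\<Prod>h\<in>G. lin_act h f)" if g: "g \<in> G" for g
  proof -
    have inj_g: "inj_on (\<lambda>h. g ** h) G"
    proof (rule inj_onI)
      fix h k assume "g ** h = g ** k"
      moreover obtain g' where "g' ** g = mat 1" using invG g by blast
      ultimately show "h = k" by (metis matrix_mul_assoc matrix_mul_lid)
    qed
    have im: "(\<lambda>h. g ** h) ` G = G"
      by (rule endo_inj_surj[OF finG _ inj_g]) (use multG g in auto)
    have "lin_act g (\<Prod>h\<in>G. lin_act h f) = (\<Prod>h\<in>G. lin_act (g ** h) f)"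
      by (simp add: LA.hom_prod lin_act_mult)
    also have "\<dots> = (\<Prod>h\<in>(\<lambda>h. g ** h) ` G. lin_act h f)"
      by (subst prod.reindex[OF inj_g]) simp
    finally show ?thesis by (simp only: im)
  qed
  moreover have "lin_act g f \<in> RA" if "g \<in> G" for g
    by (rule lin_act_poly2_over[OF is_subring_A entriesG[OF that] f])
  then have "(\<Prod>h\<in>G. lin_act h f) \<in> RA" by (intro subring_prod[OF is_subring_RA])
  ultimately show ?thesis by (simp add: invariants_def)
qed

lemma norm_in_ideal:
  assumes M: "is_ideal RA M" and f: "f \<in> M"
  shows "(\<Prod>g\<in>G. lin_act g f) \<in> M"
proof -
  have fR: "f \<in> RA" using f ideal_subset[OF M] by blast
  have gR: "lin_act g f \<in> RA" if "g \<in> G" for g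
    by (rule lin_act_poly2_over[OF is_subring_A entriesG[OF that] fR])
  have "(\<Prod>g\<in>G. lin_act g f) = lin_act (mat 1) f * (\<Prod>g\<in>G - {mat 1}. lin_act g f)"
    by (rule prod.remove[OF finG oneG])
  also have "\<dots> \<in> M"
    by (intro ideal_mult'[OF M] subring_prod[OF is_subring_RA] gR) (auto simp: lin_act_mat_1 f)
  finally show ?thesis .
qed

text \<open>The factors \<open>t\<close> outside \<open>m\<close> express regularity in the
  localization at \<open>m\<close>. They come from purity, which carries the cancellation from
  polynomials over a valuation ring down to the invariants.\<close>

theorem regular_sequence_in_maximal_ideal:
  assumes m: "is_maximal SA m"
  shows "\<exists>x1 x2 x3. x1 \<in> m \<and> x2 \<in> m \<and> x3 \<in> m \<and> x1 \<noteq> 0 \<and>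
    (\<forall>s\<in>SA. \<forall>a\<in>SA. x2 * s = x1 * a \<longrightarrow> (\<exists>t\<in>SA - m. \<exists>a'\<in>SA. t * s = x1 * a')) \<and>
    (\<forall>s\<in>SA. \<forall>a\<in>SA. \<forall>b\<in>SA. x3 * s = x1 * a + x2 * b \<longrightarrow>
      (\<exists>t\<in>SA - m. \<exists>a'\<in>SA. \<exists>b'\<in>SA. t * s = x1 * a' + x2 * b'))"
proof -
  let ?p = "CHAR('q)"
  obtain M where M: "is_maximal RA M" "M \<inter> SA = m" using maximal_ideal_above[OF m] by blast
  have I: "is_ideal RA M" using M(1) by (simp add: is_maximal_def)
  have finM: "finite_quotient RA M" by (rule finite_residue_ring[OF M(1)])
  \<comment> \<open>The variable of the base. Two of its powers agree in the finite residue ring,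
    which puts a nonzero element of the base into \<open>M\<close>.\<close>
  define t0 where "t0 = const2 (\<psi> (monom 1 1))"
  have t0R: "t0 \<in> RA" unfolding t0_def by (intro poly2_over_const2[OF is_subring_A]) (simp add: C.integral_hom)
  obtain i j where ij: "i < j" "t0 ^ j - t0 ^ i \<in> M"
    using finite_quotient_pigeonhole[OF is_subring_RA I finM, of "\<lambda>n. t0 ^ n"] subring_power[OF is_subring_RA t0R] by blast
  define g0 where "g0 = monom (1::'q) j - monom 1 i"
  have "poly.coeff g0 j = 1" using ij(1) by (simp add: g0_def)
  then have g0: "g0 \<noteq> 0" by auto
  define x where "x = \<psi> g0"
  have xA: "x \<in> A" by (simp add: x_def C.integral_hom)
  have x0: "x \<noteq> 0" using g0 by (simp add: x_def inj_\<psi>)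
  have "const2 x = t0 ^ j - t0 ^ i"
  proof -
    have "g0 = monom 1 1 ^ j - monom 1 1 ^ i" by (simp add: g0_def monom_power)
    then show ?thesis
      by (simp only: x_def t0_def rhom.hom_diff[OF rhom_const2_\<psi>] rhom.hom_power[OF rhom_const2_\<psi>])
  qed
  then have xM: "const2 x \<in> M" using ij(2) by simp
  have xm: "const2 x \<in> m" using xM M(2) invariants_const2[OF is_subring_A xA] by blast
  let ?I = "{x * a | a. a \<in> A}"
  have IA: "is_ideal A ?I"
  proof -
    have "is_ideal A (lincomb A {x})" by (rule is_ideal_lincomb[OF is_subring_A]) (use xA in simp)
    moreover have "lincomb A {x} = ?I"
      unfolding lincomb_def by (auto simp: mult.commute[of x])
    ultimately show ?thesis by simp
  qed
  have finA: "finite_quotient A ?I" unfolding x_def by (rule finite_quotient_A[OF g0])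
  have varR: "{var_X, var_Y} \<subseteq> RA" using poly2_over_var[OF is_subring_A] by auto
  have "\<exists>b c. c > 0 \<and> (\<forall>z\<in>{var_X, var_Y}. frobenius_period ?p M z b c)"
    by (rule common_frobenius_period) (use exists_frobenius_period[OF is_subring_RA I finM] varR in auto)
  then obtain b1 c1 where bc1: "c1 > 0" "\<forall>z\<in>{var_X, var_Y}. frobenius_period ?p M z b1 c1" by blast
  \<comment> \<open>The period has to serve two purposes: for \<open>X\<close> and \<open>Y\<close>
    modulo \<open>M\<close>, so that \<open>Xt\<close> and \<open>Yt\<close> lie in
    \<open>M\<close>; and for the matrix entries modulo \<open>x\<close>, so that
    \<open>frob\<close> holds.\<close>
  define E where "E = (\<lambda>(g, i, j). g $ i $ j) ` (G \<times> UNIV \<times> UNIV)"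
  have E: "finite E" "E \<subseteq> A" using finG entriesG by (auto simp: E_def simp del: mem_Collect_eq)
  have "\<exists>b c. c > 0 \<and> (\<forall>z\<in>E. frobenius_period ?p ?I z b c)"
  proof (rule common_frobenius_period[OF E(1)])
    fix z assume "z \<in> E"
    then have "z \<in> A" using E(2) by blast
    then show "\<exists>b c. c > 0 \<and> frobenius_period ?p ?I z b c"
      by (rule exists_frobenius_period[OF is_subring_A IA finA])
  qed
  then obtain b2 c2 where bc2: "c2 > 0" "\<forall>z\<in>E. frobenius_period ?p ?I z b2 c2" by blast
  \<comment> \<open>Adding the starting points and multiplying the lengths keeps both periods
    valid.\<close>
  define b c where "b = b1 + b2" and "c = c1 * c2"
  have c0: "c > 0" using bc1(1) bc2(1) by (simp add: c_def)
  define \<sigma> n where "\<sigma> = ?p ^ b" and "n = ?p ^ (b + c)"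
  have XY: "var_pair n \<sigma> var_X \<in> M" "var_pair n \<sigma> var_Y \<in> M"
  proof -
    have "frobenius_period ?p M z b c" if "z \<in> {var_X, var_Y}" for z
      using bc1(2) that by (auto simp: b_def c_def intro: frobenius_period_mono)
    then have "z ^ (?p ^ (b + 1 * c)) - z ^ (?p ^ b) \<in> M" if "z \<in> {var_X, var_Y}" for z
      using that unfolding frobenius_period_def by blast
    then show "var_pair n \<sigma> var_X \<in> M" "var_pair n \<sigma> var_Y \<in> M" by (auto simp: var_pair_def n_def \<sigma>_def)
  qed
  let ?P = "base_prime m"
  have pm: "is_prime SA m" by (rule maximal_prime[OF is_subring_SA m])
  have P: "is_prime A ?P" by (rule is_prime_base_prime[OF pm])
  let ?V = "local_ring_at A ?P"
  interpret V: valued_matrix_group G ?p ?V by (rule valued_group[OF P])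
  have AV: "A \<subseteq> ?V" by (rule local_ring_at_subset[OF is_subring_A P])
  have frob: "\<exists>v\<in>?V. (g $ i $ j) ^ (?p ^ (b + c)) - (g $ i $ j) ^ (?p ^ b) = x * v" if g: "g \<in> G" for g and i j :: 2
  proof -
    have "g $ i $ j \<in> E" using g unfolding E_def by (intro image_eqI[of _ _ "(g, i, j)"]) auto
    then have "frobenius_period ?p ?I (g $ i $ j) b c"
      using bc2(2) by (auto simp: b_def c_def intro: frobenius_period_mono)
    then have "(g $ i $ j) ^ (?p ^ (b + 1 * c)) - (g $ i $ j) ^ (?p ^ b) \<in> ?I"
      unfolding frobenius_period_def by blast
    then show ?thesis using AV by auto
  qed
  have xV: "x \<in> ?V" using xA AV by blast
  define Xt Yt where "Xt = (var_pair n \<sigma> var_X :: 'k poly poly)" and "Yt = (var_pair n \<sigma> var_Y :: 'k poly poly)"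
  define Et where "Et = Yt ^ (?p ^ c) - Yt * Xt ^ (?p ^ c - 1) + Xt ^ (?p ^ c)"
  have Et: "V.Et \<sigma> b c = Et" by (simp add: V.Et_def[OF xV x0 \<sigma>_def c0 frob] Et_def Xt_def Yt_def n_def)
  have XtM: "Xt \<in> M" "Yt \<in> M" using XY by (simp_all add: Xt_def Yt_def)
  have XtR: "Xt \<in> RA" "Yt \<in> RA" using XtM ideal_subset[OF I] by auto
  have EtM: "Et \<in> M"
  proof -
    obtain k where k: "?p ^ c = Suc k" using prime_gt_0_nat[OF prime_char_p] by (metis gr0_implies_Suc zero_less_power)
    show ?thesis unfolding Et_def k power_Suc
      by (intro ideal_add[OF I] ideal_diff[OF is_subring_RA I] ideal_mult'[OF I] subring_power[OF is_subring_RA] XtM XtR)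
  qed
  have EtR: "Et \<in> RA" using EtM ideal_subset[OF I] by blast
  define x2 x3 where "x2 = (\<Prod>g\<in>G. lin_act g Xt)" and "x3 = (\<Prod>g\<in>G. lin_act g Et)"
  have x2S: "x2 \<in> SA" and x3S: "x3 \<in> SA" unfolding x2_def x3_def by (intro norm_invariant XtR EtR)+
  have x2m: "x2 \<in> m" and x3m: "x3 \<in> m"
    using x2S x3S M(2) norm_in_ideal[OF I XtM(1)] norm_in_ideal[OF I EtM] by (auto simp: x2_def x3_def)
  have reg: "V.nonzerodivisor_mod x2 (V.gen2 x 0)" "V.nonzerodivisor_mod x3 (V.gen2 x x2)"
    using V.regular_sequence[OF xV x0 \<sigma>_def c0 frob] unfolding Et by (simp_all add: x2_def x3_def Xt_def n_def)
  have SV: "SA \<subseteq> V.R" using SA_RA poly2_over_mono[OF AV] by blast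
  have tS: "const2 a \<in> SA - m" if "a \<in> A" "a \<notin> ?P" for a
    using that invariants_const2[OF is_subring_A] by (auto simp: base_prime_def)
  have xS: "const2 x \<in> SA" by (rule invariants_const2[OF is_subring_A xA])
  have r2: "\<exists>t\<in>SA - m. \<exists>a'\<in>SA. t * s = const2 x * a'" if s: "s \<in> SA" "a \<in> SA" "x2 * s = const2 x * a" for s a
  proof -
    have "x2 * s \<in> V.gen2 x 0" unfolding V.gen2_0 using s SV by blast
    then have "s \<in> V.gen2 x 0" using reg(1) s(1) SV unfolding V.nonzerodivisor_mod_def by blast
    then obtain k where k: "k \<in> V.R" "s = const2 x * k" unfolding V.gen2_0 by blast
    have sum: "(\<Sum>j\<in>{()}. const2 x * k) = s" by (simp add: k(2))
    have "\<exists>a\<in>A. a \<notin> ?P \<and> (\<exists>s'. (\<forall>j\<in>{()}. s' j \<in> SA) \<and>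
      const2 a * (\<Sum>j\<in>{()}. const2 x * k) = (\<Sum>j\<in>{()}. const2 x * s' j))"
      by (rule purity_local[OF P, where x = "\<lambda>_. const2 x" and r = "\<lambda>_. k"]) (use k s xS in \<open>auto simp: sum\<close>)
    then obtain a s' where as: "a \<in> A" "a \<notin> ?P" "s' () \<in> SA" "const2 a * s = const2 x * s' ()"
      unfolding sum by auto
    show ?thesis using tS[OF as(1,2)] as(3,4) by (intro bexI[of _ "const2 a"] bexI[of _ "s' ()"])
  qed
  have r3: "\<exists>t\<in>SA - m. \<exists>a'\<in>SA. \<exists>b'\<in>SA. t * s = const2 x * a' + x2 * b'"
    if s: "s \<in> SA" "a \<in> SA" "b \<in> SA" "x3 * s = const2 x * a + x2 * b" for s a b
  proof -
    have "x3 * s \<in> V.gen2 x x2" unfolding s(4) using s SV by (intro V.gen2I) auto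
    then have "s \<in> V.gen2 x x2" using reg(2) s(1) SV unfolding V.nonzerodivisor_mod_def by blast
    then obtain k k' where k: "k \<in> V.R" "k' \<in> V.R" "s = const2 x * k + x2 * k'" unfolding V.gen2_def by blast
    \<comment> \<open>Indexing the two generators by \<open>bool\<close> avoids having to know that
      they differ.\<close>
    define xx where "xx j = (if j then const2 x else x2)" for j
    define K where "K j = (if j then k else k')" for j
    have sum: "(\<Sum>j\<in>UNIV. xx j * f j) = const2 x * f True + x2 * f False" for f by (simp add: xx_def UNIV_bool)
    have sumK: "(\<Sum>j\<in>UNIV. xx j * K j) = s" unfolding sum k(3) by (simp add: K_def)
    have "\<exists>a\<in>A. a \<notin> ?P \<and> (\<exists>s'. (\<forall>j\<in>UNIV. s' j \<in> SA) \<and>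
      const2 a * (\<Sum>j\<in>UNIV. xx j * K j) = (\<Sum>j\<in>UNIV. xx j * s' j))"
      by (rule purity_local[OF P]) (use k s(1) xS x2S sumK in \<open>auto simp: xx_def K_def\<close>)
    then obtain a s' where as: "a \<in> A" "a \<notin> ?P" "\<forall>j\<in>UNIV. s' j \<in> SA"
      "const2 a * s = const2 x * s' True + x2 * s' False"
      unfolding sumK sum by blast
    then show ?thesis using tS[OF as(1,2)] by (intro bexI[of _ "const2 a"] bexI[of _ "s' True"] bexI[of _ "s' False"]) auto
  qed
  have "const2 x \<noteq> 0" using x0 by simp
  moreover have "\<forall>s\<in>SA. \<forall>a\<in>SA. x2 * s = const2 x * a \<longrightarrow> (\<exists>t\<in>SA - m. \<exists>a'\<in>SA. t * s = const2 x * a')"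
    by (intro ballI impI) (rule r2)
  moreover have "\<forall>s\<in>SA. \<forall>a\<in>SA. \<forall>b\<in>SA. x3 * s = const2 x * a + x2 * b \<longrightarrow>
      (\<exists>t\<in>SA - m. \<exists>a'\<in>SA. \<exists>b'\<in>SA. t * s = const2 x * a' + x2 * b')"
    by (intro ballI impI) (rule r3)
  ultimately show ?thesis using xm x2m x3m
    by (intro exI[of _ "const2 x"] exI[of _ x2] exI[of _ x3] conjI)
qed

end

subsection \<open>The dimension is at most three\<close>

definition filtration :: "(nat \<Rightarrow> 'b::comm_ring_1 set) \<Rightarrow> bool"
  where "filtration B \<longleftrightarrow> (\<forall>d. finite (B d) \<and> 0 \<in> B d \<and> 1 \<in> B d) \<and> (\<forall>d e. d \<le> e \<longrightarrow> B d \<subseteq> B e) \<and> (\<Union>d. B d) = UNIV \<and>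
    (\<forall>d. \<forall>x\<in>B d. \<forall>y\<in>B d. x + y \<in> B d) \<and> (\<forall>d e. \<forall>x\<in>B d. \<forall>y\<in>B e. x * y \<in> B (d + e))"

text \<open>Iterated, this bounds the degree in each variable separately rather than the total
  degree, so that cardinalities are plain powers.\<close>

definition polys_box :: "'b::zero set \<Rightarrow> nat \<Rightarrow> 'b poly set"
  where "polys_box B d = {f. degree f \<le> d \<and> (\<forall>i. poly.coeff f i \<in> B)}"

lemma card_polys_box:
  assumes B: "finite B" "0 \<in> B"
  shows "finite (polys_box B d)" and "card (polys_box B d) = card B ^ Suc d"
proof -
  let ?L = "{xs. set xs \<subseteq> B \<and> length xs = Suc d}"
  have co: "poly.coeff (Poly xs) i = (if i < length xs then xs ! i else 0)" for xs :: "'a list" and i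
    by (simp add: coeff_Poly_eq nth_default_def)
  have "bij_betw Poly ?L (polys_box B d)"
  proof (rule bij_betw_imageI)
    show "inj_on Poly ?L"
    proof (rule inj_onI)
      fix xs ys assume *: "xs \<in> ?L" "ys \<in> ?L" "Poly xs = Poly ys"
      show "xs = ys"
      proof (rule nth_equalityI)
        show "length xs = length ys" using * by simp
        fix i assume "i < length xs"
        then show "xs ! i = ys ! i" using co[of xs i] co[of ys i] * by simp
      qed
    qed
    show "Poly ` ?L = polys_box B d"
    proof (intro equalityI subsetI)
      fix f assume "f \<in> Poly ` ?L"
      then obtain xs where xs: "xs \<in> ?L" "f = Poly xs" by blast
      have "poly.coeff f i \<in> B" for i using xs B(2) co[of xs i] by (auto intro: nth_mem)
      moreover have "degree f \<le> d" using xs by (intro degree_le) (auto simp: co nth_default_def)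
      ultimately show "f \<in> polys_box B d" by (simp add: polys_box_def)
    next
      fix f assume f: "f \<in> polys_box B d"
      have "f = Poly (map (poly.coeff f) [0..<Suc d])"
      proof (rule poly_eqI)
        fix i show "poly.coeff f i = poly.coeff (Poly (map (poly.coeff f) [0..<Suc d])) i"
          using f by (cases "i < Suc d") (auto simp: co nth_default_def polys_box_def coeff_eq_0 simp del: upt_Suc)
      qed
      moreover have "map (poly.coeff f) [0..<Suc d] \<in> ?L" using f by (auto simp: polys_box_def)
      ultimately show "f \<in> Poly ` ?L" by blast
    qed
  qed
  from bij_betw_finite[OF this] bij_betw_same_card[OF this]
  show "finite (polys_box B d)" "card (polys_box B d) = card B ^ Suc d"
    using finite_lists_length_eq[OF B(1), of "Suc d"] card_lists_length_eq[OF B(1), of "Suc d"] by simp_all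
qed

lemma filtrationD:
  assumes "filtration B"
  shows "finite (B d)" "0 \<in> B d" "1 \<in> B d" "d \<le> e \<Longrightarrow> B d \<subseteq> B e" "\<exists>d. x \<in> B d"
    "x \<in> B d \<Longrightarrow> y \<in> B d \<Longrightarrow> x + y \<in> B d" "x \<in> B d \<Longrightarrow> y \<in> B e \<Longrightarrow> x * y \<in> B (d + e)"
  using assms unfolding filtration_def by blast+

lemma filtration_sum:
  "filtration B \<Longrightarrow> (\<And>i. i \<in> I \<Longrightarrow> f i \<in> B d) \<Longrightarrow> sum f I \<in> B d"
  by (induction I rule: infinite_finite_induct) (auto simp: filtrationD)

lemma filtration_finite_subset:
  assumes B: "filtration B" and F: "finite F"
  shows "\<exists>d. F \<subseteq> B d"
  using F
proof (induction rule: finite_induct)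
  case (insert x F)
  then obtain d where d: "F \<subseteq> B d" by blast
  obtain e where e: "x \<in> B e" using filtrationD(5)[OF B] by blast
  have "F \<subseteq> B (d + e)" "x \<in> B (d + e)"
    using d e filtrationD(4)[OF B, of d "d + e"] filtrationD(4)[OF B, of e "d + e"] by auto
  then show ?case by blast
qed simp

lemma filtration_polys:
  assumes B: "filtration B"
  shows "filtration (\<lambda>d. polys_box (B d) d)"
  unfolding filtration_def
proof (intro conjI allI ballI impI)
  note D = filtrationD[OF B]
  show "finite (polys_box (B d) d)" for d using card_polys_box(1) D by blast
  show "0 \<in> polys_box (B d) d" "1 \<in> polys_box (B d) d" for d
    using D by (auto simp: polys_box_def one_pCons coeff_pCons split: nat.splits)
  show "polys_box (B d) d \<subseteq> polys_box (B e) e" if "d \<le> e" for d e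
    using D(4)[OF that] that by (auto simp: polys_box_def)
  show "f + g \<in> polys_box (B d) d" if "f \<in> polys_box (B d) d" "g \<in> polys_box (B d) d" for d f g
    using that D(6) by (auto simp: polys_box_def degree_add_le)
  show "f * g \<in> polys_box (B (d + e)) (d + e)" if "f \<in> polys_box (B d) d" "g \<in> polys_box (B e) e" for d e f g
    using that D(7) degree_mult_le[of f g]
    by (auto simp: polys_box_def coeff_mult intro!: filtration_sum[OF B])
  show "(\<Union>d. polys_box (B d) d) = UNIV"
  proof (intro equalityI subsetI UNIV_I)
    fix f :: "'a poly"
    have "finite (poly.coeff f ` {..degree f})" by simp
    then obtain d where d: "poly.coeff f ` {..degree f} \<subseteq> B d" using filtration_finite_subset[OF B] by blast
    have "poly.coeff f i \<in> B d" for i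
      using d D(2) by (cases "i \<le> degree f") (auto simp: coeff_eq_0)
    then have "f \<in> polys_box (B (d + degree f)) (d + degree f)"
      using D(4)[of d "d + degree f"] by (auto simp: polys_box_def)
    then show "f \<in> (\<Union>d. polys_box (B d) d)" by blast
  qed
qed

text \<open>Factors \<open>x\<close> cancel because \<open>x\<close> is outside the prime
  \<open>P\<close>. Once the constant coefficient \<open>a\<close> is nonzero, \<open>h a\<close>
  differs from a value in \<open>P\<close> by a multiple of \<open>x\<close>, so it lies in
  \<open>P'\<close>.\<close>

lemma eval_nonzero_coeff_in_larger_prime:
  assumes h: "rhom h" and S: "is_subring S" "\<And>c. h c \<in> S"
    and P: "is_prime S P" "is_prime S P'" "P \<subseteq> P'" and x: "x \<in> P'" "x \<notin> P"
    and f: "f \<noteq> 0" "poly (map_poly h f) x \<in> P"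
  shows "\<exists>c. c \<noteq> 0 \<and> h c \<in> P'"
  using f
proof (induction f)
  case 0
  then show ?case by simp
next
  case (pCons a f)
  interpret rhom h by (rule h)
  have I': "is_ideal S P'" by (rule prime_ideal[OF P(2)])
  have xS: "x \<in> S" using x(1) ideal_subset[OF I'] by blast
  have ev: "poly (map_poly h (pCons a f)) x = h a + x * poly (map_poly h f) x"
    using pCons.hyps by (simp add: map_poly_pCons hom_0)
  have fS: "poly (map_poly h f) x \<in> S" by (rule eval_closed[OF h S(2) xS S(1)])
  show ?case
  proof (cases "a = 0")
    case True
    then have "x * poly (map_poly h f) x \<in> P" using pCons.prems(2) ev by (simp add: hom_0)
    then have "poly (map_poly h f) x \<in> P" using primeD[OF P(1) xS fS] x(2) by blast
    then show ?thesis using pCons.IH pCons.hyps True by auto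
  next
    case False
    have "h a = (h a + x * poly (map_poly h f) x) - x * poly (map_poly h f) x" by simp
    also have "\<dots> \<in> P'" using pCons.prems(2) P(3) unfolding ev
      by (intro ideal_diff[OF S(1) I'] ideal_mult'[OF I' fS x(1)]) auto
    finally show ?thesis using False by blast
  qed
qed

section \<open>Counting, and chains of primes\<close>

context invariant_theory
begin

abbreviation F1 :: "nat \<Rightarrow> 'q poly set" where "F1 d \<equiv> polys_box UNIV d"
abbreviation F2 :: "nat \<Rightarrow> 'q poly poly set" where "F2 d \<equiv> polys_box (F1 d) d"
abbreviation F3 :: "nat \<Rightarrow> 'q poly poly poly set" where "F3 d \<equiv> polys_box (F2 d) d"
abbreviation F4 :: "nat \<Rightarrow> 'q poly poly poly poly set" where "F4 d \<equiv> polys_box (F3 d) d"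

lemma filtration_F3: "filtration F3" and filtration_F4: "filtration F4"
proof -
  have 0: "filtration (\<lambda>_. UNIV :: 'q set)" by (auto simp: filtration_def)
  note 1 = filtration_polys[OF 0] note 2 = filtration_polys[OF 1] note 3 = filtration_polys[OF 2]
  show "filtration F3" "filtration F4" by (rule 3, rule filtration_polys[OF 3])
qed

lemma card_F3: "card (F3 d) = CARD('q) ^ (Suc d ^ 3)" and card_F4: "card (F4 d) = CARD('q) ^ (Suc d ^ 4)"
proof -
  have 0: "filtration (\<lambda>_. UNIV :: 'q set)" by (auto simp: filtration_def)
  note 1 = filtration_polys[OF 0] note 2 = filtration_polys[OF 1] note 3 = filtration_polys[OF 2]
  have c1: "card (F1 d) = CARD('q) ^ Suc d" by (rule card_polys_box) auto
  have c2: "card (F2 d) = CARD('q) ^ (Suc d ^ 2)"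
    using card_polys_box(2)[OF filtrationD(1,2)[OF 1], of d d] unfolding c1 by (simp only: power_mult[symmetric] power2_eq_square)
  show c3: "card (F3 d) = CARD('q) ^ (Suc d ^ 3)"
    using card_polys_box(2)[OF filtrationD(1,2)[OF 2], of d d] unfolding c2
    by (simp only: power_mult[symmetric]) (simp only: power2_eq_square power3_eq_cube)
  show "card (F4 d) = CARD('q) ^ (Suc d ^ 4)"
    using card_polys_box(2)[OF filtrationD(1,2)[OF 3], of d d] unfolding c3
    by (simp only: power_mult[symmetric]) (simp only: power4_eq_xxxx power3_eq_cube)
qed

definition h0 :: "'q \<Rightarrow> 'k poly poly" where "h0 c = hD [:[:[:c:]:]:]"
definition ev :: "('b \<Rightarrow> 'k poly poly) \<Rightarrow> 'k poly poly \<Rightarrow> 'b::comm_ring_1 poly \<Rightarrow> 'k poly poly"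
  where "ev h x f = poly (map_poly h f) x"

lemma rhom_h0: "rhom h0"
proof
  have "[:[:[:a + b:]:]:] = [:[:[:a:]:]:] + [:[:[:b:]:]:]" "[:[:[:a * b:]:]:] = [:[:[:a:]:]:] * [:[:[:b:]:]:]" for a b :: 'q
    by simp_all
  then show "h0 (a + b) = h0 a + h0 b" "h0 (a * b) = h0 a * h0 b" for a b
    unfolding h0_def by (simp_all only: D.hom_add D.hom_mult)
  show "h0 1 = 1" unfolding h0_def by (simp only: one_pCons[symmetric] D.hom_1)
qed

lemma rhom_ev: "rhom h \<Longrightarrow> rhom (ev h x)"
  unfolding ev_def by (rule rhom_poly_map_poly)

text \<open>With \<open>q\<close> constants, at most \<open>q ^ (card Z * Suc d ^ 3)\<close>
  elements of \<open>RA\<close> have coordinates in the box of size \<open>d\<close>, while the box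
  of size \<open>N\<close> in four variables has \<open>q ^ (Suc N ^ 4)\<close> polynomials.
  Evaluation enlarges boxes only linearly, so it is not injective for suitable
  \<open>N\<close>.\<close>

theorem algebraically_dependent:
  assumes x: "x1 \<in> RA" "x2 \<in> RA" "x3 \<in> RA" "x4 \<in> RA"
  shows "\<exists>f. f \<noteq> 0 \<and> ev (ev (ev (ev h0 x1) x2) x3) x4 f = 0"
proof -
  from RA_finitely_generated obtain Z where Z: "finite Z" "RA = spn hD Z" by (elim exE conjE)
  note D3 = filtrationD[OF filtration_F3]
  define RR where "RR d = {\<Sum>z\<in>Z. hD (c z) * z | c. \<forall>z\<in>Z. c z \<in> F3 d}" for d
  have RR_I: "(\<Sum>z\<in>Z. hD (c z) * z) \<in> RR d" if "\<forall>z\<in>Z. c z \<in> F3 d" for c d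
    using that unfolding RR_def by blast
  have RR_D: "\<exists>c. (\<forall>z\<in>Z. c z \<in> F3 d) \<and> f = (\<Sum>z\<in>Z. hD (c z) * z)" if "f \<in> RR d" for f d
    using that unfolding RR_def by blast
  have RR_mem: "\<exists>d. f \<in> RR d" if f: "f \<in> RA" for f
  proof -
    obtain c where c: "f = (\<Sum>z\<in>Z. hD (c z) * z)" using f D.span_finite[OF Z(1)] Z(2) by auto
    obtain d where "c ` Z \<subseteq> F3 d" using filtration_finite_subset[OF filtration_F3, of "c ` Z"] Z(1) by blast
    then have "\<forall>z\<in>Z. c z \<in> F3 d" by blast
    then show ?thesis unfolding c using RR_I by blast
  qed
  have RR_mono: "RR d \<subseteq> RR e" if "d \<le> e" for d e
    using D3(4)[OF that] unfolding RR_def by blast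
  have RR_sum: "sum f I \<in> RR d" if f: "\<And>i. i \<in> I \<Longrightarrow> f i \<in> RR d" for f d and I :: "'i set"
  proof -
    have "\<exists>c. \<forall>i\<in>I. (\<forall>z\<in>Z. c i z \<in> F3 d) \<and> f i = (\<Sum>z\<in>Z. hD (c i z) * z)"
      using f RR_D by (intro bchoice) blast
    then obtain c where c: "\<And>i z. i \<in> I \<Longrightarrow> z \<in> Z \<Longrightarrow> c i z \<in> F3 d" "\<And>i. i \<in> I \<Longrightarrow> f i = (\<Sum>z\<in>Z. hD (c i z) * z)"
      by blast
    have "sum f I = (\<Sum>i\<in>I. \<Sum>z\<in>Z. hD (c i z) * z)" by (intro sum.cong refl c(2))
    also have "\<dots> = (\<Sum>z\<in>Z. hD (\<Sum>i\<in>I. c i z) * z)"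
      by (subst sum.swap) (simp add: D.hom_sum sum_distrib_right)
    finally have "sum f I = (\<Sum>z\<in>Z. hD (\<Sum>i\<in>I. c i z) * z)" .
    moreover have "\<forall>z\<in>Z. (\<Sum>i\<in>I. c i z) \<in> F3 d" using c(1) by (auto intro!: filtration_sum[OF filtration_F3])
    ultimately show ?thesis using RR_I[of "\<lambda>z. \<Sum>i\<in>I. c i z" d] by simp
  qed
  have RR_scale: "hD a * f \<in> RR (d + e)" if a: "a \<in> F3 d" and f: "f \<in> RR e" for a f d e
  proof -
    obtain c where c: "\<forall>z\<in>Z. c z \<in> F3 e" "f = (\<Sum>z\<in>Z. hD (c z) * z)" using RR_D[OF f] by blast
    have "hD a * f = (\<Sum>z\<in>Z. hD (a * c z) * z)" 
      unfolding c(2) sum_distrib_left by (intro sum.cong refl) (simp only: D.hom_mult mult.assoc)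
    moreover have "\<forall>z\<in>Z. a * c z \<in> F3 (d + e)" using c(1) D3(7)[OF a] by blast
    ultimately show ?thesis using RR_I[of "\<lambda>z. a * c z" "d + e"] by simp
  qed
  have ZR: "Z \<subseteq> RA" unfolding Z(2) by (rule D.span_superset)
  obtain dd where dd: "\<And>f. f \<in> RA \<Longrightarrow> f \<in> RR (dd f)" using RR_mem by metis
  \<comment> \<open>The cost of rewriting a product of two generators in terms of \<open>Z\<close>,
    summed so as to bound it for every pair.\<close>
  define \<kappa> where "\<kappa> = (\<Sum>z\<in>Z. \<Sum>z'\<in>Z. dd (z * z'))"
  have RR_ZZ: "z * z' \<in> RR \<kappa>" if z: "z \<in> Z" "z' \<in> Z" for z z'
  proof -
    have "dd (z * z') \<le> (\<Sum>z'\<in>Z. dd (z * z'))" by (rule member_le_sum) (use z Z(1) in auto)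
    also have "\<dots> \<le> \<kappa>" unfolding \<kappa>_def by (rule member_le_sum) (use z Z(1) in auto)
    finally have "RR (dd (z * z')) \<subseteq> RR \<kappa>" by (rule RR_mono)
    moreover have "z * z' \<in> RA" using z ZR subring_mult[OF is_subring_RA] by blast
    ultimately show ?thesis using dd by blast
  qed
  have RR_mult: "f * g \<in> RR (d + e + \<kappa>)" if f: "f \<in> RR d" and g: "g \<in> RR e" for f g d e
  proof -
    obtain c where c: "\<forall>z\<in>Z. c z \<in> F3 d" "f = (\<Sum>z\<in>Z. hD (c z) * z)" using RR_D[OF f] by blast
    obtain c' where c': "\<forall>z\<in>Z. c' z \<in> F3 e" "g = (\<Sum>z\<in>Z. hD (c' z) * z)" using RR_D[OF g] by blast
    have "f * g = (\<Sum>z\<in>Z. \<Sum>z'\<in>Z. hD (c z * c' z') * (z * z'))"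
      unfolding c(2) c'(2) sum_product by (intro sum.cong refl) (simp only: D.hom_mult mult_ac)
    also have "\<dots> \<in> RR (d + e + \<kappa>)"
      using c(1) c'(1) by (intro RR_sum RR_scale RR_ZZ D3(7)) auto
    finally show ?thesis .
  qed
  have fin_RR: "finite (RR d)" and card_RR: "card (RR d) \<le> CARD('q) ^ (card Z * Suc d ^ 3)" for d
  proof -
    let ?f = "\<lambda>c. \<Sum>z\<in>Z. hD (c z) * z"
    have sub: "RR d \<subseteq> ?f ` (\<Pi>\<^sub>E z\<in>Z. F3 d)"
    proof
      fix f assume "f \<in> RR d"
      then obtain c where c: "\<forall>z\<in>Z. c z \<in> F3 d" "f = ?f c" using RR_D by blast
      have "f = ?f (restrict c Z)" unfolding c(2) by (intro sum.cong) auto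
      then show "f \<in> ?f ` (\<Pi>\<^sub>E z\<in>Z. F3 d)" using c(1) by (intro image_eqI[of _ _ "restrict c Z"]) auto
    qed
    have fp: "finite (\<Pi>\<^sub>E z\<in>Z. F3 d)" by (intro finite_PiE Z(1) D3(1))
    show "finite (RR d)" by (rule finite_subset[OF sub finite_imageI[OF fp]])
    have "card (RR d) \<le> card (\<Pi>\<^sub>E z\<in>Z. F3 d)"
      using card_mono[OF finite_imageI[OF fp] sub] card_image_le[OF fp, of ?f] by linarith
    also have "\<dots> = CARD('q) ^ (card Z * Suc d ^ 3)"
      by (simp add: card_PiE[OF Z(1)] card_F3 power_mult[symmetric] mult.commute)
    finally show "card (RR d) \<le> CARD('q) ^ (card Z * Suc d ^ 3)" .
  qed
  define e where "e = dd x1 + dd x2 + dd x3 + dd x4 + \<kappa>"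
  define s1 where "s1 = dd 1"
  have xe: "f * x \<in> RR (d + e)" if "f \<in> RR d" "x \<in> {x1, x2, x3, x4}" for f x d
  proof -
    have "x \<in> RA" using that x by auto
    then have "f * x \<in> RR (d + dd x + \<kappa>)" by (intro RR_mult that(1) dd)
    moreover have "d + dd x + \<kappa> \<le> d + e" using that(2) by (auto simp: e_def)
    ultimately show ?thesis using RR_mono by blast
  qed
  have ev_RR: "ev h x f \<in> RR (s + N * e)" if f: "degree f \<le> N" "\<And>i. h (poly.coeff f i) \<in> RR s" and h: "rhom h" and x: "x \<in> {x1, x2, x3, x4}"
    for h :: "'b::comm_ring_1 \<Rightarrow> _" and f N s x
  proof -
    have pw: "g * x ^ i \<in> RR (s + i * e)" if g: "g \<in> RR s" for g i
    proof (induction i)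
      case (Suc i)
      then have "(g * x ^ i) * x \<in> RR (s + i * e + e)" by (intro xe x)
      then show ?case by (simp add: mult_ac add_ac)
    qed (simp add: g)
    have "degree (map_poly h f) \<le> N" 
      using f(1) by (intro degree_le) (auto simp: coeff_map_poly rhom.hom_0[OF h] coeff_eq_0)
    then have "ev h x f = (\<Sum>i\<le>degree (map_poly h f). h (poly.coeff f i) * x ^ i)"
      by (simp add: ev_def poly_altdef coeff_map_poly rhom.hom_0[OF h])
    also have "\<dots> \<in> RR (s + N * e)"
    proof (rule RR_sum)
      fix i assume "i \<in> {..degree (map_poly h f)}"
      then have "i \<le> N" using \<open>degree (map_poly h f) \<le> N\<close> by simp
      then have "s + i * e \<le> s + N * e" by simp
      then show "h (poly.coeff f i) * x ^ i \<in> RR (s + N * e)" using pw[OF f(2)] RR_mono by blast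
    qed
    finally show ?thesis .
  qed
  have h0_RR: "h0 c \<in> RR s1" for c
  proof -
    have "[:[:[:c:]:]:] \<in> F3 0" by (auto simp: polys_box_def coeff_pCons split: nat.splits)
    moreover have "1 \<in> RR s1" unfolding s1_def by (rule dd[OF subring_1[OF is_subring_RA]])
    ultimately have "hD [:[:[:c:]:]:] * 1 \<in> RR (0 + s1)" by (rule RR_scale)
    then show ?thesis by (simp add: h0_def)
  qed
  note rh1 = rhom_ev[OF rhom_h0] note rh2 = rhom_ev[OF rh1] note rh3 = rhom_ev[OF rh2] note rh4 = rhom_ev[OF rh3]
  let ?E = "ev (ev (ev (ev h0 x1) x2) x3) x4"
  have E: "?E f \<in> RR (s1 + N * e + N * e + N * e + N * e)" if "f \<in> F4 N" for f N
    using that by (intro ev_RR rhom_h0 rh1 rh2 rh3 h0_RR) (auto simp: polys_box_def)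
  \<comment> \<open>\<open>K\<close> absorbs the linear growth:
    \<open>Suc s \<le> K * Suc N\<close>. With \<open>N = card Z * K ^ 3\<close> the exponent
    \<open>card Z * (K * Suc N) ^ 3\<close> equals \<open>N * Suc N ^ 3\<close>, just below
    \<open>Suc N ^ 4\<close>.\<close>
  define K where "K = s1 + 4 * e + 1"
  define N where "N = card Z * K ^ 3"
  define s where "s = s1 + N * e + N * e + N * e + N * e"
  have "Suc s \<le> K * Suc N" by (simp add: s_def K_def algebra_simps)
  then have "card Z * Suc s ^ 3 \<le> card Z * (K * Suc N) ^ 3" by (intro mult_left_mono power_mono) auto
  also have "\<dots> = N * Suc N ^ 3" by (simp only: N_def power_mult_distrib mult.assoc)
  also have "\<dots> < Suc N ^ 4" by (simp add: power4_eq_xxxx power3_eq_cube)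
  finally have "CARD('q) ^ (card Z * Suc s ^ 3) < CARD('q) ^ (Suc N ^ 4)"
  proof (intro power_strict_increasing)
    have "card {0, 1::'q} \<le> CARD('q)" by (rule card_mono) auto
    then show "1 < CARD('q)" by simp
  qed
  then have "card (RR s) < card (F4 N)" using card_RR[of s] unfolding card_F4 by linarith
  moreover have "?E ` F4 N \<subseteq> RR s" using E unfolding s_def by blast
  ultimately have "\<not> inj_on ?E (F4 N)" using card_inj_on_le[OF _ _ fin_RR, of ?E "F4 N" s] by linarith
  then obtain f g where "f \<noteq> g" "?E f = ?E g" unfolding inj_on_def by blast
  then show ?thesis by (intro exI[of _ "f - g"]) (simp add: rhom.hom_diff[OF rh4])
qed

text \<open>Choose an element in each step of the chain. A polynomial relation among the four has
  its value \<open>0\<close> in \<open>P 0\<close> and loses a variable at each step up, until a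
  nonzero constant, which is a unit, lies in \<open>P 4\<close>.\<close>

theorem no_prime_chain_of_length_4:
  assumes P: "\<And>i. i \<le> 4 \<Longrightarrow> is_prime SA (P i)" and sub: "\<And>i. i < 4 \<Longrightarrow> P i \<subset> P (Suc i)"
  shows False
proof -
  have sub': "P 0 \<subset> P 1" "P 1 \<subset> P 2" "P 2 \<subset> P 3" "P 3 \<subset> P 4"
    using sub[of 0] sub[of 1] sub[of 2] sub[of 3] by (simp_all add: numeral_eq_Suc)
  \<comment> \<open>\<open>x4\<close> belongs to the outermost variable, which is eliminated first,
    so it is taken from the bottom step.\<close>
  obtain x4 where x4: "x4 \<in> P 1" "x4 \<notin> P 0" using sub'(1) by blast
  obtain x3 where x3: "x3 \<in> P 2" "x3 \<notin> P 1" using sub'(2) by blast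
  obtain x2 where x2: "x2 \<in> P 3" "x2 \<notin> P 2" using sub'(3) by blast
  obtain x1 where x1: "x1 \<in> P 4" "x1 \<notin> P 3" using sub'(4) by blast
  have PS: "P i \<subseteq> SA" if "i \<le> 4" for i using ideal_subset[OF prime_ideal[OF P[OF that]]] .
  have xS: "x1 \<in> SA" "x2 \<in> SA" "x3 \<in> SA" "x4 \<in> SA"
    using x1 x2 x3 x4 PS[of 1] PS[of 2] PS[of 3] PS[of 4] by auto
  have c0: "h0 c \<in> SA" for c
    unfolding h0_def hD_const by (intro invariants_const2[OF is_subring_A]) (simp add: C.integral_hom)
  note r0 = rhom_h0
  note r1 = rhom_ev[OF r0, of x1] note r2 = rhom_ev[OF r1, of x2] note r3 = rhom_ev[OF r2, of x3]
  have c1: "ev h0 x1 c \<in> SA" for c unfolding ev_def by (rule eval_closed[OF r0 c0 xS(1) is_subring_SA])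
  have c2: "ev (ev h0 x1) x2 c \<in> SA" for c unfolding ev_def[of _ x2] by (rule eval_closed[OF r1 c1 xS(2) is_subring_SA])
  have c3: "ev (ev (ev h0 x1) x2) x3 c \<in> SA" for c unfolding ev_def[of _ x3] by (rule eval_closed[OF r2 c2 xS(3) is_subring_SA])
  obtain f where f: "f \<noteq> 0" "ev (ev (ev (ev h0 x1) x2) x3) x4 f = 0"
    using algebraically_dependent[of x1 x2 x3 x4] xS SA_RA by blast
  have f0: "poly (map_poly (ev (ev (ev h0 x1) x2) x3) f) x4 \<in> P 0"
    using f(2) ideal_0[OF prime_ideal[OF P[of 0]]] by (simp add: ev_def[of _ x4])
  obtain f3 where f3: "f3 \<noteq> 0" "ev (ev (ev h0 x1) x2) x3 f3 \<in> P 1"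
    using eval_nonzero_coeff_in_larger_prime[OF r3 is_subring_SA c3 P[of 0] P[of 1] _ x4 f(1) f0] sub'(1) by auto
  obtain f2 where f2: "f2 \<noteq> 0" "ev (ev h0 x1) x2 f2 \<in> P 2"
    using eval_nonzero_coeff_in_larger_prime[OF r2 is_subring_SA c2 P[of 1] P[of 2] _ x3 f3(1)] f3(2) sub'(2)
    unfolding ev_def[of _ x3] by auto
  obtain f1 where f1: "f1 \<noteq> 0" "ev h0 x1 f1 \<in> P 3"
    using eval_nonzero_coeff_in_larger_prime[OF r1 is_subring_SA c1 P[of 2] P[of 3] _ x2 f2(1)] f2(2) sub'(3)
    unfolding ev_def[of _ x2] by auto
  obtain c where c: "c \<noteq> 0" "h0 c \<in> P 4"
    using eval_nonzero_coeff_in_larger_prime[OF r0 is_subring_SA c0 P[of 3] P[of 4] _ x1 f1(1)] f1(2) sub'(4)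
    unfolding ev_def by auto
  have "h0 (inverse c) * h0 c = 1"
    using c(1) rhom.hom_mult[OF r0, of "inverse c" c] by (simp add: rhom.hom_1[OF r0])
  then have "1 \<in> P 4" using ideal_mult[OF prime_ideal[OF P[of 4]] c0 c(2), of "inverse c"] by simp
  then show False using P[of 4] by (simp add: is_prime_def)
qed

end

subsection \<open>Localization\<close>

text \<open>A prime over \<open>J\<close> that misses all \<open>s * x ^ n\<close> with
  \<open>s\<close> outside \<open>Q\<close> is contained in \<open>Q\<close> and omits
  \<open>x\<close>. It exists because cancelling \<open>x\<close> modulo \<open>J\<close> shows that
  no such product lies in \<open>J\<close>.\<close>

lemma smaller_prime:
  assumes B: "is_subring B" and J: "is_ideal B J" and Q: "is_prime B Q" "J \<subseteq> Q"
    and x: "x \<in> Q" "\<And>a. a \<in> B \<Longrightarrow> x * a \<in> J \<Longrightarrow> a \<in> J"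
  shows "\<exists>P. is_prime B P \<and> J \<subseteq> P \<and> P \<subset> Q"
proof -
  have xB: "x \<in> B" using x(1) ideal_subset[OF prime_ideal[OF Q(1)]] by blast
  define W where "W = {s * x ^ n | s n. s \<in> B \<and> s \<notin> Q}"
  have WI: "s * x ^ n \<in> W" if "s \<in> B" "s \<notin> Q" for s n using that by (auto simp: W_def)
  have one: "1 \<in> B" "1 \<notin> Q" using subring_1[OF B] Q(1) by (auto simp: is_prime_def)
  have "1 \<in> W" using WI[OF one, of 0] by simp
  moreover have "v * w \<in> W" if v: "v \<in> W" and w: "w \<in> W" for v w
  proof -
    obtain s n where 1: "v = s * x ^ n" "s \<in> B" "s \<notin> Q" using v unfolding W_def by blast
    obtain t k where 2: "w = t * x ^ k" "t \<in> B" "t \<notin> Q" using w unfolding W_def by blast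
    have "v * w = (s * t) * x ^ (n + k)" by (simp add: 1 2 power_add mult_ac)
    moreover have "s * t \<in> B" "s * t \<notin> Q" using 1 2 subring_mult[OF B] primeD[OF Q(1)] by auto
    ultimately show ?thesis using WI by simp
  qed
  moreover have "s * x ^ n \<in> J \<Longrightarrow> s \<in> B \<Longrightarrow> s \<in> J" for s n
  proof (induction n)
    case (Suc n)
    have "x * (s * x ^ n) \<in> J" using Suc.prems(1) by (simp add: mult_ac)
    then have "s * x ^ n \<in> J" using x(2) subring_mult[OF B Suc.prems(2) subring_power[OF B xB]] by blast
    then show ?case using Suc by blast
  qed simp
  then have "J \<inter> W = {}" using Q(2) unfolding W_def by blast
  ultimately have "\<exists>P. is_prime B P \<and> J \<subseteq> P \<and> P \<inter> W = {} \<and>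
      (\<forall>J. is_ideal B J \<longrightarrow> P \<subseteq> J \<longrightarrow> J \<inter> W = {} \<longrightarrow> J = P)"
    by (intro prime_avoiding[OF B J])
  then obtain P where P: "is_prime B P" "J \<subseteq> P" "P \<inter> W = {}" by (elim exE conjE)
  have "y \<in> Q" if "y \<in> P" for y
  proof (rule ccontr)
    assume "y \<notin> Q"
    then have "y * x ^ 0 \<in> W" using that ideal_subset[OF prime_ideal[OF P(1)]] by (intro WI) auto
    then show False using P(3) that by auto
  qed
  moreover have "x \<notin> P" using WI[OF one, of 1] P(3) by auto
  ultimately show ?thesis using P(1,2) x(1) by blast
qed

text \<open>The chain is built downwards from \<open>M\<close>: each term of the sequence leads to a
  strictly smaller prime over the ideal of its predecessors. This serves both to bound the dimension
  from below and to bound the depth from above.\<close>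

lemma prime_chain_of_regular_sequence:
  assumes B: "is_subring B" and M: "is_prime B M" and xs: "set xs \<subseteq> M"
    and reg: "\<And>i a. i < length xs \<Longrightarrow> a \<in> B \<Longrightarrow> xs ! i * a \<in> lincomb B (set (take i xs)) \<Longrightarrow>
      a \<in> lincomb B (set (take i xs))"
  shows "\<exists>P. (\<forall>i\<le>length xs. is_prime B (P i)) \<and> (\<forall>i<length xs. P i \<subset> P (Suc i))"
proof -
  let ?n = "length xs"
  have MB: "M \<subseteq> B" by (rule ideal_subset[OF prime_ideal[OF M]])
  have J: "is_ideal B (lincomb B (set (take i xs)))" for i
    using xs MB by (intro is_ideal_lincomb[OF B]) (auto dest: in_set_takeD)
  have "\<exists>P. (\<forall>t. i \<le> t \<and> t \<le> ?n \<longrightarrow> is_prime B (P t)) \<and> (\<forall>t. i \<le> t \<and> t < ?n \<longrightarrow> P t \<subset> P (Suc t)) \<and>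
    lincomb B (set (take i xs)) \<subseteq> P i" if "i \<le> ?n" for i
    using that
  proof (induction rule: inc_induct)
    case base
    show ?case using M lincomb_subset_ideal[OF prime_ideal[OF M] xs] by (intro exI[of _ "\<lambda>_. M"]) auto
  next
    case (step i)
    from step.IH obtain P where P0: "\<forall>t. Suc i \<le> t \<and> t \<le> ?n \<longrightarrow> is_prime B (P t)"
      "\<forall>t. Suc i \<le> t \<and> t < ?n \<longrightarrow> P t \<subset> P (Suc t)" "lincomb B (set (take (Suc i) xs)) \<subseteq> P (Suc i)"
      by (elim exE conjE)
    have P: "is_prime B (P t)" if "Suc i \<le> t" "t \<le> ?n" for t using P0(1) that by simp
    note P = P P0(2,3)
    have base: "set (take (Suc i) xs) \<subseteq> lincomb B (set (take (Suc i) xs))"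
      by (rule subsetI) (rule lincomb_base[OF B], simp_all)
    have "xs ! i \<in> set (take (Suc i) xs)" using step.hyps by (auto simp: take_Suc_conv_app_nth)
    then have xi: "xs ! i \<in> P (Suc i)" using base P0(3) by blast
    have "set (take i xs) \<subseteq> set (take (Suc i) xs)" by (rule set_take_subset_set_take) simp
    then have "lincomb B (set (take i xs)) \<subseteq> P (Suc i)"
      using base P0(3) step.hyps by (intro lincomb_subset_ideal[OF prime_ideal[OF P(1)]]) auto
    then obtain P' where P': "is_prime B P'" "lincomb B (set (take i xs)) \<subseteq> P'" "P' \<subset> P (Suc i)"
      using smaller_prime[OF B J P(1)[of "Suc i"] _ xi reg[of i]] step.hyps by auto
    show ?case
      using P P' by (intro exI[of _ "P(i := P')"]) (auto simp: Suc_le_eq)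
  qed
  from this[of 0] show ?thesis by auto
qed

section \<open>Passage to rings given by records\<close>

text \<open>\<open>T\<close> is a copy of the subring \<open>L\<close> along \<open>k\<close>. The
  invariants are treated with the identity as \<open>k\<close>, their localizations with the map
  from fractions to classes of pairs.\<close>

locale concrete_ring =
  fixes L :: "'u::comm_ring_1 set" and T :: "('t, 'm) ring_scheme" and k :: "'u \<Rightarrow> 't"
  assumes L: "is_subring L" and inj: "inj_on k L" and carr: "carrier T = k ` L"
    and km: "x \<in> L \<Longrightarrow> y \<in> L \<Longrightarrow> k x \<otimes>\<^bsub>T\<^esub> k y = k (x * y)"
    and ka: "x \<in> L \<Longrightarrow> y \<in> L \<Longrightarrow> k x \<oplus>\<^bsub>T\<^esub> k y = k (x + y)"
    and k1: "\<one>\<^bsub>T\<^esub> = k 1" and k0: "\<zero>\<^bsub>T\<^esub> = k 0"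
begin

lemmas Lc = subring_0[OF L] subring_1[OF L] subring_mult[OF L] subring_add[OF L] subring_diff[OF L] subring_uminus[OF L]

lemma is_cring: "cring T"
proof (rule cringI)
  show "abelian_group T"
  proof (rule abelian_groupI)
    fix x assume "x \<in> carrier T"
    then obtain a where a: "a \<in> L" "x = k a" by (auto simp: carr)
    then show "\<exists>y\<in>carrier T. y \<oplus>\<^bsub>T\<^esub> x = \<zero>\<^bsub>T\<^esub>"
      by (intro bexI[of _ "k (- a)"]) (simp_all add: ka k0 carr Lc)
  qed (auto simp: carr ka k0 Lc add_ac)
  show "Group.comm_monoid T"
    by (rule comm_monoidI) (auto simp: carr km k1 Lc mult_ac)
qed (auto simp: carr km ka Lc distrib_right)

sublocale T: cring T by (rule is_cring)

lemma mem_iff: "x \<in> L \<Longrightarrow> I \<subseteq> L \<Longrightarrow> k x \<in> k ` I \<longleftrightarrow> x \<in> I"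
  using inj by (auto simp: inj_on_def)

lemma img_sub: "I \<subseteq> L \<Longrightarrow> J \<subseteq> L \<Longrightarrow> k ` I \<subseteq> k ` J \<longleftrightarrow> I \<subseteq> J"
  using inj unfolding inj_on_def by blast

lemma neg: "x \<in> L \<Longrightarrow> \<ominus>\<^bsub>T\<^esub> k x = k (- x)"
  by (rule T.minus_equality) (simp_all add: ka k0 carr Lc)

lemma ideal_image:
  assumes I: "is_ideal L I"
  shows "ideal (k ` I) T"
proof (rule idealI)
  show "ring T" by (rule T.ring_axioms)
  have IL: "I \<subseteq> L" by (rule ideal_subset[OF I])
  show "subgroup (k ` I) (add_monoid T)"
  proof (rule T.add.subgroupI)
    show "k ` I \<subseteq> carrier T" using IL by (auto simp: carr)
    show "k ` I \<noteq> {}" using ideal_0[OF I] by blast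
    show "\<ominus>\<^bsub>T\<^esub> a \<in> k ` I" if a: "a \<in> k ` I" for a
    proof -
      obtain x where x: "x \<in> I" "a = k x" using a by blast
      then have "\<ominus>\<^bsub>T\<^esub> a = k (- x)" using IL neg by blast
      then show ?thesis using ideal_uminus[OF L I x(1)] by simp
    qed
    show "a \<oplus>\<^bsub>T\<^esub> b \<in> k ` I" if a: "a \<in> k ` I" and b: "b \<in> k ` I" for a b
    proof -
      obtain x y where x: "x \<in> I" "a = k x" "y \<in> I" "b = k y" using a b by blast
      then have "a \<oplus>\<^bsub>T\<^esub> b = k (x + y)" using IL ka by blast
      then show ?thesis using ideal_add[OF I x(1,3)] by simp
    qed
  qed
  show "x \<otimes>\<^bsub>T\<^esub> a \<in> k ` I" "a \<otimes>\<^bsub>T\<^esub> x \<in> k ` I" if a: "a \<in> k ` I" and x: "x \<in> carrier T" for a x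
  proof -
    obtain b where b: "b \<in> I" "a = k b" using a by blast
    obtain y where y: "y \<in> L" "x = k y" using x by (auto simp: carr)
    have bL: "b \<in> L" using IL b(1) by blast
    show "x \<otimes>\<^bsub>T\<^esub> a \<in> k ` I" using b y bL km ideal_mult[OF I y(1) b(1)] by simp
    show "a \<otimes>\<^bsub>T\<^esub> x \<in> k ` I" using b y bL km ideal_mult'[OF I y(1) b(1)] by simp
  qed
qed

lemma ideal_preimage:
  assumes J: "ideal J T"
  shows "\<exists>I. is_ideal L I \<and> J = k ` I"
proof -
  interpret J: ideal J T by (rule J)
  define I where "I = {x \<in> L. k x \<in> J}"
  have "J = k ` I" using J.a_subset by (auto simp: I_def carr)
  moreover have "is_ideal L I"
    unfolding is_ideal_def
  proof (intro conjI ballI)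
    show "0 \<in> I" using J.zero_closed Lc by (simp add: I_def k0)
    show "x + y \<in> I" if "x \<in> I" "y \<in> I" for x y
      using that J.a_closed[of "k x" "k y"] Lc by (simp add: I_def ka)
    show "b * x \<in> I" if "b \<in> L" "x \<in> I" for b x
      using that J.I_l_closed[of "k x" "k b"] Lc by (simp add: I_def km carr)
  qed (auto simp: I_def)
  ultimately show ?thesis by blast
qed

lemma is_ideal_of_image:
  assumes "ideal (k ` I) T" "I \<subseteq> L"
  shows "is_ideal L I"
proof -
  obtain I' where I': "is_ideal L I'" "k ` I = k ` I'" using ideal_preimage[OF assms(1)] by blast
  then have "I = I'" using inj_on_image_eq_iff[OF inj assms(2) ideal_subset[OF I'(1)]] by simp
  then show ?thesis using I'(1) by simp
qed

lemma ideal_one_iff: "is_ideal L I \<Longrightarrow> 1 \<in> I \<longleftrightarrow> I = L"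
  using ideal_mult'[of L I _ 1] Lc ideal_subset[of L I] by auto

lemma primeideal_image:
  assumes P: "is_prime L P"
  shows "primeideal (k ` P) T"
proof (rule primeidealI[OF ideal_image[OF prime_ideal[OF P]] is_cring])
  have PL: "P \<subseteq> L" by (rule ideal_subset[OF prime_ideal[OF P]])
  have "1 \<notin> P" using P by (simp add: is_prime_def)
  then have "k 1 \<notin> k ` P" using mem_iff[OF _ PL] Lc by blast
  then show "carrier T \<noteq> k ` P" using Lc by (auto simp: carr)
  fix a b assume "a \<in> carrier T" "b \<in> carrier T" "a \<otimes>\<^bsub>T\<^esub> b \<in> k ` P"
  then obtain x y where xy: "x \<in> L" "y \<in> L" "a = k x" "b = k y" "k (x * y) \<in> k ` P" by (auto simp: carr km)
  then have "x * y \<in> P" using mem_iff[OF _ PL] Lc by blast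
  then show "a \<in> k ` P \<or> b \<in> k ` P" using primeD[OF P xy(1,2)] xy by blast
qed

lemma primeideal_preimage:
  assumes Q: "primeideal Q T"
  shows "\<exists>P. is_prime L P \<and> Q = k ` P"
proof -
  interpret Q: primeideal Q T by (rule Q)
  obtain P where P: "is_ideal L P" "Q = k ` P" using ideal_preimage[OF Q.is_ideal] by blast
  have PL: "P \<subseteq> L" by (rule ideal_subset[OF P(1)])
  have "1 \<notin> P" using Q.I_notcarr ideal_one_iff[OF P(1)] P(2) by (auto simp: carr)
  moreover have "x \<in> P \<or> y \<in> P" if xy: "x \<in> L" "y \<in> L" "x * y \<in> P" for x y
  proof -
    have "k x \<otimes>\<^bsub>T\<^esub> k y \<in> Q" using xy P(2) by (simp add: km)
    then have "k x \<in> Q \<or> k y \<in> Q" using Q.I_prime[of "k x" "k y"] xy by (simp add: carr)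
    then show ?thesis using mem_iff[OF _ PL] xy P(2) by blast
  qed
  ultimately show ?thesis using P by (auto simp: is_prime_def)
qed

lemma maximalideal_iff:
  assumes I: "I \<subseteq> L"
  shows "maximalideal (k ` I) T \<longleftrightarrow> is_maximal L I"
proof
  assume "maximalideal (k ` I) T"
  then interpret M: maximalideal "k ` I" T .
  have iI: "is_ideal L I" by (rule is_ideal_of_image[OF M.is_ideal I])
  have "1 \<notin> I" using M.I_notcarr ideal_one_iff[OF iI] by (auto simp: carr)
  moreover have "J = I" if J: "is_ideal L J" "I \<subseteq> J" "1 \<notin> J" for J
  proof -
    have JL: "J \<subseteq> L" by (rule ideal_subset[OF J(1)])
    have "k ` J = k ` I \<or> k ` J = carrier T"
      using J(2) JL by (intro M.I_maximal ideal_image J(1)) (auto simp: carr)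
    moreover have "k ` J \<noteq> carrier T"
      using J(3) ideal_one_iff[OF J(1)] inj_on_image_eq_iff[OF inj JL order.refl] by (auto simp: carr)
    ultimately show ?thesis using inj_on_image_eq_iff[OF inj JL I] by simp
  qed
  ultimately show "is_maximal L I" using iI by (auto simp: is_maximal_def)
next
  assume M: "is_maximal L I"
  have iI: "is_ideal L I" and 1: "1 \<notin> I" using M by (auto simp: is_maximal_def)
  show "maximalideal (k ` I) T"
  proof (rule maximalidealI[OF ideal_image[OF iI]])
    show "carrier T \<noteq> k ` I"
      using 1 ideal_one_iff[OF iI] inj_on_image_eq_iff[OF inj order.refl I] by (auto simp: carr)
    fix J' assume J': "ideal J' T" "k ` I \<subseteq> J'"
    obtain J where J: "is_ideal L J" "J' = k ` J" using ideal_preimage[OF J'(1)] by blast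
    have JL: "J \<subseteq> L" by (rule ideal_subset[OF J(1)])
    have "I \<subseteq> J" using J'(2) img_sub[OF I JL] unfolding J(2) by simp
    then show "J' = k ` I \<or> J' = carrier T"
      using M J ideal_one_iff[OF J(1)] unfolding is_maximal_def by (auto simp: carr)
  qed
qed

lemma genideal_image:
  assumes F: "finite F" "F \<subseteq> L"
  shows "genideal T (k ` F) = k ` lincomb L F"
proof
  have kF: "k ` F \<subseteq> carrier T" using F(2) by (auto simp: carr)
  have id: "ideal (k ` lincomb L F) T" by (rule ideal_image[OF is_ideal_lincomb[OF L F(2)]])
  have "k ` F \<subseteq> k ` lincomb L F" by (rule image_mono) (use lincomb_base[OF L F(1)] in blast)
  then show "genideal T (k ` F) \<subseteq> k ` lincomb L F" by (rule T.genideal_minimal[OF id])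
  obtain I where I: "is_ideal L I" "genideal T (k ` F) = k ` I"
    using ideal_preimage[OF T.genideal_ideal[OF kF]] by blast
  have "k ` F \<subseteq> k ` I" using T.genideal_self[OF kF] I(2) by simp
  then have "F \<subseteq> I" using img_sub[OF F(2) ideal_subset[OF I(1)]] by simp
  then have "lincomb L F \<subseteq> I" by (rule lincomb_subset_ideal[OF I(1)])
  then show "k ` lincomb L F \<subseteq> genideal T (k ` F)" unfolding I(2) by (rule image_mono)
qed

lemma noetherian:
  assumes "\<And>I. is_ideal L I \<Longrightarrow> \<exists>F. finite F \<and> F \<subseteq> I \<and> I = lincomb L F"
  shows "noetherian_ring T"
proof (rule noetherian_ring.intro[OF T.ring_axioms], unfold_locales)
  fix J assume "ideal J T"
  then obtain I where I: "is_ideal L I" "J = k ` I" using ideal_preimage by blast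
  obtain F where F: "finite F" "F \<subseteq> I" "I = lincomb L F" using assms[OF I(1)] by blast
  have FL: "F \<subseteq> L" using F(2) ideal_subset[OF I(1)] by blast
  show "\<exists>A\<subseteq>carrier T. finite A \<and> J = genideal T A"
    using F(1,3) FL genideal_image[OF F(1) FL] I(2) by (intro exI[of _ "k ` F"]) (auto simp: carr)
qed

lemma regular_seq_iff:
  assumes xs: "set xs \<subseteq> L"
  shows "regular_seq T (map k xs) \<longleftrightarrow>
    (\<forall>i<length xs. \<forall>a\<in>L. xs ! i * a \<in> lincomb L (set (take i xs)) \<longrightarrow> a \<in> lincomb L (set (take i xs))) \<and>
    lincomb L (set xs) \<noteq> L"
proof -
  have sub: "set (take i xs) \<subseteq> L" for i using xs by (auto dest: in_set_takeD)
  have g: "genideal T (set (take i (map k xs))) = k ` lincomb L (set (take i xs))" for i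
    using genideal_image[OF _ sub, of i] by (simp add: take_map)
  have gg: "genideal T (set (map k xs)) = k ` lincomb L (set xs)"
    using genideal_image[OF _ xs] by simp
  have lL: "lincomb L (set (take i xs)) \<subseteq> L" for i by (rule ideal_subset[OF is_ideal_lincomb[OF L sub]])
  have lL': "lincomb L (set xs) \<subseteq> L" by (rule ideal_subset[OF is_ideal_lincomb[OF L xs]])
  have "(\<forall>a\<in>carrier T. map k xs ! i \<otimes>\<^bsub>T\<^esub> a \<in> k ` lincomb L (set (take i xs)) \<longrightarrow> a \<in> k ` lincomb L (set (take i xs)))
    \<longleftrightarrow> (\<forall>a\<in>L. xs ! i * a \<in> lincomb L (set (take i xs)) \<longrightarrow> a \<in> lincomb L (set (take i xs)))" if i: "i < length xs" for i
  proof -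
    have xi: "xs ! i \<in> L" using xs i by auto
    have "map k xs ! i \<otimes>\<^bsub>T\<^esub> k a = k (xs ! i * a)" if "a \<in> L" for a using i km[OF xi that] by simp
    then show ?thesis using mem_iff[OF _ lL] subring_mult[OF L xi] by (simp add: carr)
  qed
  moreover have "set (map k xs) \<subseteq> carrier T" using xs by (auto simp: carr)
  moreover have "k ` lincomb L (set xs) = carrier T \<longleftrightarrow> lincomb L (set xs) = L"
    unfolding carr by (rule inj_on_image_eq_iff[OF inj lL' order.refl])
  ultimately show ?thesis unfolding regular_seq_def g gg by simp
qed

text \<open>\<open>dim\<close> bounds the chains of primes by \<open>n\<close>, and every regular
  sequence in \<open>M\<close> yields a chain of its own length. So the sequence \<open>xs\<close>
  pins both depth and dimension to \<open>n\<close>.\<close>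

lemma cohen_macaulay_local:
  assumes noeth: "\<And>I. is_ideal L I \<Longrightarrow> \<exists>F. finite F \<and> F \<subseteq> I \<and> I = lincomb L F"
    and M: "is_maximal L M" "\<And>I. is_ideal L I \<Longrightarrow> 1 \<notin> I \<Longrightarrow> I \<subseteq> M"
    and xs: "set xs \<subseteq> M" and len: "length xs = n"
    and reg: "\<And>i a. i < n \<Longrightarrow> a \<in> L \<Longrightarrow> xs ! i * a \<in> lincomb L (set (take i xs)) \<Longrightarrow> a \<in> lincomb L (set (take i xs))"
    and dim: "\<And>P. (\<And>i. i \<le> Suc n \<Longrightarrow> is_prime L (P i)) \<Longrightarrow> (\<And>i. i < Suc n \<Longrightarrow> P i \<subset> P (Suc i)) \<Longrightarrow> False"
  shows "cohen_macaulay_local T"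
proof -
  have MI: "is_ideal L M" "1 \<notin> M" using M(1) by (auto simp: is_maximal_def)
  have subM: "M \<subseteq> L" by (rule ideal_subset[OF MI(1)])
  have Mp: "is_prime L M" by (rule maximal_prime[OF L M(1)])
  \<comment> \<open>A longer chain would contain an initial part with \<open>Suc n\<close> steps,
    which \<open>dim\<close> excludes.\<close>
  have chain_le: "j \<le> n" if P: "\<forall>i\<le>j. is_prime L (P i)" "\<forall>i<j. P i \<subset> P (Suc i)" for j P
  proof (rule ccontr)
    assume "\<not> j \<le> n"
    then show False using dim[of P] P by auto
  qed
  have kd: "krull_dim T = enat n"
  proof (rule antisym)
    show "krull_dim T \<le> enat n" unfolding krull_dim_def
    proof (rule Sup_least)
      fix d assume "d \<in> {enat n |n. \<exists>P. (\<forall>i\<le>n. primeideal (P i) T) \<and> (\<forall>i<n. P i \<subset> P (Suc i))}"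
      then obtain j P where d: "d = enat j" "\<forall>i\<le>j. primeideal (P i) T" "\<forall>i<j. P i \<subset> P (Suc i)" by blast
      have "\<forall>i. \<exists>Q. i \<le> j \<longrightarrow> is_prime L Q \<and> P i = k ` Q" using d(2) primeideal_preimage by blast
      then obtain Q where Q: "\<And>i. i \<le> j \<Longrightarrow> is_prime L (Q i) \<and> P i = k ` Q i" by metis
      have "Q i \<subset> Q (Suc i)" if "i < j" for i
      proof -
        have "is_prime L (Q i)" "is_prime L (Q (Suc i))" using Q[of i] Q[of "Suc i"] that by auto
        note q = this[THEN prime_ideal, THEN ideal_subset]
        have "P i = k ` Q i" "P (Suc i) = k ` Q (Suc i)" using Q[of i] Q[of "Suc i"] that by auto
        then have "k ` Q i \<subset> k ` Q (Suc i)" using d(3) that by metis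
        then show ?thesis using img_sub[OF q] by blast
      qed
      then have "j \<le> n" using Q by (intro chain_le[of j Q]) auto
      then show "d \<le> enat n" by (simp add: d(1))
    qed
    obtain P where P: "\<forall>i\<le>length xs. is_prime L (P i)" "\<forall>i<length xs. P i \<subset> P (Suc i)"
      using prime_chain_of_regular_sequence[OF L Mp xs] reg len by blast
    have "\<forall>i\<le>n. primeideal (k ` P i) T" using P(1) len primeideal_image by blast
    moreover have "\<forall>i<n. k ` P i \<subset> k ` P (Suc i)"
    proof (intro allI impI)
      fix i assume i: "i < n"
      then have "is_prime L (P i)" "is_prime L (P (Suc i))" using P(1) len by auto
      note q = this[THEN prime_ideal, THEN ideal_subset]
      have "P i \<subset> P (Suc i)" using P(2) i len by auto
      then show "k ` P i \<subset> k ` P (Suc i)"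
        unfolding psubset_eq img_sub[OF q] inj_on_image_eq_iff[OF inj q] .
    qed
    ultimately show "enat n \<le> krull_dim T"
      unfolding krull_dim_def by (intro Sup_upper CollectI exI[of _ n] exI[of _ "\<lambda>i. k ` P i"] conjI refl)
  qed
  have dp: "depth T (k ` M) = enat n"
  proof (rule antisym)
    show "depth T (k ` M) \<le> enat n" unfolding depth_def
    proof (rule Sup_least)
      fix d assume "d \<in> {enat (length xs) |xs. set xs \<subseteq> k ` M \<and> regular_seq T xs}"
      then obtain zs where zs: "d = enat (length zs)" "set zs \<subseteq> k ` M" "regular_seq T zs" by blast
      define ys where "ys = map (inv_into M k) zs"
      have ysM: "set ys \<subseteq> M" using zs(2) by (auto simp: ys_def intro: inv_into_into)
      have "map k ys = zs" using zs(2) by (auto simp: ys_def f_inv_into_f intro!: map_idI)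
      then have r: "regular_seq T (map k ys)" using zs(3) by simp
      then have "\<exists>P. (\<forall>i\<le>length ys. is_prime L (P i)) \<and> (\<forall>i<length ys. P i \<subset> P (Suc i))"
        using ysM subM regular_seq_iff[of ys] by (intro prime_chain_of_regular_sequence[OF L Mp]) auto
      then have "length ys \<le> n" using chain_le by blast
      then show "d \<le> enat n" by (simp add: zs(1) ys_def)
    qed
    have "lincomb L (set xs) \<noteq> L"
      using lincomb_subset_ideal[OF MI(1) xs] MI(2) Lc by blast
    then have "regular_seq T (map k xs)" using xs subM reg len by (subst regular_seq_iff) auto
    moreover have "set (map k xs) \<subseteq> k ` M" using xs by auto
    ultimately have "enat (length (map k xs)) \<in> {enat (length xs) |xs. set xs \<subseteq> k ` M \<and> regular_seq T xs}" by blast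
    then show "enat n \<le> depth T (k ` M)" unfolding depth_def using len by (intro Sup_upper) simp
  qed
  have "{I. maximalideal I T} = {k ` M}"
  proof (intro equalityI subsetI)
    fix I' assume "I' \<in> {I. maximalideal I T}"
    then have mI: "maximalideal I' T" by simp
    then obtain I where I: "is_ideal L I" "I' = k ` I" using ideal_preimage maximalideal.axioms(1) by blast
    have IL: "I \<subseteq> L" by (rule ideal_subset[OF I(1)])
    have "is_maximal L I" using mI maximalideal_iff[OF IL] I(2) by simp
    then have "I = M" using M(2)[OF I(1)] MI unfolding is_maximal_def by blast
    then show "I' \<in> {k ` M}" using I(2) by simp
  next
    fix I' assume "I' \<in> {k ` M}"
    then show "I' \<in> {I. maximalideal I T}" using maximalideal_iff[OF subM] M(1) by simp
  qed
  then show ?thesis unfolding cohen_macaulay_local_def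
    using is_cring noetherian[OF noeth] dp kd by auto
qed

end

lemma concrete_ring_of_type_algebra:
  assumes "is_subring B"
  shows "concrete_ring B (ring_of_type_algebra\<lparr>carrier := B\<rparr>) (\<lambda>x. x)"
  using assms by unfold_locales (simp_all add: ring_of_type_algebra_def)

section \<open>Localizations inside the fraction field\<close>

locale localized_ring =
  fixes B P :: "'u::idom set"
  assumes B: "is_subring B" and P: "is_prime B P"
begin

interpretation R: concrete_ring B "ring_of_type_algebra\<lparr>carrier := B\<rparr>" "\<lambda>x. x"
  by (rule concrete_ring_of_type_algebra[OF B])

text \<open>For \<open>I = B\<close> this is the localization itself, as a subring of the fraction
  field.\<close>

definition extension :: "'u set \<Rightarrow> 'u fract set"
  where "extension I = {Fract a s | a s. a \<in> I \<and> s \<in> B - P}"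

definition contraction :: "'u fract set \<Rightarrow> 'u set"
  where "contraction J = {a \<in> B. Fract a 1 \<in> J}"

abbreviation "L \<equiv> extension B"

text \<open>The equivalence class that stands for \<open>z\<close> in \<open>ring_of_fracs\<close>;
  this is the map \<open>k\<close> of \<open>concrete_ring\<close>.\<close>

definition fractions :: "'u fract \<Rightarrow> ('u \<times> 'u) set"
  where "fractions z = {(a, s). a \<in> B \<and> s \<in> B - P \<and> Fract a s = z}"

lemma denominator_nz: "s \<in> B - P \<Longrightarrow> s \<noteq> 0"
  using ideal_0[OF prime_ideal[OF P]] by blast

lemma denominator_1: "1 \<in> B - P"
  using prime_1[OF P] subring_1[OF B] by blast

lemma denominator_mult: "s \<in> B - P \<Longrightarrow> t \<in> B - P \<Longrightarrow> s * t \<in> B - P"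
  using primeD[OF P] subring_mult[OF B] by blast

lemma extensionI: "a \<in> I \<Longrightarrow> s \<in> B - P \<Longrightarrow> Fract a s \<in> extension I"
  unfolding extension_def by blast

lemma extensionE:
  assumes "z \<in> extension I"
  obtains a s where "a \<in> I" "s \<in> B - P" "z = Fract a s"
  using assms unfolding extension_def by blast

lemma extension_1: "a \<in> I \<Longrightarrow> Fract a 1 \<in> extension I"
  by (rule extensionI[OF _ denominator_1])

lemma extension_add:
  assumes I: "is_ideal B I" and z: "z \<in> extension I" "w \<in> extension I"
  shows "z + w \<in> extension I"
proof -
  from z(1) obtain a s where a: "a \<in> I" "s \<in> B - P" "z = Fract a s" by (rule extensionE)
  from z(2) obtain b t where b: "b \<in> I" "t \<in> B - P" "w = Fract b t" by (rule extensionE)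
  have "z + w = Fract (t * a + s * b) (s * t)"
    using denominator_nz[OF a(2)] denominator_nz[OF b(2)] by (simp add: a b mult.commute)
  moreover have "t * a + s * b \<in> I" using a b by (intro ideal_add[OF I] ideal_mult[OF I]) auto
  ultimately show ?thesis using extensionI denominator_mult[OF a(2) b(2)] by simp
qed

lemma extension_mult:
  assumes I: "is_ideal B I" and z: "z \<in> L" "w \<in> extension I"
  shows "z * w \<in> extension I"
proof -
  from z(1) obtain a s where a: "a \<in> B" "s \<in> B - P" "z = Fract a s" by (rule extensionE)
  from z(2) obtain b t where b: "b \<in> I" "t \<in> B - P" "w = Fract b t" by (rule extensionE)
  have "z * w = Fract (a * b) (s * t)" by (simp add: a b)
  then show ?thesis using extensionI[OF ideal_mult[OF I a(1) b(1)] denominator_mult[OF a(2) b(2)]] by simp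
qed

lemma is_ideal_B: "is_ideal B B"
  using subring_0[OF B] subring_add[OF B] subring_mult[OF B] by (auto simp: is_ideal_def)

lemma is_subring_L: "is_subring L"
proof -
  have "- z \<in> L" if z: "z \<in> L" for z
  proof -
    from z obtain a s where a: "a \<in> B" "s \<in> B - P" "z = Fract a s" by (rule extensionE)
    then show ?thesis using extensionI[OF subring_uminus[OF B a(1)] a(2)] by simp
  qed
  then have "z - w \<in> L" if "z \<in> L" "w \<in> L" for z w
    using extension_add[OF is_ideal_B that(1), of "- w"] that(2) by simp
  then show ?thesis
    using extension_mult[OF is_ideal_B] extension_1[OF subring_1[OF B]]
    unfolding is_subring_def One_fract_def by blast
qed

lemma is_ideal_extension:
  assumes I: "is_ideal B I"
  shows "is_ideal L (extension I)"
proof -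
  have "extension I \<subseteq> L" using ideal_subset[OF I] unfolding extension_def by blast
  then show ?thesis
    using extension_add[OF I] extension_mult[OF I] extension_1[OF ideal_0[OF I]]
    unfolding is_ideal_def Zero_fract_def by blast
qed

lemma Fract_mem_ideal_iff:
  assumes J: "is_ideal L J" and a: "a \<in> B" "s \<in> B - P"
  shows "Fract a s \<in> J \<longleftrightarrow> a \<in> contraction J"
proof
  assume "Fract a s \<in> J"
  then have "Fract s 1 * Fract a s \<in> J" using a(2) by (intro ideal_mult[OF J] extension_1) auto
  also have "Fract s 1 * Fract a s = Fract a 1" using denominator_nz[OF a(2)] by (simp add: eq_fract)
  finally show "a \<in> contraction J" using a by (simp add: contraction_def)
next
  assume "a \<in> contraction J"
  then have "Fract 1 s * Fract a 1 \<in> J"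
    using a(2) subring_1[OF B] by (intro ideal_mult[OF J] extensionI) (auto simp: contraction_def)
  then show "Fract a s \<in> J" by simp
qed

lemma contraction_extension_iff:
  assumes I: "is_ideal B I" and a: "a \<in> B"
  shows "a \<in> contraction (extension I) \<longleftrightarrow> (\<exists>t\<in>B - P. t * a \<in> I)"
proof
  assume "a \<in> contraction (extension I)"
  then have "Fract a 1 \<in> extension I" by (simp add: contraction_def)
  then obtain b s where b: "b \<in> I" "s \<in> B - P" "Fract a 1 = Fract b s" by (rule extensionE)
  then have "s * a \<in> I" using denominator_nz[OF b(2)] by (simp add: eq_fract mult.commute)
  then show "\<exists>t\<in>B - P. t * a \<in> I" using b(2) by blast
next
  assume "\<exists>t\<in>B - P. t * a \<in> I"
  then obtain t where t: "t \<in> B - P" "t * a \<in> I" by blast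
  have "Fract (t * a) t \<in> extension I" by (rule extensionI[OF t(2,1)])
  also have "Fract (t * a) t = Fract a 1" using denominator_nz[OF t(1)] by (simp add: eq_fract)
  finally show "a \<in> contraction (extension I)" using a by (simp add: contraction_def)
qed

lemma is_ideal_contraction:
  assumes J: "is_ideal L J"
  shows "is_ideal B (contraction J)"
  unfolding is_ideal_def
proof (intro conjI ballI)
  show "contraction J \<subseteq> B" by (auto simp: contraction_def)
  show "0 \<in> contraction J" using ideal_0[OF J] subring_0[OF B] by (simp add: contraction_def Zero_fract_def)
  fix x assume x: "x \<in> contraction J"
  show "x + y \<in> contraction J" if "y \<in> contraction J" for y
    using ideal_add[OF J, of "Fract x 1" "Fract y 1"] x that subring_add[OF B, of x y] by (simp add: contraction_def)
  show "b * x \<in> contraction J" if "b \<in> B" for b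
    using ideal_mult[OF J, of "Fract b 1" "Fract x 1"] x that subring_mult[OF B, of b x] extension_1[of b B]
    by (simp add: contraction_def)
qed

lemma contraction_mono: "is_ideal L I \<Longrightarrow> is_ideal L J \<Longrightarrow> contraction I \<subseteq> contraction J \<longleftrightarrow> I \<subseteq> J"
proof
  assume I: "is_ideal L I" and J: "is_ideal L J" and sub: "contraction I \<subseteq> contraction J"
  show "I \<subseteq> J"
  proof
    fix z assume z: "z \<in> I"
    then have "z \<in> L" using ideal_subset[OF I] by blast
    then obtain a s where a: "a \<in> B" "s \<in> B - P" "z = Fract a s" by (rule extensionE)
    then show "z \<in> J" using z sub Fract_mem_ideal_iff[OF I a(1,2)] Fract_mem_ideal_iff[OF J a(1,2)] by blast
  qed
qed (auto simp: contraction_def)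

lemma is_prime_contraction:
  assumes Q: "is_prime L Q"
  shows "is_prime B (contraction Q)"
  unfolding is_prime_def
proof (intro conjI ballI impI)
  show "is_ideal B (contraction Q)" by (rule is_ideal_contraction[OF prime_ideal[OF Q]])
  show "1 \<notin> contraction Q" using prime_1[OF Q] by (simp add: contraction_def One_fract_def)
  fix x y assume xy: "x \<in> B" "y \<in> B" "x * y \<in> contraction Q"
  then have "Fract x 1 * Fract y 1 \<in> Q" by (simp add: contraction_def)
  then show "x \<in> contraction Q \<or> y \<in> contraction Q"
    using primeD[OF Q extension_1[OF xy(1)] extension_1[OF xy(2)]] xy by (simp add: contraction_def)
qed

lemma proper_ideal_subset:
  assumes J: "is_ideal L J" "1 \<notin> J"
  shows "J \<subseteq> extension P"
proof
  fix z assume z: "z \<in> J"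
  then have "z \<in> L" using ideal_subset[OF J(1)] by blast
  then obtain a s where a: "a \<in> B" "s \<in> B - P" "z = Fract a s" by (rule extensionE)
  have "a \<in> P"
  proof (rule ccontr)
    assume na: "a \<notin> P"
    have "Fract s a * z \<in> J" using na a z by (intro ideal_mult[OF J(1)] extensionI) auto
    also have "Fract s a * z = 1"
      using denominator_nz[OF a(2)] denominator_nz[of a] na a by (simp add: One_fract_def eq_fract mult.commute)
    finally show False using J(2) by simp
  qed
  then show "z \<in> extension P" using a by (simp add: extensionI)
qed

lemma is_maximal_extension: "is_maximal L (extension P)"
proof -
  have "1 \<notin> extension P"
  proof
    assume "1 \<in> extension P"
    then obtain a s where a: "a \<in> P" "s \<in> B - P" "1 = Fract a s" by (rule extensionE)
    then have "s = a" using denominator_nz[OF a(2)] by (simp add: One_fract_def eq_fract)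
    then show False using a by simp
  qed
  then show ?thesis unfolding is_maximal_def using is_ideal_extension[OF prime_ideal[OF P]] proper_ideal_subset by blast
qed

lemma ideal_finitely_generated:
  assumes noeth: "\<And>I. is_ideal B I \<Longrightarrow> \<exists>F. finite F \<and> F \<subseteq> I \<and> I = lincomb B F" and J: "is_ideal L J"
  shows "\<exists>F. finite F \<and> F \<subseteq> J \<and> J = lincomb L F"
proof -
  obtain F where F: "finite F" "F \<subseteq> contraction J" "contraction J = lincomb B F"
    using noeth[OF is_ideal_contraction[OF J]] by blast
  define E where "E = (\<lambda>a. Fract a 1) ` F"
  have E: "finite E" "E \<subseteq> J" using F by (auto simp: E_def contraction_def)
  have EL: "is_ideal L (lincomb L E)" using E(2) ideal_subset[OF J] by (intro is_ideal_lincomb is_subring_L) blast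
  have "F \<subseteq> contraction (lincomb L E)"
    using F(2) lincomb_base[OF is_subring_L E(1)] by (auto simp: contraction_def E_def)
  then have "contraction J \<subseteq> contraction (lincomb L E)"
    unfolding F(3) by (rule lincomb_subset_ideal[OF is_ideal_contraction[OF EL]])
  then have "J \<subseteq> lincomb L E" using contraction_mono[OF J EL] by blast
  then have "J = lincomb L E" using lincomb_subset_ideal[OF J E(2)] by blast
  then show ?thesis using E by blast
qed

lemma contraction_lincomb_iff:
  assumes F: "finite F" "F \<subseteq> B" and a: "a \<in> B"
  shows "a \<in> contraction (lincomb L ((\<lambda>a. Fract a 1) ` F)) \<longleftrightarrow> (\<exists>t\<in>B - P. t * a \<in> lincomb B F)"
proof -
  define E where "E = (\<lambda>a. Fract a 1) ` F"
  have E: "finite E" "E \<subseteq> L" using F extension_1 by (auto simp: E_def)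
  have I: "is_ideal B (lincomb B F)" by (rule is_ideal_lincomb[OF B F(2)])
  have EL: "is_ideal L (lincomb L E)" by (rule is_ideal_lincomb[OF is_subring_L E(2)])
  have "E \<subseteq> extension (lincomb B F)" using lincomb_base[OF B F(1)] extension_1 by (auto simp: E_def)
  then have 1: "lincomb L E \<subseteq> extension (lincomb B F)"
    by (rule lincomb_subset_ideal[OF is_ideal_extension[OF I]])
  have "F \<subseteq> contraction (lincomb L E)"
    using F(2) lincomb_base[OF is_subring_L E(1)] by (auto simp: contraction_def E_def)
  then have 2: "lincomb B F \<subseteq> contraction (lincomb L E)"
    by (rule lincomb_subset_ideal[OF is_ideal_contraction[OF EL]])
  have "extension (lincomb B F) \<subseteq> lincomb L E"
  proof
    fix z assume "z \<in> extension (lincomb B F)"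
    then obtain b s where b: "b \<in> lincomb B F" "s \<in> B - P" "z = Fract b s" by (rule extensionE)
    then show "z \<in> lincomb L E" using 2 Fract_mem_ideal_iff[OF EL _ b(2), of b] ideal_subset[OF I] by blast
  qed
  with 1 have "lincomb L E = extension (lincomb B F)" by blast
  then show ?thesis using contraction_extension_iff[OF I a] by (simp add: E_def)
qed

text \<open>The ambient ring is a domain and denominators are nonzero, so the factor
  \<open>u\<close> in \<open>frac_rel\<close> cancels.\<close>

lemma frac_rel_iff:
  "((a, s), (b, t)) \<in> frac_rel (ring_of_type_algebra\<lparr>carrier := B\<rparr>) (B - P) \<longleftrightarrow>
    a \<in> B \<and> b \<in> B \<and> s \<in> B - P \<and> t \<in> B - P \<and> Fract a s = Fract b t"
proof (cases "a \<in> B \<and> b \<in> B \<and> s \<in> B - P \<and> t \<in> B - P")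
  case True
  let ?R = "ring_of_type_algebra\<lparr>carrier := B\<rparr>"
  have mem: "t * a \<in> B" "s * b \<in> B" using True subring_mult[OF B] by auto
  have "t \<otimes>\<^bsub>?R\<^esub> a \<ominus>\<^bsub>?R\<^esub> s \<otimes>\<^bsub>?R\<^esub> b = t * a - s * b"
    using R.neg[OF mem(2)] by (simp add: a_minus_def) (simp add: ring_of_type_algebra_def)
  then have "((a, s), (b, t)) \<in> frac_rel ?R (B - P) \<longleftrightarrow> (\<exists>u\<in>B - P. u * (t * a - s * b) = 0)"
    using True by (simp add: frac_rel_def) (simp add: ring_of_type_algebra_def)
  also have "\<dots> \<longleftrightarrow> t * a - s * b = 0" using denominator_nz denominator_1 by (metis mult_eq_0_iff)
  also have "\<dots> \<longleftrightarrow> Fract a s = Fract b t"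
    using True denominator_nz[of s] denominator_nz[of t] by (simp add: eq_fract mult.commute)
  finally show ?thesis using True by simp
next
  case False
  then show ?thesis by (auto simp: frac_rel_def ring_of_type_algebra_def)
qed

lemma fraction_eq:
  "a \<in> B \<Longrightarrow> s \<in> B - P \<Longrightarrow>
    fraction (ring_of_type_algebra\<lparr>carrier := B\<rparr>) (B - P) a s = fractions (Fract a s)"
  unfolding fraction_def fractions_def Image_singleton by (auto simp: frac_rel_iff)

lemma concrete_ring_localization:
  "concrete_ring L (localization (ring_of_type_algebra\<lparr>carrier := B\<rparr>) P) fractions"
proof
  let ?R = "ring_of_type_algebra\<lparr>carrier := B\<rparr>"
  have rep: "\<exists>a s. (a, s) \<in> fractions z" if "z \<in> L" for z
    using that by (rule extensionE) (auto simp: fractions_def)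
  show "is_subring L" by (rule is_subring_L)
  show "inj_on fractions L"
  proof
    fix x y assume "x \<in> L" "y \<in> L" "fractions x = fractions y"
    then show "x = y" using rep[of x] by (auto simp: fractions_def)
  qed
  have "carrier (localization ?R P) = (\<Union>(a, s)\<in>B \<times> (B - P). {fraction ?R (B - P) a s})"
    by (simp add: localization_def ring_of_fracs_def quotient_def fraction_def split_def)
  also have "\<dots> = fractions ` L"
    by (force simp: fraction_eq extension_def)
  finally show "carrier (localization ?R P) = fractions ` L" .
  show "\<one>\<^bsub>localization ?R P\<^esub> = fractions 1"
    using fraction_eq[OF subring_1[OF B] denominator_1]
    by (simp add: localization_def ring_of_fracs_def One_fract_def) (simp add: ring_of_type_algebra_def)
  show "\<zero>\<^bsub>localization ?R P\<^esub> = fractions 0"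
    using fraction_eq[OF subring_0[OF B] denominator_1]
    by (simp add: localization_def ring_of_fracs_def Zero_fract_def) (simp add: ring_of_type_algebra_def)
  fix x y assume xy: "x \<in> L" "y \<in> L"
  \<comment> \<open>All members of the union coincide, and \<open>rep\<close> supplies at least one
    of them.\<close>
  have union: "(\<Union>(a, s)\<in>fractions x. \<Union>(b, t)\<in>fractions y. h a s b t) = c"
    if h: "\<And>a s b t. (a, s) \<in> fractions x \<Longrightarrow> (b, t) \<in> fractions y \<Longrightarrow> h a s b t = c" for h and c :: "('u \<times> 'u) set"
    using rep[OF xy(1)] rep[OF xy(2)] h by fastforce
  show "fractions x \<otimes>\<^bsub>localization ?R P\<^esub> fractions y = fractions (x * y)"
  proof -
    have "fraction ?R (B - P) (a \<otimes>\<^bsub>?R\<^esub> b) (s \<otimes>\<^bsub>?R\<^esub> t) = fractions (x * y)"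
      if as: "(a, s) \<in> fractions x" and bt: "(b, t) \<in> fractions y" for a s b t
    proof -
      have "a \<in> B" "b \<in> B" and st: "s \<in> B - P" "t \<in> B - P" and xy': "x = Fract a s" "y = Fract b t"
        using as bt by (auto simp: fractions_def)
      then have "fraction ?R (B - P) (a * b) (s * t) = fractions (Fract (a * b) (s * t))"
        by (intro fraction_eq subring_mult[OF B] denominator_mult)
      then show ?thesis unfolding xy' by (simp add: ring_of_type_algebra_def)
    qed
    then show ?thesis by (simp add: localization_def ring_of_fracs_def union)
  qed
  show "fractions x \<oplus>\<^bsub>localization ?R P\<^esub> fractions y = fractions (x + y)"
  proof -
    have "fraction ?R (B - P) (t \<otimes>\<^bsub>?R\<^esub> a \<oplus>\<^bsub>?R\<^esub> s \<otimes>\<^bsub>?R\<^esub> b) (s \<otimes>\<^bsub>?R\<^esub> t) = fractions (x + y)"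
      if as: "(a, s) \<in> fractions x" and bt: "(b, t) \<in> fractions y" for a s b t
    proof -
      have ab: "a \<in> B" "b \<in> B" and st: "s \<in> B - P" "t \<in> B - P" and xy': "x = Fract a s" "y = Fract b t"
        using as bt by (auto simp: fractions_def)
      have "fraction ?R (B - P) (t * a + s * b) (s * t) = fractions (Fract (t * a + s * b) (s * t))"
        using ab st by (intro fraction_eq subring_add[OF B] subring_mult[OF B] denominator_mult) auto
      moreover have "x + y = Fract (t * a + s * b) (s * t)"
        unfolding xy' using denominator_nz[OF st(1)] denominator_nz[OF st(2)] by (simp add: mult.commute)
      ultimately show ?thesis by (simp add: ring_of_type_algebra_def)
    qed
    then show ?thesis by (simp add: localization_def ring_of_fracs_def union)
  qed
qed

text \<open>Elements outside \<open>P\<close> become units, so cancellation up to a factor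
  \<open>t\<close> in \<open>B\<close> is cancellation in the localization. Strict inclusions of
  primes survive contraction, which transfers the bound on chains.\<close>

lemma cohen_macaulay_local_localization:
  assumes noeth: "\<And>I. is_ideal B I \<Longrightarrow> \<exists>F. finite F \<and> F \<subseteq> I \<and> I = lincomb B F"
    and xs: "set xs \<subseteq> P" and len: "length xs = n"
    and reg: "\<And>i a. i < n \<Longrightarrow> a \<in> B \<Longrightarrow> xs ! i * a \<in> lincomb B (set (take i xs)) \<Longrightarrow>
      \<exists>t\<in>B - P. t * a \<in> lincomb B (set (take i xs))"
    and dim: "\<And>Q. (\<And>i. i \<le> Suc n \<Longrightarrow> is_prime B (Q i)) \<Longrightarrow> (\<And>i. i < Suc n \<Longrightarrow> Q i \<subset> Q (Suc i)) \<Longrightarrow> False"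
  shows "cohen_macaulay_local (localization (ring_of_type_algebra\<lparr>carrier := B\<rparr>) P)"
proof -
  interpret T: concrete_ring L "localization (ring_of_type_algebra\<lparr>carrier := B\<rparr>) P" fractions
    by (rule concrete_ring_localization)
  define ys where "ys = map (\<lambda>a. Fract a 1) xs"
  have PB: "P \<subseteq> B" by (rule ideal_subset[OF prime_ideal[OF P]])
  show ?thesis
  proof (rule T.cohen_macaulay_local[of "extension P" ys n])
    show "\<exists>F. finite F \<and> F \<subseteq> I \<and> I = lincomb L F" if "is_ideal L I" for I
      by (rule ideal_finitely_generated[OF noeth that])
    show "is_maximal L (extension P)" by (rule is_maximal_extension)
    show "I \<subseteq> extension P" if "is_ideal L I" "1 \<notin> I" for I by (rule proper_ideal_subset[OF that])
    show "set ys \<subseteq> extension P" using xs extension_1 by (auto simp: ys_def)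
    show "length ys = n" by (simp add: ys_def len)
  next
    fix i z assume i: "i < n" and z: "z \<in> L" and h: "ys ! i * z \<in> lincomb L (set (take i ys))"
    let ?F = "set (take i xs)"
    have F: "?F \<subseteq> B" using xs PB set_take_subset[of i xs] by blast
    have E: "set (take i ys) = (\<lambda>a. Fract a 1) ` ?F" by (simp add: ys_def take_map)
    have J: "is_ideal L (lincomb L (set (take i ys)))"
      unfolding E using F extension_1 by (intro is_ideal_lincomb is_subring_L) auto
    have I: "is_ideal B (lincomb B ?F)" by (rule is_ideal_lincomb[OF B F])
    obtain a s where a: "a \<in> B" "s \<in> B - P" "z = Fract a s" using z by (rule extensionE)
    have xi: "xs ! i \<in> B" using xs PB i len nth_mem by blast
    have xa: "xs ! i * a \<in> B" by (rule subring_mult[OF B xi a(1)])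
    have "ys ! i * z = Fract (xs ! i * a) s" using i len by (simp add: ys_def a(3))
    then have "xs ! i * a \<in> contraction (lincomb L (set (take i ys)))"
      using h Fract_mem_ideal_iff[OF J xa a(2)] by simp
    \<comment> \<open>Membership in the ideal of \<open>B\<close> holds only after multiplying by
      \<open>t\<close>, so \<open>reg\<close> is applied to \<open>t * a\<close> and contributes a
      second factor \<open>u\<close>.\<close>
    then obtain t where t: "t \<in> B - P" "t * (xs ! i * a) \<in> lincomb B ?F"
      unfolding E using contraction_lincomb_iff[OF _ F xa] by auto
    have ta: "t * a \<in> B" using t a by (intro subring_mult[OF B]) auto
    have "xs ! i * (t * a) \<in> lincomb B ?F" using t(2) by (simp add: mult.left_commute)
    then obtain u where u: "u \<in> B - P" "u * (t * a) \<in> lincomb B ?F" using reg[OF i ta] by blast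
    have "u * t * a \<in> lincomb B ?F" using u(2) by (simp add: mult.assoc)
    then have "a \<in> contraction (lincomb L (set (take i ys)))"
      unfolding E using contraction_lincomb_iff[OF _ F a(1)] denominator_mult[OF u(1) t(1)] by auto
    then show "z \<in> lincomb L (set (take i ys))" using Fract_mem_ideal_iff[OF J a(1,2)] a(3) by simp
  next
    fix Q assume Q: "\<And>i. i \<le> Suc n \<Longrightarrow> is_prime L (Q i)" "\<And>i. i < Suc n \<Longrightarrow> Q i \<subset> Q (Suc i)"
    show False
    proof (rule dim[of "\<lambda>i. contraction (Q i)"])
      show "is_prime B (contraction (Q i))" if "i \<le> Suc n" for i by (rule is_prime_contraction[OF Q(1)[OF that]])
      show "contraction (Q i) \<subset> contraction (Q (Suc i))" if i: "i < Suc n" for i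
      proof -
        have "is_ideal L (Q i)" "is_ideal L (Q (Suc i))" using i by (intro prime_ideal Q(1); simp)+
        then show ?thesis using Q(2)[OF i] contraction_mono[of "Q i" "Q (Suc i)"] contraction_mono[of "Q (Suc i)" "Q i"] by blast
      qed
    qed
  qed
qed

end

section \<open>Assembly\<close>

lemma lincomb_empty: "lincomb B {} = {0}"
  by (simp add: lincomb_def)

lemma lincomb_insert_iff:
  assumes B: "is_subring B" and F: "finite F" "F \<subseteq> B" "x \<in> B"
  shows "y \<in> lincomb B (insert x F) \<longleftrightarrow> (\<exists>a\<in>B. \<exists>z\<in>lincomb B F. y = x * a + z)"
proof
  assume "y \<in> lincomb B (insert x F)"
  then obtain c where c: "\<forall>z\<in>insert x F. c z \<in> B" "y = (\<Sum>z\<in>insert x F. c z * z)" using lincombD by blast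
  have I: "is_ideal B (lincomb B F)" by (rule is_ideal_lincomb[OF B F(2)])
  show "\<exists>a\<in>B. \<exists>z\<in>lincomb B F. y = x * a + z"
  proof (cases "x \<in> F")
    case True
    then have "y \<in> lincomb B F" using c by (auto simp: insert_absorb intro: lincombI)
    then show ?thesis using subring_0[OF B] by (intro bexI[of _ 0] bexI[of _ y]) auto
  next
    case False
    then have "y = x * c x + (\<Sum>z\<in>F. c z * z)" using c F(1) by (simp add: mult.commute)
    moreover have "(\<Sum>z\<in>F. c z * z) \<in> lincomb B F" using c by (intro lincombI) auto
    ultimately show ?thesis using c by blast
  qed
next
  assume "\<exists>a\<in>B. \<exists>z\<in>lincomb B F. y = x * a + z"
  then obtain a z where az: "a \<in> B" "z \<in> lincomb B F" "y = x * a + z" by blast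
  have I: "is_ideal B (lincomb B (insert x F))" by (rule is_ideal_lincomb[OF B]) (use F in auto)
  have base: "\<And>w. w \<in> insert x F \<Longrightarrow> w \<in> lincomb B (insert x F)" by (rule lincomb_base[OF B]) (use F in auto)
  then have "F \<subseteq> lincomb B (insert x F)" by blast
  then have "z \<in> lincomb B (insert x F)" using lincomb_subset_ideal[OF I] az(2) by blast
  moreover have "a * x \<in> lincomb B (insert x F)" using base az(1) by (intro ideal_mult[OF I]) auto
  ultimately show "y \<in> lincomb B (insert x F)" unfolding az(3) by (simp add: ideal_add[OF I] mult.commute)
qed

context invariant_theory
begin

lemma cohen_macaulay_invariants: "cohen_macaulay (ring_of_type_algebra\<lparr>carrier := SA\<rparr>)"
proof -
  interpret R: concrete_ring SA "ring_of_type_algebra\<lparr>carrier := SA\<rparr>" "\<lambda>x. x"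
    by (rule concrete_ring_of_type_algebra[OF is_subring_SA])
  have "cohen_macaulay_local (localization (ring_of_type_algebra\<lparr>carrier := SA\<rparr>) m)"
    if "maximalideal m (ring_of_type_algebra\<lparr>carrier := SA\<rparr>)" for m
  proof -
    have "m \<subseteq> SA"
      using maximalideal.axioms(1)[OF that] ideal.axioms(1) additive_subgroup.a_subset
      by (fastforce simp: R.carr)
    then have m: "is_maximal SA m" using R.maximalideal_iff that by simp
    have prm: "is_prime SA m" by (rule maximal_prime[OF is_subring_SA m])
    interpret localized_ring SA m by unfold_locales (rule is_subring_SA prm)+
    have mS: "m \<subseteq> SA" by fact
    obtain x1 x2 x3 where x: "x1 \<in> m" "x2 \<in> m" "x3 \<in> m" "x1 \<noteq> 0"
      and r2: "\<forall>s\<in>SA. \<forall>a\<in>SA. x2 * s = x1 * a \<longrightarrow> (\<exists>t\<in>SA - m. \<exists>a'\<in>SA. t * s = x1 * a')"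
      and r3: "\<forall>s\<in>SA. \<forall>a\<in>SA. \<forall>b\<in>SA. x3 * s = x1 * a + x2 * b \<longrightarrow>
        (\<exists>t\<in>SA - m. \<exists>a'\<in>SA. \<exists>b'\<in>SA. t * s = x1 * a' + x2 * b')"
      using regular_sequence_in_maximal_ideal[OF m] by blast
    have xS: "x1 \<in> SA" "x2 \<in> SA" using x mS by auto
    have l1: "y \<in> lincomb SA {x1} \<longleftrightarrow> (\<exists>a\<in>SA. y = x1 * a)" for y
      using xS by (simp add: lincomb_insert_iff[OF is_subring_SA] lincomb_empty)
    have E: "lincomb SA {x1} = {x1 * a | a. a \<in> SA}" using l1 by blast
    have "y \<in> lincomb SA {x2, x1} \<longleftrightarrow> (\<exists>b\<in>SA. \<exists>z\<in>lincomb SA {x1}. y = x2 * b + z)" for y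
      using xS by (intro lincomb_insert_iff[OF is_subring_SA]) auto
    then have "y \<in> lincomb SA {x2, x1} \<longleftrightarrow> (\<exists>b\<in>SA. \<exists>a\<in>SA. y = x2 * b + x1 * a)" for y
      unfolding E by blast
    then have l2: "y \<in> lincomb SA {x1, x2} \<longleftrightarrow> (\<exists>a\<in>SA. \<exists>b\<in>SA. y = x1 * a + x2 * b)" for y
      unfolding insert_commute[of x1] by (metis add.commute)
    show ?thesis
    proof (rule cohen_macaulay_local_localization[of "[x1, x2, x3]" 3])
      show "\<exists>F. finite F \<and> F \<subseteq> I \<and> I = lincomb SA F" if "is_ideal SA I" for I by (rule SA_noetherian[OF that])
      show "set [x1, x2, x3] \<subseteq> m" "length [x1, x2, x3] = 3" using x by auto
      show False if "\<And>i. i \<le> Suc 3 \<Longrightarrow> is_prime SA (Q i)" "\<And>i. i < Suc 3 \<Longrightarrow> Q i \<subset> Q (Suc i)" for Q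
        by (rule no_prime_chain_of_length_4[of Q]) (use that in auto)
      fix i s assume i: "i < 3" and s: "s \<in> SA" and h: "[x1, x2, x3] ! i * s \<in> lincomb SA (set (take i [x1, x2, x3]))"
      consider "i = 0" | "i = 1" | "i = 2" using i by linarith
      then show "\<exists>t\<in>SA - m. t * s \<in> lincomb SA (set (take i [x1, x2, x3]))"
      proof cases
        case 1
        \<comment> \<open>The first element is regular because it is nonzero in a domain.\<close>
        then have "s = 0" using h x(4) by (simp add: lincomb_empty)
        then show ?thesis using 1 denominator_1 by (auto simp: lincomb_empty)
      next
        case 2
        then obtain a where a: "a \<in> SA" "x2 * s = x1 * a" using h l1 by auto
        then obtain t a' where t: "t \<in> SA - m" "a' \<in> SA" "t * s = x1 * a'" using r2 s by blast
        then have "t * s \<in> lincomb SA {x1}" using l1 by blast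
        then show ?thesis using 2 t(1) by auto
      next
        case 3
        then obtain a b where a: "a \<in> SA" "b \<in> SA" "x3 * s = x1 * a + x2 * b" using h l2 by (auto simp: numeral_2_eq_2)
        then obtain t a' b' where t: "t \<in> SA - m" "a' \<in> SA" "b' \<in> SA" "t * s = x1 * a' + x2 * b'" using r3 s by blast
        then have "t * s \<in> lincomb SA {x1, x2}" using l2 by blast
        then show ?thesis using 3 t(1) by (auto simp: numeral_2_eq_2)
      qed
    qed
  qed
  then show ?thesis unfolding cohen_macaulay_def using R.is_cring R.noetherian SA_noetherian by blast
qed

end

text \<open>Along the inductive definition of \<open>dimension\<close>, each line extension adds one
  generator to the span.\<close>

lemma function_field_of_ext:
  fixes \<phi> :: "'q::{field, finite} poly fract \<Rightarrow> 'k::field"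
  assumes ext: "finite_function_field_ext \<phi>"
  shows "function_field \<phi>"
proof -
  have h: "\<phi> \<in> ring_hom ring_of_type_algebra ring_of_type_algebra"
    and fin: "ring.finite_dimension (ring_of_type_algebra :: 'k ring) (range \<phi>) UNIV"
    using ext by (simp_all add: finite_function_field_ext_def)
  interpret rhom \<phi>
    using ring_hom_one[OF h] ring_hom_add[OF h] ring_hom_mult[OF h]
    by unfold_locales (simp_all add: ring_of_type_algebra_def)
  let ?R = "ring_of_type_algebra :: 'k ring"
  interpret R: ring ?R by (rule ring_from_type_algebra)
  have "\<exists>T. finite T \<and> E \<subseteq> spn \<phi> T" if "R.dimension n (range \<phi>) E" for n E
    using that
  proof (induction n "range \<phi>" E rule: R.dimension.induct)
    case zero_dim
    show ?case by (intro exI[of _ "{}"]) (simp add: ring_of_type_algebra_def)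
  next
    case (Suc_dim v E n)
    then obtain T where T: "finite T" "E \<subseteq> spn \<phi> T" by blast
    have "R.line_extension (range \<phi>) v E = {\<phi> c * v + e | c e. e \<in> E}"
      unfolding R.line_extension_def set_add_def' r_coset_def by (auto simp: ring_of_type_algebra_def)
    moreover have "\<phi> c * v + e \<in> spn \<phi> (insert v T)" if "e \<in> E" for c e
    proof (rule span_add)
      show "\<phi> c * v \<in> spn \<phi> (insert v T)" by (intro span_scale span_base) simp
      show "e \<in> spn \<phi> (insert v T)" using span_mono[of T "insert v T"] T(2) that by blast
    qed
    ultimately show ?case using T(1) by (intro exI[of _ "insert v T"]) auto
  qed
  then obtain T where "finite T" "UNIV \<subseteq> spn \<phi> T" using fin unfolding R.finite_dimension_def by blast
  then show ?thesis by unfold_locales blast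
qed

lemma subgroup_GL2:
  assumes A: "is_subring A" and G: "subgroup G (GL2 A)"
  shows "mat 1 \<in> G" and "g \<in> G \<Longrightarrow> h \<in> G \<Longrightarrow> g ** h \<in> G"
    and "g \<in> G \<Longrightarrow> \<exists>h\<in>G. g ** h = mat 1 \<and> h ** g = mat 1"
    and "g \<in> G \<Longrightarrow> g $ i $ j \<in> A"
proof -
  let ?M = "\<lparr>carrier = {M::'a^2^2. \<forall>i j. M $ i $ j \<in> A}, monoid.mult = (\<lambda>M N. M ** N), one = mat 1\<rparr>"
  have "(x ** y) $ i $ j \<in> A" if "\<forall>i j. x $ i $ j \<in> A" "\<forall>i j. y $ i $ j \<in> A" for x y :: "'a^2^2" and i j
    using that subring_add[OF A] subring_mult[OF A] by (simp add: matrix_matrix_mult_def sum_2)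
  moreover have "(mat 1 :: 'a^2^2) $ i $ j \<in> A" for i j
    using subring_0[OF A] subring_1[OF A] by (simp add: mat_def)
  ultimately interpret M: monoid ?M by unfold_locales (auto simp: matrix_mul_assoc)
  have GL: "GL2 A = units_of ?M" by (simp add: GL2_def)
  interpret U: group "GL2 A" unfolding GL by (rule M.units_group)
  have mult: "x \<otimes>\<^bsub>GL2 A\<^esub> y = x ** y" for x y by (simp add: GL units_of_mult)
  have one: "\<one>\<^bsub>GL2 A\<^esub> = mat 1" by (simp add: GL units_of_one)
  show "mat 1 \<in> G" using subgroup.one_closed[OF G] by (simp add: one)
  show "g \<in> G \<Longrightarrow> h \<in> G \<Longrightarrow> g ** h \<in> G" using subgroup.m_closed[OF G, of g h] by (simp add: mult)
  show "\<exists>h\<in>G. g ** h = mat 1 \<and> h ** g = mat 1" if "g \<in> G"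
    using subgroup.m_inv_closed[OF G that] U.r_inv U.l_inv subgroup.mem_carrier[OF G that]
    by (metis mult one)
  show "g $ i $ j \<in> A" if "g \<in> G"
    using subgroup.mem_carrier[OF G that] M.Units_closed[of g] by (simp add: GL units_of_carrier)
qed

theorem theorem1p3:
  fixes \<phi> :: "'q::{field, finite} poly fract \<Rightarrow> 'k::field"
    and A :: "'k set"
    and G :: "('k^2^2) set"
  assumes "finite_function_field_ext \<phi>"
    and "A = ring_of_integers \<phi>"
    and "subgroup G (GL2 A)"
    and "finite G"
  shows "cohen_macaulay (invariant_ring A G)"
proof -
  interpret F: function_field \<phi> by (rule function_field_of_ext[OF assms(1)])
  have A: "A = Collect F.C.integral"
    unfolding assms(2) ring_of_integers_def F.C.integral_closure_range[symmetric] F.\<psi>_def ..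
  note G = subgroup_GL2[OF F.is_subring_A assms(3)[unfolded A]]
  interpret I: invariant_theory \<phi> G
    by unfold_locales (use assms(4) G in auto)
  show ?thesis
    using I.cohen_macaulay_invariants by (simp add: invariant_ring_def invariants_def A)
qed

end
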